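(* Let $\mathfrak{g}$ be a simple Lie algebra of exceptional type (that is, of type $G_2$, $F_4$, $E_6$, $E_7$ or $E_8$) over an algebraically closed field of characteristic $0$, and let $x\in\mathfrak{g}$. Then $\mathrm{ind}(C_{\mathfrak{g}}(x))$ is equal to the rank of $\mathfrak{g}$.
   Context: For $x\in\mathfrak{g}$, $C_{\mathfrak{g}}(x)=\{y\in\mathfrak{g}\mid [x,y]=0\}$ denotes the centralizer of $x$ in $\mathfrak{g}$. The rank of $\mathfrak{g}$ is the dimension of a Cartan subalgebra. For a finite-dimensional Lie algebra $K$ with dual space $K^*$ and $f\in K^*$, set $K^f=\{u\in K\mid f([u,v])=0 \text{ for all } v\in K\}$. The index of $K$ is $\mathrm{ind}(K)=\inf_{f\in K^*}\dim K^f$. *)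

theory Defs
  imports "HOL-Computational_Algebra.Computational_Algebra"
begin

locale lie_algebra = vector_space scale
  for scale :: "'k::field \<Rightarrow> 'v::ab_group_add \<Rightarrow> 'v" (infixr \<open>*s\<close> 75) +
  fixes bracket :: "'v \<Rightarrow> 'v \<Rightarrow> 'v"
  assumes bracket_add_left: "bracket (x + y) z = bracket x z + bracket y z"
    and bracket_add_right: "bracket x (y + z) = bracket x y + bracket x z"
    and bracket_scale_left: "bracket (c *s x) y = c *s bracket x y"
    and bracket_scale_right: "bracket x (c *s y) = c *s bracket x y"
    and bracket_self: "bracket x x = 0"
    and jacobi: "bracket x (bracket y z) + bracket y (bracket z x) + bracket z (bracket x y) = 0"
begin

definition finite_dimensional :: bool where
  "finite_dimensional \<longleftrightarrow> (\<exists>B. finite B \<and> span B = UNIV)"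

definition lie_subalgebra :: "'v set \<Rightarrow> bool" where
  "lie_subalgebra K \<longleftrightarrow> subspace K \<and> (\<forall>x\<in>K. \<forall>y\<in>K. bracket x y \<in> K)"

definition lie_ideal :: "'v set \<Rightarrow> bool" where
  "lie_ideal I \<longleftrightarrow> subspace I \<and> (\<forall>x. \<forall>y\<in>I. bracket x y \<in> I)"

definition simple :: bool where
  "simple \<longleftrightarrow> (\<exists>x y. bracket x y \<noteq> 0) \<and> (\<forall>I. lie_ideal I \<longrightarrow> I = {0} \<or> I = UNIV)"

definition bracket_space :: "'v set \<Rightarrow> 'v set \<Rightarrow> 'v set" where
  "bracket_space A B = span {bracket x y | x y. x \<in> A \<and> y \<in> B}"

primrec lower_central :: "'v set \<Rightarrow> nat \<Rightarrow> 'v set" where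
  "lower_central K 0 = K"
| "lower_central K (Suc n) = bracket_space K (lower_central K n)"

definition nilpotent :: "'v set \<Rightarrow> bool" where
  "nilpotent K \<longleftrightarrow> (\<exists>n. lower_central K n = {0})"

definition normalizer :: "'v set \<Rightarrow> 'v set" where
  "normalizer K = {x. \<forall>y\<in>K. bracket x y \<in> K}"

definition cartan_subalgebra :: "'v set \<Rightarrow> bool" where
  "cartan_subalgebra H \<longleftrightarrow> lie_subalgebra H \<and> nilpotent H \<and> normalizer H = H"

text \<open>Over an algebraically closed field of characteristic 0, all Cartan subalgebras of a
  finite-dimensional Lie algebra have the same dimension.\<close>

definition rank :: nat where
  "rank = (THE r. \<exists>H. cartan_subalgebra H \<and> dim H = r)"

definition centralizer :: "'v \<Rightarrow> 'v set" where
  "centralizer x = {y. bracket x y = 0}"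

text \<open>A linear functional on a subspace \<open>K\<close> is represented by the function on the whole type
  that extends it by 0 outside \<open>K\<close>, so that functionals on \<open>K\<close> are equal iff they agree on \<open>K\<close>.\<close>

definition dual :: "'v set \<Rightarrow> ('v \<Rightarrow> 'k) set" where
  "dual K = {f. (\<forall>u\<in>K. \<forall>v\<in>K. f (u + v) = f u + f v) \<and> (\<forall>c. \<forall>u\<in>K. f (c *s u) = c * f u)
    \<and> (\<forall>u. u \<notin> K \<longrightarrow> f u = 0)}"

definition form_radical :: "'v set \<Rightarrow> ('v \<Rightarrow> 'k) \<Rightarrow> 'v set" where
  "form_radical K f = {u \<in> K. \<forall>v\<in>K. f (bracket u v) = 0}"

definition index :: "'v set \<Rightarrow> nat" where
  "index K = (INF f\<in>dual K. dim (form_radical K f))"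

text \<open>Cartan subalgebras of a semisimple Lie algebra in characteristic 0 act diagonalizably, so the
  root spaces are genuine (not merely generalized) simultaneous eigenspaces.\<close>

definition root_space :: "'v set \<Rightarrow> ('v \<Rightarrow> 'k) \<Rightarrow> 'v set" where
  "root_space H \<alpha> = {x. \<forall>h\<in>H. bracket h x = \<alpha> h *s x}"

definition roots :: "'v set \<Rightarrow> ('v \<Rightarrow> 'k) set" where
  "roots H = {\<alpha> \<in> dual H. \<alpha> \<noteq> (\<lambda>_. 0) \<and> root_space H \<alpha> \<noteq> {0}}"

definition coroot :: "'v set \<Rightarrow> ('v \<Rightarrow> 'k) \<Rightarrow> 'v" where
  "coroot H \<alpha> = (THE h. h \<in> bracket_space (root_space H \<alpha>) (root_space H (\<lambda>u. - \<alpha> u)) \<and> \<alpha> h = 2)"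

text \<open>An (ordered) base: linearly independent roots such that every root is an integral
  combination of them with coefficients all nonnegative or all nonpositive.\<close>

definition root_base :: "'v set \<Rightarrow> ('v \<Rightarrow> 'k) list \<Rightarrow> bool" where
  "root_base H \<alpha>s \<longleftrightarrow> set \<alpha>s \<subseteq> roots H
    \<and> (\<forall>c. (\<forall>h\<in>H. (\<Sum>i<length \<alpha>s. c i * (\<alpha>s ! i) h) = 0) \<longrightarrow> (\<forall>i<length \<alpha>s. c i = 0))
    \<and> (\<forall>\<beta>\<in>roots H. \<exists>c :: nat \<Rightarrow> int.
         (\<forall>h\<in>H. \<beta> h = (\<Sum>i<length \<alpha>s. of_int (c i) * (\<alpha>s ! i) h))
         \<and> ((\<forall>i<length \<alpha>s. 0 \<le> c i) \<or> (\<forall>i<length \<alpha>s. c i \<le> 0)))"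

definition has_cartan_matrix :: "int list list \<Rightarrow> bool" where
  "has_cartan_matrix A \<longleftrightarrow> (\<exists>H \<alpha>s. cartan_subalgebra H \<and> root_base H \<alpha>s \<and> length \<alpha>s = length A
    \<and> (\<forall>i<length A. \<forall>j<length A. (\<alpha>s ! i) (coroot H (\<alpha>s ! j)) = of_int (A ! i ! j)))"

lemma bracket_zero_right: "bracket x 0 = 0"
  using bracket_scale_right[of x 0 0] by simp

lemma bracket_commute: "bracket x y = - bracket y x"
proof -
  have "bracket (x + y) (x + y) = (bracket x x + bracket y x) + (bracket x y + bracket y y)"
    by (simp only: bracket_add_left bracket_add_right)
  then have "bracket x y + bracket y x = 0"
    by (simp add: bracket_self add.commute)
  then show ?thesis
    by (simp only: eq_neg_iff_add_eq_0)
qed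

lemma lie_subalgebra_centralizer: "lie_subalgebra (centralizer x)"
  unfolding lie_subalgebra_def
proof (intro conjI ballI)
  show "subspace (centralizer x)"
    by (rule subspaceI)
      (auto simp: centralizer_def bracket_add_right bracket_scale_right bracket_zero_right)
next
  fix y z assume "y \<in> centralizer x" "z \<in> centralizer x"
  then have "bracket x y = 0" "bracket z x = 0"
    using bracket_commute[of z x] by (auto simp: centralizer_def)
  then show "bracket y z \<in> centralizer x"
    using jacobi[of x y z] by (simp add: centralizer_def bracket_zero_right)
qed

end

datatype exceptional_type = G2 | F4 | E6 | E7 | E8

text \<open>Bourbaki numbering of the simple roots; the \<open>(i, j)\<close> entry is the value of the \<open>i\<close>-th
  simple root at the \<open>j\<close>-th simple coroot.\<close>

fun cartan_matrix :: "exceptional_type \<Rightarrow> int list list" where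
  "cartan_matrix G2 =
    [[ 2, -1],
     [-3,  2]]"
| "cartan_matrix F4 =
    [[ 2, -1,  0,  0],
     [-1,  2, -2,  0],
     [ 0, -1,  2, -1],
     [ 0,  0, -1,  2]]"
| "cartan_matrix E6 =
    [[ 2,  0, -1,  0,  0,  0],
     [ 0,  2,  0, -1,  0,  0],
     [-1,  0,  2, -1,  0,  0],
     [ 0, -1, -1,  2, -1,  0],
     [ 0,  0,  0, -1,  2, -1],
     [ 0,  0,  0,  0, -1,  2]]"
| "cartan_matrix E7 =
    [[ 2,  0, -1,  0,  0,  0,  0],
     [ 0,  2,  0, -1,  0,  0,  0],
     [-1,  0,  2, -1,  0,  0,  0],
     [ 0, -1, -1,  2, -1,  0,  0],
     [ 0,  0,  0, -1,  2, -1,  0],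
     [ 0,  0,  0,  0, -1,  2, -1],
     [ 0,  0,  0,  0,  0, -1,  2]]"
| "cartan_matrix E8 =
    [[ 2,  0, -1,  0,  0,  0,  0,  0],
     [ 0,  2,  0, -1,  0,  0,  0,  0],
     [-1,  0,  2, -1,  0,  0,  0,  0],
     [ 0, -1, -1,  2, -1,  0,  0,  0],
     [ 0,  0,  0, -1,  2, -1,  0,  0],
     [ 0,  0,  0,  0, -1,  2, -1,  0],
     [ 0,  0,  0,  0,  0, -1,  2, -1],
     [ 0,  0,  0,  0,  0,  0, -1,  2]]"

definition (in lie_algebra) of_exceptional_type :: bool where
  "of_exceptional_type \<longleftrightarrow> (\<exists>T. has_cartan_matrix (cartan_matrix T))"

end

theory Submission
  imports Defs "HOL-Library.Function_Algebras" "Jordan_Normal_Form.Char_Poly"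
begin


text \<open>
  Let \<open>\<gg>\<close> be the Lie algebra, \<open>n\<close> its dimension, \<open>\<kappa>\<close> its Killing form and \<open>r\<close> the least
  dimension of the centralizer of an element.  The theorem follows from two facts: the centralizer
  of every \<open>x\<close> has index \<open>r\<close>, and a Cartan subalgebra \<open>H\<close> is abelian and the centralizer of one of
  its elements.  For an abelian algebra the index is the dimension, so \<open>dim H = r\<close> for every \<open>H\<close>,
  and \<open>r\<close> is the rank.  From the exceptional type the argument takes that a Cartan subalgebra
  exists, and from simplicity that \<open>\<kappa>\<close> is nondegenerate.

  By nondegeneracy the functionals on \<open>C(x)\<close> are the restrictions of \<open>\<kappa>(z, -)\<close>, so the index
  of \<open>C(x)\<close> is the least dimension of the radical of the form \<open>\<kappa>(z, [u, v])\<close> on \<open>C(x)\<close>.  No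
  radical has dimension less than \<open>r\<close>: this is Vinberg's inequality (\<open>radical_ge\<close>), which compares
  \<open>ad x\<close> with \<open>ad (x + t z)\<close> for small \<open>t\<close>.

  The converse (\<open>radical_le\<close>) is shown for generic \<open>z\<close>, whose coordinates are independent variables,
  over the field of rational functions in these and a further variable \<open>s\<close>, with the valuation
  along \<open>s = 0\<close>.  Consider \<open>\<gamma> = x + s z\<close>, where \<open>ad \<gamma>\<close> has rank \<open>n - r\<close>.  A vector \<open>u\<close> in the
  radical satisfies \<open>[z, u] = - [x, u']\<close> for some \<open>u'\<close>, because \<open>[z, u]\<close> is orthogonal to \<open>C(x)\<close>;
  so \<open>u + s u'\<close> commutes with \<open>\<gamma>\<close> up to an error of order \<open>s\<^sup>2\<close>.  If \<open>s\<close> kills the torsion of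
  the cokernel of \<open>ad \<gamma>\<close> on integral vectors, the error can be corrected
  without changing \<open>u\<close> modulo \<open>s\<close> (\<open>lift_kernel\<close>), and independent vectors of the radical give
  independent vectors in the kernel of \<open>ad \<gamma>\<close>, of which there are at most \<open>r\<close> (\<open>pencil_rank\<close>).

  That \<open>s\<close> kills the torsion (\<open>torsion_killed\<close>) is the heart of the proof.  It means that
  \<open>s \<kappa>(\<zeta>\<^sub>1, \<xi>\<^sub>2)\<close> is integral whenever \<open>\<zeta>\<^sub>i = [\<gamma>, \<xi>\<^sub>i]\<close> are integral.  As the coordinates of \<open>z\<close> are
  free variables, there are derivations \<open>D\<^sub>i\<close> of the field that preserve integrality, kill \<open>s\<close>, and
  move \<open>z\<close> by \<open>- \<zeta>\<^sub>i\<close>; they move \<open>A = ad \<gamma>\<close> along its conjugacy class,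
  \<open>D\<^sub>i A = [X\<^sub>i, A]\<close> with \<open>X\<^sub>i = ad (s \<xi>\<^sub>i)\<close>.  The required integrality is the statement that \<open>tr (A [X\<^sub>1, X\<^sub>2])\<close>
  lies in the maximal ideal, which holds for any matrix \<open>A\<close> that is integral and, modulo the
  maximal ideal, triangular with constant eigenvalues (\<open>isospectral_kirillov_small\<close>).  There \<open>A\<close> is
  conjugate over the field to a matrix of the same kind whose entries are killed by \<open>D\<^sub>1\<close> and
  \<open>D\<^sub>2\<close>, a rational canonical form (\<open>frobenius_normal_form\<close>).  The conjugating matrix is brought to
  monomial form by Iwahori row and column operations (\<open>iwahori_elimination\<close>), and then its
  logarithmic derivatives can be estimated factor by factor (\<open>kirillov_small\<close>).

  The two facts about semisimple Lie algebras come from one construction.  Every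
  operator \<open>T\<close> has a triangular basis with blocks separated by eigenvalue (\<open>jordan_basis\<close>), and for a
  function \<open>\<phi>\<close> on the field the operator acting on the generalised eigenspace of \<open>\<mu>\<close> as
  \<open>\<phi> \<mu>\<close> has trace \<open>\<Sum> \<lambda> \<phi>(\<lambda>)\<close> against \<open>T\<close>.  Additive \<open>\<phi>\<close> give derivations, hence the
  nondegeneracy of \<open>\<kappa>\<close> (\<open>kil_nondegenerate\<close>); indicator functions show that central commutators of
  \<open>H\<close> act nilpotently, hence that \<open>H\<close> is abelian (\<open>cartan_centralizer\<close>).
\<close>

section \<open>Matrices over a discretely valued field\<close>

locale valued_field =
  fixes v :: "'a::field \<Rightarrow> int"
  assumes v_mult: "x \<noteq> 0 \<Longrightarrow> y \<noteq> 0 \<Longrightarrow> v (x * y) = v x + v y"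
    and v_add: "x \<noteq> 0 \<Longrightarrow> y \<noteq> 0 \<Longrightarrow> x + y \<noteq> 0 \<Longrightarrow> min (v x) (v y) \<le> v (x + y)"
begin

text \<open>The value \<open>v 0\<close> is irrelevant: zero lies in every step of the filtration.\<close>

definition vge :: "int \<Rightarrow> 'a \<Rightarrow> bool" where
  "vge e x \<longleftrightarrow> x = 0 \<or> e \<le> v x"

lemma v_one [simp]: "v 1 = 0"
  using v_mult[of 1 1] by simp

lemma v_minus [simp]: "v (- x) = v x"
proof (cases "x = 0")
  case False
  have "v (- 1) + v (- 1) = v ((- 1) * (- 1))" by (subst v_mult) auto
  then have "v (- 1) = 0" by simp
  then show ?thesis using v_mult[of "- 1" x] False by simp
qed simp

lemma v_inverse: "x \<noteq> 0 \<Longrightarrow> v (inverse x) = - v x"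
  using v_mult[of x "inverse x"] by simp

lemma v_divide: "x \<noteq> 0 \<Longrightarrow> y \<noteq> 0 \<Longrightarrow> v (x / y) = v x - v y"
  using v_mult[of x "inverse y"] v_inverse[of y] by (simp add: divide_inverse)

lemma vge_0 [simp]: "vge e 0" by (simp add: vge_def)
lemma vge_1 [simp]: "vge 0 1" by (simp add: vge_def)
lemma vge_minus [simp]: "vge e (- x) \<longleftrightarrow> vge e x" by (simp add: vge_def)
lemma vge_add: "vge e x \<Longrightarrow> vge e y \<Longrightarrow> vge e (x + y)"
  unfolding vge_def using v_add[of x y] by (cases "x = 0"; cases "y = 0"; cases "x + y = 0") auto
lemma vge_diff: "vge e x \<Longrightarrow> vge e y \<Longrightarrow> vge e (x - y)"
  using vge_add[of e x "- y"] by simp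
lemma vge_mult: "vge a x \<Longrightarrow> vge b y \<Longrightarrow> vge (a + b) (x * y)"
  unfolding vge_def using v_mult[of x y] by (cases "x = 0"; cases "y = 0") auto
lemma vge_mult0: "vge 0 x \<Longrightarrow> vge 0 y \<Longrightarrow> vge 0 (x * y)" using vge_mult[of 0 x 0 y] by simp
lemma vge_mult1l: "vge 1 x \<Longrightarrow> vge 0 y \<Longrightarrow> vge 1 (x * y)" using vge_mult[of 1 x 0 y] by simp
lemma vge_mult1r: "vge 0 x \<Longrightarrow> vge 1 y \<Longrightarrow> vge 1 (x * y)" using vge_mult[of 0 x 1 y] by simp
lemma vge_mono: "vge a x \<Longrightarrow> b \<le> a \<Longrightarrow> vge b x" by (auto simp: vge_def)
lemma vge_sum: "(\<And>i. i \<in> I \<Longrightarrow> vge e (f i)) \<Longrightarrow> vge e (sum f I)"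
  by (induction I rule: infinite_finite_induct) (auto intro: vge_add)
lemma vge_cong_add: "vge e (x - y) \<Longrightarrow> vge e y \<Longrightarrow> vge e x"
  using vge_add[of e "x - y" y] by simp

text \<open>Derivations respecting the valuation filtration, as a derivation killing a uniformiser does.\<close>

definition vderiv :: "('a \<Rightarrow> 'a) \<Rightarrow> bool" where
  "vderiv D \<longleftrightarrow> (\<forall>x y. D (x + y) = D x + D y) \<and> (\<forall>x y. D (x * y) = D x * y + x * D y)
     \<and> (\<forall>e x. vge e x \<longrightarrow> vge e (D x))"

lemma vderivD:
  assumes "vderiv D"
  shows "D (x + y) = D x + D y" "D (x * y) = D x * y + x * D y" "vge e x \<Longrightarrow> vge e (D x)"
  using assms unfolding vderiv_def by auto

end

locale valued_field_mat = valued_field v for v :: "'a::field \<Rightarrow> int" +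
  fixes n :: nat
begin

type_synonym 'b mtx = "nat \<Rightarrow> nat \<Rightarrow> 'b"

text \<open>The size is a number rather than a type, since matrices of two different sizes, both depending on
  the data, occur together.\<close>

definition mats :: "'a mtx set" where
  "mats = {A. \<forall>i j. \<not> (i < n \<and> j < n) \<longrightarrow> A i j = 0}"

definition mm :: "'a mtx \<Rightarrow> 'a mtx \<Rightarrow> 'a mtx" (infixl \<open>\<star>\<close> 70) where
  "A \<star> B = (\<lambda>i j. if i < n \<and> j < n then \<Sum>k<n. A i k * B k j else 0)"

definition idm :: "'a mtx" where
  "idm = (\<lambda>i j. if i < n \<and> i = j then 1 else 0)"

definition tr :: "'a mtx \<Rightarrow> 'a" where
  "tr A = (\<Sum>i<n. A i i)"

definition cm :: "'a mtx \<Rightarrow> 'a mtx \<Rightarrow> 'a mtx" where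
  "cm A B = A \<star> B - B \<star> A"

definition Dm :: "('a \<Rightarrow> 'a) \<Rightarrow> 'a mtx \<Rightarrow> 'a mtx" where
  "Dm D A = (\<lambda>i j. D (A i j))"

lemma mm_in [simp, intro]: "A \<star> B \<in> mats" by (auto simp: mats_def mm_def)
lemma idm_in [simp, intro]: "idm \<in> mats" by (auto simp: mats_def idm_def)
lemma mats_diff [simp, intro]: "A \<in> mats \<Longrightarrow> B \<in> mats \<Longrightarrow> A - B \<in> mats" by (auto simp: mats_def)

lemma mm_assoc: "A \<star> B \<star> C = A \<star> (B \<star> C)"
proof (intro ext)
  fix i j
  show "(A \<star> B \<star> C) i j = (A \<star> (B \<star> C)) i j"
  proof (cases "i < n \<and> j < n")
    case True
    have "(\<Sum>k<n. (\<Sum>l<n. A i l * B l k) * C k j) = (\<Sum>k<n. \<Sum>l<n. A i l * B l k * C k j)"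
      by (simp add: sum_distrib_right)
    also have "\<dots> = (\<Sum>l<n. \<Sum>k<n. A i l * B l k * C k j)" by (rule sum.swap)
    also have "\<dots> = (\<Sum>l<n. A i l * (\<Sum>k<n. B l k * C k j))"
      by (simp add: sum_distrib_left mult.assoc)
    finally show ?thesis using True by (simp add: mm_def)
  qed (auto simp: mm_def)
qed

lemma mm_idl [simp]: "A \<in> mats \<Longrightarrow> idm \<star> A = A"
  by (intro ext) (auto simp: mm_def idm_def mats_def if_distrib[of "\<lambda>x. x * _"] sum.delta cong: if_cong)
lemma mm_idr [simp]: "A \<in> mats \<Longrightarrow> A \<star> idm = A"
proof (intro ext)
  fix i j assume "A \<in> mats"
  then show "(A \<star> idm) i j = A i j"
    by (cases "i < n \<and> j < n")
      (auto simp: mm_def idm_def mats_def if_distrib[of "\<lambda>x. _ * x"] sum.delta' cong: if_cong)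
qed

lemma mm_add_l: "(A + B) \<star> C = A \<star> C + B \<star> C"
  by (intro ext) (auto simp: mm_def sum.distrib algebra_simps)
lemma mm_add_r: "C \<star> (A + B) = C \<star> A + C \<star> B"
  by (intro ext) (auto simp: mm_def sum.distrib algebra_simps)
lemma mm_diff_l: "(A - B) \<star> C = A \<star> C - B \<star> C"
  by (intro ext) (auto simp: mm_def sum_subtractf algebra_simps)
lemma mm_diff_r: "C \<star> (A - B) = C \<star> A - C \<star> B"
  by (intro ext) (auto simp: mm_def sum_subtractf algebra_simps)
lemma mm_minus_l: "(- A) \<star> C = - (A \<star> C)"
  by (intro ext) (auto simp: mm_def sum_negf)
lemma mm_minus_r: "C \<star> (- A) = - (C \<star> A)"
  by (intro ext) (auto simp: mm_def sum_negf)
lemma mm_zero_l [simp]: "0 \<star> A = 0" by (intro ext) (auto simp: mm_def)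

lemmas mm_ring = mm_add_l mm_add_r mm_diff_l mm_diff_r mm_minus_l mm_minus_r

lemma tr_add: "tr (A + B) = tr A + tr B" by (simp add: tr_def sum.distrib)
lemma tr_diff: "tr (A - B) = tr A - tr B" by (simp add: tr_def sum_subtractf)
lemma tr_minus: "tr (- A) = - tr A" by (simp add: tr_def sum_negf)
lemma tr_comm: "tr (A \<star> B) = tr (B \<star> A)"
proof -
  have "(\<Sum>i<n. \<Sum>k<n. A i k * B k i) = (\<Sum>k<n. \<Sum>i<n. B k i * A i k)"
    by (subst sum.swap) (simp add: mult.commute)
  then show ?thesis by (simp add: tr_def mm_def)
qed

lemma tr_cm: "tr (A \<star> cm B C) = tr (cm A B \<star> C)"
proof -
  have "tr (A \<star> (C \<star> B)) = tr (B \<star> A \<star> C)"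
    using tr_comm[of B "A \<star> C"] by (simp add: mm_assoc)
  then show ?thesis by (simp add: cm_def mm_ring tr_diff mm_assoc)
qed

lemma cm_skew: "cm A B = - cm B A" by (simp add: cm_def)

text \<open>By invariance of the trace, \<open>tr (A [Z, Y])\<close> vanishes when \<open>Z\<close> commutes with \<open>A\<close>.\<close>

lemma tr_cm_shift:
  assumes "cm X A = cm X' A" "cm Y A = cm Y' A"
  shows "tr (A \<star> cm X Y) = tr (A \<star> cm X' Y')"
proof -
  have "tr (A \<star> cm X Y) = tr (cm A X \<star> Y)" by (rule tr_cm)
  also have "\<dots> = tr (cm A X' \<star> Y)" using assms(1) cm_skew[of A X] cm_skew[of A X'] by simp
  also have "\<dots> = tr (A \<star> cm X' Y)" by (rule tr_cm[symmetric])
  also have "\<dots> = - tr (A \<star> cm Y X')" by (subst cm_skew) (simp add: mm_ring tr_minus)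
  also have "\<dots> = - tr (cm A Y \<star> X')" by (simp add: tr_cm)
  also have "\<dots> = - tr (cm A Y' \<star> X')" using assms(2) cm_skew[of A Y] cm_skew[of A Y'] by simp
  also have "\<dots> = - tr (A \<star> cm Y' X')" by (simp add: tr_cm)
  also have "\<dots> = tr (A \<star> cm X' Y')" by (subst cm_skew) (simp add: mm_ring tr_minus)
  finally show ?thesis .
qed

lemma Dm_mm:
  assumes "vderiv D"
  shows "Dm D (A \<star> B) = Dm D A \<star> B + A \<star> Dm D B"
proof -
  have D0: "D 0 = 0" using vderivD(1)[OF assms, of 0 0] by (metis add.right_neutral add_left_cancel)
  have Ds: "D (sum f I) = (\<Sum>i\<in>I. D (f i))" if "finite I" for f and I :: "nat set"
    using that by (induction I rule: finite_induct) (auto simp: D0 vderivD(1)[OF assms])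
  show ?thesis
    by (intro ext) (auto simp: Dm_def mm_def Ds D0 vderivD(2)[OF assms] sum.distrib)
qed

lemma D_0: "vderiv D \<Longrightarrow> D 0 = 0"
  using vderivD(1)[of D 0 0] by (metis add.right_neutral add_left_cancel)
lemma D_1: "vderiv D \<Longrightarrow> D 1 = 0"
  using vderivD(2)[of D 1 1] by (metis add.right_neutral add_left_cancel mult.left_neutral mult.right_neutral)

lemma Dm_idm: "vderiv D \<Longrightarrow> Dm D idm = 0"
  by (intro ext) (auto simp: Dm_def idm_def D_0 D_1)

lemma Dm_in: "vderiv D \<Longrightarrow> A \<in> mats \<Longrightarrow> Dm D A \<in> mats"
  by (auto simp: Dm_def mats_def D_0)

section \<open>The Iwahori filtration and Bruhat decomposition\<close>

text \<open>The matrices with \<open>iw 0\<close> are those integral ones that are upper triangular modulo the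
  maximal ideal (the Iwahori order), \<open>iw 1\<close> describes its radical.  Measuring the entry at
  \<open>(i, j)\<close> by \<open>n v(x) - i + j\<close> turns both into steps of one multiplicative filtration.\<close>

definition deg :: "nat \<Rightarrow> nat \<Rightarrow> 'a \<Rightarrow> int" where
  "deg i j x = int n * v x - int i + int j"

definition iw :: "int \<Rightarrow> 'a mtx \<Rightarrow> bool" where
  "iw e A \<longleftrightarrow> (\<forall>i<n. \<forall>j<n. A i j \<noteq> 0 \<longrightarrow> e \<le> deg i j (A i j))"

lemma deg_mult: "x \<noteq> 0 \<Longrightarrow> y \<noteq> 0 \<Longrightarrow> deg i j (x * y) = deg i k x + deg k j y"
  by (simp add: deg_def v_mult algebra_simps)

lemma deg_add: "x \<noteq> 0 \<Longrightarrow> y \<noteq> 0 \<Longrightarrow> x + y \<noteq> 0 \<Longrightarrow> e \<le> deg i j x \<Longrightarrow> e \<le> deg i j y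
    \<Longrightarrow> e \<le> deg i j (x + y)"
proof -
  assume a: "x \<noteq> 0" "y \<noteq> 0" "x + y \<noteq> 0" "e \<le> deg i j x" "e \<le> deg i j y"
  then have "v x \<le> v (x + y) \<or> v y \<le> v (x + y)" using v_add[of x y] by linarith
  then have "int n * v x \<le> int n * v (x + y) \<or> int n * v y \<le> int n * v (x + y)"
    by (meson mult_left_mono of_nat_0_le_iff)
  then show ?thesis using a unfolding deg_def by auto
qed

lemma deg_sum:
  assumes "finite I" "\<And>k. k \<in> I \<Longrightarrow> f k \<noteq> 0 \<Longrightarrow> e \<le> deg i j (f k)" "sum f I \<noteq> 0"
  shows "e \<le> deg i j (sum f I)"
  using assms
proof (induction I rule: finite_induct)
  case (insert x F)
  then show ?case
    by (cases "f x = 0"; cases "sum f F = 0") (auto intro: deg_add)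
qed simp

lemma iw_add: "iw e A \<Longrightarrow> iw e B \<Longrightarrow> iw e (A + B)"
  unfolding iw_def
proof (intro allI impI)
  fix i j assume a: "\<forall>i<n. \<forall>j<n. A i j \<noteq> 0 \<longrightarrow> e \<le> deg i j (A i j)"
    "\<forall>i<n. \<forall>j<n. B i j \<noteq> 0 \<longrightarrow> e \<le> deg i j (B i j)" "i < n" "j < n" "(A + B) i j \<noteq> 0"
  then show "e \<le> deg i j ((A + B) i j)"
    by (cases "A i j = 0"; cases "B i j = 0") (auto intro: deg_add)
qed

lemma iw_minus: "iw e (- A) \<longleftrightarrow> iw e A"
  by (simp add: iw_def deg_def)

lemma iw_diff: "iw e A \<Longrightarrow> iw e B \<Longrightarrow> iw e (A - B)"
  using iw_add[of e A "- B"] iw_minus[of e B] by (simp add: diff_conv_add_uminus del: add_uminus_conv_diff)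

lemma iw_mm: 
  assumes "iw a A" "iw b B"
  shows "iw (a + b) (A \<star> B)"
  unfolding iw_def
proof (intro allI impI)
  fix i j assume ij: "i < n" "j < n" and nz: "(A \<star> B) i j \<noteq> 0"
  have "a + b \<le> deg i j (A i k * B k j)" if "k < n" "A i k * B k j \<noteq> 0" for k
    using that assms ij deg_mult[of "A i k" "B k j" i j k] unfolding iw_def by (force intro: add_mono)
  then show "a + b \<le> deg i j ((A \<star> B) i j)"
    using nz ij by (auto simp: mm_def intro!: deg_sum)
qed

lemma iw_mm0: "iw 0 A \<Longrightarrow> iw 0 B \<Longrightarrow> iw 0 (A \<star> B)" using iw_mm[of 0 A 0 B] by simp

lemma iw_idm: "iw 0 idm" by (auto simp: iw_def idm_def deg_def)

lemma iw_integral: "iw 0 A \<Longrightarrow> i < n \<Longrightarrow> j < n \<Longrightarrow> vge 0 (A i j)"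
proof -
  assume a: "iw 0 A" "i < n" "j < n"
  show ?thesis
  proof (cases "A i j = 0")
    case False
    then have "0 \<le> int n * v (A i j) - int i + int j" using a by (auto simp: iw_def deg_def)
    then have "int n * v (A i j) > - int n" using a by linarith
    then have "int n * (v (A i j) + 1) > 0" by (simp add: algebra_simps)
    then have "v (A i j) + 1 > 0" by (simp add: zero_less_mult_iff)
    then show ?thesis by (simp add: vge_def)
  qed simp
qed

lemma iw_lower: "iw 0 A \<Longrightarrow> i < n \<Longrightarrow> j < i \<Longrightarrow> vge 1 (A i j)"
proof -
  assume a: "iw 0 A" "i < n" "j < i"
  show ?thesis
  proof (cases "A i j = 0")
    case False
    then have "0 \<le> int n * v (A i j) - int i + int j" using a by (auto simp: iw_def deg_def)
    then have "int n * v (A i j) > 0" using a by linarith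
    then have "v (A i j) > 0" by (simp add: zero_less_mult_iff)
    then show ?thesis by (simp add: vge_def)
  qed simp
qed

lemma iw0I:
  assumes "\<And>i j. i < n \<Longrightarrow> j < n \<Longrightarrow> vge 0 (A i j)" "\<And>i j. i < n \<Longrightarrow> j < i \<Longrightarrow> vge 1 (A i j)"
  shows "iw 0 A"
  unfolding iw_def
proof (intro allI impI)
  fix i j assume ij: "i < n" "j < n" "A i j \<noteq> 0"
  show "0 \<le> deg i j (A i j)"
  proof (cases "j < i")
    case True
    then have "1 \<le> v (A i j)" using assms(2) ij by (auto simp: vge_def)
    then have "int n * 1 \<le> int n * v (A i j)" by (intro mult_left_mono) auto
    then show ?thesis using ij unfolding deg_def by linarith
  next
    case False
    have "0 \<le> v (A i j)" using assms(1) ij by (auto simp: vge_def)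
    then have "int n * 0 \<le> int n * v (A i j)" by (intro mult_left_mono) auto
    then show ?thesis using False by (simp add: deg_def)
  qed
qed

lemma iw1I:
  assumes A: "iw 0 A" and d: "\<And>i. i < n \<Longrightarrow> vge 1 (A i i)"
  shows "iw 1 A"
  unfolding iw_def
proof (intro allI impI)
  fix i j assume ij: "i < n" "j < n" "A i j \<noteq> 0"
  show "1 \<le> deg i j (A i j)"
  proof (cases "j = i")
    case True
    then have "1 \<le> v (A i j)" using d ij by (auto simp: vge_def)
    then have "int n * 1 \<le> int n * v (A i j)" by (intro mult_left_mono) auto
    then show ?thesis using ij True unfolding deg_def by linarith
  next
    case False
    have ge: "0 \<le> deg i j (A i j)" using A ij by (auto simp: iw_def)
    have "deg i j (A i j) \<noteq> 0"
    proof
      assume "deg i j (A i j) = 0"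
      then have "int i - int j = int n * v (A i j)" by (simp add: deg_def)
      then have "int n dvd int i - int j" by simp
      then have "\<bar>int n\<bar> \<le> \<bar>int i - int j\<bar>" using False by (intro dvd_imp_le_int) auto
      then show False using ij by linarith
    qed
    then show ?thesis using ge by linarith
  qed
qed

lemma iw1_tr: "iw 1 A \<Longrightarrow> vge 1 (tr A)"
  unfolding tr_def
proof (intro vge_sum)
  fix i assume a: "iw 1 A" "i \<in> {..<n}"
  show "vge 1 (A i i)"
  proof (cases "A i i = 0")
    case False
    then have "1 \<le> int n * v (A i i)" using a by (force simp: iw_def deg_def)
    then have "int n * v (A i i) > 0" by linarith
    then have "v (A i i) > 0" by (simp add: zero_less_mult_iff)
    then show ?thesis by (simp add: vge_def)
  qed simp
qed

lemma iw_Dm: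
  assumes "vderiv D" "iw e A"
  shows "iw e (Dm D A)"
  unfolding iw_def
proof (intro allI impI)
  fix i j assume ij: "i < n" "j < n" "Dm D A i j \<noteq> 0"
  then have nz: "A i j \<noteq> 0" using D_0[OF assms(1)] by (auto simp: Dm_def)
  have "vge (v (A i j)) (D (A i j))" by (rule vderivD(3)[OF assms(1)]) (simp add: vge_def)
  then have "v (A i j) \<le> v (D (A i j))" using ij by (auto simp: vge_def Dm_def)
  then have "int n * v (A i j) \<le> int n * v (D (A i j))" by (intro mult_left_mono) auto
  moreover have "e \<le> deg i j (A i j)" using assms(2) ij nz by (auto simp: iw_def)
  ultimately show "e \<le> deg i j (Dm D A i j)" by (simp add: deg_def Dm_def)
qed

text \<open>In an off-diagonal term of the sum one of the two factors is an entry below the diagonal.\<close>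

lemma iw_diag_mult:
  assumes "iw 0 A" "iw 0 B" "i < n"
  shows "vge 1 ((A \<star> B) i i - A i i * B i i)"
proof -
  have "(A \<star> B) i i - A i i * B i i = (\<Sum>k\<in>{..<n} - {i}. A i k * B k i)"
    using assms(3) by (simp add: mm_def sum.remove[of "{..<n}" i])
  also have "vge 1 \<dots>"
  proof (rule vge_sum)
    fix k assume k: "k \<in> {..<n} - {i}"
    show "vge 1 (A i k * B k i)"
    proof (cases "k < i")
      case True
      then show ?thesis using iw_lower[OF assms(1,3)] iw_integral[OF assms(2)] k assms(3)
        by (intro vge_mult1l) auto
    next
      case False
      then show ?thesis using iw_lower[OF assms(2), of k i] iw_integral[OF assms(1)] k assms(3)
        by (intro vge_mult1r) auto
    qed
  qed
  finally show ?thesis .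
qed

lemma iw_cm_diag:
  assumes "iw 0 A" "iw 0 B" "i < n"
  shows "vge 1 (cm A B i i)"
proof -
  have "cm A B i i = ((A \<star> B) i i - A i i * B i i) - ((B \<star> A) i i - B i i * A i i)"
    by (simp add: cm_def mult.commute)
  then show ?thesis using vge_diff[OF iw_diag_mult[OF assms] iw_diag_mult[OF assms(2,1,3)]] by simp
qed

text \<open>Modulo the maximal ideal the trace only sees products of diagonal entries, and commutators
  vanish on the diagonal.\<close>

lemma iw_tr_cm:
  assumes "iw 0 A" "iw 0 X" "iw 0 Y"
  shows "vge 1 (tr (A \<star> cm X Y))"
proof -
  have c: "iw 0 (cm X Y)" unfolding cm_def using assms by (intro iw_diff iw_mm0)
  have "iw 1 (cm X Y)" using c iw_cm_diag[OF assms(2,3)] by (rule iw1I)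
  then have "iw (0 + 1) (A \<star> cm X Y)" by (rule iw_mm[OF assms(1)])
  then show ?thesis using iw1_tr by simp
qed

definition iwgroup :: "'a mtx \<Rightarrow> 'a mtx \<Rightarrow> bool" where
  "iwgroup g g' \<longleftrightarrow> g \<in> mats \<and> g' \<in> mats \<and> iw 0 g \<and> iw 0 g' \<and> g \<star> g' = idm \<and> g' \<star> g = idm"

lemma iwgroup_idm: "iwgroup idm idm"
  by (simp add: iwgroup_def iw_idm)

lemma iwgroup_mm:
  assumes "iwgroup g g'" "iwgroup h h'"
  shows "iwgroup (g \<star> h) (h' \<star> g')"
proof -
  have "g \<star> h \<star> (h' \<star> g') = g \<star> (h \<star> h') \<star> g'" by (simp add: mm_assoc)
  moreover have "h' \<star> g' \<star> (g \<star> h) = h' \<star> (g' \<star> g) \<star> h" by (simp add: mm_assoc)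
  ultimately show ?thesis using assms by (auto simp: iwgroup_def iw_mm0)
qed

definition rowop :: "nat \<Rightarrow> (nat \<Rightarrow> 'a) \<Rightarrow> 'a mtx" where
  "rowop p c = (\<lambda>i j. if i < n \<and> j < n then (if i = j then 1 else 0) + (if j = p then c i else 0) else 0)"

definition colop :: "nat \<Rightarrow> (nat \<Rightarrow> 'a) \<Rightarrow> 'a mtx" where
  "colop q d = (\<lambda>i j. if i < n \<and> j < n then (if i = j then 1 else 0) + (if i = q then d j else 0) else 0)"

lemma rowop_mm:
  assumes "p < n" "i < n" "j < n"
  shows "(rowop p c \<star> A) i j = A i j + c i * A p j"
proof -
  have "(rowop p c \<star> A) i j = (\<Sum>k<n. (if i = k then A k j else 0) + (if k = p then c i * A k j else 0))"
    using assms by (simp add: mm_def rowop_def) (intro sum.cong, auto simp: algebra_simps)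
  then show ?thesis using assms by (simp add: sum.distrib sum.delta sum.delta')
qed

lemma mm_colop:
  assumes "q < n" "i < n" "j < n"
  shows "(A \<star> colop q d) i j = A i j + A i q * d j"
proof -
  have "(A \<star> colop q d) i j = (\<Sum>k<n. (if k = j then A i k else 0) + (if k = q then A i k * d j else 0))"
    using assms by (simp add: mm_def colop_def) (intro sum.cong, auto simp: algebra_simps)
  then show ?thesis using assms by (simp add: sum.distrib sum.delta sum.delta')
qed

lemma rowop_inv:
  assumes "p < n" "c p = 0"
  shows "rowop p c \<star> rowop p (- c) = idm"
proof (intro ext)
  fix i j
  show "(rowop p c \<star> rowop p (- c)) i j = idm i j"
  proof (cases "i < n \<and> j < n")
    case True
    then show ?thesis using assms by (simp add: rowop_mm) (auto simp: rowop_def idm_def)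
  qed (auto simp: mm_def idm_def)
qed

lemma colop_inv:
  assumes "q < n" "d q = 0"
  shows "colop q d \<star> colop q (- d) = idm"
proof (intro ext)
  fix i j
  show "(colop q d \<star> colop q (- d)) i j = idm i j"
  proof (cases "i < n \<and> j < n")
    case True
    then show ?thesis using assms by (simp add: mm_colop) (auto simp: colop_def idm_def)
  qed (auto simp: mm_def idm_def)
qed

lemma rowop_group:
  assumes p: "p < n" and cp: "c p = 0" and c: "\<And>i. i < n \<Longrightarrow> c i \<noteq> 0 \<Longrightarrow> 0 \<le> deg i p (c i)"
  shows "iwgroup (rowop p c) (rowop p (- c))"
proof -
  have iw: "iw 0 (rowop p d)" if dp: "d p = 0" and d: "\<And>i. i < n \<Longrightarrow> d i \<noteq> 0 \<Longrightarrow> 0 \<le> deg i p (d i)" for d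
    unfolding iw_def
  proof (intro allI impI)
    fix i j assume ij: "i < n" "j < n" and nz: "rowop p d i j \<noteq> 0"
    show "0 \<le> deg i j (rowop p d i j)"
    proof (cases "i = j")
      case True then show ?thesis using ij dp by (auto simp: rowop_def deg_def)
    next
      case False
      then have e: "rowop p d i j = d i" "j = p" using nz ij by (auto simp: rowop_def split: if_splits)
      then show ?thesis using nz d[of i] ij unfolding e by simp
    qed
  qed
  have "rowop p (- c) \<star> rowop p c = idm" using rowop_inv[of p "- c"] p cp by simp
  then show ?thesis
    using iw[of c] iw[of "- c"] p cp c rowop_inv[of p c]
    by (auto simp: iwgroup_def mats_def rowop_def deg_def)
qed

lemma colop_group:
  assumes q: "q < n" and dq: "d q = 0" and d: "\<And>j. j < n \<Longrightarrow> d j \<noteq> 0 \<Longrightarrow> 0 \<le> deg q j (d j)"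
  shows "iwgroup (colop q d) (colop q (- d))"
proof -
  have iw: "iw 0 (colop q d)" if dq: "d q = 0" and d: "\<And>j. j < n \<Longrightarrow> d j \<noteq> 0 \<Longrightarrow> 0 \<le> deg q j (d j)" for d
    unfolding iw_def
  proof (intro allI impI)
    fix i j assume ij: "i < n" "j < n" and nz: "colop q d i j \<noteq> 0"
    show "0 \<le> deg i j (colop q d i j)"
    proof (cases "i = j")
      case True then show ?thesis using ij dq by (auto simp: colop_def deg_def)
    next
      case False
      then have e: "colop q d i j = d j" "i = q" using nz ij by (auto simp: colop_def split: if_splits)
      then show ?thesis using nz d[of j] ij unfolding e by simp
    qed
  qed
  have "colop q (- d) \<star> colop q d = idm" using colop_inv[of q "- d"] q dq by simp
  then show ?thesis
    using iw[of d] iw[of "- d"] q dq d colop_inv[of q d]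
    by (auto simp: iwgroup_def mats_def colop_def deg_def)
qed

definition clean :: "'a mtx \<Rightarrow> nat \<Rightarrow> nat \<Rightarrow> bool" where
  "clean S p q \<longleftrightarrow> p < n \<and> q < n \<and> S p q \<noteq> 0 \<and> (\<forall>j<n. j \<noteq> q \<longrightarrow> S p j = 0) \<and> (\<forall>i<n. i \<noteq> p \<longrightarrow> S i q = 0)"

text \<open>Rows and columns may vanish, so that singular matrices have monomial forms too.\<close>

definition monomial :: "'a mtx \<Rightarrow> bool" where
  "monomial S \<longleftrightarrow> S \<in> mats \<and> (\<forall>i<n. \<forall>j<n. S i j \<noteq> 0 \<longrightarrow> clean S i j)"

text \<open>The pivot is an entry of least degree among those not yet isolated in their row and column.
  Least degree makes the multipliers that clear its row and column have degree at least 0, and the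
  entries isolated before are untouched because they meet the row and the column of the pivot in zeros.\<close>

lemma elimination_step:
  assumes X: "X \<in> mats" and nm: "\<not> monomial X"
  shows "\<exists>g g' h h'. iwgroup g g' \<and> iwgroup h h' \<and>
    {p. \<exists>q. clean X p q} \<subset> {p. \<exists>q. clean (g \<star> X \<star> h) p q}"
proof -
  define U where "U = {(i, j). i < n \<and> j < n \<and> X i j \<noteq> 0 \<and> \<not> clean X i j}"
  have "U \<subseteq> {..<n} \<times> {..<n}" by (auto simp: U_def)
  then have fin: "finite U" by (rule finite_subset) auto
  have ne: "U \<noteq> {}" using X nm by (auto simp: monomial_def U_def)
  define f where "f = (\<lambda>(i, j). deg i j (X i j))"
  define pq where "pq = arg_min_on f U"
  have pqU: "pq \<in> U" and pqm: "\<And>u. u \<in> U \<Longrightarrow> f pq \<le> f u"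
    using arg_min_if_finite[OF fin ne, of f] unfolding pq_def by (auto simp: not_less)
  obtain p q where pq: "pq = (p, q)" by (cases pq)
  have p: "p < n" and q: "q < n" and nz: "X p q \<noteq> 0" and ncl: "\<not> clean X p q"
    using pqU by (auto simp: pq U_def)
  have min: "deg p q (X p q) \<le> deg i j (X i j)" if "i < n" "j < n" "X i j \<noteq> 0" "\<not> clean X i j" for i j
    using pqm[of "(i, j)"] that by (simp add: U_def pq f_def)
  have clc: "\<not> clean X i q" for i using nz p ncl by (auto simp: clean_def)
  have clr: "\<not> clean X p j" for j using nz q ncl by (auto simp: clean_def)
  define c where "c = (\<lambda>i. if i = p then 0 else - X i q / X p q)"
  define d where "d = (\<lambda>j. if j = q then 0 else - X p j / X p q)"
  have c: "0 \<le> deg i p (c i)" if "i < n" "c i \<noteq> 0" for i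
  proof -
    have "X i q \<noteq> 0" using that by (auto simp: c_def split: if_splits)
    then have "deg p q (X p q) \<le> deg i q (X i q)" using min that q clc by simp
    moreover have vv: "v (c i) = v (X i q) - v (X p q)" using that \<open>X i q \<noteq> 0\<close> nz
      by (auto simp: c_def v_divide split: if_splits)
    moreover have "int n * v (c i) = int n * v (X i q) - int n * v (X p q)" unfolding vv by (simp add: right_diff_distrib)
    ultimately show ?thesis unfolding deg_def by linarith
  qed
  have d: "0 \<le> deg q j (d j)" if "j < n" "d j \<noteq> 0" for j
  proof -
    have "X p j \<noteq> 0" using that by (auto simp: d_def split: if_splits)
    then have "deg p q (X p q) \<le> deg p j (X p j)" using min that p clr by simp
    moreover have vv: "v (d j) = v (X p j) - v (X p q)" using that \<open>X p j \<noteq> 0\<close> nz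
      by (auto simp: d_def v_divide split: if_splits)
    moreover have "int n * v (d j) = int n * v (X p j) - int n * v (X p q)" unfolding vv by (simp add: right_diff_distrib)
    ultimately show ?thesis unfolding deg_def by linarith
  qed
  define Y where "Y = rowop p c \<star> X \<star> colop q d"
  have Y: "Y i j = X i j + c i * X p j + (X i q + c i * X p q) * d j" if "i < n" "j < n" for i j
    unfolding Y_def using that p q by (simp add: mm_colop rowop_mm)
  have Yq: "Y i j = X i j + c i * X p j" if "i < n" "j < n" "i \<noteq> p" for i j
    using that nz by (simp add: Y c_def)
  have Yp: "Y p j = (if j = q then X p q else 0)" if "j < n" for j
    using that nz p by (simp add: Y c_def d_def)
  have new: "clean Y p q"
    using p q nz by (auto simp: clean_def Yp Yq) (auto simp: c_def)
  have old: "clean Y p0 q0" if cl: "clean X p0 q0" for p0 q0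
  proof -
    have 1: "p0 \<noteq> p" "q0 \<noteq> q" using cl clr clc by auto
    have 2: "X p q0 = 0" "X p0 q = 0" "p0 < n" "q0 < n" using cl 1 p q by (auto simp: clean_def)
    then have c0: "c p0 = 0" by (simp add: c_def)
    have "Y i q0 = X i q0" if "i < n" for i
      by (cases "i = p") (use that 1 2 in \<open>auto simp: Yp Yq\<close>)
    moreover have "Y p0 j = X p0 j" if "j < n" for j using that 1 2 c0 by (simp add: Yq)
    ultimately show ?thesis using cl by (auto simp: clean_def)
  qed
  have "{p. \<exists>q. clean X p q} \<subset> {p. \<exists>q. clean Y p q}" using old new clr by blast
  moreover have "iwgroup (rowop p c) (rowop p (- c))" using p c by (intro rowop_group) (auto simp: c_def)
  moreover have "iwgroup (colop q d) (colop q (- d))" using q d by (intro colop_group) (auto simp: d_def)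
  ultimately show ?thesis unfolding Y_def by blast
qed

text \<open>Gaussian elimination with pivots of least degree only uses Iwahori row and column
  operations.  For an invertible matrix this is the Bruhat decomposition of \<open>GL\<^sub>n\<close> over the valued
  field, but the singular case is wanted as well.\<close>

theorem iwahori_elimination:
  assumes "X \<in> mats"
  shows "\<exists>g g' h h'. iwgroup g g' \<and> iwgroup h h' \<and> monomial (g \<star> X \<star> h)"
  using assms
proof (induction "n - card {p. \<exists>q. clean X p q}" arbitrary: X rule: less_induct)
  case less
  show ?case
  proof (cases "monomial X")
    case True
    then show ?thesis using iwgroup_idm less(2) by (metis mm_idl mm_idr)
  next
    case False
    obtain g g' h h' where gh: "iwgroup g g'" "iwgroup h h'"
      and ss: "{p. \<exists>q. clean X p q} \<subset> {p. \<exists>q. clean (g \<star> X \<star> h) p q}"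
      using elimination_step[OF less(2) False] by blast
    have sub: "{p. \<exists>q. clean (g \<star> X \<star> h) p q} \<subseteq> {..<n}" by (auto simp: clean_def)
    have "card {p. \<exists>q. clean X p q} < card {p. \<exists>q. clean (g \<star> X \<star> h) p q}"
      by (rule psubset_card_mono[OF finite_subset[OF sub] ss]) simp
    moreover have "card {p. \<exists>q. clean (g \<star> X \<star> h) p q} \<le> n"
      using card_mono[OF _ sub] by simp
    ultimately have "n - card {p. \<exists>q. clean (g \<star> X \<star> h) p q} < n - card {p. \<exists>q. clean X p q}" by linarith
    from less(1)[OF this] obtain a a' b b' where
      ab: "iwgroup a a'" "iwgroup b b'" "monomial (a \<star> (g \<star> X \<star> h) \<star> b)" by auto
    have "monomial ((a \<star> g) \<star> X \<star> (h \<star> b))" using ab(3) by (simp add: mm_assoc)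
    then show ?thesis using iwgroup_mm[OF ab(1) gh(1)] iwgroup_mm[OF gh(2) ab(2)] by blast
  qed
qed


end

context valued_field_mat begin

section \<open>Isospectral derivations of a triangular matrix\<close>

text \<open>As \<open>B\<close> is constant, only the logarithmic derivative of the conjugator matters.\<close>

lemma Dm_conj:
  assumes D: "vderiv D" and hh: "h \<star> h' = idm" "h' \<star> h = idm" and h: "h \<in> mats" "h' \<in> mats"
    and B: "B \<in> mats" "Dm D B = 0"
  shows "Dm D (h \<star> B \<star> h') = cm (Dm D h \<star> h') (h \<star> B \<star> h')"
proof -
  have "0 = Dm D h \<star> h' + h \<star> Dm D h'"
    using Dm_mm[OF D, of h h'] by (simp add: hh Dm_idm[OF D])
  then have 0: "h \<star> Dm D h' = - (Dm D h \<star> h')" by (simp add: eq_neg_iff_add_eq_0 add.commute)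
  have "Dm D h' = h' \<star> (h \<star> Dm D h')" using h D by (simp add: mm_assoc[symmetric] hh Dm_in)
  then have 1: "Dm D h' = - (h' \<star> (Dm D h \<star> h'))" by (simp add: 0 mm_minus_r)
  have "cm (Dm D h \<star> h') (h \<star> B \<star> h') = Dm D h \<star> (h' \<star> h) \<star> B \<star> h' - h \<star> B \<star> h' \<star> (Dm D h \<star> h')"
    by (simp add: cm_def mm_assoc)
  also have "\<dots> = Dm D (h \<star> B \<star> h')"
    using h D by (simp add: Dm_mm B mm_ring 1 hh Dm_in mm_assoc)
  finally show ?thesis by simp
qed

lemma tr_conj:
  assumes "i' \<star> i = idm"
  shows "tr (A \<star> cm (i \<star> P \<star> i') (i \<star> Q \<star> i')) = tr ((i' \<star> A \<star> i) \<star> cm P Q)"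
proof -
  have e: "i \<star> P \<star> i' \<star> (i \<star> Q \<star> i') = i \<star> (P \<star> Q) \<star> i'" for P Q
  proof -
    have "i \<star> P \<star> i' \<star> (i \<star> Q \<star> i') = i \<star> P \<star> (i' \<star> i) \<star> Q \<star> i'" by (simp add: mm_assoc)
    then show ?thesis unfolding assms by (metis mm_assoc mm_in mm_idr)
  qed
  have "cm (i \<star> P \<star> i') (i \<star> Q \<star> i') = i \<star> cm P Q \<star> i'"
    unfolding cm_def e by (simp add: mm_ring)
  then show ?thesis using tr_comm[of "A \<star> (i \<star> cm P Q)" i'] by (simp add: mm_assoc)
qed

text \<open>A column of \<open>w\<close> has at most one entry \<open>x\<close>, so the logarithmic derivative is diagonal with
  entries \<open>D x / x\<close>, and \<open>D\<close> does not lower the valuation.\<close>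

lemma monomial_logderiv:
  assumes D: "vderiv D" and w: "monomial w" and w': "w' \<star> w = idm"
  shows "iw 0 (w' \<star> Dm D w)"
proof -
  define c where "c j = (if \<exists>k<n. w k j \<noteq> 0 then let k = (SOME k. k < n \<and> w k j \<noteq> 0) in D (w k j) / w k j else 0)" for j
  define C where "C = (\<lambda>i j. if i < n \<and> i = j then c j else 0)"
  have c: "D (w k j) = c j * w k j" if "k < n" "j < n" for k j
  proof (cases "w k j = 0")
    case False
    define k' where "k' = (SOME k. k < n \<and> w k j \<noteq> 0)"
    have k': "k' < n \<and> w k' j \<noteq> 0" unfolding k'_def by (rule someI[of _ k]) (use that False in auto)
    have "clean w k j" using w that False by (auto simp: monomial_def)
    then have "k' = k" using k' unfolding clean_def by blast
    moreover have "c j = D (w k' j) / w k' j"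
      using that False unfolding c_def k'_def Let_def by (subst if_P) blast+
    ultimately show ?thesis using False by simp
  qed (simp add: D_0[OF D])
  have vc: "vge 0 (c j)" for j
  proof (cases "\<exists>k<n. w k j \<noteq> 0")
    case True
    define k where "k = (SOME k. k < n \<and> w k j \<noteq> 0)"
    have k: "k < n \<and> w k j \<noteq> 0" unfolding k_def by (rule someI_ex) (use True in auto)
    have "vge (v (w k j)) (D (w k j))" by (rule vderivD(3)[OF D]) (simp add: vge_def)
    then have "vge (v (w k j) + - v (w k j)) (D (w k j) * inverse (w k j))"
      using k by (intro vge_mult) (auto simp: vge_def v_inverse)
    moreover have "c j = D (w k j) / w k j"
      using True unfolding c_def k_def Let_def by (subst if_P) blast+
    ultimately show ?thesis by (simp add: divide_inverse)
  next
    case False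
    then have "c j = 0" unfolding c_def by (simp only: if_False)
    then show ?thesis by simp
  qed
  have "Dm D w = w \<star> C"
  proof (intro ext)
    fix i j
    show "Dm D w i j = (w \<star> C) i j"
    proof (cases "i < n \<and> j < n")
      case True
      have "(w \<star> C) i j = (\<Sum>k<n. w i k * C k j)" using True by (simp add: mm_def)
      also have "\<dots> = (\<Sum>k<n. if k = j then w i k * c j else 0)"
        by (intro sum.cong) (auto simp: C_def)
      finally have "(w \<star> C) i j = (\<Sum>k<n. if k = j then w i k * c j else 0)" .
      then show ?thesis using True c[of i j] by (simp add: sum.delta' Dm_def mult.commute)
    next
      case False
      then show ?thesis using w by (auto simp: mm_def Dm_def monomial_def mats_def D_0[OF D])
    qed
  qed
  moreover have "C \<in> mats" by (auto simp: C_def mats_def)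
  ultimately have "w' \<star> Dm D w = C" by (simp add: mm_assoc[symmetric] w')
  moreover have "iw 0 C" by (rule iw0I) (auto simp: C_def vc)
  ultimately show ?thesis by simp
qed

text \<open>Modulo the maximal ideal the diagonal is multiplicative and hence invariant under conjugation.\<close>

lemma iw_conj_diag:
  assumes g: "iwgroup g g'" and A: "iw 0 A" and k: "k < n"
  shows "vge 1 ((g' \<star> A \<star> g) k k - A k k)"
proof -
  have gs: "iw 0 g" "iw 0 g'" "g' \<star> g = idm" using g by (auto simp: iwgroup_def)
  have 1: "vge 1 ((g' \<star> A \<star> g) k k - (g' \<star> A) k k * g k k)"
    by (rule iw_diag_mult) (use gs A k iw_mm0 in auto)
  have 2: "vge 1 (((g' \<star> A) k k - g' k k * A k k) * g k k)"
    by (intro vge_mult1l iw_diag_mult iw_integral) (use gs A k in auto)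
  have "vge 1 (1 - g' k k * g k k)"
    using iw_diag_mult[OF gs(2,1) k] k unfolding gs(3) by (simp add: idm_def)
  then have "vge 1 (g' k k * g k k - 1)" using vge_minus[of 1 "1 - g' k k * g k k"] by simp
  then have 3: "vge 1 ((g' k k * g k k - 1) * A k k)"
    by (intro vge_mult1l iw_integral[OF A k k])
  have e: "(g' \<star> A \<star> g) k k - A k k = ((g' \<star> A \<star> g) k k - (g' \<star> A) k k * g k k)
    + ((g' \<star> A) k k - g' k k * A k k) * g k k + (g' k k * g k k - 1) * A k k"
    by (simp add: algebra_simps)
  show ?thesis unfolding e by (intro vge_add 1 2 3)
qed

text \<open>Suppose \<open>A\<close> is integral and triangular modulo the maximal ideal, with residual
  eigenvalues that are constants, and that two derivations move \<open>A\<close> inside its conjugacy class.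
  Writing the conjugator to a constant normal form as \<open>h = i w j\<close> by the Bruhat decomposition,
  the logarithmic derivatives of \<open>i\<close>, \<open>j\<close> and of the monomial \<open>w\<close> are integral, and the
  Kirillov form of the two directions splits into four terms: those belonging to \<open>i\<close> alone and to
  \<open>w j\<close> alone are traces against a commutator of Iwahori matrices, and in the mixed ones a
  commutator with \<open>A\<close> turns into a derivative of \<open>A\<close>, which is small.\<close>

theorem kirillov_small:
  assumes D: "vderiv D1" "vderiv D2"
    and A: "A \<in> mats" "iw 0 A" "\<forall>k<n. vge 1 (D1 (A k k))" "\<forall>k<n. vge 1 (D2 (A k k))"
    and h: "h \<in> mats" "h' \<in> mats" "h \<star> h' = idm" "h' \<star> h = idm"
    and B: "B \<in> mats" "iw 0 B" "Dm D1 B = 0" "Dm D2 B = 0" "A \<star> h = h \<star> B"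
    and X: "Dm D1 A = cm X1 A" "Dm D2 A = cm X2 A"
  shows "vge 1 (tr (A \<star> cm X1 X2))"
proof -
  obtain i' i j' j where g: "iwgroup i' i" "iwgroup j' j" and w: "monomial (i' \<star> h \<star> j')"
    using iwahori_elimination[OF h(1)] by blast
  have gi: "i \<in> mats" "i' \<in> mats" "iw 0 i" "iw 0 i'" "i \<star> i' = idm" "i' \<star> i = idm"
    and gj: "j \<in> mats" "j' \<in> mats" "iw 0 j" "iw 0 j'" "j \<star> j' = idm" "j' \<star> j = idm"
    using g by (auto simp: iwgroup_def)
  define w where "w = i' \<star> h \<star> j'"
  define w' where "w' = j \<star> h' \<star> i"
  have wm: "monomial w" using w by (simp add: w_def)
  have c1: "i \<star> (i' \<star> Y) = Y" "i' \<star> (i \<star> Y) = Y" "j \<star> (j' \<star> Y) = Y" "j' \<star> (j \<star> Y) = Y"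
    "h \<star> (h' \<star> Y) = Y" "h' \<star> (h \<star> Y) = Y" if "Y \<in> mats" for Y
    using that by (simp_all add: mm_assoc[symmetric] gi gj h)
  have ww: "w \<star> w' = idm" "w' \<star> w = idm"
    by (simp_all add: w_def w'_def mm_assoc c1 gi gj h)
  have c2: "w \<star> (w' \<star> Y) = Y" "w' \<star> (w \<star> Y) = Y" if "Y \<in> mats" for Y
    using that by (simp_all add: mm_assoc[symmetric] ww)
  have wmats: "w \<in> mats" "w' \<in> mats" by (auto simp: w_def w'_def)
  have hw: "h = i \<star> w \<star> j" "h' = j' \<star> w' \<star> i'"
    using gi gj h by (simp_all add: w_def w'_def mm_assoc c1)
  have AB: "A = h \<star> B \<star> h'"
    using A(1) h(1,3) B(5) by (metis mm_assoc mm_idr)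
  \<comment> \<open>All computations take place in the frame given by \<open>i\<close>; \<open>u\<close> and \<open>mu\<close> belong to the remaining factor \<open>w j\<close>.\<close>
  define A' where "A' = i' \<star> A \<star> i"
  have A'm: "A' \<in> mats" "iw 0 A'" using A gi by (auto simp: A'_def intro: iw_mm0)
  define u where "u = w \<star> j"
  define u' where "u' = j' \<star> w'"
  have uu: "u \<in> mats" "u' \<in> mats" "u \<star> u' = idm" "u' \<star> u = idm"
    by (auto simp: u_def u'_def mm_assoc c1 c2 gj wmats ww)
  have A'u: "A' = u \<star> B \<star> u'"
    unfolding A'_def AB hw u_def u'_def using B gi gj wmats by (simp add: mm_assoc c1)
  define B' where "B' = j \<star> B \<star> j'"
  have B'm: "iw 0 B'" using B gj by (auto simp: B'_def intro: iw_mm0)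
  have B'A': "w' \<star> A' \<star> w = B'"
    unfolding A'u B'_def u_def u'_def using B gj wmats by (simp add: mm_assoc c1 c2 ww)
  define eta where "eta D = i' \<star> Dm D i" for D
  define nu where "nu D = w' \<star> Dm D w + Dm D j \<star> j'" for D
  define mu where "mu D = w \<star> nu D \<star> w'" for D
  have small: "iw 0 (eta D)" "iw 0 (nu D)" "Dm D A' = cm (mu D) A'" "iw 1 (Dm D A')"
    "Dm D h \<star> h' = i \<star> (eta D + mu D) \<star> i'" "Dm D A = cm (Dm D h \<star> h') A"
    if D: "vderiv D" "Dm D B = 0" "\<forall>k<n. vge 1 (D (A k k))" for D
  proof -
    show "iw 0 (eta D)" unfolding eta_def using gi iw_Dm[OF D(1)] by (intro iw_mm0) auto
    show "iw 0 (nu D)" unfolding nu_def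
      by (intro iw_add monomial_logderiv[OF D(1) wm ww(2)] iw_mm0 iw_Dm[OF D(1)] gj)
    have mats: "Dm D i \<in> mats" "Dm D w \<in> mats" "Dm D j \<in> mats" using gi gj wmats Dm_in[OF D(1)] by auto
    have "Dm D u \<star> u' = Dm D w \<star> (j \<star> (j' \<star> w')) + w \<star> (Dm D j \<star> (j' \<star> w'))"
      by (simp only: u_def u'_def Dm_mm[OF D(1)] mm_add_l mm_assoc)
    also have "\<dots> = w \<star> (w' \<star> (Dm D w \<star> w')) + w \<star> (Dm D j \<star> (j' \<star> w'))"
      by (simp only: c1(3)[OF wmats(2)] c2(1)[OF mm_in])
    also have "\<dots> = mu D"
      by (simp only: mu_def nu_def mm_add_l mm_add_r mm_assoc)
    finally have "Dm D u \<star> u' = mu D" .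
    then show dA: "Dm D A' = cm (mu D) A'"
      using Dm_conj[OF D(1) uu(3,4,1,2) B(1) D(2)] by (simp add: A'u)
    show "iw 1 (Dm D A')"
    proof (rule iw1I)
      show "iw 0 (Dm D A')" by (rule iw_Dm[OF D(1) A'm(2)])
      fix k assume k: "k < n"
      have "iwgroup i i'" using g by (auto simp: iwgroup_def)
      then have "vge 1 (A' k k - A k k)" unfolding A'_def by (rule iw_conj_diag[OF _ A(2) k])
      then have "vge 1 (D (A' k k - A k k) + D (A k k))" using D(3) k vderivD(3)[OF D(1)] vge_add by blast
      moreover have "D (A' k k - A k k) + D (A k k) = D (A' k k)"
        using vderivD(1)[OF D(1), of "A' k k - A k k" "A k k"] by simp
      ultimately show "vge 1 (Dm D A' k k)" by (simp add: Dm_def)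
    qed
    show "Dm D h \<star> h' = i \<star> (eta D + mu D) \<star> i'"
    proof -
      have "Dm D h \<star> h' = Dm D i \<star> (w \<star> (j \<star> (j' \<star> (w' \<star> i')))) + i \<star> (Dm D w \<star> (j \<star> (j' \<star> (w' \<star> i'))))
          + i \<star> (w \<star> (Dm D j \<star> (j' \<star> (w' \<star> i'))))"
        by (subst hw(1), subst hw(2)) (simp only: Dm_mm[OF D(1)] mm_add_l mm_add_r mm_assoc add.assoc)
      also have "\<dots> = Dm D i \<star> i' + i \<star> (Dm D w \<star> (w' \<star> i')) + i \<star> (w \<star> (Dm D j \<star> (j' \<star> (w' \<star> i'))))"
        by (simp only: c1(3)[OF mm_in] c2(1)[OF gi(2)])
      also have "\<dots> = i \<star> (i' \<star> (Dm D i \<star> i')) + i \<star> (w \<star> (w' \<star> (Dm D w \<star> (w' \<star> i')))) + i \<star> (w \<star> (Dm D j \<star> (j' \<star> (w' \<star> i'))))"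
        by (simp only: c1(1)[OF mm_in] c2(1)[OF mm_in])
      also have "\<dots> = i \<star> (eta D + mu D) \<star> i'"
        by (simp only: eta_def mu_def nu_def mm_add_l mm_add_r mm_assoc add.assoc)
      finally show ?thesis .
    qed
    show "Dm D A = cm (Dm D h \<star> h') A"
      using Dm_conj[OF D(1) h(3,4,1,2) B(1) D(2)] unfolding AB[symmetric] .
  qed
  note s1 = small[OF D(1) B(3) A(3)] and s2 = small[OF D(2) B(4) A(4)]
  have "tr (A \<star> cm X1 X2) = tr (A \<star> cm (Dm D1 h \<star> h') (Dm D2 h \<star> h'))"
    by (rule tr_cm_shift[OF trans[OF X(1)[symmetric] s1(6)] trans[OF X(2)[symmetric] s2(6)]])
  also have "\<dots> = tr (A' \<star> cm (eta D1 + mu D1) (eta D2 + mu D2))"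
    unfolding s1(5) s2(5) A'_def by (rule tr_conj[OF gi(6)])
  also have "\<dots> = tr (A' \<star> cm (eta D1) (eta D2)) + tr (A' \<star> cm (mu D1) (mu D2))
      + (tr (A' \<star> cm (eta D1) (mu D2)) + tr (A' \<star> cm (mu D1) (eta D2)))"
    by (simp add: cm_def mm_ring tr_add tr_diff)
  also have "tr (A' \<star> cm (mu D1) (mu D2)) = tr (B' \<star> cm (nu D1) (nu D2))"
    unfolding mu_def B'A'[symmetric] by (rule tr_conj[OF ww(2)])
  also have "tr (A' \<star> cm (mu D1) (eta D2)) = - tr (Dm D1 A' \<star> eta D2)"
    unfolding tr_cm s1(3) by (subst cm_skew) (simp add: mm_ring tr_minus)
  also have "tr (A' \<star> cm (eta D1) (mu D2)) = tr (Dm D2 A' \<star> eta D1)"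
    unfolding s2(3) by (subst (1 2) cm_skew) (simp add: mm_ring tr_minus tr_cm)
  finally have e: "tr (A \<star> cm X1 X2) = tr (A' \<star> cm (eta D1) (eta D2)) + tr (B' \<star> cm (nu D1) (nu D2))
      + (tr (Dm D2 A' \<star> eta D1) + - tr (Dm D1 A' \<star> eta D2))" .
  show ?thesis unfolding e
    using iw1_tr[OF iw_mm[OF s2(4) s1(1), simplified]] iw1_tr[OF iw_mm[OF s1(4) s2(1), simplified]]
    by (intro vge_add) (auto intro: iw_tr_cm A'm B'm s1 s2)
qed

end

section \<open>Factors of integral polynomials\<close>

context valued_field begin

definition pint :: "'a poly \<Rightarrow> bool" where "pint p \<longleftrightarrow> (\<forall>i. vge 0 (coeff p i))"
definition psmall :: "'a poly \<Rightarrow> bool" where "psmall p \<longleftrightarrow> (\<forall>i. vge 1 (coeff p i))"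

lemma pint_mult: "pint p \<Longrightarrow> pint q \<Longrightarrow> pint (p * q)"
  unfolding pint_def coeff_mult by (auto intro!: vge_sum vge_mult0)
lemma psmall_mult: "psmall p \<Longrightarrow> pint q \<Longrightarrow> psmall (p * q)"
  unfolding psmall_def pint_def coeff_mult by (auto intro!: vge_sum vge_mult1l)
lemma psmall_add: "psmall p \<Longrightarrow> psmall q \<Longrightarrow> psmall (p + q)"
  unfolding psmall_def by (auto intro!: vge_add)
lemma psmall_diff: "psmall p \<Longrightarrow> psmall q \<Longrightarrow> psmall (p - q)"
  unfolding psmall_def by (auto intro!: vge_diff)
lemma psmall_const: "vge 1 c \<Longrightarrow> psmall [:c:]"
  by (auto simp: psmall_def coeff_pCons split: nat.split)
lemma pint_linear: "vge 0 c \<Longrightarrow> pint [:- c, 1:]"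
  by (auto simp: pint_def coeff_pCons split: nat.split)
lemma pint_1: "pint 1"
  by (auto simp: pint_def coeff_1)

lemma not_vge_1_1 [simp]: "\<not> vge 1 1" by (simp add: vge_def)

lemma vge_prime: "vge 1 (x * y) \<Longrightarrow> vge 0 x \<Longrightarrow> vge 0 y \<Longrightarrow> vge 1 x \<or> vge 1 y"
  by (cases "x = 0"; cases "y = 0") (auto simp: vge_def v_mult)

lemma vge_poly: "psmall p \<Longrightarrow> vge 0 x \<Longrightarrow> vge 1 (poly p x)"
proof (induction p)
  case (pCons a p)
  have "vge 1 a" using pCons(3) by (auto simp: psmall_def dest: spec[of _ 0])
  moreover have "psmall p" using pCons(3) unfolding psmall_def
    by (metis coeff_pCons_Suc)
  ultimately show ?case using pCons(2,4) by (auto intro!: vge_add vge_mult1r)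
qed simp

lemma vge_poly0: "pint p \<Longrightarrow> vge 0 x \<Longrightarrow> vge 0 (poly p x)"
proof (induction p)
  case (pCons a p)
  have "vge 0 a" using pCons(3) by (auto simp: pint_def dest: spec[of _ 0])
  moreover have "pint p" using pCons(3) unfolding pint_def
    by (metis coeff_pCons_Suc)
  ultimately show ?case using pCons(2,4) by (auto intro!: vge_add vge_mult0)
qed simp

lemma coeff_linear_mult: "coeff ([:- a, 1:] * r) (Suc i) = coeff r i - a * coeff r (Suc i)" for a :: 'a
  by simp

text \<open>The coefficients of \<open>r\<close> are recovered from those of the product by descending recursion.\<close>

lemma psmall_cancel_linear:
  assumes a: "vge 0 a" and s: "psmall ([:- a, 1:] * r)"
  shows "psmall r"
proof -
  have "vge 1 (coeff r (Suc (degree r) - k))" for k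
  proof (induction k)
    case (Suc k)
    show ?case
    proof (cases "k < Suc (degree r)")
      case True
      define i where "i = Suc (degree r) - Suc k"
      have i: "Suc (degree r) - k = Suc i" using True by (simp add: i_def)
      have "vge 1 (coeff ([:- a, 1:] * r) (Suc i))" using s unfolding psmall_def by blast
      then have "vge 1 (coeff r i - a * coeff r (Suc i))" by (simp only: coeff_linear_mult)
      moreover have "vge 1 (a * coeff r (Suc i))" using Suc a unfolding i by (intro vge_mult1r)
      ultimately show ?thesis unfolding i_def[symmetric] using vge_cong_add by (metis diff_add_cancel vge_add)
    next
      case False
      then show ?thesis using Suc by simp
    qed
  qed (simp add: coeff_eq_0)
  then have "vge 1 (coeff r i)" for i
  proof (cases "i \<le> Suc (degree r)")
    case True
    then have "Suc (degree r) - (Suc (degree r) - i) = i" by simp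
    then show ?thesis using \<open>\<And>k. vge 1 (coeff r (Suc (degree r) - k))\<close> by metis
  qed (simp add: coeff_eq_0)
  then show ?thesis by (simp add: psmall_def)
qed

text \<open>Gauss's lemma: the least coefficient valuation is additive, and it is at most 0 for a monic
  polynomial.\<close>

lemma gauss_monic:
  assumes q: "lead_coeff q = 1" and g: "lead_coeff g = 1" and i: "pint (q * g)"
  shows "pint q"
proof -
  have ex: "\<exists>i. coeff p i \<noteq> 0 \<and> (\<forall>j. vge (v (coeff p i)) (coeff p j)) \<and> (\<forall>j<i. vge (v (coeff p i) + 1) (coeff p j))"
    if "p \<noteq> 0" for p :: "'a poly"
  proof -
    define S where "S = {i. coeff p i \<noteq> 0}"
    have fin: "finite S" unfolding S_def by (rule finite_subset[of _ "{..degree p}"]) (auto intro: le_degree)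
    have ne: "S \<noteq> {}" using that unfolding S_def by (auto simp: poly_eq_iff)
    define m where "m = arg_min_on (\<lambda>i. v (coeff p i)) S"
    have m: "m \<in> S" "\<And>j. j \<in> S \<Longrightarrow> v (coeff p m) \<le> v (coeff p j)"
      using arg_min_if_finite[OF fin ne, of "\<lambda>i. v (coeff p i)"] unfolding m_def by (auto simp: not_less)
    define i where "i = (LEAST i. i \<in> S \<and> v (coeff p i) = v (coeff p m))"
    have i: "i \<in> S \<and> v (coeff p i) = v (coeff p m)" unfolding i_def by (rule LeastI[of _ m]) (use m in auto)
    have "v (coeff p i) + 1 \<le> v (coeff p j)" if "j < i" "j \<in> S" for j
    proof -
      have "v (coeff p j) \<noteq> v (coeff p m)" using not_less_Least[of j] that unfolding i_def by blast
      then show ?thesis using m(2)[OF that(2)] i by simp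
    qed
    then show ?thesis using i m by (intro exI[of _ i]) (auto simp: S_def vge_def)
  qed
  have q0: "q \<noteq> 0" and g0: "g \<noteq> 0" using q g by auto
  obtain a where a: "coeff q a \<noteq> 0" "\<And>j. vge (v (coeff q a)) (coeff q j)" "\<And>j. j < a \<Longrightarrow> vge (v (coeff q a) + 1) (coeff q j)"
    using ex[OF q0] by blast
  obtain b where b: "coeff g b \<noteq> 0" "\<And>j. vge (v (coeff g b)) (coeff g j)" "\<And>j. j < b \<Longrightarrow> vge (v (coeff g b) + 1) (coeff g j)"
    using ex[OF g0] by blast
  have "v (coeff g b) \<le> 0" using b(2)[of "degree g"] g by (simp add: vge_def)
  have "coeff (q * g) (a + b) = coeff q a * coeff g b + (\<Sum>i\<in>{..a + b} - {a}. coeff q i * coeff g (a + b - i))"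
    unfolding coeff_mult by (subst sum.remove[of _ a]) auto
  moreover have "vge (v (coeff q a) + v (coeff g b) + 1) (\<Sum>i\<in>{..a + b} - {a}. coeff q i * coeff g (a + b - i))"
  proof (rule vge_sum)
    fix i assume i: "i \<in> {..a + b} - {a}"
    show "vge (v (coeff q a) + v (coeff g b) + 1) (coeff q i * coeff g (a + b - i))"
    proof (cases "i < a")
      case True
      then show ?thesis using vge_mult[OF a(3)[OF True] b(2)[of "a + b - i"]] by (simp add: ac_simps)
    next
      case False
      then have "a + b - i < b" using i by auto
      then show ?thesis using vge_mult[OF a(2)[of i] b(3)[of "a + b - i"]] by (simp add: ac_simps)
    qed
  qed
  ultimately have "vge (v (coeff q a) + v (coeff g b) + 1) (coeff (q * g) (a + b) - coeff q a * coeff g b)" by simp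
  moreover have "vge 0 (coeff (q * g) (a + b))" using i by (auto simp: pint_def)
  ultimately have "0 \<le> v (coeff q a) + v (coeff g b)"
  proof (rule_tac ccontr)
    assume h: "vge (v (coeff q a) + v (coeff g b) + 1) (coeff (q * g) (a + b) - coeff q a * coeff g b)"
      "vge 0 (coeff (q * g) (a + b))" "\<not> 0 \<le> v (coeff q a) + v (coeff g b)"
    have "vge (v (coeff q a) + v (coeff g b) + 1) (coeff (q * g) (a + b))"
      by (rule vge_mono[OF h(2)]) (use h(3) in simp)
    from vge_diff[OF this h(1)] have "vge (v (coeff q a) + v (coeff g b) + 1) (coeff q a * coeff g b)" by simp
    then show False using a(1) b(1) by (simp add: vge_def v_mult)
  qed
  then have "0 \<le> v (coeff q a)" using \<open>v (coeff g b) \<le> 0\<close> by linarith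
  then show ?thesis unfolding pint_def using a(2) vge_mono by blast
qed

text \<open>Unique factorisation over the residue field, phrased without mentioning that field: a residual
  root of a product is a residual root of one of the factors, from which a linear factor is then
  divided off.\<close>

lemma residual_split_factor:
  assumes "lead_coeff q = 1" "lead_coeff g = 1" "pint q" "pint g"
    and "\<And>a. a \<in> set ls \<Longrightarrow> vge 0 a" and "psmall (q * g - (\<Prod>a\<leftarrow>ls. [:- a, 1:]))"
  shows "\<exists>ls'. set ls' \<subseteq> set ls \<and> length ls' = degree q \<and> psmall (q - (\<Prod>a\<leftarrow>ls'. [:- a, 1:]))"
  using assms
proof (induction ls arbitrary: q g)
  case Nil
  have "degree (q * g) = 0"
  proof (rule ccontr)
    assume n: "degree (q * g) \<noteq> 0"
    then have "coeff (q * g - 1) (degree (q * g)) = 1" using Nil(1,2) by (simp add: lead_coeff_mult coeff_1)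
    then show False using Nil(6) by (auto simp: psmall_def dest: spec[of _ "degree (q * g)"])
  qed
  then have "degree q = 0" using Nil(1,2) by (subst (asm) degree_mult_eq) auto
  then have "q = 1" using Nil(1) by (auto elim!: degree_eq_zeroE)
  then show ?case by (intro exI[of _ "[]"]) (simp add: psmall_def)
next
  case (Cons a ls)
  have a: "vge 0 a" using Cons(6) by simp
  have "vge 1 (poly (q * g - (\<Prod>a\<leftarrow>a # ls. [:- a, 1:])) a)"
    by (rule vge_poly[OF Cons(7) a])
  then have "vge 1 (poly q a * poly g a)" by simp
  then consider "vge 1 (poly q a)" | "vge 1 (poly g a)"
    using vge_prime vge_poly0[OF Cons(4) a] vge_poly0[OF Cons(5) a] by blast
  moreover have split: "\<exists>q'. q = [:- a, 1:] * q' + [:poly q a:] \<and> lead_coeff q' = 1 \<and> pint q' \<and> degree q = Suc (degree q')"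
    if q: "lead_coeff q = 1" "pint q" and s: "vge 1 (poly q a)" for q
  proof -
    define q' where "q' = synthetic_div q a"
    have e: "q = [:- a, 1:] * q' + [:poly q a:]"
      unfolding q'_def using synthetic_div_correct'[of a q] by simp
    have "degree q \<noteq> 0"
    proof
      assume "degree q = 0"
      then have "q = 1" using q(1) by (auto elim!: degree_eq_zeroE)
      then show False using s by simp
    qed
    then have d: "degree q = Suc (degree q')" unfolding q'_def by (simp add: degree_synthetic_div)
    have l: "lead_coeff q' = 1"
    proof -
      have "lead_coeff q = coeff ([:- a, 1:] * q' + [:poly q a:]) (Suc (degree q'))" using d e by metis
      also have "\<dots> = coeff q' (degree q')" by (simp add: coeff_eq_0)
      finally show ?thesis using q by simp
    qed
    have "pint ([:- a, 1:] * q')"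
    proof -
      have "[:- a, 1:] * q' = q - [:poly q a:]" using e by (simp add: algebra_simps)
      moreover have "vge 0 (coeff [:poly q a:] i)" for i
        using vge_poly0[OF q(2) a] by (auto simp: coeff_pCons split: nat.split)
      ultimately show ?thesis using q(2) unfolding pint_def by (simp only: coeff_diff) (auto intro: vge_diff)
    qed
    then have "pint q'" using gauss_monic[of q' "[:- a, 1:]"] l by (simp add: mult.commute)
    then show ?thesis using e d l by blast
  qed
  ultimately show ?case
  proof cases
    case 1
    obtain q' where q': "q = [:- a, 1:] * q' + [:poly q a:]" "lead_coeff q' = 1" "pint q'" "degree q = Suc (degree q')"
      using split[OF Cons(2,4) 1] by blast
    have "psmall ([:- a, 1:] * (q' * g - (\<Prod>a\<leftarrow>ls. [:- a, 1:])))"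
    proof -
      have "[:- a, 1:] * (q' * g - (\<Prod>a\<leftarrow>ls. [:- a, 1:])) = ([:- a, 1:] * q') * g - (\<Prod>a\<leftarrow>a # ls. [:- a, 1:])"
        by (simp add: right_diff_distrib del: mult_pCons_left mult_pCons_right)
      also have "[:- a, 1:] * q' = q - [:poly q a:]" using q'(1) by (metis add_diff_cancel_right')
      finally have "[:- a, 1:] * (q' * g - (\<Prod>a\<leftarrow>ls. [:- a, 1:])) = (q * g - (\<Prod>a\<leftarrow>a # ls. [:- a, 1:])) - [:poly q a:] * g"
        by (simp add: left_diff_distrib del: mult_pCons_left mult_pCons_right)
      then show ?thesis using psmall_diff[OF Cons(7) psmall_mult[OF psmall_const[OF 1] Cons(5)]] by simp
    qed
    then have "psmall (q' * g - (\<Prod>a\<leftarrow>ls. [:- a, 1:]))" by (rule psmall_cancel_linear[OF a])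
    then obtain ls' where ls': "set ls' \<subseteq> set ls" "length ls' = degree q'" "psmall (q' - (\<Prod>a\<leftarrow>ls'. [:- a, 1:]))"
      using Cons(1)[OF q'(2) Cons(3) q'(3) Cons(5)] Cons(6) by auto
    have "q - (\<Prod>a\<leftarrow>a # ls'. [:- a, 1:]) = (q' - (\<Prod>a\<leftarrow>ls'. [:- a, 1:])) * [:- a, 1:] + [:poly q a:]"
      by (subst q'(1)) (simp add: algebra_simps del: mult_pCons_left mult_pCons_right)
    then have "psmall (q - (\<Prod>a\<leftarrow>a # ls'. [:- a, 1:]))"
      using psmall_add[OF psmall_mult[OF ls'(3) pint_linear[OF a]] psmall_const[OF 1]] by simp
    then show ?thesis using ls' q'(4) by (intro exI[of _ "a # ls'"]) auto
  next
    case 2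
    obtain g' where g': "g = [:- a, 1:] * g' + [:poly g a:]" "lead_coeff g' = 1" "pint g'" "degree g = Suc (degree g')"
      using split[OF Cons(3,5) 2] by blast
    have "psmall ([:- a, 1:] * (q * g' - (\<Prod>a\<leftarrow>ls. [:- a, 1:])))"
    proof -
      have "[:- a, 1:] * (q * g' - (\<Prod>a\<leftarrow>ls. [:- a, 1:])) = q * ([:- a, 1:] * g') - (\<Prod>a\<leftarrow>a # ls. [:- a, 1:])"
        by (simp add: right_diff_distrib mult.left_commute del: mult_pCons_left mult_pCons_right)
      also have "[:- a, 1:] * g' = g - [:poly g a:]" using g'(1) by (metis add_diff_cancel_right')
      finally have "[:- a, 1:] * (q * g' - (\<Prod>a\<leftarrow>ls. [:- a, 1:])) = (q * g - (\<Prod>a\<leftarrow>a # ls. [:- a, 1:])) - [:poly g a:] * q"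
        by (simp add: right_diff_distrib mult.commute del: mult_pCons_left mult_pCons_right)
      then show ?thesis using psmall_diff[OF Cons(7) psmall_mult[OF psmall_const[OF 2] Cons(4)]] by simp
    qed
    then have "psmall (q * g' - (\<Prod>a\<leftarrow>ls. [:- a, 1:]))" by (rule psmall_cancel_linear[OF a])
    then obtain ls' where "set ls' \<subseteq> set ls" "length ls' = degree q" "psmall (q - (\<Prod>a\<leftarrow>ls'. [:- a, 1:]))"
      using Cons(1)[OF Cons(2) g'(2) Cons(4) g'(3)] Cons(6) by auto
    then show ?thesis by (intro exI[of _ ls']) auto
  qed
qed

end

section \<open>Finite-dimensional subspaces and Fitting's lemma\<close>

lemma sum_add_index: "(\<Sum>l<a + b. f l) = (\<Sum>l<a. f l) + (\<Sum>l<b. f (a + l))" for f :: "nat \<Rightarrow> 'c::comm_monoid_add"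
  by (induction b) (auto simp: add.assoc)

locale linear_space = vector_space scale
  for scale :: "'a::field \<Rightarrow> 'b::ab_group_add \<Rightarrow> 'b" (infixr \<open>*s\<close> 75)
begin

definition fd :: "'b set \<Rightarrow> bool" where "fd W \<longleftrightarrow> (\<exists>B. finite B \<and> W \<subseteq> span B)"

lemma fd_subset: "U \<subseteq> W \<Longrightarrow> fd W \<Longrightarrow> fd U" by (auto simp: fd_def)

lemma fd_basis:
  assumes "fd W"
  obtains B where "finite B" "B \<subseteq> W" "independent B" "W \<subseteq> span B" "card B = dim W"
proof -
  obtain B where B: "B \<subseteq> W" "independent B" "W \<subseteq> span B" "card B = dim W" using basis_exists by blast
  obtain C where "finite C" "W \<subseteq> span C" using assms by (auto simp: fd_def)
  then have "finite B" using independent_span_bound B by blast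
  then show thesis using that B by blast
qed

lemma dim_mono_fd: "S \<subseteq> T \<Longrightarrow> fd T \<Longrightarrow> dim S \<le> dim T"
  by (metis fd_basis dim_le_card order_trans)

lemma independent_card_fd: "B \<subseteq> W \<Longrightarrow> independent B \<Longrightarrow> fd W \<Longrightarrow> finite B \<and> card B \<le> dim W"
  by (metis fd_basis independent_span_bound order_trans)

lemma dim_eq_fd:
  assumes "subspace S" "S \<subseteq> T" "fd T" "dim T \<le> dim S"
  shows "S = T"
proof (rule ccontr)
  assume "S \<noteq> T"
  then obtain t where t: "t \<in> T" "t \<notin> S" using assms(2) by blast
  obtain B where B: "finite B" "B \<subseteq> S" "independent B" "S \<subseteq> span B" "card B = dim S"
    using fd_basis[OF fd_subset[OF assms(2,3)]] by blast
  have "span B \<subseteq> S" using B assms(1) by (simp add: span_minimal)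
  then have "t \<notin> span B" using t by blast
  then have "independent (insert t B)" using B by (simp add: independent_insertI)
  moreover have "insert t B \<subseteq> T" using t B assms(2) by blast
  ultimately have "card (insert t B) \<le> dim T" using independent_card_fd assms(3) by blast
  moreover have "t \<notin> B" using t B by blast
  ultimately show False using B assms(4) by simp
qed

lemma dim_less_fd: "subspace S \<Longrightarrow> S \<subset> T \<Longrightarrow> fd T \<Longrightarrow> dim S < dim T"
  using dim_eq_fd dim_mono_fd by (metis leI psubsetE psubset_imp_subset)

text \<open>Bases indexed by an initial segment of the natural numbers.\<close>

definition famb :: "nat \<Rightarrow> (nat \<Rightarrow> 'b) \<Rightarrow> 'b set \<Rightarrow> bool" where
  "famb d h W \<longleftrightarrow> (\<forall>l<d. h l \<in> W) \<and> (\<forall>w\<in>W. \<exists>c. w = (\<Sum>l<d. c l *s h l))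
     \<and> (\<forall>c. (\<Sum>l<d. c l *s h l) = 0 \<longrightarrow> (\<forall>l<d. c l = 0))"

lemma famb_in: "famb d h W \<Longrightarrow> l < d \<Longrightarrow> h l \<in> W"
  by (simp add: famb_def)

lemma famb_span: "famb d h W \<Longrightarrow> w \<in> W \<Longrightarrow> \<exists>c. w = (\<Sum>l<d. c l *s h l)"
  unfolding famb_def by (elim conjE) (erule (1) bspec)

lemma famb_indep: "famb d h W \<Longrightarrow> (\<Sum>l<d. c l *s h l) = 0 \<Longrightarrow> l < d \<Longrightarrow> c l = 0"
  unfolding famb_def by (elim conjE) (drule spec[of _ c], simp)

lemma fambI:
  assumes "\<And>l. l < d \<Longrightarrow> h l \<in> W" "\<And>w. w \<in> W \<Longrightarrow> \<exists>c. w = (\<Sum>l<d. c l *s h l)"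
    and "\<And>c l. (\<Sum>l<d. c l *s h l) = 0 \<Longrightarrow> l < d \<Longrightarrow> c l = 0"
  shows "famb d h W"
  unfolding famb_def by (intro conjI allI ballI impI) (fact assms)+

lemma indep_fam_set:
  fixes d :: nat and h :: "nat \<Rightarrow> 'b"
  assumes "\<And>c. (\<Sum>l<d. c l *s h l) = 0 \<Longrightarrow> \<forall>l<d. c l = 0"
  shows "inj_on h {..<d}" "independent (h ` {..<d})"
proof -
  show inj: "inj_on h {..<d}"
  proof (rule inj_onI, rule ccontr)
    fix i j assume ij: "i \<in> {..<d}" "j \<in> {..<d}" "h i = h j" "i \<noteq> j"
    let ?c = "\<lambda>l. if l = i then 1 else if l = j then - 1 else 0 :: 'a"
    have "(\<Sum>l<d. ?c l *s h l) = (\<Sum>l\<in>{i, j}. ?c l *s h l)"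
      using ij by (intro sum.mono_neutral_right) auto
    also have "\<dots> = 0" using ij by simp
    finally have "\<forall>l<d. ?c l = 0" by (rule assms)
    then show False using ij by auto
  qed
  show "independent (h ` {..<d})"
  proof (rule independent_if_scalars_zero)
    fix f x assume "(\<Sum>x\<in>h ` {..<d}. f x *s x) = 0" "x \<in> h ` {..<d}"
    then show "f x = 0" using assms[of "\<lambda>l. f (h l)"] sum.reindex[OF inj, of "\<lambda>x. f x *s x"] by auto
  qed simp
qed

lemma famb_dim:
  assumes "famb d h W"
  shows "dim W = d"
proof -
  have i: "inj_on h {..<d}" "independent (h ` {..<d})"
    using indep_fam_set[where d = d and h = h] assms unfolding famb_def by blast+
  have "W \<subseteq> span (h ` {..<d})"
  proof
    fix w assume "w \<in> W"
    then obtain c where "w = (\<Sum>l<d. c l *s h l)" using assms by (auto simp: famb_def)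
    then show "w \<in> span (h ` {..<d})"
      by (simp only:) (intro span_sum span_scale span_base imageI)
  qed
  moreover have "h ` {..<d} \<subseteq> W" using assms by (auto simp: famb_def)
  ultimately have "card (h ` {..<d}) = dim W" using i(2) basis_card_eq_dim by blast
  then show ?thesis using card_image[OF i(1)] by simp
qed

lemma famb_of_basis:
  assumes h: "bij_betw h {..<N} B" and B: "independent B" "B \<subseteq> W" "W \<subseteq> span B"
  shows "famb N h W"
proof (rule fambI)
  have inj: "inj_on h {..<N}" and im: "h ` {..<N} = B" using h by (auto simp: bij_betw_def)
  have fin: "finite B" using im by blast
  show "h l \<in> W" if "l < N" for l using that im B(2) by blast
  show "\<exists>c. w = (\<Sum>l<N. c l *s h l)" if "w \<in> W" for w
  proof -
    have "w \<in> span B" using that B by blast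
    then obtain u where "w = (\<Sum>v\<in>B. u v *s v)" using span_finite[OF fin] by auto
    then have "w = (\<Sum>l<N. u (h l) *s h l)" using sum.reindex[OF inj, of "\<lambda>v. u v *s v"] im by simp
    then show ?thesis by (rule exI[of _ "\<lambda>l. u (h l)"])
  qed
  show "c l = 0" if s: "(\<Sum>l<N. c l *s h l) = 0" and l: "l < N" for c l
  proof -
    define u where "u = (\<lambda>v. c (inv_into {..<N} h v))"
    have "(\<Sum>v\<in>B. u v *s v) = (\<Sum>l<N. u (h l) *s h l)"
      using sum.reindex[OF inj, of "\<lambda>v. u v *s v"] im by simp
    also have "\<dots> = (\<Sum>l<N. c l *s h l)" by (intro sum.cong) (auto simp: u_def inj)
    finally have "(\<Sum>v\<in>B. u v *s v) = 0" using s by simp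
    then have "u (h l) = 0" using independentD[OF B(1) fin subset_refl] im l by auto
    then show ?thesis using l by (simp add: u_def inj)
  qed
qed

lemma famb_exists:
  assumes "fd W"
  obtains h where "famb (dim W) h W"
proof -
  obtain B where B: "finite B" "B \<subseteq> W" "independent B" "W \<subseteq> span B" "card B = dim W"
    using fd_basis[OF assms] by blast
  obtain h where "bij_betw h {..<dim W} B"
    using ex_bij_betw_nat_finite[OF B(1)] B(5) by (auto simp: atLeast0LessThan)
  then have "famb (dim W) h W" by (rule famb_of_basis[OF _ B(3,2,4)])
  then show thesis by (rule that)
qed

definition lin :: "('b \<Rightarrow> 'b) \<Rightarrow> bool" where
  "lin T \<longleftrightarrow> (\<forall>x y. T (x + y) = T x + T y) \<and> (\<forall>c x. T (c *s x) = c *s T x)"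

lemma lin_add: "lin T \<Longrightarrow> T (x + y) = T x + T y" by (simp add: lin_def)
lemma lin_scale: "lin T \<Longrightarrow> T (c *s x) = c *s T x" by (simp add: lin_def)
lemma lin_0: "lin T \<Longrightarrow> T 0 = 0" using lin_scale[of T 0 0] by simp
lemma lin_diff: "lin T \<Longrightarrow> T (x - y) = T x - T y"
  using lin_add[of T "x - y" y] by (simp add: algebra_simps)
lemma lin_sum: "lin T \<Longrightarrow> T (sum f I) = (\<Sum>i\<in>I. T (f i))"
  by (induction I rule: infinite_finite_induct) (auto simp: lin_0 lin_add)
lemma lin_comp: "lin S \<Longrightarrow> lin T \<Longrightarrow> lin (\<lambda>x. S (T x))" by (simp add: lin_def)
lemma lin_pow: "lin T \<Longrightarrow> lin (T ^^ k)"
  by (induction k) (auto simp: lin_def)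

lemma subspace_ker: "lin T \<Longrightarrow> subspace W \<Longrightarrow> subspace {w \<in> W. T w = 0}"
  unfolding subspace_def by (auto simp: lin_0 lin_add lin_scale)

lemma subspace_im: 
  assumes T: "lin T" and W: "subspace W"
  shows "subspace (T ` W)"
  unfolding subspace_def
proof (intro conjI ballI allI)
  show "0 \<in> T ` W" using lin_0[OF T] W by (force simp: subspace_def)
next
  fix x y assume "x \<in> T ` W" "y \<in> T ` W"
  then obtain a b where "a \<in> W" "b \<in> W" "x = T a" "y = T b" by blast
  then show "x + y \<in> T ` W" using W by (intro image_eqI[of _ _ "a + b"]) (auto simp: lin_add[OF T] subspace_def)
next
  fix c x assume "x \<in> T ` W"
  then obtain a where "a \<in> W" "x = T a" by blast
  then show "c *s x \<in> T ` W" using W by (intro image_eqI[of _ _ "c *s a"]) (auto simp: lin_scale[OF T] subspace_def)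
qed

lemma pow_in: "T ` W \<subseteq> W \<Longrightarrow> w \<in> W \<Longrightarrow> (T ^^ k) w \<in> W"
  by (induction k) auto

text \<open>The kernels of the powers increase and their images decrease, so both become stationary.\<close>

lemma fitting:
  assumes T: "lin T" and W: "subspace W" "fd W" "T ` W \<subseteq> W"
  obtains N where "N \<ge> 1" "\<And>w. w \<in> W \<Longrightarrow> (T ^^ N) ((T ^^ N) w) = 0 \<Longrightarrow> (T ^^ N) w = 0"
    "\<And>w. w \<in> W \<Longrightarrow> \<exists>u\<in>W. (T ^^ N) w = (T ^^ N) ((T ^^ N) u)"
proof -
  define K where "K k = {w \<in> W. (T ^^ k) w = 0}" for k
  define I where "I k = (T ^^ k) ` W" for k
  have KW: "K k \<subseteq> W" for k by (auto simp: K_def)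
  have IW: "I k \<subseteq> W" for k using pow_in[OF W(3)] by (auto simp: I_def)
  have Ks: "subspace (K k)" for k unfolding K_def by (rule subspace_ker[OF lin_pow[OF T] W(1)])
  have Is: "subspace (I k)" for k unfolding I_def by (rule subspace_im[OF lin_pow[OF T] W(1)])
  have Km: "K i \<subseteq> K j" if "i \<le> j" for i j
  proof
    fix w assume w: "w \<in> K i"
    have "(T ^^ j) w = (T ^^ (j - i)) ((T ^^ i) w)"
      using that by (metis comp_apply funpow_add le_add_diff_inverse2)
    then show "w \<in> K j" using w lin_0[OF lin_pow[OF T]] by (auto simp: K_def)
  qed
  have Im: "I j \<subseteq> I i" if "i \<le> j" for i j
  proof
    fix w assume "w \<in> I j"
    then obtain u where u: "u \<in> W" "w = (T ^^ j) u" by (auto simp: I_def)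
    have "(T ^^ j) u = (T ^^ i) ((T ^^ (j - i)) u)"
      using that by (metis comp_apply funpow_add le_add_diff_inverse)
    then show "w \<in> I i" using u pow_in[OF W(3)] by (auto simp: I_def)
  qed
  define f where "f k = dim (K k) + (dim W - dim (I k))" for k
  have b: "dim (K k) \<le> dim W" "dim (I k) \<le> dim W" for k using dim_mono_fd[OF _ W(2)] KW IW by auto
  have fb: "f k < Suc (2 * dim W)" for k using b[of k] by (simp add: f_def)
  obtain N0 where N0: "\<And>k. f k \<le> f N0"
    using ex_has_greatest_nat[of "\<lambda>_. True" 0 f "Suc (2 * dim W)"] fb by (meson less_imp_le)
  define N where "N = Suc N0"
  have mono: "dim (K i) \<le> dim (K j)" "dim (I j) \<le> dim (I i)" if "i \<le> j" for i j
    using dim_mono_fd Km[OF that] Im[OF that] fd_subset[OF KW W(2)] fd_subset[OF IW W(2)] by auto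
  have st: "dim (K j) = dim (K N0) \<and> dim (I j) = dim (I N0)" if "N0 \<le> j" for j
    using mono[OF that] N0[of j] b[of j] b[of N0] unfolding f_def by linarith
  have KN: "K N = K (N + N)"
    by (rule dim_eq_fd[OF Ks Km fd_subset[OF KW W(2)]]) (use st[of N] st[of "N + N"] in \<open>auto simp: N_def\<close>)
  have IN: "I (N + N) = I N"
    by (rule dim_eq_fd[OF Is Im fd_subset[OF IW W(2)]]) (use st[of N] st[of "N + N"] in \<open>auto simp: N_def\<close>)
  show thesis
  proof
    show "N \<ge> 1" by (simp add: N_def)
    fix w assume w: "w \<in> W"
    show "(T ^^ N) w = 0" if "(T ^^ N) ((T ^^ N) w) = 0"
    proof -
      have "w \<in> K (N + N)" using that w by (simp add: K_def funpow_add)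
      then show ?thesis unfolding KN[symmetric] by (simp add: K_def)
    qed
    have "(T ^^ N) w \<in> I (N + N)" unfolding IN using w by (simp add: I_def)
    then show "\<exists>u\<in>W. (T ^^ N) w = (T ^^ N) ((T ^^ N) u)" by (auto simp: I_def funpow_add)
  qed
qed

section \<open>The action of polynomials in an operator\<close>

definition pa :: "('b \<Rightarrow> 'b) \<Rightarrow> 'a poly \<Rightarrow> 'b \<Rightarrow> 'b" where
  "pa T p w = fold_coeffs (\<lambda>c x. c *s w + T x) p 0"

lemma pa_0 [simp]: "pa T 0 w = 0" by (simp add: pa_def)

lemma pa_pCons: "lin T \<Longrightarrow> pa T (pCons c p) w = c *s w + T (pa T p w)"
  by (cases "c = 0 \<and> p = 0") (auto simp: pa_def lin_0)

lemma pa_const [simp]: "lin T \<Longrightarrow> pa T [:c:] w = c *s w"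
  by (simp add: pa_pCons lin_0)

lemma pa_1 [simp]: "lin T \<Longrightarrow> pa T 1 w = w"
  using pa_const[of T 1 w] by (simp add: one_pCons)

lemma pa_add: "lin T \<Longrightarrow> pa T (p + q) w = pa T p w + pa T q w"
proof (induction p arbitrary: q)
  case (pCons c p)
  obtain d r where "q = pCons d r" by (cases q)
  then show ?case using pCons by (simp add: pa_pCons lin_add scale_left_distrib)
qed simp

lemma pa_smult: "lin T \<Longrightarrow> pa T (Polynomial.smult a p) w = a *s pa T p w"
proof (induction p)
  case (pCons c p)
  then show ?case by (simp add: pa_pCons lin_scale scale_right_distrib)
qed simp

lemma pa_diff: "lin T \<Longrightarrow> pa T (p - q) w = pa T p w - pa T q w"
  using pa_add[of T "p - q" q w] by (simp add: algebra_simps)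

lemma pa_lin: "lin T \<Longrightarrow> lin (pa T p)"
proof (induction p)
  case 0 then show ?case by (simp add: lin_def)
next
  case (pCons c p)
  then show ?case by (simp add: pa_pCons lin_def scale_right_distrib scale_scale mult.commute algebra_simps)
qed

lemma pa_comm: "lin T \<Longrightarrow> pa T p (T w) = T (pa T p w)"
  by (induction p) (auto simp: pa_pCons lin_0 lin_add lin_scale)

lemma pa_mult: "lin T \<Longrightarrow> pa T (p * q) w = pa T p (pa T q w)"
proof (induction p)
  case (pCons c p)
  then show ?case by (simp add: pa_pCons pa_add pa_smult)
qed simp

lemma pa_sum: "lin T \<Longrightarrow> pa T (sum f I) w = (\<Sum>i\<in>I. pa T (f i) w)"
  by (induction I rule: infinite_finite_induct) (auto simp: pa_add)

lemma pa_power: "lin T \<Longrightarrow> pa T (p ^ k) w = (pa T p ^^ k) w"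
  by (induction k) (auto simp: pa_mult)

lemma pa_in:
  assumes "lin T" "subspace W" "T ` W \<subseteq> W" "w \<in> W"
  shows "pa T p w \<in> W"
proof (induction p)
  case 0 then show ?case using assms(2) by (simp add: subspace_0)
next
  case (pCons c p)
  then show ?case using assms by (auto simp: pa_pCons intro: subspace_add subspace_scale)
qed

definition stable :: "('b \<Rightarrow> 'b) \<Rightarrow> 'b set \<Rightarrow> bool" where
  "stable T W \<longleftrightarrow> subspace W \<and> T ` W \<subseteq> W"

definition indecomposable :: "('b \<Rightarrow> 'b) \<Rightarrow> 'b set \<Rightarrow> bool" where
  "indecomposable T W \<longleftrightarrow> (\<forall>U V. stable T U \<and> stable T V \<and> U \<subseteq> W \<and> V \<subseteq> W \<and> U \<inter> V = {0}
     \<and> (\<forall>w\<in>W. \<exists>u\<in>U. \<exists>v\<in>V. w = u + v) \<longrightarrow> U = {0} \<or> V = {0})"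

lemma indecomposableD:
  assumes "indecomposable T W" "stable T U" "stable T V" "U \<subseteq> W" "V \<subseteq> W" "U \<inter> V = {0}"
    and "\<And>w. w \<in> W \<Longrightarrow> \<exists>u\<in>U. \<exists>v\<in>V. w = u + v"
  shows "U = {0} \<or> V = {0}"
  using assms(1)[unfolded indecomposable_def, rule_format, of U V] assms(2-) by simp

lemma stable_ker:
  assumes "lin T" "stable T W" "lin S" "\<And>w. S (T w) = T (S w)"
  shows "stable T {w \<in> W. S w = 0}"
  using assms subspace_ker[of S W] unfolding stable_def by (auto simp: lin_0)

lemma stable_im:
  assumes "stable T W" "lin S" "\<And>w. S (T w) = T (S w)"
  shows "stable T (S ` W)"
  using assms subspace_im[of S W] unfolding stable_def by (auto simp: image_subset_iff) (metis image_eqI)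

text \<open>By Fitting's lemma the kernel and the image of some power of \<open>f(T)\<close> are complementary submodules.\<close>

lemma indecomposable_dichotomy:
  assumes T: "lin T" and W: "stable T W" "fd W" "indecomposable T W"
    and x: "x \<in> W" "x \<noteq> 0" "pa T f x = 0"
  shows "\<exists>N. \<forall>w\<in>W. pa T (f ^ N) w = 0"
proof -
  have S: "lin (pa T f)" by (rule pa_lin[OF T])
  have sW: "subspace W" "T ` W \<subseteq> W" using W by (auto simp: stable_def)
  have "pa T f ` W \<subseteq> W" using pa_in[OF T sW] by blast
  then obtain N where N: "N \<ge> 1" "\<And>w. w \<in> W \<Longrightarrow> (pa T f ^^ N) ((pa T f ^^ N) w) = 0 \<Longrightarrow> (pa T f ^^ N) w = 0"
    "\<And>w. w \<in> W \<Longrightarrow> \<exists>u\<in>W. (pa T f ^^ N) w = (pa T f ^^ N) ((pa T f ^^ N) u)"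
    using fitting[OF S sW(1) W(2)] by blast
  define F where "F = pa T (f ^ N)"
  have F: "F w = (pa T f ^^ N) w" for w by (simp add: F_def pa_power[OF T])
  have linF: "lin F" unfolding F_def by (rule pa_lin[OF T])
  have comm: "F (T w) = T (F w)" for w unfolding F_def by (rule pa_comm[OF T])
  have FW: "F w \<in> W" if "w \<in> W" for w unfolding F_def by (rule pa_in[OF T sW that])
  have U: "stable T {w \<in> W. F w = 0}" by (rule stable_ker[OF T W(1) linF comm])
  have V: "stable T (F ` W)" by (rule stable_im[OF W(1) linF comm])
  have "{w \<in> W. F w = 0} \<inter> F ` W = {0}"
  proof -
    have "0 \<in> W" using sW(1) by (rule subspace_0)
    show ?thesis
    proof (intro equalityI subsetI)
      fix y assume "y \<in> {w \<in> W. F w = 0} \<inter> F ` W"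
      then obtain w where w: "w \<in> W" "y = F w" "F (F w) = 0" by auto
      then show "y \<in> {0}" using N(2)[OF w(1)] by (simp add: F)
    next
      fix y :: 'b assume "y \<in> {0}"
      then show "y \<in> {w \<in> W. F w = 0} \<inter> F ` W"
        using \<open>0 \<in> W\<close> lin_0[OF linF] by (auto intro: image_eqI[of _ _ 0])
    qed
  qed
  moreover have "\<exists>u\<in>{w \<in> W. F w = 0}. \<exists>v\<in>F ` W. w = u + v" if w: "w \<in> W" for w
  proof -
    obtain u where u: "u \<in> W" "F w = F (F u)" using N(3)[OF w] by (auto simp: F)
    have "w - F u \<in> {w \<in> W. F w = 0}" using w u FW sW(1) lin_diff[OF linF] by (auto intro: subspace_diff)
    then show ?thesis using u by (intro bexI[of _ "w - F u"] bexI[of _ "F u"]) auto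
  qed
  ultimately have "{w \<in> W. F w = 0} = {0} \<or> F ` W = {0}"
    using FW by (intro indecomposableD[OF W(3) U V]) auto
  moreover have "F x = 0"
  proof -
    obtain M where "N = Suc M" using N(1) by (cases N) auto
    then have "f ^ N = f ^ M * f" by (simp add: mult.commute)
    then show ?thesis by (simp add: F_def pa_mult[OF T] x(3) lin_0[OF pa_lin[OF T]])
  qed
  ultimately have "F ` W = {0}" using x by blast
  then show ?thesis unfolding F_def by (intro exI[of _ N]) auto
qed

text \<open>The polynomials acting nilpotently form an ideal, generated by \<open>p\<close> say, and any vector not
  killed by the last nonvanishing power of \<open>p\<close> has the same annihilator as the whole module.\<close>

lemma faithful_vector:
  assumes T: "lin T" and W: "stable T W" "fd W" "indecomposable T W" "W \<noteq> {0}"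
    and chi: "chi \<noteq> 0" "\<And>w. w \<in> W \<Longrightarrow> pa T chi w = 0"
  obtains x where "x \<in> W" "\<And>f w. pa T f x = 0 \<Longrightarrow> w \<in> W \<Longrightarrow> pa T f w = 0"
proof -
  have sW: "subspace W" "T ` W \<subseteq> W" using W by (auto simp: stable_def)
  define P where "P f \<longleftrightarrow> (\<exists>x\<in>W. x \<noteq> 0 \<and> pa T f x = 0)" for f
  have nil: "\<exists>N. \<forall>w\<in>W. pa T (f ^ N) w = 0" if "P f" for f
    using that indecomposable_dichotomy[OF T W(1-3)] unfolding P_def by blast
  have Pdiff: "P (f - g)" if Pf: "P f" and Pg: "P g" for f g
  proof -
    obtain x where x: "x \<in> W" "x \<noteq> 0" "pa T f x = 0" using Pf by (auto simp: P_def)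
    obtain N where "\<forall>w\<in>W. pa T (g ^ N) w = 0" using nil[OF Pg] by blast
    then have N: "pa T (g ^ N) x = 0" using x by blast
    define j where "j = (LEAST j. pa T (g ^ j) x = 0)"
    have j: "pa T (g ^ j) x = 0" unfolding j_def by (rule LeastI[of _ N]) (rule N)
    have "j \<noteq> 0" using j x T by (metis pa_1 power_0)
    then obtain i where i: "j = Suc i" by (cases j) auto
    define y where "y = pa T (g ^ i) x"
    have "y \<noteq> 0" using not_less_Least[of i "\<lambda>j. pa T (g ^ j) x = 0"] i unfolding j_def y_def by auto
    moreover have "y \<in> W" unfolding y_def by (rule pa_in[OF T sW x(1)])
    moreover have "pa T g y = 0" using j unfolding y_def i by (simp add: pa_mult[OF T, symmetric])
    moreover have "pa T f y = 0"
    proof -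
      have "pa T f y = pa T (g ^ i) (pa T f x)" unfolding y_def by (simp add: pa_mult[OF T, symmetric] mult.commute)
      then show ?thesis using x by (simp add: lin_0[OF pa_lin[OF T]])
    qed
    ultimately show ?thesis unfolding P_def by (intro bexI[of _ y]) (auto simp: pa_diff[OF T])
  qed
  have Pmult: "P (h * f)" if Pf: "P f" for f h
  proof -
    obtain x where x: "x \<in> W" "x \<noteq> 0" "pa T f x = 0" using Pf by (auto simp: P_def)
    have "pa T (h * f) x = 0" by (simp add: pa_mult[OF T] x(3) lin_0[OF pa_lin[OF T]])
    then show ?thesis using x by (auto simp: P_def)
  qed
  obtain x0 where "x0 \<in> W" "x0 \<noteq> 0" using W(4) sW(1) subspace_0 by blast
  then have "P chi" using chi by (auto simp: P_def)
  then obtain p where p: "P p \<and> p \<noteq> 0" "\<And>g. P g \<and> g \<noteq> 0 \<Longrightarrow> degree p \<le> degree g"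
    using ex_has_least_nat[of "\<lambda>p. P p \<and> p \<noteq> 0" chi degree] chi(1) by blast
  have dvd: "\<exists>g. f = p * g" if "P f" for f
  proof -
    define q r where "q = f div p" and "r = f mod p"
    have qr: "f = p * q + r" by (simp add: q_def r_def)
    have r: "r = 0 \<or> degree r < degree p" unfolding r_def using degree_mod_less[of p f] p(1) by blast
    have "r = f - q * p" unfolding q_def r_def by (metis minus_div_mult_eq_mod)
    then have "P r" using Pdiff[OF that Pmult] p(1) by simp
    then have "r = 0" using r p(2)[of r] by linarith
    then have "f = p * q" using qr by (metis add.right_neutral)
    then show ?thesis by (rule exI)
  qed
  obtain N where N: "\<forall>w\<in>W. pa T (p ^ N) w = 0" using nil p(1) by blast
  define e where "e = (LEAST e. \<forall>w\<in>W. pa T (p ^ e) w = 0)"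
  have e: "\<forall>w\<in>W. pa T (p ^ e) w = 0" unfolding e_def by (rule LeastI[of _ N]) (rule N)
  have "e \<noteq> 0" using e \<open>x0 \<in> W\<close> \<open>x0 \<noteq> 0\<close> T by (metis pa_1 power_0)
  then obtain e' where e': "e = Suc e'" by (cases e) auto
  then obtain x where x: "x \<in> W" "pa T (p ^ e') x \<noteq> 0"
    using not_less_Least[of e' "\<lambda>e. \<forall>w\<in>W. pa T (p ^ e) w = 0"] unfolding e_def by auto
  show thesis
  proof (rule that[OF x(1)])
    fix f w assume f: "pa T f x = 0" and w: "w \<in> W"
    have pw: "j \<le> e \<Longrightarrow> \<exists>g. f = p ^ j * g" for j
    proof (induction j)
      case (Suc j)
      have "j \<le> e" using Suc(2) by simp
      from Suc(1)[OF this] obtain g where g: "f = p ^ j * g" by blast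
      have "pa T (p ^ j) x \<noteq> 0"
      proof
        assume 0: "pa T (p ^ j) x = 0"
        have "p ^ e' = p ^ (e' - j) * p ^ j" using Suc(2) e' by (simp add: power_add[symmetric])
        then show False using x(2) 0 by (simp add: pa_mult[OF T] lin_0[OF pa_lin[OF T]])
      qed
      moreover have "pa T g (pa T (p ^ j) x) = 0" using f unfolding g by (simp add: pa_mult[OF T, symmetric] mult.commute)
      ultimately have "P g" using pa_in[OF T sW x(1)] unfolding P_def by blast
      from dvd[OF this] obtain g' where g': "g = p * g'" ..
      have "p ^ j * (p * g') = p ^ Suc j * g'" by (simp add: mult_ac)
      then have "f = p ^ Suc j * g'" unfolding g' g by (simp only:)
      then show ?case by (rule exI)
    next
      case 0
      show ?case by (intro exI[of _ f]) simp
    qed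
    obtain g where "f = p ^ e * g" using pw[of e] by blast
    then have "f = g * p ^ e" by (simp only: mult.commute)
    then show "pa T f w = 0" using e w by (simp add: pa_mult[OF T] lin_0[OF pa_lin[OF T]])
  qed
qed

end

section \<open>Normal forms compatible with connections\<close>

context linear_space begin

lemma pa_monom: "lin T \<Longrightarrow> pa T (Polynomial.monom c k) w = c *s (T ^^ k) w"
proof (induction k)
  case 0 then show ?case by (simp add: monom_0)
next
  case (Suc k) then show ?case by (simp add: monom_Suc pa_pCons lin_scale)
qed

lemma pa_sum_monom:
  assumes "lin T" "degree f < d"
  shows "pa T f w = (\<Sum>l<d. Polynomial.coeff f l *s (T ^^ l) w)"
proof -
  have "f = (\<Sum>l\<le>d - 1. Polynomial.monom (Polynomial.coeff f l) l)"
    using assms(2) by (intro poly_as_sum_of_monoms'[symmetric]) simp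
  moreover have "{..d - 1} = {..<d}" using assms(2) by auto
  ultimately have "pa T f w = pa T (\<Sum>l<d. Polynomial.monom (Polynomial.coeff f l) l) w" by simp
  then show ?thesis by (simp add: pa_sum[OF assms(1)] pa_monom[OF assms(1)])
qed

text \<open>A faithful cyclic submodule of a finite-dimensional module over a polynomial ring in one variable
  has a complement, the orthogonal of a functional detecting its socle.  So an indecomposable module
  is cyclic.\<close>

lemma indecomposable_cyclic:
  assumes T: "lin T" and W: "stable T W" "fd W" "indecomposable T W" "W \<noteq> {0}"
    and chi: "chi \<noteq> 0" "\<And>w. w \<in> W \<Longrightarrow> pa T chi w = 0"
    and x: "x \<in> W" "\<And>f w. pa T f x = 0 \<Longrightarrow> w \<in> W \<Longrightarrow> pa T f w = 0"
  obtains q where "lead_coeff q = 1" "pa T q x = 0"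
    "\<And>f. pa T f x = 0 \<Longrightarrow> degree f < degree q \<Longrightarrow> f = 0"
    "\<And>w. w \<in> W \<Longrightarrow> \<exists>f. degree f < degree q \<and> w = pa T f x"
proof -
  have sW: "subspace W" "T ` W \<subseteq> W" using W by (auto simp: stable_def)
  have "pa T chi x = 0 \<and> chi \<noteq> 0" using chi x by blast
  then obtain q0 where q0: "pa T q0 x = 0 \<and> q0 \<noteq> 0"
    "\<And>f. pa T f x = 0 \<and> f \<noteq> 0 \<Longrightarrow> degree q0 \<le> degree f"
    using ex_has_least_nat[of "\<lambda>p. pa T p x = 0 \<and> p \<noteq> 0" chi degree] by blast
  define q where "q = Polynomial.smult (inverse (lead_coeff q0)) q0"
  have q: "lead_coeff q = 1" "pa T q x = 0" using q0(1) by (simp_all add: q_def pa_smult[OF T])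
  have "degree q = degree q0" using q0(1) by (simp add: q_def)
  then have qmin: "f = 0" if "pa T f x = 0" "degree f < degree q" for f using q0(2)[of f] that by auto
  define d where "d = degree q"
  have d0: "d > 0"
  proof (rule ccontr)
    assume "\<not> d > 0"
    then have "q = 1" using q(1) by (auto simp: d_def elim!: degree_eq_zeroE)
    then have "pa T 1 x = 0" using q(2) by simp
    then have "w = 0" if "w \<in> W" for w using x(2)[OF _ that, of 1] T by simp
    then show False using W(4) sW(1) subspace_0 by blast
  qed
  have red: "pa T f w = pa T (f mod q) w" if "w \<in> W" for f w
  proof -
    have "pa T q w = 0" using x(2)[OF q(2) that] .
    then have "pa T (f div q * q) w = 0" by (simp add: pa_mult[OF T] lin_0[OF pa_lin[OF T]])
    moreover have "pa T f w = pa T (f div q * q + f mod q) w" by simp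
    ultimately show ?thesis by (simp only: pa_add[OF T]) simp
  qed
  have degmod: "degree (f mod q) < d" for f
  proof (cases "f mod q = 0")
    case False
    have "q \<noteq> 0" using q(1) by auto
    then show ?thesis using degree_mod_less[of q f] False by (simp add: d_def)
  qed (use d0 in simp)
  define e where "e j = (T ^^ j) x" for j
  have ind: "\<forall>l<d. c l = 0" if "(\<Sum>l<d. c l *s e l) = 0" for c
  proof -
    define f where "f = (\<Sum>l<d. Polynomial.monom (c l) l)"
    have cf: "Polynomial.coeff f l = (if l < d then c l else 0)" for l
      unfolding f_def by (simp add: coeff_sum coeff_monom)
    have "degree f < d" using d0 by (intro degree_lessI) (auto simp: cf)
    moreover have "pa T f x = 0" using that by (simp add: f_def pa_sum[OF T] pa_monom[OF T] e_def)
    ultimately have "f = 0" using qmin by (simp add: d_def)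
    then show ?thesis using cf by (metis coeff_0)
  qed
  note fs = indep_fam_set[where d = d and h = e, OF ind]
  interpret vp: vector_space_pair scale "(*) :: 'a \<Rightarrow> 'a \<Rightarrow> 'a"
    by unfold_locales (auto simp: algebra_simps)
  obtain phi where phi: "Vector_Spaces.linear scale (*) phi"
    "\<And>y. y \<in> e ` {..<d} \<Longrightarrow> phi y = (if y = e (d - 1) then 1 else 0)"
    using vp.linear_independent_extend[OF fs(2), of "\<lambda>y. if y = e (d - 1) then 1 else 0"] by blast
  have phia: "phi (y + z) = phi y + phi z" "phi (c *s y) = c * phi y" for y z c
    using phi(1) by (simp_all add: Vector_Spaces.linear_iff)
  have phi0: "phi 0 = 0" using phia(2)[of 0 0] by simp
  have phis: "phi (\<Sum>i\<in>I. g i) = (\<Sum>i\<in>I. phi (g i))" for g and I :: "nat set"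
    by (induction I rule: infinite_finite_induct) (auto simp: phi0 phia)
  have phie: "phi (e l) = (if l = d - 1 then 1 else 0)" if "l < d" for l
    using phi(2)[of "e l"] that inj_onD[OF fs(1), of l "d - 1"] d0 by auto
  have phip: "phi (pa T f x) = Polynomial.coeff f (d - 1)" if "degree f < d" for f
  proof -
    have "phi (pa T f x) = (\<Sum>l<d. Polynomial.coeff f l * phi (e l))"
      unfolding pa_sum_monom[OF T that] by (simp add: phis phia e_def)
    also have "\<dots> = (\<Sum>l<d. if l = d - 1 then Polynomial.coeff f l else 0)"
      by (intro sum.cong) (auto simp: phie)
    finally show ?thesis using d0 by simp
  qed
  define U where "U = range (\<lambda>f. pa T f x)"
  define V where "V = {w \<in> W. \<forall>f. phi (pa T f w) = 0}"
  have U: "stable T U"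
    unfolding stable_def
  proof
    show "subspace U"
    proof (rule subspaceI)
      show "0 \<in> U" unfolding U_def by (rule range_eqI[of _ _ 0]) simp
      show "a + b \<in> U" if ab: "a \<in> U" "b \<in> U" for a b
      proof -
        obtain f g where "a = pa T f x" "b = pa T g x" using ab by (auto simp: U_def)
        then show ?thesis unfolding U_def by (intro range_eqI[of _ _ "f + g"]) (simp add: pa_add[OF T])
      qed
      show "c *s a \<in> U" if a: "a \<in> U" for c a
      proof -
        obtain f where "a = pa T f x" using a by (auto simp: U_def)
        then show ?thesis unfolding U_def by (intro range_eqI[of _ _ "Polynomial.smult c f"]) (simp add: pa_smult[OF T])
      qed
    qed
    show "T ` U \<subseteq> U"
    proof
      fix y assume "y \<in> T ` U"
      then obtain f where "y = T (pa T f x)" by (auto simp: U_def)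
      then show "y \<in> U" unfolding U_def by (intro range_eqI[of _ _ "pCons 0 f"]) (simp add: pa_pCons[OF T])
    qed
  qed
  have V: "stable T V"
    unfolding stable_def
  proof
    show "subspace V"
      by (rule subspaceI)
        (auto simp: V_def subspace_0[OF sW(1)] subspace_add[OF sW(1)] subspace_scale[OF sW(1)]
          lin_0[OF pa_lin[OF T]] lin_add[OF pa_lin[OF T]] lin_scale[OF pa_lin[OF T]] phi0 phia)
    show "T ` V \<subseteq> V"
    proof
      fix y assume "y \<in> T ` V"
      then obtain w where w: "w \<in> W" "\<And>f. phi (pa T f w) = 0" "y = T w" by (auto simp: V_def)
      have "phi (pa T f y) = phi (pa T (pCons 0 f) w)" for f
        by (simp add: w(3) pa_pCons[OF T] pa_comm[OF T])
      then show "y \<in> V" using w sW(2) by (auto simp: V_def)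
    qed
  qed
  have UW: "U \<subseteq> W" using pa_in[OF T sW x(1)] by (auto simp: U_def)
  have "U \<inter> V = {0}"
  proof (intro equalityI subsetI)
    fix y assume y: "y \<in> U \<inter> V"
    then obtain f where f: "y = pa T f x" by (auto simp: U_def)
    define g where "g = f mod q"
    have g: "y = pa T g x" unfolding g_def using f red[OF x(1)] by simp
    have dg: "degree g < d" unfolding g_def by (rule degmod)
    have "g = 0"
    proof (rule ccontr)
      assume gn: "g \<noteq> 0"
      define h where "h = Polynomial.monom 1 (d - 1 - degree g) * g"
      have "degree h = degree (Polynomial.monom (1 :: 'a) (d - 1 - degree g)) + degree g"
        unfolding h_def using gn by (intro degree_mult_eq) (simp_all del: coeff_0)
      also have "degree (Polynomial.monom (1 :: 'a) (d - 1 - degree g)) = d - 1 - degree g"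
        by (rule Polynomial.degree_monom_eq) simp
      finally have dh: "degree h = d - 1" using dg by linarith
      have "Polynomial.coeff h (d - 1) = lead_coeff g"
      proof -
        have "lead_coeff h = lead_coeff g" unfolding h_def lead_coeff_mult Polynomial.lead_coeff_monom by simp
        then show ?thesis by (simp add: dh)
      qed
      moreover have "phi (pa T h x) = 0" using y unfolding h_def pa_mult[OF T] g[symmetric] by (simp add: V_def)
      ultimately show False using phip[of h] dh d0 gn by simp
    qed
    then show "y \<in> {0}" using g by simp
  next
    fix y :: 'b assume "y \<in> {0}"
    then show "y \<in> U \<inter> V" using U V by (simp add: stable_def subspace_0)
  qed
  moreover have dec: "\<exists>f. w - pa T f x \<in> V" if w: "w \<in> W" for w
  proof -
    have "\<exists>f. \<forall>j<m. phi ((T ^^ j) (w - pa T f x)) = 0" if "m \<le> d" for m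
      using that
    proof (induction m)
      case (Suc m)
      then obtain f where f: "\<forall>j<m. phi ((T ^^ j) (w - pa T f x)) = 0" by auto
      define c where "c = phi ((T ^^ m) (w - pa T f x))"
      define f' where "f' = f + Polynomial.monom c (d - 1 - m)"
      have "phi ((T ^^ j) (w - pa T f' x)) = 0" if "j < Suc m" for j
      proof -
        have "w - pa T f' x = (w - pa T f x) + (- c) *s e (d - 1 - m)"
          unfolding f'_def e_def by (simp add: pa_add[OF T] pa_monom[OF T] algebra_simps)
        then have "(T ^^ j) (w - pa T f' x) = (T ^^ j) (w - pa T f x) + (- c) *s e (j + (d - 1 - m))"
          by (simp only: lin_add[OF lin_pow[OF T]] lin_scale[OF lin_pow[OF T]] e_def funpow_add comp_apply)
        then have "phi ((T ^^ j) (w - pa T f' x)) = phi ((T ^^ j) (w - pa T f x)) + (- c) * phi (e (j + (d - 1 - m)))"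
          by (simp only: phia)
        also have "phi (e (j + (d - 1 - m))) = (if j = m then 1 else 0)"
          using that Suc(2) by (subst phie) auto
        finally show ?thesis using f that by (cases "j = m") (auto simp: c_def)
      qed
      then show ?case by blast
    qed simp
    then obtain f where f: "\<forall>j<d. phi ((T ^^ j) (w - pa T f x)) = 0" by blast
    have wW: "w - pa T f x \<in> W" using w UW sW(1) by (auto simp: U_def intro: subspace_diff)
    have "phi (pa T g (w - pa T f x)) = 0" for g
      unfolding red[OF wW, of g] pa_sum_monom[OF T degmod] using f by (simp add: phis phia)
    then show ?thesis using wW by (auto simp: V_def)
  qed
  moreover have "\<exists>u\<in>U. \<exists>v\<in>V. w = u + v" if w: "w \<in> W" for w
  proof -
    obtain f where "w - pa T f x \<in> V" using dec[OF w] by blast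
    moreover have "pa T f x \<in> U" by (simp add: U_def)
    moreover have "w = pa T f x + (w - pa T f x)" by simp
    ultimately show ?thesis by blast
  qed
  ultimately have "U = {0} \<or> V = {0}"
    using UW by (intro indecomposableD[OF W(3) U V]) (auto simp: V_def)
  moreover have "x \<in> U" unfolding U_def by (rule range_eqI[of _ _ 1]) (simp add: T)
  moreover have "x \<noteq> 0"
  proof
    assume "x = 0"
    then have "pa T 1 x = 0" using T by simp
    then have "w = 0" if "w \<in> W" for w using x(2)[OF _ that, of 1] T by simp
    then show False using W(4) sW(1) subspace_0 by blast
  qed
  ultimately have V0: "V = {0}" by auto
  have "\<exists>f. degree f < degree q \<and> w = pa T f x" if w: "w \<in> W" for w
  proof -
    obtain f where "w - pa T f x \<in> V" using dec[OF w] by blast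
    then have "w = pa T f x" using V0 by simp
    then show ?thesis using red[OF x(1), of f] degmod[of f] by (auto simp: d_def)
  qed
  then show thesis using that q qmin by blast
qed

text \<open>A connection along the derivation \<open>D\<close> for which \<open>T\<close> is horizontal.  Only its values on \<open>W\<close> matter.\<close>

definition conn :: "('a \<Rightarrow> 'a) \<Rightarrow> ('b \<Rightarrow> 'b) \<Rightarrow> ('b \<Rightarrow> 'b) \<Rightarrow> 'b set \<Rightarrow> bool" where
  "conn D N T W \<longleftrightarrow> (\<forall>x\<in>W. N x \<in> W) \<and> (\<forall>x\<in>W. \<forall>y\<in>W. N (x + y) = N x + N y)
     \<and> (\<forall>c. \<forall>x\<in>W. N (c *s x) = D c *s x + c *s N x) \<and> (\<forall>x\<in>W. N (T x) = T (N x))"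

lemma conn_sum:
  assumes "conn D N T W" "subspace W" "\<And>i. i \<in> I \<Longrightarrow> f i \<in> W" "finite I"
  shows "N (sum f I) = (\<Sum>i\<in>I. N (f i))"
  using assms(4,3)
proof (induction I rule: finite_induct)
  case empty
  have "N (0 *s 0) = D 0 *s 0 + 0 *s N 0" using assms(1) subspace_0[OF assms(2)] unfolding conn_def by blast
  then show ?case by simp
next
  case (insert i I)
  then have "sum f I \<in> W" by (intro subspace_sum[OF assms(2)]) auto
  then have "N (f i + sum f I) = N (f i) + N (sum f I)" using insert(4) assms(1) unfolding conn_def by blast
  then show ?case using insert by simp
qed

end

locale valued_space = valued_field v + linear_space scale
  for v :: "'a::field \<Rightarrow> int" and scale :: "'a \<Rightarrow> 'b::ab_group_add \<Rightarrow> 'b" (infixr \<open>*s\<close> 75)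
begin

text \<open>In this basis of the polynomials, multiplication by the variable is triangular with diagonal \<open>ls\<close>.\<close>

definition newton :: "'a list \<Rightarrow> nat \<Rightarrow> 'a poly" where
  "newton ls j = (\<Prod>a\<leftarrow>take j ls. [:- a, 1:])"

lemma newton_0 [simp]: "newton ls 0 = 1" by (simp add: newton_def)

lemma newton_Suc: "j < length ls \<Longrightarrow> newton ls (Suc j) = [:- (ls ! j), 1:] * newton ls j"
  by (simp add: newton_def take_Suc_conv_app_nth mult.commute del: mult_pCons_left mult_pCons_right)

lemma newton_props:
  assumes "\<forall>a\<in>set ls. vge 0 a" "j \<le> length ls"
  shows "degree (newton ls j) = j \<and> lead_coeff (newton ls j) = 1 \<and> pint (newton ls j)"
  using assms(2)
proof (induction j)
  case (Suc j)
  then have IH: "degree (newton ls j) = j" "lead_coeff (newton ls j) = 1" "pint (newton ls j)" by auto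
  have nz: "newton ls j \<noteq> 0" using IH(2) by auto
  have "degree ([:- (ls ! j), 1:] * newton ls j) = Suc j"
    using nz IH(1) by (subst degree_mult_eq) auto
  moreover have "lead_coeff ([:- (ls ! j), 1:] * newton ls j) = 1"
    using IH(2) by (subst lead_coeff_mult) auto
  moreover have "pint ([:- (ls ! j), 1:] * newton ls j)"
    using Suc(2) assms(1) IH(3) by (intro pint_mult pint_linear) auto
  ultimately show ?case using Suc(2) by (simp only: newton_Suc Suc_le_eq)
qed (simp add: pint_1)

lemma newton_expand:
  assumes ls: "\<forall>a\<in>set ls. vge 0 a" and d: "d \<le> length ls" and r: "\<And>i. i \<ge> d \<Longrightarrow> coeff r i = 0"
  shows "\<exists>m. r = (\<Sum>j<d. Polynomial.smult (m j) (newton ls j)) \<and> (psmall r \<longrightarrow> (\<forall>j<d. vge 1 (m j)))"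
  using d r
proof (induction d arbitrary: r)
  case 0
  then show ?case by (auto simp: poly_eq_iff)
next
  case (Suc d)
  note np = newton_props[OF ls, where j = d]
  have dl: "d \<le> length ls" using Suc(2) by simp
  define r' where "r' = r - Polynomial.smult (coeff r d) (newton ls d)"
  have "coeff r' i = 0" if "i \<ge> d" for i
  proof (cases "i = d")
    case True
    have "coeff (newton ls d) d = 1" using np dl by metis
    then show ?thesis using True by (simp add: r'_def)
  next
    case False then show ?thesis using that np dl Suc(3)[of i] by (simp add: r'_def coeff_eq_0)
  qed
  from Suc(1)[OF dl this] obtain m where m: "r' = (\<Sum>j<d. Polynomial.smult (m j) (newton ls j))"
    "psmall r' \<longrightarrow> (\<forall>j<d. vge 1 (m j))" by blast
  have "psmall r'" if "psmall r"
    unfolding r'_def psmall_def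
  proof
    fix i
    have "vge 1 (coeff r d * coeff (newton ls d) i)" "vge 1 (coeff r i)"
      using that np dl by (auto simp: psmall_def pint_def intro!: vge_mult1l)
    then show "vge 1 (coeff (r - Polynomial.smult (coeff r d) (newton ls d)) i)"
      by (simp add: vge_diff)
  qed
  moreover have "r = r' + Polynomial.smult (coeff r d) (newton ls d)" by (simp add: r'_def)
  then have "r = (\<Sum>j<Suc d. Polynomial.smult ((m(d := coeff r d)) j) (newton ls j))"
    using m(1) by simp
  ultimately show ?case using m(2) by (intro exI[of _ "m(d := coeff r d)"]) (auto simp: psmall_def less_Suc_eq)
qed

lemma newton_indep:
  assumes ls: "\<forall>a\<in>set ls. vge 0 a" and d: "d \<le> length ls"
    and s: "(\<Sum>j<d. Polynomial.smult (c j) (newton ls j)) = 0"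
  shows "\<forall>j<d. c j = 0"
  using d s
proof (induction d)
  case (Suc d)
  note np = newton_props[OF ls]
  have "coeff (\<Sum>j<Suc d. Polynomial.smult (c j) (newton ls j)) d = c d"
  proof -
    have z: "coeff (newton ls j) d = 0" if "j < d" for j using np[where j = j] that Suc(2) by (simp add: coeff_eq_0)
    have o: "coeff (newton ls d) d = 1" using np[where j = d] Suc(2) by (metis Suc_leD)
    have "coeff (\<Sum>j<Suc d. Polynomial.smult (c j) (newton ls j)) d = (\<Sum>j<Suc d. c j * coeff (newton ls j) d)"
      by (simp add: coeff_sum)
    also have "\<dots> = (\<Sum>j<d. c j * coeff (newton ls j) d) + c d" by (simp add: o)
    also have "(\<Sum>j<d. c j * coeff (newton ls j) d) = 0" by (intro sum.neutral) (simp add: z)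
    finally show ?thesis by simp
  qed
  then have "c d = 0" unfolding Suc(3) by simp
  then show ?case using Suc by (auto simp: less_Suc_eq)
qed simp

definition normal_form :: "('i \<Rightarrow> 'a \<Rightarrow> 'a) \<Rightarrow> ('b \<Rightarrow> 'b) \<Rightarrow> 'b set \<Rightarrow> bool" where
  "normal_form D T W \<longleftrightarrow> (\<exists>d h B. famb d h W \<and> (\<forall>l<d. T (h l) = (\<Sum>k<d. B k l *s h k))
     \<and> (\<forall>k<d. \<forall>l<d. (\<forall>i. D i (B k l) = 0) \<and> vge 0 (B k l) \<and> (l < k \<longrightarrow> vge 1 (B k l))))"

text \<open>The coefficients of the Newton polynomials are killed by \<open>D\<close>.\<close>

lemma pa_conn:
  assumes T: "lin T" "stable T W" and N: "conn D N T W" and D: "vderiv D"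
    and ls: "\<And>a. a \<in> set ls \<Longrightarrow> D a = 0" and w: "w \<in> W" and j: "j \<le> length ls"
  shows "N (pa T (newton ls j) w) = pa T (newton ls j) (N w)"
  using j
proof (induction j)
  case (Suc j)
  define u where "u = pa T (newton ls j) w"
  have u: "u \<in> W" unfolding u_def using T w by (intro pa_in) (auto simp: stable_def)
  have mW: "(- (ls ! j)) *s u \<in> W" "T u \<in> W"
    using u T by (auto simp: stable_def intro: subspace_scale subspace_neg)
  have D0: "D (- (ls ! j)) = 0"
  proof -
    have "D 0 = 0" using vderivD(1)[OF D, of 0 0] by (metis add.right_neutral add_left_cancel)
    then have "D (- (ls ! j)) + D (ls ! j) = 0" using vderivD(1)[OF D, of "- (ls ! j)" "ls ! j"] by simp
    then show ?thesis using ls[of "ls ! j"] Suc(2) by simp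
  qed
  have e: "pa T (newton ls (Suc j)) y = (- (ls ! j)) *s pa T (newton ls j) y + T (pa T (newton ls j) y)" for y
    using Suc(2) by (simp only: newton_Suc Suc_le_eq pa_mult[OF T(1)] pa_pCons[OF T(1)] pa_const[OF T(1)])
      (simp add: lin_0[OF T(1)] flip: one_pCons)
  have "N (pa T (newton ls (Suc j)) w) = N ((- (ls ! j)) *s u) + N (T u)"
    unfolding e u_def[symmetric] using N mW unfolding conn_def by blast
  also have "N ((- (ls ! j)) *s u) = D (- (ls ! j)) *s u + (- (ls ! j)) *s N u"
    using N u unfolding conn_def by blast
  also have "N (T u) = T (N u)" using N u unfolding conn_def by blast
  also have "N u = pa T (newton ls j) (N w)" unfolding u_def using Suc by simp
  finally show ?case unfolding e D0 by simp
qed (simp add: pa_1[OF T(1)] flip: one_pCons)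

text \<open>In the Newton basis of a generator \<open>x\<close> the matrix of \<open>T\<close> is triangular up to one column, filled
  with the coefficients \<open>m\<close> of the relation that expresses the last Newton polynomial by the earlier
  ones.  They are small because the minimal polynomial splits residually, and constant because
  the connection takes the relation for \<open>x\<close> to the same relation for its image with a
  correction given by the derivatives of \<open>m\<close>.\<close>

lemma cyclic_normal_form:
  assumes T: "lin T" and W: "stable T W"
    and N: "\<And>i. conn (D i) (N i) T W" and D: "\<And>i. vderiv (D i)"
    and chi: "lead_coeff chi = 1" "pint chi" "\<And>w. w \<in> W \<Longrightarrow> pa T chi w = 0"
      "psmall (chi - (\<Prod>a\<leftarrow>ls. [:- a, 1:]))"
    and ls: "\<And>a. a \<in> set ls \<Longrightarrow> vge 0 a" "\<And>a i. a \<in> set ls \<Longrightarrow> D i a = 0"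
    and x: "x \<in> W" "\<And>f w. pa T f x = 0 \<Longrightarrow> w \<in> W \<Longrightarrow> pa T f w = 0"
    and q: "lead_coeff q = 1" "pa T q x = 0"
      "\<And>f. pa T f x = 0 \<Longrightarrow> degree f < degree q \<Longrightarrow> f = 0"
      "\<And>w. w \<in> W \<Longrightarrow> \<exists>f. degree f < degree q \<and> w = pa T f x"
  shows "normal_form D T W"
proof -
  have sW: "subspace W" "T ` W \<subseteq> W" using W by (auto simp: stable_def)
  have "chi mod q = 0"
  proof (cases "chi mod q = 0")
    case False
    have "pa T (chi div q * q + chi mod q) x = 0" using chi(3)[OF x(1)] by simp
    then have "pa T (chi mod q) x = 0"
      by (simp only: pa_add[OF T] pa_mult[OF T] q(2) lin_0[OF pa_lin[OF T]]) simp
    moreover have "degree (chi mod q) < degree q" using degree_mod_less[of q chi] q(1) False by force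
    ultimately show ?thesis using q(3) by blast
  qed
  then obtain g where g: "chi = q * g" by (metis dvd_eq_mod_eq_0 dvdE)
  have lg: "lead_coeff g = 1" using chi(1) q(1) unfolding g by (simp add: lead_coeff_mult)
  have pq: "pint q" using gauss_monic[OF q(1) lg] chi(2) g by simp
  have pg: "pint g" using gauss_monic[OF lg q(1)] chi(2) g by (simp add: mult.commute)
  obtain la where la: "set la \<subseteq> set ls" "length la = degree q" "psmall (q - (\<Prod>a\<leftarrow>la. [:- a, 1:]))"
    using residual_split_factor[OF q(1) lg pq pg ls(1)] chi(4) unfolding g by blast
  define d where "d = degree q"
  have la0: "\<forall>a\<in>set la. vge 0 a" using la ls by blast
  have laD: "D i a = 0" if "a \<in> set la" for a i using la ls that by blast
  define u where "u j = pa T (newton la j) x" for j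
  have uW: "u j \<in> W" for j unfolding u_def by (rule pa_in[OF T sW x(1)])
  have uind: "\<forall>j<d. c j = 0" if "(\<Sum>j<d. c j *s u j) = 0" for c
  proof -
    let ?f = "\<Sum>j<d. Polynomial.smult (c j) (newton la j)"
    have "pa T ?f x = 0" using that by (simp add: pa_sum[OF T] pa_smult[OF T] u_def)
    moreover have "?f = 0 \<or> degree ?f < d"
    proof (cases "d = 0")
      case False
      have "degree ?f < d"
      proof (rule degree_lessI)
        show "?f \<noteq> 0 \<or> 0 < d" using False by simp
        show "\<forall>k\<ge>d. coeff ?f k = 0"
        proof (intro allI impI)
          fix k assume "k \<ge> d"
          then have "coeff (newton la j) k = 0" if "j < d" for j
            using newton_props[OF la0, where j = j] that la(2) by (simp add: coeff_eq_0 d_def)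
          then show "coeff ?f k = 0" by (simp add: coeff_sum)
        qed
      qed
      then show ?thesis ..
    qed simp
    ultimately have "?f = 0" using q(3) d_def by blast
    then show ?thesis using newton_indep[OF la0, where d = d] la(2) by (simp add: d_def)
  qed
  have uspan: "\<exists>c. w = (\<Sum>j<d. c j *s u j)" if w: "w \<in> W" for w
  proof -
    obtain f where f: "degree f < degree q" "w = pa T f x" using q(4)[OF w] by blast
    then have "coeff f i = 0" if "i \<ge> d" for i using that by (simp add: d_def coeff_eq_0)
    then obtain m where m: "f = (\<Sum>j<d. Polynomial.smult (m j) (newton la j))"
      using newton_expand[OF la0, where d = d and r = f] la(2) by (auto simp: d_def)
    have "w = (\<Sum>j<d. m j *s u j)" unfolding f(2) by (subst m) (simp add: pa_sum[OF T] pa_smult[OF T] u_def)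
    then show ?thesis by (rule exI[of _ m])
  qed
  have Tu: "T (u j) = (la ! j) *s u j + u (Suc j)" if "j < d" for j
  proof -
    have "u (Suc j) = pa T [:- (la ! j), 1:] (u j)"
      unfolding u_def using that la(2) by (simp only: newton_Suc d_def pa_mult[OF T])
    also have "\<dots> = (- (la ! j)) *s u j + T (u j)" by (simp add: pa_pCons[OF T] lin_0[OF T])
    finally show ?thesis by simp
  qed
  define r where "r = newton la d - q"
  have nd: "newton la d = (\<Prod>a\<leftarrow>la. [:- a, 1:])" using la(2) by (simp add: newton_def d_def)
  have "psmall (0 - (q - newton la d))" using psmall_diff[of 0 "q - newton la d"] la(3) nd by (simp add: psmall_def)
  then have rs: "psmall r" by (simp add: r_def)
  have "coeff r i = 0" if "i \<ge> d" for i
  proof (cases "i = d")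
    case True
    have "coeff (newton la d) d = 1" using newton_props[OF la0, where j = d] la(2) by (metis d_def order_refl)
    then show ?thesis using True q(1) by (simp add: r_def d_def)
  next
    case False then show ?thesis using that newton_props[OF la0, where j = d] la(2) by (simp add: r_def d_def coeff_eq_0)
  qed
  then obtain m where m: "r = (\<Sum>j<d. Polynomial.smult (m j) (newton la j))" "\<forall>j<d. vge 1 (m j)"
    using newton_expand[OF la0, where d = d and r = r] la(2) rs by (auto simp: d_def)
  have rel: "pa T (newton la d) w = (\<Sum>j<d. m j *s pa T (newton la j) w)" if "w \<in> W" for w
  proof -
    have "pa T (newton la d) w = pa T (r + q) w" by (simp add: r_def)
    also have "\<dots> = pa T r w" using x(2)[OF q(2) that] by (simp add: pa_add[OF T])
    also have "\<dots> = (\<Sum>j<d. m j *s pa T (newton la j) w)" by (subst m(1)) (simp add: pa_sum[OF T] pa_smult[OF T])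
    finally show ?thesis .
  qed
  have Dm: "D i (m j) = 0" if "j < d" for i j
  proof -
    have Nx: "N i x \<in> W" using N[of i] x(1) unfolding conn_def by blast
    have c: "N i (pa T (newton la j) x) = pa T (newton la j) (N i x)" if "j \<le> d" for j
      by (rule pa_conn[OF T W N D laD x(1)]) (use that la(2) in \<open>auto simp: d_def\<close>)
    have "pa T (newton la d) (N i x) = N i (\<Sum>j<d. m j *s u j)"
      using c[of d] rel[OF x(1)] by (simp add: u_def)
    also have "\<dots> = (\<Sum>j<d. N i (m j *s u j))"
      by (rule conn_sum[OF N sW(1)]) (auto intro: subspace_scale[OF sW(1)] uW)
    also have "\<dots> = (\<Sum>j<d. D i (m j) *s u j + m j *s pa T (newton la j) (N i x))"
    proof (rule sum.cong)
      fix j assume "j \<in> {..<d}"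
      then have "N i (u j) = pa T (newton la j) (N i x)" unfolding u_def by (intro c) simp
      moreover have "N i (m j *s u j) = D i (m j) *s u j + m j *s N i (u j)" using N[of i] uW unfolding conn_def by blast
      ultimately show "N i (m j *s u j) = D i (m j) *s u j + m j *s pa T (newton la j) (N i x)" by simp
    qed simp
    also have "\<dots> = (\<Sum>j<d. D i (m j) *s u j) + pa T (newton la d) (N i x)"
      by (simp add: sum.distrib rel[OF Nx])
    finally have "(\<Sum>j<d. D i (m j) *s u j) = 0" by simp
    from uind[of "\<lambda>j. D i (m j)", OF this] show ?thesis using that by blast
  qed
  \<comment> \<open>Reversing the order makes the matrix upper rather than lower triangular.\<close>
  define h where "h l = u (d - 1 - l)" for l
  define B where "B k l = (if k = l then la ! (d - 1 - l) else 0) + (if Suc k = l then 1 else 0)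
     + (if l = 0 then m (d - 1 - k) else 0)" for k l
  have flip: "(\<Sum>l<d. f l) = (\<Sum>j<d. f (d - 1 - j))" for f :: "nat \<Rightarrow> 'b"
    using sum.nat_diff_reindex[of f d] by simp
  have "famb d h W"
  proof (rule fambI)
    show "h l \<in> W" for l unfolding h_def by (rule uW)
    fix w assume "w \<in> W"
    then obtain c where "w = (\<Sum>j<d. c j *s u j)" using uspan by blast
    then have "w = (\<Sum>l<d. c (d - 1 - l) *s h l)" unfolding h_def by (subst (asm) flip)
    then show "\<exists>c. w = (\<Sum>l<d. c l *s h l)" by (rule exI[of _ "\<lambda>l. c (d - 1 - l)"])
  next
    fix c l assume s: "(\<Sum>l<d. c l *s h l) = 0" and l: "l < d"
    have "(\<Sum>l<d. c l *s h l) = (\<Sum>j<d. c (d - 1 - j) *s u j)"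
      by (subst flip, rule sum.cong) (auto simp: h_def)
    then have "\<forall>j<d. c (d - 1 - j) = 0" using s uind[of "\<lambda>j. c (d - 1 - j)"] by simp
    moreover have "d - 1 - (d - 1 - l) = l" "d - 1 - l < d" using l by auto
    ultimately show "c l = 0" by metis
  qed
  moreover have "T (h l) = (\<Sum>k<d. B k l *s h k)" if l: "l < d" for l
  proof -
    have "(\<Sum>k<d. B k l *s h k) = (\<Sum>k<d. (if k = l then la ! (d - 1 - l) *s h l else 0))
       + (\<Sum>k<d. (if Suc k = l then h k else 0)) + (\<Sum>k<d. (if l = 0 then m (d - 1 - k) *s h k else 0))"
      unfolding sum.distrib[symmetric] by (intro sum.cong) (auto simp: B_def scale_left_distrib)
    also have "(\<Sum>k<d. (if k = l then la ! (d - 1 - l) *s h l else 0)) = la ! (d - 1 - l) *s h l"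
      using l by simp
    finally have 1: "(\<Sum>k<d. B k l *s h k) = la ! (d - 1 - l) *s h l + (\<Sum>k<d. (if Suc k = l then h k else 0))
        + (\<Sum>k<d. (if l = 0 then m (d - 1 - k) *s h k else 0))" .
    have 2: "T (h l) = la ! (d - 1 - l) *s h l + u (Suc (d - 1 - l))" unfolding h_def by (rule Tu) (use l in simp)
    show ?thesis
    proof (cases l)
      case 0
      have "(\<Sum>k<d. m (d - 1 - k) *s h k) = (\<Sum>j<d. m j *s u j)"
        unfolding flip[of "\<lambda>j. m j *s u j"] h_def by simp
      then have "u d = (\<Sum>k<d. m (d - 1 - k) *s h k)" using rel[OF x(1)] by (simp add: u_def)
      then show ?thesis using 1 2 l 0 by simp
    next
      case (Suc k)
      have "(\<Sum>k'<d. (if Suc k' = l then h k' else 0)) = h k" using l Suc by (simp add: sum.delta')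
      moreover have "u (Suc (d - 1 - l)) = h k" using l Suc by (simp add: h_def Suc_diff_Suc)
      ultimately show ?thesis using 1 2 Suc by simp
    qed
  qed
  moreover have "(\<forall>i. D i (B k l) = 0) \<and> vge 0 (B k l) \<and> (l < k \<longrightarrow> vge 1 (B k l))" if kl: "k < d" "l < d" for k l
  proof (intro conjI allI impI)
    have D0: "D i 0 = 0" for i using vderivD(1)[OF D, of i 0 0] by (metis add.right_neutral add_left_cancel)
    have D1: "D i 1 = 0" for i using vderivD(2)[OF D, of i 1 1]
      by (metis add.right_neutral add_left_cancel mult.left_neutral mult.right_neutral)
    have lal: "la ! (d - 1 - l) \<in> set la" using kl la(2) by (simp add: d_def)
    show "D i (B k l) = 0" for i
      using kl Dm[of "d - 1 - k" i] laD[OF lal] by (auto simp: B_def vderivD(1)[OF D] D0 D1)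
    have mk: "vge 1 (m (d - 1 - k))" using m(2) kl by simp
    show "vge 0 (B k l)" unfolding B_def
      using bspec[OF la0 lal] vge_mono[OF mk, of 0] by (intro vge_add) auto
    show "vge 1 (B k l)" if "l < k" using that mk by (simp add: B_def)
  qed
  ultimately show ?thesis unfolding normal_form_def by blast
qed

lemma direct_sum_unique:
  assumes "subspace U" "subspace V" "U \<inter> V = {0}" "u \<in> U" "w - u \<in> V" "u' \<in> U" "w - u' \<in> V"
  shows "u = u'"
proof -
  have "u - u' \<in> U" by (rule subspace_diff[OF assms(1,4,6)])
  moreover have "(w - u') - (w - u) \<in> V" by (rule subspace_diff[OF assms(2,7,5)])
  then have "u - u' \<in> V" by simp
  ultimately have "u - u' = 0" using assms(3) by blast
  then show ?thesis by simp
qed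

text \<open>A connection need not preserve the summands of a decomposition, but its projection to a summand
  is again a connection.\<close>

lemma conn_restrict:
  assumes N: "conn D N T W" and U: "stable T U" "U \<subseteq> W" and V: "stable T V" "V \<subseteq> W"
    and UV: "U \<inter> V = {0}" "\<And>w. w \<in> W \<Longrightarrow> \<exists>u\<in>U. \<exists>v\<in>V. w = u + v" and T: "lin T"
  shows "conn D (\<lambda>w. SOME u. u \<in> U \<and> N w - u \<in> V) T U"
proof -
  define P where "P w = (SOME u. u \<in> U \<and> w - u \<in> V)" for w
  have s: "subspace U" "subspace V" and TU: "T ` U \<subseteq> U" "T ` V \<subseteq> V" using U V by (auto simp: stable_def)
  have P: "P w \<in> U \<and> w - P w \<in> V" if w: "w \<in> W" for w
  proof -
    obtain u v where "u \<in> U" "v \<in> V" "w = u + v" using UV(2)[OF w] by blast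
    then have "u \<in> U \<and> w - u \<in> V" by simp
    then show ?thesis unfolding P_def by (rule someI)
  qed
  have Pe: "P w = u" if "w \<in> W" "u \<in> U" "w - u \<in> V" for w u
    by (rule direct_sum_unique[OF s UV(1) _ _ that(2,3)]) (use P[OF that(1)] in blast)+
  have NW: "N x \<in> W" if "x \<in> W" for x using N that unfolding conn_def by blast
  show ?thesis
    unfolding conn_def P_def[symmetric]
  proof (intro conjI ballI allI)
    fix x assume x: "x \<in> U"
    then have xW: "x \<in> W" using U by blast
    show "P (N x) \<in> U" using P[OF NW[OF xW]] by blast
    show "P (N (T x)) = T (P (N x))"
    proof (rule Pe)
      have "T x \<in> U" using x TU by blast
      then show "N (T x) \<in> W" using NW U by blast
      show "T (P (N x)) \<in> U" using P[OF NW[OF xW]] TU by blast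
      have "N (T x) - T (P (N x)) = T (N x - P (N x))"
        using N xW unfolding conn_def by (simp add: lin_diff[OF T])
      then show "N (T x) - T (P (N x)) \<in> V" using P[OF NW[OF xW]] TU by auto
    qed
    fix y assume y: "y \<in> U"
    then have yW: "y \<in> W" using U by blast
    have e: "N (x + y) = N x + N y" using N xW yW unfolding conn_def by blast
    show "P (N (x + y)) = P (N x) + P (N y)"
    proof (rule Pe)
      show "N (x + y) \<in> W" using subspace_add[OF s(1) x y] NW U by blast
      show "P (N x) + P (N y) \<in> U" using P[OF NW[OF xW]] P[OF NW[OF yW]] s by (blast intro: subspace_add)
      have e2: "N (x + y) - (P (N x) + P (N y)) = (N x - P (N x)) + (N y - P (N y))" by (simp add: e)
      show "N (x + y) - (P (N x) + P (N y)) \<in> V"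
        unfolding e2 using P[OF NW[OF xW]] P[OF NW[OF yW]] by (intro subspace_add[OF s(2)]) blast+
    qed
  next
    fix c x assume x: "x \<in> U"
    then have xW: "x \<in> W" using U by blast
    have e: "N (c *s x) = D c *s x + c *s N x" using N xW unfolding conn_def by blast
    show "P (N (c *s x)) = D c *s x + c *s P (N x)"
    proof (rule Pe)
      show "N (c *s x) \<in> W" using subspace_scale[OF s(1) x] NW U by blast
      show "D c *s x + c *s P (N x) \<in> U" 
        by (intro subspace_add[OF s(1)] subspace_scale[OF s(1)] x conjunct1[OF P[OF NW[OF xW]]])
      have e2: "N (c *s x) - (D c *s x + c *s P (N x)) = c *s (N x - P (N x))" by (simp add: e scale_right_diff_distrib)
      show "N (c *s x) - (D c *s x + c *s P (N x)) \<in> V"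
        unfolding e2 using P[OF NW[OF xW]] by (intro subspace_scale[OF s(2)]) blast
    qed
  qed
qed

lemma normal_formI:
  assumes "famb d h W" "\<And>l. l < d \<Longrightarrow> T (h l) = (\<Sum>k<d. B k l *s h k)"
    and "\<And>k l. k < d \<Longrightarrow> l < d \<Longrightarrow> (\<forall>i. D i (B k l) = 0) \<and> vge 0 (B k l) \<and> (l < k \<longrightarrow> vge 1 (B k l))"
  shows "normal_form D T W"
  unfolding normal_form_def
  by (rule exI[of _ d], rule exI[of _ h], rule exI[of _ B], intro conjI allI impI)
    (use assms in blast)+

end

context valued_space begin

lemma normal_form_sum:
  assumes U: "normal_form D T U" "subspace U" "U \<subseteq> W" and V: "normal_form D T V" "subspace V" "V \<subseteq> W"
    and UV: "U \<inter> V = {0}" "\<And>w. w \<in> W \<Longrightarrow> \<exists>u\<in>U. \<exists>v\<in>V. w = u + v"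
    and D: "\<And>i. D i 0 = 0"
  shows "normal_form D T W"
proof -
  from U(1)[unfolded normal_form_def] obtain d1 h1 B1 where 1: "famb d1 h1 U"
      "\<forall>l<d1. T (h1 l) = (\<Sum>k<d1. B1 k l *s h1 k)"
      "\<forall>k<d1. \<forall>l<d1. (\<forall>i. D i (B1 k l) = 0) \<and> vge 0 (B1 k l) \<and> (l < k \<longrightarrow> vge 1 (B1 k l))"
    by (elim exE conjE)
  from V(1)[unfolded normal_form_def] obtain d2 h2 B2 where 2: "famb d2 h2 V"
      "\<forall>l<d2. T (h2 l) = (\<Sum>k<d2. B2 k l *s h2 k)"
      "\<forall>k<d2. \<forall>l<d2. (\<forall>i. D i (B2 k l) = 0) \<and> vge 0 (B2 k l) \<and> (l < k \<longrightarrow> vge 1 (B2 k l))"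
    by (elim exE conjE)
  note b1 = 1(3)[rule_format] and b2 = 2(3)[rule_format]
  define h where "h l = (if l < d1 then h1 l else h2 (l - d1))" for l
  define B where "B k l = (if k < d1 \<and> l < d1 then B1 k l else if k < d1 \<or> l < d1 then 0 else B2 (k - d1) (l - d1))" for k l
  have hs: "(\<Sum>l<d1 + d2. c l *s h l) = (\<Sum>l<d1. c l *s h1 l) + (\<Sum>l<d2. c (d1 + l) *s h2 l)" for c
    unfolding sum_add_index by (simp add: h_def)
  have h1: "h1 l \<in> U" if "l < d1" for l by (rule famb_in[OF 1(1) that])
  have h2: "h2 l \<in> V" if "l < d2" for l by (rule famb_in[OF 2(1) that])
  have inU: "(\<Sum>l<d1. c l *s h1 l) \<in> U" for c
    using h1 by (intro subspace_sum[OF U(2)] subspace_scale[OF U(2)]) simp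
  have inV: "(\<Sum>l<d2. c l *s h2 l) \<in> V" for c
    using h2 by (intro subspace_sum[OF V(2)] subspace_scale[OF V(2)]) simp
  have F: "famb (d1 + d2) h W"
  proof (rule fambI)
    fix l assume "l < d1 + d2"
    then have "l < d1 \<or> l - d1 < d2" by linarith
    then show "h l \<in> W" using h1 h2 U(3) V(3) \<open>l < d1 + d2\<close> unfolding h_def by (cases "l < d1") auto
  next
    fix w assume "w \<in> W"
    then obtain u x where ux: "u \<in> U" "x \<in> V" "w = u + x" using UV(2) by blast
    obtain c1 where c1: "u = (\<Sum>l<d1. c1 l *s h1 l)" using famb_span[OF 1(1) ux(1)] by (elim exE)
    obtain c2 where c2: "x = (\<Sum>l<d2. c2 l *s h2 l)" using famb_span[OF 2(1) ux(2)] by (elim exE)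
    have "w = (\<Sum>l<d1 + d2. (if l < d1 then c1 l else c2 (l - d1)) *s h l)"
      unfolding hs ux(3) c1 c2 by simp
    then show "\<exists>c. w = (\<Sum>l<d1 + d2. c l *s h l)"
      by (rule exI[of _ "\<lambda>l. if l < d1 then c1 l else c2 (l - d1)"])
  next
    fix c l assume s: "(\<Sum>l<d1 + d2. c l *s h l) = 0" and l: "l < d1 + d2"
    have e: "(\<Sum>l<d1. c l *s h1 l) = - (\<Sum>l<d2. c (d1 + l) *s h2 l)"
      using s unfolding hs by (simp add: eq_neg_iff_add_eq_0)
    then have "(\<Sum>l<d1. c l *s h1 l) \<in> V" using inV[of "\<lambda>l. c (d1 + l)"] V(2) by (simp add: subspace_neg)
    then have z: "(\<Sum>l<d1. c l *s h1 l) = 0" using inU[of c] UV(1) by blast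
    then have z2: "(\<Sum>l<d2. c (d1 + l) *s h2 l) = 0" using e by simp
    have a1: "\<forall>l<d1. c l = 0" using famb_indep[OF 1(1) z] by blast
    have a2: "c (d1 + l) = 0" if "l < d2" for l by (rule famb_indep[OF 2(1), where c = "\<lambda>l. c (d1 + l)", OF z2 that])
    show "c l = 0"
    proof (cases "l < d1")
      case False
      then show ?thesis using a2[of "l - d1"] l by simp
    qed (use a1 in blast)
  qed
  have E: "T (h l) = (\<Sum>k<d1 + d2. B k l *s h k)" if l: "l < d1 + d2" for l
  proof (cases "l < d1")
    case True
    have "(\<Sum>k<d1 + d2. B k l *s h k) = (\<Sum>k<d1. B1 k l *s h1 k)"
      unfolding hs using True by (simp add: B_def)
    moreover have "h l = h1 l" using True by (simp add: h_def)
    ultimately show ?thesis using 1(2)[rule_format, OF True] by (simp only:)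
  next
    case False
    then have l2: "l - d1 < d2" using l by simp
    have "(\<Sum>k<d1 + d2. B k l *s h k) = (\<Sum>k<d2. B2 k (l - d1) *s h2 k)"
      unfolding hs using False by (simp add: B_def)
    moreover have "h l = h2 (l - d1)" using False by (simp add: h_def)
    ultimately show ?thesis using 2(2)[rule_format, OF l2] by (simp only:)
  qed
  have G: "(\<forall>i. D i (B k l) = 0) \<and> vge 0 (B k l) \<and> (l < k \<longrightarrow> vge 1 (B k l))" if "k < d1 + d2" "l < d1 + d2" for k l
  proof -
    consider "k < d1" "l < d1" | "k < d1" "\<not> l < d1" | "\<not> k < d1" "l < d1" | "\<not> k < d1" "\<not> l < d1" by blast
    then show ?thesis
    proof cases
      case 1 then show ?thesis using b1[of k l]
        by (simp add: B_def)
    next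
      case 2 then show ?thesis by (simp add: B_def D)
    next
      case 3 then show ?thesis by (simp add: B_def D)
    next
      case 4
      then have "k - d1 < d2" "l - d1 < d2" using that by auto
      then show ?thesis using b2[of "k - d1" "l - d1"] 4 by (auto simp: B_def)
    qed
  qed
  show ?thesis by (rule normal_formI[OF F E G])
qed

text \<open>The connections express that \<open>T\<close> moves in its conjugacy class along the derivations \<open>D i\<close>.
  They can be projected to indecomposable summands, which are cyclic, and in the Newton basis of a
  cyclic module they force the entries of the matrix to be constant.\<close>

theorem frobenius_normal_form:
  assumes T: "lin T" and W: "stable T W" "fd W"
    and N: "\<And>i. conn (D i) (N i) T W" and D: "\<And>i. vderiv (D i)"
    and chi: "lead_coeff chi = 1" "pint chi" "\<And>w. w \<in> W \<Longrightarrow> pa T chi w = 0"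
      "psmall (chi - (\<Prod>a\<leftarrow>ls. [:- a, 1:]))"
    and ls: "\<And>a. a \<in> set ls \<Longrightarrow> vge 0 a" "\<And>a i. a \<in> set ls \<Longrightarrow> D i a = 0"
  shows "normal_form D T W"
  using W N chi(3)
proof (induction "dim W" arbitrary: W N rule: less_induct)
  case less
  have sW: "subspace W" "T ` W \<subseteq> W" using less(2) by (auto simp: stable_def)
  show ?case
  proof (cases "W = {0}")
    case True
    have "famb 0 (\<lambda>_. 0) W" using True by (auto simp: famb_def)
    then show ?thesis unfolding normal_form_def by (intro exI[of _ 0] exI[of _ "\<lambda>_. 0"]) auto
  next
    case W0: False
    show ?thesis
    proof (cases "indecomposable T W")
      case True
      have c0: "chi \<noteq> 0" using chi(1) by auto
      obtain x where x: "x \<in> W" "\<And>f w. pa T f x = 0 \<Longrightarrow> w \<in> W \<Longrightarrow> pa T f w = 0"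
        using faithful_vector[OF T less(2,3) True W0 c0 less(5)] by metis
      obtain q where q: "lead_coeff q = 1" "pa T q x = 0"
          "\<And>f. pa T f x = 0 \<Longrightarrow> degree f < degree q \<Longrightarrow> f = 0"
          "\<And>w. w \<in> W \<Longrightarrow> \<exists>f. degree f < degree q \<and> w = pa T f x"
        using indecomposable_cyclic[OF T less(2,3) True W0 c0 less(5) x] by metis
      show ?thesis
        by (rule cyclic_normal_form[OF T less(2) less(4) D chi(1,2) less(5) chi(4) ls x q])
    next
      case False
      then obtain U V where UV: "stable T U" "stable T V" "U \<subseteq> W" "V \<subseteq> W" "U \<inter> V = {0}"
        "\<forall>w\<in>W. \<exists>u\<in>U. \<exists>v\<in>V. w = u + v" "U \<noteq> {0}" "V \<noteq> {0}"
        unfolding indecomposable_def by blast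
      have s: "subspace U" "subspace V" using UV by (auto simp: stable_def)
      have "U \<noteq> W" using UV(4,5,8) subspace_0[OF s(2)] by blast
      then have dU: "dim U < dim W" using UV(3) by (intro dim_less_fd s less(3)) blast
      have "V \<noteq> W" using UV(3,5,7) subspace_0[OF s(1)] by blast
      then have dV: "dim V < dim W" using UV(4) by (intro dim_less_fd s less(3)) blast
      have UV1: "V \<inter> U = {0}" using UV(5) by (simp only: Int_commute)
      have UV2: "\<exists>u\<in>V. \<exists>v\<in>U. w = u + v" if w: "w \<in> W" for w
      proof -
        obtain u v where "u \<in> U" "v \<in> V" "w = u + v" using UV(6) w by blast
        then show ?thesis by (intro bexI[of _ v] bexI[of _ u]) (simp_all add: add.commute)
      qed
      have nU: "normal_form D T U"
        by (rule less(1)[OF dU UV(1) fd_subset[OF UV(3) less(3)]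
              conn_restrict[OF less(4) UV(1,3,2,4,5) UV(6)[rule_format] T] less(5)[OF subsetD[OF UV(3)]]])
      have nV: "normal_form D T V"
        by (rule less(1)[OF dV UV(2) fd_subset[OF UV(4) less(3)]
              conn_restrict[OF less(4) UV(2,4,1,3) UV1 UV2 T] less(5)[OF subsetD[OF UV(4)]]])
      have D0: "D i 0 = 0" for i using vderivD(1)[OF D, of i 0 0] by (metis add.right_neutral add_left_cancel)
      show ?thesis by (rule normal_form_sum[OF nU s(1) UV(3) nV s(2) UV(4,5) UV(6)[rule_format] D0])
    qed
  qed
qed

end

section \<open>Characteristic polynomials modulo the maximal ideal\<close>

context valued_field begin

lemma pint_prod: "(\<And>i. i \<in> I \<Longrightarrow> pint (f i)) \<Longrightarrow> pint (prod f I)"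
  by (induction I rule: infinite_finite_induct) (auto intro: pint_mult simp: pint_1)

lemma psmall_0 [simp]: "psmall 0" by (simp add: psmall_def)

lemma psmall_sum: "(\<And>i. i \<in> I \<Longrightarrow> psmall (f i)) \<Longrightarrow> psmall (sum f I)"
  by (induction I rule: infinite_finite_induct) (auto intro: psmall_add)

lemma psmall_prod_diff:
  assumes "\<And>i. i \<in> I \<Longrightarrow> pint (f i)" "\<And>i. i \<in> I \<Longrightarrow> pint (g i)" "\<And>i. i \<in> I \<Longrightarrow> psmall (f i - g i)"
  shows "psmall (prod f I - prod g I)"
  using assms
proof (induction I rule: infinite_finite_induct)
  case (insert x F)
  have "prod f (insert x F) - prod g (insert x F) = (f x - g x) * prod f F + (prod f F - prod g F) * g x"
    using insert by (simp add: algebra_simps)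
  moreover have "psmall ((f x - g x) * prod f F)" using insert by (intro psmall_mult pint_prod) auto
  moreover have "psmall ((prod f F - prod g F) * g x)" using insert by (intro psmall_mult) auto
  ultimately show ?case by (simp add: psmall_add)
qed (auto simp: psmall_def)

lemma psmall_pint: "psmall p \<Longrightarrow> pint p"
  using vge_mono[of 1 _ 0] by (auto simp: psmall_def pint_def)

lemma pint_add: "pint p \<Longrightarrow> pint q \<Longrightarrow> pint (p + q)"
  by (auto simp: pint_def intro: vge_add)

lemma pint_const: "vge 0 c \<Longrightarrow> pint [:c:]"
  by (auto simp: pint_def coeff_pCons split: nat.split)

text \<open>A permutation other than the identity moves some index down, and so contributes a product with an
  entry below the diagonal to the determinant.\<close>

lemma char_poly_residual:
  assumes int: "\<And>i j. i < n \<Longrightarrow> j < n \<Longrightarrow> vge 0 (A i j)" and low: "\<And>i j. i < n \<Longrightarrow> j < i \<Longrightarrow> vge 1 (A i j)"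
    and ls: "length ls = n" "\<And>k. k < n \<Longrightarrow> vge 0 (ls ! k)" "\<And>k. k < n \<Longrightarrow> vge 1 (A k k - ls ! k)"
  defines "chi \<equiv> char_poly (mat n n (\<lambda>(i, j). A i j))"
  shows "psmall (chi - (\<Prod>a\<leftarrow>ls. [:- a, 1:]))" "pint chi"
proof -
  let ?A = "mat n n (\<lambda>(i, j). A i j)"
  let ?C = "char_poly_matrix ?A"
  have C: "?C \<in> carrier_mat n n" by simp
  have Cij: "?C $$ (i, j) = (if i = j then [:- A i j, 1:] else [:- A i j:])" if "i < n" "j < n" for i j
    using that by (auto simp: char_poly_matrix_def)
  have Cint: "pint (?C $$ (i, j))" if "i < n" "j < n" for i j
    using that int by (auto simp: Cij intro!: pint_linear pint_const)
  let ?P = "{p. p permutes {0..<n}}"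
  have fin: "finite ?P" by (rule finite_permutations) simp
  have "chi = (\<Sum>p\<in>?P. signof p * (\<Prod>i = 0..<n. ?C $$ (i, p i)))"
    unfolding chi_def char_poly_def by (rule det_def'[OF C])
  also have "\<dots> = (\<Prod>i = 0..<n. ?C $$ (i, i)) + (\<Sum>p\<in>?P - {id}. signof p * (\<Prod>i = 0..<n. ?C $$ (i, p i)))"
    by (subst sum.remove[OF fin, of id]) (auto simp: permutes_id)
  finally have chi: "chi = \<dots>" .
  have s1: "psmall (\<Sum>p\<in>?P - {id}. signof p * (\<Prod>i = 0..<n. ?C $$ (i, p i)))"
  proof (rule psmall_sum)
    fix p assume p: "p \<in> ?P - {id}"
    then have pp: "p permutes {0..<n}" "p \<noteq> id" by auto
    have pn: "p i < n" if "i < n" for i using permutes_in_image[OF pp(1), of i] that by simp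
    obtain i where i: "i < n" "p i < i"
      using permutes_natset_ge[OF pp(1)] pp(2) by (meson atLeastLessThan_iff not_le_imp_less)
    have "(\<Prod>i = 0..<n. ?C $$ (i, p i)) = ?C $$ (i, p i) * (\<Prod>i\<in>{0..<n} - {i}. ?C $$ (i, p i))"
      using i by (subst prod.remove[of _ i]) auto
    moreover have "psmall (?C $$ (i, p i))"
      using i pn low[of i "p i"] by (auto simp: Cij intro!: psmall_const)
    moreover have "pint (\<Prod>i\<in>{0..<n} - {i}. ?C $$ (i, p i))"
      by (rule pint_prod) (use Cint pn in auto)
    ultimately have "psmall (\<Prod>i = 0..<n. ?C $$ (i, p i))" by (simp add: psmall_mult)
    moreover have "pint (signof p :: 'a poly)"
      using pint_const[of "1 :: 'a"] pint_const[of "- 1 :: 'a"] by (auto simp: sign_def one_pCons simp flip: pCons_one)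
    ultimately show "psmall (signof p * (\<Prod>i = 0..<n. ?C $$ (i, p i)))"
      using psmall_mult by (metis mult.commute)
  qed
  have ip: "(\<Prod>a\<leftarrow>ls. [:- a, 1:]) = (\<Prod>i = 0..<n. [:- (ls ! i), 1:])"
    using ls(1) by (simp add: prod.list_conv_set_nth)
  have s2: "psmall ((\<Prod>i = 0..<n. ?C $$ (i, i)) - (\<Prod>i = 0..<n. [:- (ls ! i), 1:]))"
  proof (rule psmall_prod_diff)
    fix i assume "i \<in> {0..<n}"
    then have i: "i < n" by simp
    show "pint (?C $$ (i, i))" using Cint i by blast
    show "pint [:- (ls ! i), 1:]" using ls(2)[OF i] by (rule pint_linear)
    have "vge 1 (ls ! i - A i i)" using ls(3)[OF i] vge_minus[of 1 "A i i - ls ! i"] by simp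
    then show "psmall (?C $$ (i, i) - [:- (ls ! i), 1:])"
      using psmall_const[of "ls ! i - A i i"] i by (simp add: Cij)
  qed
  show ps: "psmall (chi - (\<Prod>a\<leftarrow>ls. [:- a, 1:]))"
    using psmall_add[OF s2 s1] unfolding chi ip by (simp add: algebra_simps)
  have "pint (\<Prod>i = 0..<n. [:- (ls ! i), 1:])"
    by (rule pint_prod) (use ls(2) pint_linear in auto)
  then have "pint ((chi - (\<Prod>a\<leftarrow>ls. [:- a, 1:])) + (\<Prod>a\<leftarrow>ls. [:- a, 1:]))"
    unfolding ip[symmetric] using psmall_pint[OF ps] by (rule pint_add[rotated])
  then show "pint chi" by simp
qed

end

context linear_space begin

text \<open>The matrix of polynomials \<open>X - A\<close> annihilates the generators \<open>e\<close>; so does its product with the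
  adjugate, which is the characteristic polynomial.\<close>

lemma cayley_hamilton:
  assumes T: "lin T" and Te: "\<And>k. k < n \<Longrightarrow> T (e k) = (\<Sum>i<n. A i k *s e i)" and l: "l < n"
  shows "pa T (char_poly (mat n n (\<lambda>(i, j). A i j))) (e l) = 0"
proof -
  let ?A = "mat n n (\<lambda>(i, j). A i j)"
  let ?C = "char_poly_matrix ?A"
  let ?J = "adj_mat ?C"
  have C: "?C \<in> carrier_mat n n" by simp
  have J: "?J \<in> carrier_mat n n" and CJ: "?C * ?J = det ?C \<cdot>\<^sub>m 1\<^sub>m n" using adj_mat[OF C] by auto
  have Cij: "?C $$ (i, j) = (if i = j then [:- A i j, 1:] else [:- A i j:])" if "i < n" "j < n" for i j
    using that by (auto simp: char_poly_matrix_def)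
  have CJil: "(\<Sum>k<n. ?C $$ (i, k) * ?J $$ (k, l)) = (if i = l then char_poly ?A else 0)" if i: "i < n" for i
  proof -
    have "(\<Sum>k<n. ?C $$ (i, k) * ?J $$ (k, l)) = (?C * ?J) $$ (i, l)"
      using i l carrier_matD[OF C] carrier_matD[OF J]
      by (subst index_mult_mat(1)) (auto simp: scalar_prod_def atLeast0LessThan)
    also have "\<dots> = (if i = l then char_poly ?A else 0)"
      unfolding CJ using i l by (simp add: char_poly_def)
    finally show ?thesis .
  qed
  have 0: "(\<Sum>i<n. pa T (?C $$ (i, k)) (e i)) = 0" if k: "k < n" for k
  proof -
    have "(\<Sum>i<n. pa T (?C $$ (i, k)) (e i)) = (\<Sum>i<n. (if i = k then T (e k) else 0) - A i k *s e i)"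
      using k by (intro sum.cong) (auto simp: Cij pa_pCons[OF T] lin_0[OF T])
    also have "\<dots> = 0" using k by (simp add: sum_subtractf Te)
    finally show ?thesis .
  qed
  have "0 = (\<Sum>k<n. pa T (?J $$ (k, l)) (\<Sum>i<n. pa T (?C $$ (i, k)) (e i)))"
    using 0 by (simp add: lin_0[OF pa_lin[OF T]])
  also have "\<dots> = (\<Sum>k<n. \<Sum>i<n. pa T (?C $$ (i, k) * ?J $$ (k, l)) (e i))"
    by (simp add: lin_sum[OF pa_lin[OF T]] pa_mult[OF T, symmetric] mult.commute)
  also have "\<dots> = (\<Sum>i<n. pa T (\<Sum>k<n. ?C $$ (i, k) * ?J $$ (k, l)) (e i))"
    by (subst sum.swap) (simp add: pa_sum[OF T])
  also have "\<dots> = (\<Sum>i<n. if i = l then pa T (char_poly ?A) (e l) else 0)"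
    by (intro sum.cong) (auto simp: CJil)
  also have "\<dots> = pa T (char_poly ?A) (e l)" using l by simp
  finally show ?thesis by simp
qed

end

section \<open>The Kirillov form of isospectral directions\<close>

context valued_field_mat begin

definition vscale :: "'a \<Rightarrow> (nat \<Rightarrow> 'a) \<Rightarrow> nat \<Rightarrow> 'a" where
  "vscale c x = (\<lambda>i. c * x i)"

definition mv :: "'a mtx \<Rightarrow> (nat \<Rightarrow> 'a) \<Rightarrow> nat \<Rightarrow> 'a" where
  "mv A x = (\<lambda>i. if i < n then \<Sum>k<n. A i k * x k else 0)"

definition vecs :: "(nat \<Rightarrow> 'a) set" where
  "vecs = {x. \<forall>i\<ge>n. x i = 0}"

definition unitv :: "nat \<Rightarrow> nat \<Rightarrow> 'a" where
  "unitv l = (\<lambda>i. if i = l then 1 else 0)"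

sublocale vs: valued_space v vscale
  by unfold_locales (auto simp: vscale_def fun_eq_iff algebra_simps)

lemma vs_sum: "(\<Sum>l\<in>I. vscale (c l) (h l)) i = (\<Sum>l\<in>I. c l * h l i)"
  by (induction I rule: infinite_finite_induct) (auto simp: vscale_def)

lemma vecs_subspace: "vs.subspace vecs"
  by (rule vs.subspaceI) (auto simp: vecs_def vscale_def)

lemma unitv_basis: "vs.famb n unitv vecs"
proof (rule vs.fambI)
  show "unitv l \<in> vecs" if "l < n" for l using that by (auto simp: unitv_def vecs_def)
  fix w assume w: "w \<in> vecs"
  have "w = (\<Sum>l<n. vscale (w l) (unitv l))"
  proof
    fix i
    show "w i = (\<Sum>l<n. vscale (w l) (unitv l)) i"
      using w by (cases "i < n") (auto simp: vs_sum unitv_def vecs_def if_distrib[of "\<lambda>x. _ * x"] sum.delta cong: if_cong)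
  qed
  then show "\<exists>c. w = (\<Sum>l<n. vscale (c l) (unitv l))" by (rule exI[of _ w])
next
  fix c l assume s: "(\<Sum>l<n. vscale (c l) (unitv l)) = 0" and l: "l < n"
  have "(\<Sum>l<n. vscale (c l) (unitv l)) l = c l"
    using l by (simp add: vs_sum unitv_def if_distrib[of "\<lambda>x. _ * x"] cong: if_cong)
  then show "c l = 0" unfolding s by simp
qed

lemma fd_vecs: "vs.fd vecs"
proof -
  have "vecs \<subseteq> vs.span (unitv ` {..<n})"
  proof
    fix w assume "w \<in> vecs"
    from vs.famb_span[OF unitv_basis this] obtain c where "w = (\<Sum>l<n. vscale (c l) (unitv l))" by (elim exE)
    then show "w \<in> vs.span (unitv ` {..<n})"
      by (simp only:) (intro vs.span_sum vs.span_scale vs.span_base imageI)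
  qed
  then show ?thesis unfolding vs.fd_def by (intro exI[of _ "unitv ` {..<n}"]) simp
qed

lemma mv_lin: "vs.lin (mv A)"
  by (auto simp: vs.lin_def mv_def vscale_def fun_eq_iff sum.distrib algebra_simps sum_distrib_left)

lemma mv_vecs [simp]: "mv A x \<in> vecs" by (simp add: mv_def vecs_def)

lemma mv_mm: "mv A (mv B x) = mv (A \<star> B) x"
proof
  fix i
  show "mv A (mv B x) i = mv (A \<star> B) x i"
  proof (cases "i < n")
    case True
    have "(\<Sum>k<n. A i k * (\<Sum>l<n. B k l * x l)) = (\<Sum>k<n. \<Sum>l<n. A i k * B k l * x l)"
      by (simp add: sum_distrib_left mult.assoc)
    also have "\<dots> = (\<Sum>l<n. \<Sum>k<n. A i k * B k l * x l)" by (rule sum.swap)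
    finally show ?thesis using True by (simp add: mv_def mm_def sum_distrib_right)
  qed (simp add: mv_def)
qed

lemma mv_unitv: "l < n \<Longrightarrow> mv A (unitv l) = (\<Sum>i<n. vscale (A i l) (unitv i))"
proof
  fix i assume "l < n"
  then show "mv A (unitv l) i = (\<Sum>i<n. vscale (A i l) (unitv i)) i"
    by (auto simp: mv_def vs_sum unitv_def if_distrib[of "\<lambda>x. _ * x"] sum.delta sum.delta' cong: if_cong)
qed

text \<open>The equation \<open>D A = [X, A]\<close> says that \<open>A\<close> is horizontal for the connection \<open>D - X\<close>.\<close>

lemma constant_normal_form:
  fixes D :: "'i \<Rightarrow> 'a \<Rightarrow> 'a"
  assumes D: "\<And>i. vderiv (D i)" and A: "A \<in> mats" "iw 0 A"
    and ls: "length ls = n" "\<And>k. k < n \<Longrightarrow> vge 1 (A k k - ls ! k)" "\<And>k i. k < n \<Longrightarrow> D i (ls ! k) = 0"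
    and X: "\<And>i. X i \<in> mats" "\<And>i. Dm (D i) A = cm (X i) A"
  obtains h h' B where "h \<in> mats" "h' \<in> mats" "h \<star> h' = idm" "h' \<star> h = idm"
    "B \<in> mats" "iw 0 B" "\<And>i. Dm (D i) B = 0" "A \<star> h = h \<star> B"
proof -
  define chi where "chi = char_poly (mat n n (\<lambda>(i, j). A i j))"
  have ls0: "vge 0 (ls ! k)" if k: "k < n" for k
  proof -
    have "vge 0 (A k k - (A k k - ls ! k))"
      using iw_integral[OF A(2) k k] vge_mono[OF ls(2)[OF k], of 0] by (rule vge_diff) simp
    then show ?thesis by simp
  qed
  have cr: "psmall (chi - (\<Prod>a\<leftarrow>ls. [:- a, 1:]))" "pint chi"
    unfolding chi_def using iw_integral[OF A(2)] iw_lower[OF A(2)] ls(1,2) ls0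
    by (intro char_poly_residual; blast)+
  have lc: "lead_coeff chi = 1"
    using degree_monic_char_poly[of "mat n n (\<lambda>(i, j). A i j)" n] unfolding chi_def by auto
  have T: "vs.lin (mv A)" by (rule mv_lin)
  have chi0: "vs.pa (mv A) chi w = 0" if w: "w \<in> vecs" for w
  proof -
    obtain c where c: "w = (\<Sum>l<n. vscale (c l) (unitv l))" using vs.famb_span[OF unitv_basis w] by (elim exE)
    have "vs.pa (mv A) chi (unitv l) = 0" if "l < n" for l
      unfolding chi_def by (rule vs.cayley_hamilton[OF T mv_unitv that])
    then show ?thesis
      unfolding c by (simp add: vs.lin_sum[OF vs.pa_lin[OF T]] vs.lin_scale[OF vs.pa_lin[OF T]])
  qed
  have st: "vs.stable (mv A) vecs" using vecs_subspace by (auto simp: vs.stable_def)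
  define N where "N i x = (\<lambda>j. D i (x j) - mv (X i) x j)" for i x
  have D0: "D i 0 = 0" for i using D_0[OF D] .
  have Ds: "D i (sum f I) = (\<Sum>k\<in>I. D i (f k))" for i f and I :: "nat set"
    by (induction I rule: infinite_finite_induct) (auto simp: D0 vderivD(1)[OF D])
  have conn: "vs.conn (D i) (N i) (mv A) vecs" for i
    unfolding vs.conn_def
  proof (intro conjI ballI allI)
    fix x assume x: "x \<in> vecs"
    show "N i x \<in> vecs" using x by (auto simp: N_def vecs_def D0 mv_def)
    show "N i (mv A x) = mv A (N i x)"
    proof -
      have "(\<lambda>j. D i (mv A x j)) = (\<lambda>j. mv (Dm (D i) A) x j + mv A (\<lambda>j. D i (x j)) j)"
        by (auto simp: fun_eq_iff mv_def Dm_def Ds D0 vderivD(2)[OF D] sum.distrib)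
      also have "\<dots> = (\<lambda>j. mv (X i) (mv A x) j - mv A (mv (X i) x) j + mv A (\<lambda>j. D i (x j)) j)"
        unfolding X mv_mm by (auto simp: fun_eq_iff cm_def mv_def sum_subtractf algebra_simps)
      finally have 1: "(\<lambda>j. D i (mv A x j)) = \<dots>" .
      have "mv A (N i x) = (\<lambda>j. mv A (\<lambda>j. D i (x j)) j - mv A (mv (X i) x) j)"
        unfolding N_def by (auto simp: fun_eq_iff mv_def sum_subtractf algebra_simps)
      then show ?thesis using 1 unfolding N_def by (auto simp: fun_eq_iff)
    qed
    fix y assume "y \<in> vecs"
    show "N i (x + y) = N i x + N i y"
      by (auto simp: fun_eq_iff N_def vderivD(1)[OF D] vs.lin_add[OF mv_lin])
  next
    fix c x assume "x \<in> vecs"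
    show "N i (vscale c x) = vscale (D i c) x + vscale c (N i x)"
      by (auto simp: fun_eq_iff N_def vs.lin_scale[OF mv_lin]) (simp add: vscale_def vderivD(2)[OF D] algebra_simps)
  qed
  have lsm: "vge 0 a" "D i a = 0" if "a \<in> set ls" for a i
    using that ls(1,3) ls0 by (auto simp: in_set_conv_nth)
  have "vs.normal_form D (mv A) vecs"
    by (rule vs.frobenius_normal_form[OF T st fd_vecs conn D lc cr(2) chi0 cr(1) lsm])
  from this[unfolded vs.normal_form_def] obtain d hh BB where nf: "vs.famb d hh vecs"
    "\<forall>l<d. mv A (hh l) = (\<Sum>k<d. vscale (BB k l) (hh k))"
    "\<forall>k<d. \<forall>l<d. (\<forall>i. D i (BB k l) = 0) \<and> vge 0 (BB k l) \<and> (l < k \<longrightarrow> vge 1 (BB k l))"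
    by (elim exE conjE)
  have dn: "d = n" using vs.famb_dim[OF nf(1)] vs.famb_dim[OF unitv_basis] by simp
  note nf = nf[unfolded dn]
  define h where "h = (\<lambda>i l. if i < n \<and> l < n then hh l i else 0)"
  define B where "B = (\<lambda>k l. if k < n \<and> l < n then BB k l else 0)"
  have hm: "h \<in> mats" "B \<in> mats" by (auto simp: h_def B_def mats_def)
  have "\<forall>j. \<exists>c. j < n \<longrightarrow> unitv j = (\<Sum>l<n. vscale (c l) (hh l))"
    using vs.famb_span[OF nf(1)] vs.famb_in[OF unitv_basis] by blast
  from choice[OF this] obtain c where c: "\<forall>j. j < n \<longrightarrow> unitv j = (\<Sum>l<n. vscale (c j l) (hh l))" by (elim exE)
  define h' where "h' = (\<lambda>l j. if l < n \<and> j < n then c j l else 0)"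
  have h'm: "h' \<in> mats" by (auto simp: h'_def mats_def)
  have hh': "h \<star> h' = idm"
  proof (intro ext)
    fix i j
    show "(h \<star> h') i j = idm i j"
    proof (cases "i < n \<and> j < n")
      case True
      then have "(h \<star> h') i j = (\<Sum>l<n. c j l * hh l i)" by (simp add: mm_def h_def h'_def mult.commute)
      also have "\<dots> = (\<Sum>l<n. vscale (c j l) (hh l)) i" by (rule vs_sum[symmetric])
      also have "\<dots> = unitv j i" using c True by simp
      finally show ?thesis using True by (auto simp: unitv_def idm_def)
    qed (auto simp: mm_def idm_def)
  qed
  have h'h: "h' \<star> h = idm"
  proof -
    define Y where "Y = h' \<star> h - idm"
    have Ym: "Y \<in> mats" by (auto simp: Y_def)
    have "h \<star> Y = (h \<star> h') \<star> h - h \<star> idm" by (simp add: Y_def mm_ring mm_assoc)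
    then have hY: "h \<star> Y = 0" using hm by (simp add: hh')
    have "Y l j = 0" if "l < n" "j < n" for l j
    proof -
      have "(\<Sum>l<n. vscale (Y l j) (hh l)) = 0"
      proof
        fix i
        show "(\<Sum>l<n. vscale (Y l j) (hh l)) i = 0 i"
        proof (cases "i < n")
          case True
          have "(\<Sum>l<n. vscale (Y l j) (hh l)) i = (h \<star> Y) i j"
            using True that(2) by (simp add: vs_sum mm_def h_def mult.commute)
          then show ?thesis by (simp add: hY)
        next
          case False
          then have "hh l i = 0" if "l < n" for l using vs.famb_in[OF nf(1) that] by (auto simp: vecs_def)
          then show ?thesis by (simp add: vs_sum)
        qed
      qed
      from vs.famb_indep[OF nf(1), where c = "\<lambda>l. Y l j", OF this that(1)] show ?thesis .
    qed
    then have "Y = 0" using Ym by (auto simp: fun_eq_iff mats_def)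
    then show ?thesis by (simp add: Y_def)
  qed
  have AhB: "A \<star> h = h \<star> B"
  proof (intro ext)
    fix i l
    show "(A \<star> h) i l = (h \<star> B) i l"
    proof (cases "i < n \<and> l < n")
      case True
      then have "(A \<star> h) i l = mv A (hh l) i" by (simp add: mm_def mv_def h_def)
      also have "\<dots> = (\<Sum>k<n. vscale (BB k l) (hh k)) i" using nf(2) True by simp
      also have "\<dots> = (h \<star> B) i l" using True by (simp add: vs_sum mm_def h_def B_def mult.commute)
      finally show ?thesis .
    qed (auto simp: mm_def)
  qed
  have iB: "iw 0 B" by (rule iw0I) (use nf(3) in \<open>auto simp: B_def\<close>)
  have DB: "Dm (D i) B = 0" for i
    using nf(3) by (auto simp: fun_eq_iff Dm_def B_def D0)
  show thesis by (rule that[OF hm(1) h'm hh' h'h hm(2) iB DB AhB])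
qed

theorem isospectral_kirillov_small:
  assumes D: "vderiv D1" "vderiv D2" and A: "A \<in> mats" "iw 0 A"
    and ls: "\<And>k. k < n \<Longrightarrow> vge 1 (A k k - l k)" "\<And>k. k < n \<Longrightarrow> D1 (l k) = 0" "\<And>k. k < n \<Longrightarrow> D2 (l k) = 0"
    and X: "X1 \<in> mats" "X2 \<in> mats" "Dm D1 A = cm X1 A" "Dm D2 A = cm X2 A"
  shows "vge 1 (tr (A \<star> cm X1 X2))"
proof -
  define D where "D b = (if b then D1 else D2)" for b
  define X' where "X' b = (if b then X1 else X2)" for b
  \<comment> \<open>The two derivations are indexed by the type of truth values, and one normal form serves both.\<close>
  obtain h h' B where h: "h \<in> mats" "h' \<in> mats" "h \<star> h' = idm" "h' \<star> h = idm"
    "B \<in> mats" "iw 0 B" "\<And>i. Dm (D i) B = 0" "A \<star> h = h \<star> B"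
    by (rule constant_normal_form[of D A "map l [0..<n]" X']) (use assms in \<open>auto simp: D_def X'_def\<close>)
  have d: "vge 1 (E (A k k))" if E: "vderiv E" "E (l k) = 0" and k: "k < n" for E k
  proof -
    have "E (A k k - l k) + E (l k) = E (A k k)"
      using vderivD(1)[OF E(1), of "A k k - l k" "l k"] by simp
    then show ?thesis using vderivD(3)[OF E(1) ls(1)[OF k]] E(2) by simp
  qed
  show ?thesis
    by (rule kirillov_small[OF D A _ _ h(1-6) _ _ h(8) X(3,4)])
      (use d D ls h(7)[of True] h(7)[of False] in \<open>auto simp: D_def\<close>)
qed

end

section \<open>The ring of polynomial functions in countably many variables\<close>

inductive is_pf :: "((nat \<Rightarrow> 'k::comm_ring_1) \<Rightarrow> 'k) \<Rightarrow> bool" where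
  is_pf_const: "is_pf (\<lambda>x. c)"
| is_pf_var: "is_pf (\<lambda>x. x i)"
| is_pf_add: "is_pf f \<Longrightarrow> is_pf g \<Longrightarrow> is_pf (\<lambda>x. f x + g x)"
| is_pf_mult: "is_pf f \<Longrightarrow> is_pf g \<Longrightarrow> is_pf (\<lambda>x. f x * g x)"

text \<open>Over an infinite field these functions are the same as polynomials; working with functions makes
  specialisation at a point a matter of evaluation.\<close>

typedef (overloaded) 'k polyfun = "{f :: (nat \<Rightarrow> 'k::comm_ring_1) \<Rightarrow> 'k. is_pf f}"
  morphisms ev Pf
  by (rule exI[of _ "\<lambda>x. 0"]) (simp add: is_pf_const)

lemma is_pf_ev [simp]: "is_pf (ev f)" using ev[of f] by simp
lemma ev_Pf: "is_pf f \<Longrightarrow> ev (Pf f) = f" by (simp add: Pf_inverse)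
lemma polyfun_eqI: "(\<And>x. ev f x = ev g x) \<Longrightarrow> f = g" by (simp add: ev_inject[symmetric] fun_eq_iff)

lemma is_pf_uminus: "is_pf f \<Longrightarrow> is_pf (\<lambda>x. - f x)"
  using is_pf_mult[OF is_pf_const[of "- 1"], of f] by simp

lemma is_pf_diff: "is_pf f \<Longrightarrow> is_pf g \<Longrightarrow> is_pf (\<lambda>x. f x - g x)"
  using is_pf_add[OF _ is_pf_uminus, of f g] by simp

definition pconst :: "'k::comm_ring_1 \<Rightarrow> 'k polyfun" where "pconst c = Pf (\<lambda>x. c)"
definition pvar :: "nat \<Rightarrow> 'k::comm_ring_1 polyfun" where "pvar i = Pf (\<lambda>x. x i)"

lemma ev_pconst [simp]: "ev (pconst c) x = c" by (simp add: pconst_def ev_Pf is_pf_const)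
lemma ev_pvar [simp]: "ev (pvar i) x = x i" by (simp add: pvar_def ev_Pf is_pf_var)

instantiation polyfun :: (comm_ring_1) comm_ring_1
begin

definition "0 = Pf (\<lambda>x. 0)"
definition "1 = Pf (\<lambda>x. 1)"
definition "f + g = Pf (\<lambda>x. ev f x + ev g x)"
definition "f - g = Pf (\<lambda>x. ev f x - ev g x)"
definition "- f = Pf (\<lambda>x. - ev f x)"
definition "f * g = Pf (\<lambda>x. ev f x * ev g x)"

lemma ev_simps [simp]:
  "ev 0 x = 0" "ev 1 x = 1" "ev (f + g) x = ev f x + ev g x" "ev (f - g) x = ev f x - ev g x"
  "ev (- f) x = - ev f x" "ev (f * g) x = ev f x * ev g x"
  by (simp_all add: zero_polyfun_def one_polyfun_def plus_polyfun_def minus_polyfun_def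
      uminus_polyfun_def times_polyfun_def ev_Pf is_pf_const is_pf_add is_pf_diff is_pf_uminus is_pf_mult)

instance
proof
  show "(0 :: 'a polyfun) \<noteq> 1"
  proof
    assume "(0 :: 'a polyfun) = 1"
    then have "ev (0 :: 'a polyfun) (\<lambda>_. 0) = ev 1 (\<lambda>_. 0)" by simp
    then show False by simp
  qed
qed (auto intro!: polyfun_eqI simp: algebra_simps)

end

lemma ev_sum: "ev (sum f I) x = (\<Sum>i\<in>I. ev (f i) x)"
  by (induction I rule: infinite_finite_induct) auto

lemma ev_power: "ev (f ^ k) x = ev f x ^ k"
  by (induction k) auto

lemma polyfun_eq_0_iff: "f = 0 \<longleftrightarrow> (\<forall>x. ev f x = 0)"
  using polyfun_eqI[of f 0] by auto

text \<open>Restriction to lines reduces the cancellation property to polynomials in one variable.\<close>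

lemma is_pf_line: "is_pf f \<Longrightarrow> \<exists>p. \<forall>t. f (\<lambda>i. x i + t * y i) = poly p t"
proof (induction rule: is_pf.induct)
  case (is_pf_const c)
  show ?case by (rule exI[of _ "[:c:]"]) simp
next
  case (is_pf_var i)
  show ?case by (rule exI[of _ "[:x i, y i:]"]) simp
next
  case (is_pf_add f g)
  then obtain p q where "\<forall>t. f (\<lambda>i. x i + t * y i) = poly p t" "\<forall>t. g (\<lambda>i. x i + t * y i) = poly q t" by blast
  then show ?case by (intro exI[of _ "p + q"]) simp
next
  case (is_pf_mult f g)
  then obtain p q where "\<forall>t. f (\<lambda>i. x i + t * y i) = poly p t" "\<forall>t. g (\<lambda>i. x i + t * y i) = poly q t" by blast
  then show ?case by (intro exI[of _ "p * q"]) simp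
qed

instance polyfun :: (field_char_0) idom
proof
  fix f g :: "'a polyfun"
  assume "f \<noteq> 0" "g \<noteq> 0"
  then obtain x y where xy: "ev f x \<noteq> 0" "ev g y \<noteq> 0" by (auto simp: polyfun_eq_0_iff)
  obtain p q where p: "\<forall>t. ev f (\<lambda>i. x i + t * (y i - x i)) = poly p t"
    and q: "\<forall>t. ev g (\<lambda>i. x i + t * (y i - x i)) = poly q t"
    using is_pf_line[OF is_pf_ev] by metis
  have "poly p 0 \<noteq> 0" "poly q 1 \<noteq> 0" using p[rule_format, of 0] q[rule_format, of 1] xy by auto
  then have "p * q \<noteq> 0" by auto
  then obtain t where "poly (p * q) t \<noteq> 0" using poly_all_0_iff_0 by blast
  then have "ev (f * g) (\<lambda>i. x i + t * (y i - x i)) \<noteq> 0" using p q by simp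
  then show "f * g \<noteq> 0" by (auto simp: polyfun_eq_0_iff)
qed

section \<open>Partial derivatives\<close>

text \<open>Partial derivatives are taken along coordinate lines, where a polynomial function is given by a
  unique polynomial.\<close>

definition pline :: "nat \<Rightarrow> ((nat \<Rightarrow> 'k::field_char_0) \<Rightarrow> 'k) \<Rightarrow> (nat \<Rightarrow> 'k) \<Rightarrow> 'k poly" where
  "pline i f x = (THE p. \<forall>t. f (x(i := t)) = poly p t)"

definition pdv :: "nat \<Rightarrow> ((nat \<Rightarrow> 'k::field_char_0) \<Rightarrow> 'k) \<Rightarrow> (nat \<Rightarrow> 'k) \<Rightarrow> 'k" where
  "pdv i f x = poly (pderiv (pline i f x)) (x i)"

lemma pline_eq: "(\<And>t. f (x(i := t)) = poly p t) \<Longrightarrow> pline i f x = p"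
  unfolding pline_def by (rule the_equality) (auto simp: poly_eq_poly_eq_iff[symmetric])

lemma pline:
  assumes "is_pf f"
  shows "f (x(i := t)) = poly (pline i f x) t"
proof -
  obtain p where p: "\<forall>t. f (\<lambda>j. (x(i := 0)) j + t * (if j = i then 1 else 0)) = poly p t"
    using is_pf_line[OF assms, of "x(i := 0)" "\<lambda>j. if j = i then 1 else 0"] by (elim exE)
  have "(\<lambda>j. (x(i := 0)) j + t * (if j = i then 1 else 0)) = x(i := t)" for t by auto
  then have p': "f (x(i := t)) = poly p t" for t using p by simp
  then show ?thesis using pline_eq[of f x i p] by simp
qed

lemma pline_self: "is_pf f \<Longrightarrow> poly (pline i f x) (x i) = f x"
  using pline[of f x i "x i"] by simp

lemma pdv_const: "pdv i (\<lambda>x. c) = (\<lambda>x. 0)"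
  by (rule ext) (simp add: pdv_def pline_eq[of "\<lambda>x. c" _ i "[:c:]"])
lemma pdv_var: "pdv i (\<lambda>x. x j) = (\<lambda>x. if i = j then 1 else 0)"
proof (rule ext)
  fix x
  have "pline i (\<lambda>x. x j) x = (if i = j then [:0, 1:] else [:x j:])" by (rule pline_eq) auto
  then show "pdv i (\<lambda>x. x j) x = (if i = j then 1 else 0)" by (simp add: pdv_def pderiv_pCons)
qed
lemma pdv_add:
  assumes "is_pf f" "is_pf g"
  shows "pdv i (\<lambda>x. f x + g x) = (\<lambda>x. pdv i f x + pdv i g x)"
proof (rule ext)
  fix x
  have "pline i (\<lambda>x. f x + g x) x = pline i f x + pline i g x" by (rule pline_eq) (simp add: pline assms)
  then show "pdv i (\<lambda>x. f x + g x) x = pdv i f x + pdv i g x" by (simp add: pdv_def pderiv_add)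
qed
lemma pdv_mult:
  assumes "is_pf f" "is_pf g"
  shows "pdv i (\<lambda>x. f x * g x) = (\<lambda>x. pdv i f x * g x + f x * pdv i g x)"
proof (rule ext)
  fix x
  have "pline i (\<lambda>x. f x * g x) x = pline i f x * pline i g x" by (rule pline_eq) (simp add: pline assms)
  then show "pdv i (\<lambda>x. f x * g x) x = pdv i f x * g x + f x * pdv i g x"
    by (simp add: pdv_def pderiv_mult pline_self assms algebra_simps)
qed

lemma is_pf_pdv: "is_pf f \<Longrightarrow> is_pf (pdv i f)"
proof (induction rule: is_pf.induct)
  case (is_pf_add f g)
  then show ?case using is_pf.is_pf_add by (simp add: pdv_add)
next
  case (is_pf_mult f g)
  then show ?case unfolding pdv_mult[OF is_pf_mult(1,2)]
    by (intro is_pf.is_pf_add is_pf.is_pf_mult)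
qed (auto simp: pdv_const pdv_var intro: is_pf.is_pf_const)

definition pd :: "nat \<Rightarrow> 'k::field_char_0 polyfun \<Rightarrow> 'k polyfun" where
  "pd i f = Pf (pdv i (ev f))"

lemma ev_pd: "ev (pd i f) = pdv i (ev f)"
  by (simp add: pd_def ev_Pf is_pf_pdv)

lemma ev_fun_simps: "ev (f + g) = (\<lambda>x. ev f x + ev g x)" "ev (f * g) = (\<lambda>x. ev f x * ev g x)"
  "ev (pvar j) = (\<lambda>x. x j)" "ev (pconst c) = (\<lambda>x. c)"
  by auto

lemma pd_add: "pd i (f + g) = pd i f + pd i g"
  by (rule polyfun_eqI) (simp add: ev_pd ev_fun_simps(1) pdv_add)
lemma pd_mult: "pd i (f * g) = pd i f * g + f * pd i g"
  by (rule polyfun_eqI) (simp add: ev_pd ev_fun_simps(2) pdv_mult)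
lemma pd_var: "pd i (pvar j) = (if i = j then 1 else 0)"
  by (rule polyfun_eqI) (simp add: ev_pd ev_fun_simps(3) pdv_var)
lemma pd_const: "pd i (pconst c) = 0"
  by (rule polyfun_eqI) (simp add: ev_pd ev_fun_simps(4) pdv_const)

section \<open>The valuation along the first coordinate hyperplane\<close>

abbreviation ps :: "'k::field_char_0 polyfun" where "ps \<equiv> pvar 0"

lemma ps_nonzero [simp]: "ps \<noteq> 0"
proof
  assume "(ps :: 'a polyfun) = 0"
  then have "ev (ps :: 'a polyfun) (\<lambda>_. 1) = 0" by simp
  then show False by simp
qed

text \<open>Division with remainder by the first variable.\<close>

lemma is_pf_divide:
  "is_pf f \<Longrightarrow> is_pf (\<lambda>x. f (x(0 := 0))) \<and> (\<exists>g. is_pf g \<and> (\<forall>x. f x = f (x(0 := 0)) + x 0 * g x))"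
proof (induction rule: is_pf.induct)
  case (is_pf_const c)
  show ?case by (auto intro!: is_pf.is_pf_const exI[of _ "\<lambda>_. 0"])
next
  case (is_pf_var i)
  show ?case
    by (cases "i = 0") (auto intro!: is_pf.is_pf_const is_pf.is_pf_var exI[of _ "\<lambda>_. if i = 0 then 1 else 0"])
next
  case (is_pf_add f g)
  from is_pf_add(3) obtain f' where f: "is_pf (\<lambda>x. f (x(0 := 0)))" "is_pf f'" "\<forall>x. f x = f (x(0 := 0)) + x 0 * f' x"
    by (elim conjE exE)
  from is_pf_add(4) obtain g' where g: "is_pf (\<lambda>x. g (x(0 := 0)))" "is_pf g'" "\<forall>x. g x = g (x(0 := 0)) + x 0 * g' x"
    by (elim conjE exE)
  have "f x + g x = f (x(0 := 0)) + g (x(0 := 0)) + x 0 * (f' x + g' x)" for x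
    by (subst f(3)[rule_format], subst g(3)[rule_format]) (simp add: algebra_simps)
  then show ?case
    by (intro conjI exI[of _ "\<lambda>x. f' x + g' x"] is_pf.is_pf_add f g allI)
next
  case (is_pf_mult f g)
  from is_pf_mult(3) obtain f' where f: "is_pf (\<lambda>x. f (x(0 := 0)))" "is_pf f'" "\<forall>x. f x = f (x(0 := 0)) + x 0 * f' x"
    by (elim conjE exE)
  from is_pf_mult(4) obtain g' where g: "is_pf (\<lambda>x. g (x(0 := 0)))" "is_pf g'" "\<forall>x. g x = g (x(0 := 0)) + x 0 * g' x"
    by (elim conjE exE)
  let ?h = "\<lambda>x. f' x * g x + f (x(0 := 0)) * g' x"
  have "f x * g x = f (x(0 := 0)) * g (x(0 := 0)) + x 0 * ?h x" for x
  proof -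
    have "f x * g x = f (x(0 := 0)) * g x + x 0 * f' x * g x" by (subst f(3)[rule_format]) (simp add: algebra_simps)
    also have "f (x(0 := 0)) * g x = f (x(0 := 0)) * g (x(0 := 0)) + f (x(0 := 0)) * (x 0 * g' x)"
      by (subst g(3)[rule_format]) (simp add: algebra_simps)
    finally show ?thesis by (simp add: algebra_simps)
  qed
  moreover have "is_pf ?h" by (intro is_pf.is_pf_add is_pf.is_pf_mult f g is_pf_mult(2))
  ultimately show ?case by (intro conjI exI[of _ ?h] is_pf.is_pf_mult f g allI)
qed

lemma ps_dvd_iff: "ps dvd f \<longleftrightarrow> (\<forall>x. ev f (x(0 := 0)) = 0)"
proof
  assume "ps dvd f"
  then obtain g where "f = ps * g" by (elim dvdE)
  then show "\<forall>x. ev f (x(0 := 0)) = 0" by simp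
next
  assume z: "\<forall>x. ev f (x(0 := 0)) = 0"
  obtain g where "is_pf g" "\<forall>x. ev f x = ev f (x(0 := 0)) + x 0 * g x" using is_pf_divide[OF is_pf_ev] by blast
  then have "f = ps * Pf g" using z by (intro polyfun_eqI) (simp add: ev_Pf)
  then show "ps dvd f" by (rule dvdI)
qed

lemma ps_prime: "ps dvd f * g \<Longrightarrow> ps dvd f \<or> ps dvd g"
proof -
  assume a: "ps dvd f * g"
  have pf: "is_pf (\<lambda>x. ev h (x(0 := 0)))" for h :: "'a polyfun" using is_pf_divide[OF is_pf_ev] by blast
  define r where "r h = Pf (\<lambda>x. ev h (x(0 := 0)))" for h :: "'a polyfun"
  have r: "ev (r h) x = ev h (x(0 := 0))" for h x by (simp add: r_def ev_Pf pf)
  have "r f * r g = 0" using a by (intro polyfun_eqI) (simp add: r ps_dvd_iff)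
  then have "r f = 0 \<or> r g = 0" by simp
  then show ?thesis by (auto simp: ps_dvd_iff r[symmetric])
qed

lemma ps_factor:
  assumes "f \<noteq> 0"
  shows "\<exists>n g. f = ps ^ n * g \<and> \<not> ps dvd g"
proof -
  obtain x where x: "ev f x \<noteq> 0" using assms by (auto simp: polyfun_eq_0_iff)
  define p where "p = pline 0 (ev f) x"
  have "poly p (x 0) \<noteq> 0" using x by (simp add: p_def pline_self)
  then have p0: "p \<noteq> 0" by auto
  have b: "n \<le> degree p" if "ps ^ n dvd f" for n
  proof -
    obtain g where "f = ps ^ n * g" using \<open>ps ^ n dvd f\<close> by (elim dvdE)
    then have "p = [:0, 1:] ^ n * pline 0 (ev g) x"
      unfolding p_def by (intro pline_eq) (simp add: ev_power pline poly_power)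
    then have "[:0, 1:] ^ n dvd p" by (rule dvdI)
    then have "degree ([:0, 1:] ^ n :: 'a poly) \<le> degree p" by (rule dvd_imp_degree_le) (rule p0)
    then show ?thesis by (simp add: degree_power_eq)
  qed
  define n where "n = (GREATEST n. ps ^ n dvd f)"
  have "ps ^ n dvd f" unfolding n_def by (rule GreatestI_nat[of _ 0 "degree p"]) (use b in auto)
  then obtain g where g: "f = ps ^ n * g" by (elim dvdE)
  have "\<not> ps dvd g"
  proof
    assume "ps dvd g"
    then have "ps ^ Suc n dvd f" unfolding g power_Suc2 by (rule mult_dvd_mono[OF dvd_refl])
    then have "Suc n \<le> n" unfolding n_def by (rule Greatest_le_nat[of _ _ "degree p"]) (use b in auto)
    then show False by simp
  qed
  then show ?thesis using g by (intro exI[of _ n] exI[of _ g]) simp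
qed

text \<open>The order of vanishing along the hyperplane where the first variable is zero.\<close>

definition pord :: "'k::field_char_0 polyfun \<Rightarrow> nat" where
  "pord f = (THE n. \<exists>g. f = ps ^ n * g \<and> \<not> ps dvd g)"

lemma pord_unique:
  assumes "\<not> ps dvd g"
  shows "pord (ps ^ n * g) = n"
  unfolding pord_def
proof (rule the_equality)
  show "\<exists>g'. ps ^ n * g = ps ^ n * g' \<and> \<not> ps dvd g'" using assms by blast
  fix m assume "\<exists>h. ps ^ n * g = ps ^ m * h \<and> \<not> ps dvd h"
  then obtain h where h: "ps ^ n * g = ps ^ m * h" "\<not> ps dvd h" by blast
  show "m = n"
  proof (rule ccontr)
    assume "m \<noteq> n"
    then consider "m < n" | "n < m" by linarith
    then show False
    proof cases
      case 1
      then have "ps ^ n = ps ^ m * (ps * ps ^ (n - Suc m) :: 'a polyfun)"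
        unfolding power_Suc[symmetric] power_add[symmetric] by simp
      then have "ps ^ m * (ps * (ps ^ (n - Suc m) * g)) = ps ^ m * h" using h(1) by (simp add: mult.assoc)
      then have "ps * (ps ^ (n - Suc m) * g) = h" using ps_nonzero by (simp only: mult_cancel_left power_eq_0_iff) blast
      then show False using h(2) dvd_triv_left by metis
    next
      case 2
      then have "ps ^ m = ps ^ n * (ps * ps ^ (m - Suc n) :: 'a polyfun)"
        unfolding power_Suc[symmetric] power_add[symmetric] by simp
      then have "ps ^ n * g = ps ^ n * (ps * (ps ^ (m - Suc n) * h))" using h(1) by (simp add: mult.assoc)
      then have "g = ps * (ps ^ (m - Suc n) * h)" using ps_nonzero by (simp only: mult_cancel_left power_eq_0_iff) blast
      then show False using assms dvd_triv_left by metis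
    qed
  qed
qed

lemma pord_factor:
  assumes "f \<noteq> 0"
  obtains g where "f = ps ^ pord f * g" "\<not> ps dvd g"
proof -
  obtain n g where g: "f = ps ^ n * g" "\<not> ps dvd g" using ps_factor[OF assms] by blast
  then have pf: "pord f = n" using pord_unique[OF g(2), of n] by simp
  show thesis by (rule that[of g], unfold pf, rule g(1), rule g(2))
qed

lemma pord_mult:
  assumes "f \<noteq> 0" "g \<noteq> 0"
  shows "pord (f * g) = pord f + pord g"
proof -
  obtain f' where f': "f = ps ^ pord f * f'" "\<not> ps dvd f'" using pord_factor[OF assms(1)] .
  obtain g' where g': "g = ps ^ pord g * g'" "\<not> ps dvd g'" using pord_factor[OF assms(2)] .
  have "f * g = ps ^ (pord f + pord g) * (f' * g')"
    by (subst f'(1), subst g'(1)) (simp add: power_add mult_ac)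
  moreover have "\<not> ps dvd f' * g'" using ps_prime f'(2) g'(2) by blast
  ultimately show ?thesis using pord_unique[of "f' * g'" "pord f + pord g"] by simp
qed

lemma pord_ge:
  assumes "f \<noteq> 0"
  shows "n \<le> pord f \<longleftrightarrow> ps ^ n dvd f"
proof
  assume "n \<le> pord f"
  then have "ps ^ n dvd (ps ^ pord f :: 'a polyfun)" by (rule le_imp_power_dvd)
  moreover have "ps ^ pord f dvd f" using pord_factor[OF assms] by (metis dvd_triv_left)
  ultimately show "ps ^ n dvd f" by (rule dvd_trans)
next
  assume "ps ^ n dvd f"
  then obtain h where h: "f = ps ^ n * h" by (elim dvdE)
  then have "h \<noteq> 0" using assms by auto
  moreover have "ps ^ n \<noteq> (0 :: 'a polyfun)" using ps_nonzero by simp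
  ultimately have "pord f = pord (ps ^ n :: 'a polyfun) + pord h" unfolding h by (rule pord_mult[rotated])
  moreover have "pord (ps ^ n * 1 :: 'a polyfun) = n" by (rule pord_unique) (simp add: ps_dvd_iff)
  ultimately show "n \<le> pord f" by simp
qed

lemma pord_add:
  assumes "f \<noteq> 0" "g \<noteq> 0" "f + g \<noteq> 0"
  shows "min (pord f) (pord g) \<le> pord (f + g)"
  unfolding pord_ge[OF assms(3)]
  using pord_ge[OF assms(1), of "min (pord f) (pord g)"] pord_ge[OF assms(2), of "min (pord f) (pord g)"]
  by (intro dvd_add) simp_all

text \<open>Variable 0 will be the uniformiser, the others the coordinates of a generic element of the Lie
  algebra.\<close>

type_synonym 'k genfield = "'k polyfun fract"

definition emb :: "'k::field_char_0 polyfun \<Rightarrow> 'k genfield" where "emb f = Fract f 1"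
definition cst :: "'k::field_char_0 \<Rightarrow> 'k genfield" where "cst c = emb (pconst c)"

lemma emb_add: "emb (f + g) = emb f + emb g" by (simp add: emb_def)
lemma emb_mult: "emb (f * g) = emb f * emb g" by (simp add: emb_def)
lemma emb_0 [simp]: "emb 0 = 0" by (simp add: emb_def Zero_fract_def)
lemma emb_1 [simp]: "emb 1 = 1" by (simp add: emb_def One_fract_def)
lemma emb_eq_iff [simp]: "emb f = emb g \<longleftrightarrow> f = g" by (simp add: emb_def eq_fract)
lemma emb_eq_0 [simp]: "emb f = 0 \<longleftrightarrow> f = 0" using emb_eq_iff[of f 0] by simp
lemma emb_uminus: "emb (- f) = - emb f" by (simp add: emb_def)
lemma emb_sum: "emb (sum f I) = (\<Sum>i\<in>I. emb (f i))"
  by (induction I rule: infinite_finite_induct) (auto simp: emb_add)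
lemma Fract_emb: "b \<noteq> 0 \<Longrightarrow> Fract a b = emb a / emb b"
  by (simp add: emb_def)

lemma cst_add: "cst (a + b) = cst a + cst b"
  unfolding cst_def emb_add[symmetric] by (simp add: polyfun_eqI)
lemma cst_mult: "cst (a * b) = cst a * cst b"
  unfolding cst_def emb_mult[symmetric] by (simp add: polyfun_eqI)
lemma cst_0 [simp]: "cst 0 = 0" unfolding cst_def by (simp add: polyfun_eqI)
lemma cst_1 [simp]: "cst 1 = 1" unfolding cst_def emb_1[symmetric] emb_eq_iff by (simp add: polyfun_eqI)
lemma cst_uminus: "cst (- a) = - cst a"
  unfolding cst_def emb_uminus[symmetric] by (simp add: polyfun_eqI)
lemma cst_sum: "cst (sum f I) = (\<Sum>i\<in>I. cst (f i))"
  by (induction I rule: infinite_finite_induct) (auto simp: cst_add)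
lemma cst_eq_0 [simp]: "cst a = 0 \<longleftrightarrow> a = 0"
proof
  assume "cst a = 0"
  then have "pconst a = 0" by (simp add: cst_def)
  then have "ev (pconst a) (\<lambda>_. 0) = 0" by simp
  then show "a = 0" by simp
qed simp

lemma genfield_cases:
  obtains a b where "(x :: 'k::field_char_0 genfield) = emb a / emb b" "b \<noteq> 0"
  by (cases x) (auto simp: Fract_emb)

definition gval :: "'k::field_char_0 genfield \<Rightarrow> int" where
  "gval x = (THE e. \<exists>a b. a \<noteq> 0 \<and> b \<noteq> 0 \<and> x = emb a / emb b \<and> e = int (pord a) - int (pord b))"

lemma gval:
  assumes "a \<noteq> 0" "b \<noteq> 0"
  shows "gval (emb a / emb b) = int (pord a) - int (pord b)"
  unfolding gval_def
proof (rule the_equality)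
  show "\<exists>a' b'. a' \<noteq> 0 \<and> b' \<noteq> 0 \<and> emb a / emb b = emb a' / emb b' \<and> int (pord a) - int (pord b) = int (pord a') - int (pord b')"
    using assms by blast
  fix e assume "\<exists>a' b'. a' \<noteq> 0 \<and> b' \<noteq> 0 \<and> emb a / emb b = emb a' / emb b' \<and> e = int (pord a') - int (pord b')"
  then obtain a' b' where *: "a' \<noteq> 0" "b' \<noteq> 0" "emb a / emb b = emb a' / emb b'" "e = int (pord a') - int (pord b')" by blast
  then have "emb (a * b') = emb (a' * b)" using assms by (simp add: field_simps emb_mult)
  then have "a * b' = a' * b" by (simp only: emb_eq_iff)
  then have "pord a + pord b' = pord a' + pord b" using pord_mult assms * by metis
  then show "e = int (pord a) - int (pord b)" using * by linarith
qed

interpretation gf: valued_field "gval :: 'k::field_char_0 genfield \<Rightarrow> int"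
proof
  fix x y :: "'k genfield"
  assume x0: "x \<noteq> 0" and y0: "y \<noteq> 0"
  obtain a b where x: "x = emb a / emb b" and b: "b \<noteq> 0" by (rule genfield_cases)
  obtain c d where y: "y = emb c / emb d" and d: "d \<noteq> 0" by (rule genfield_cases)
  have a: "a \<noteq> 0" and c: "c \<noteq> 0" using x0 y0 x y by auto
  have "x * y = emb (a * c) / emb (b * d)" by (simp add: x y emb_mult)
  then show "gval (x * y) = gval x + gval y"
    using a b c d by (simp only: gval x y pord_mult no_zero_divisors not_False_eq_True)
  assume xy: "x + y \<noteq> 0"
  have e: "x + y = emb (a * d + c * b) / emb (b * d)"
    using b d by (simp add: x y emb_mult emb_add field_simps)
  then have nz: "a * d + c * b \<noteq> 0" using xy by auto
  have "min (pord (a * d)) (pord (c * b)) \<le> pord (a * d + c * b)" using pord_add[OF _ _ nz] a b c d by simp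
  then have "min (pord a + pord d) (pord c + pord b) \<le> pord (a * d + c * b)" using a b c d by (simp add: pord_mult)
  moreover have "gval (x + y) = int (pord (a * d + c * b)) - int (pord b + pord d)"
    unfolding e using b d nz by (subst gval) (auto simp: pord_mult)
  moreover have "gval x = int (pord a) - int (pord b)" "gval y = int (pord c) - int (pord d)"
    using a b c d by (simp_all add: x y gval)
  ultimately show "min (gval x) (gval y) \<le> gval (x + y)" by linarith
qed

lemma gval_emb: "f \<noteq> 0 \<Longrightarrow> gval (emb f) = int (pord f)"
  using gval[of f 1] pord_unique[of 1 0] by (simp add: ps_dvd_iff)

lemma vge_emb: "gf.vge 0 (emb f)"
  by (cases "f = 0") (auto simp: gf.vge_def gval_emb)

lemma vge_cst: "gf.vge 0 (cst c)"
  unfolding cst_def by (rule vge_emb)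

lemma gval_s: "gval (emb ps) = 1"
  using pord_unique[of 1 1] by (simp add: gval_emb ps_dvd_iff)

section \<open>Derivations of the fraction field\<close>

text \<open>The quotient rule.  The value \<open>d\<close> of a derivation on the ring may lie in the field, and the formula
  does not depend on how \<open>x\<close> is written as a fraction.\<close>

definition ext_deriv :: "('k::field_char_0 polyfun \<Rightarrow> 'k genfield) \<Rightarrow> 'k genfield \<Rightarrow> 'k genfield" where
  "ext_deriv d x = (THE y. \<exists>a b. b \<noteq> 0 \<and> x = emb a / emb b \<and> y = (d a - x * d b) / emb b)"

lemma ext_deriv:
  assumes d: "\<And>f g. d (f * g) = d f * emb g + emb f * d g" and b: "b \<noteq> 0"
  shows "ext_deriv d (emb a / emb b) = (d a - emb a / emb b * d b) / emb b"
  unfolding ext_deriv_def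
proof (rule the_equality)
  show "\<exists>a' b'. b' \<noteq> 0 \<and> emb a / emb b = emb a' / emb b' \<and>
     (d a - emb a / emb b * d b) / emb b = (d a' - emb a / emb b * d b') / emb b'" using b by blast
  fix y assume "\<exists>a' b'. b' \<noteq> 0 \<and> emb a / emb b = emb a' / emb b' \<and> y = (d a' - emb a / emb b * d b') / emb b'"
  then obtain a' b' where *: "b' \<noteq> 0" "emb a / emb b = emb a' / emb b'" "y = (d a' - emb a / emb b * d b') / emb b'" by blast
  define x where "x = emb a / emb b"
  have x': "x = emb a' / emb b'" unfolding x_def by (rule *(2))
  have ea: "emb a = x * emb b" using b by (simp add: x_def)
  have ea': "emb a' = x * emb b'" using *(1) by (simp add: x')
  have "emb (a * b') = emb (a' * b)" by (simp add: emb_mult ea ea')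
  then have "d (a * b') = d (a' * b)" by simp
  then have "d a * emb b' + x * emb b * d b' = d a' * emb b + x * emb b' * d b" by (simp add: d ea ea')
  then have "(d a - x * d b) * emb b' = (d a' - x * d b') * emb b" by (simp add: algebra_simps)
  then have "(d a - x * d b) / emb b = (d a' - x * d b') / emb b'"
    using b *(1) by (simp add: frac_eq_eq)
  then show "y = (d a - emb a / emb b * d b) / emb b"
    using *(3) unfolding x_def[symmetric] by simp
qed

lemma quotient_rule_add:
  fixes b e :: "'f::field"
  assumes "b \<noteq> 0" "e \<noteq> 0"
  shows "(A * e + x * b * E + (C * b + y * e * B) - (x + y) * (B * e + b * E)) / (b * e) = (A - x * B) / b + (C - y * E) / e"
proof -
  have "(A - x * B) / b + (C - y * E) / e = ((A - x * B) * e + (C - y * E) * b) / (b * e)"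
    using assms by (simp add: add_frac_eq)
  then show ?thesis by (simp add: algebra_simps)
qed

lemma quotient_rule_mult:
  fixes b e :: "'f::field"
  assumes "b \<noteq> 0" "e \<noteq> 0"
  shows "(A * (y * e) + x * b * C - x * y * (B * e + b * E)) / (b * e) = (A - x * B) / b * y + x * ((C - y * E) / e)"
proof -
  have "(A - x * B) / b * y + x * ((C - y * E) / e) = ((A - x * B) * y * e + (x * (C - y * E)) * b) / (b * e)"
    using assms by (simp add: add_frac_eq)
  then show ?thesis by (simp add: algebra_simps)
qed

lemma ext_deriv_vderiv:
  assumes d: "\<And>f g. d (f * g) = d f * emb g + emb f * d g" "\<And>f g. d (f + g) = d f + d g"
    and s: "d ps = 0" and int: "\<And>f. gf.vge 0 (d f)"
  shows "gf.vderiv (ext_deriv d)"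
  unfolding gf.vderiv_def
proof (intro conjI allI impI)
  fix x y :: "'a genfield"
  obtain a b where x: "x = emb a / emb b" and b: "b \<noteq> 0" by (rule genfield_cases)
  obtain c e where y: "y = emb c / emb e" and e: "e \<noteq> 0" by (rule genfield_cases)
  note E = ext_deriv[OF d(1)]
  have eb: "emb b \<noteq> 0" and ee: "emb e \<noteq> 0" using b e by simp_all
  have xa: "emb a = x * emb b" and yc: "emb c = y * emb e" using eb ee by (simp_all add: x y)
  have dx: "ext_deriv d x = (d a - x * d b) / emb b" unfolding x by (rule E[OF b])
  have dy: "ext_deriv d y = (d c - y * d e) / emb e" unfolding y by (rule E[OF e])
  have be: "b * e \<noteq> 0" using b e by simp
  have xy: "x + y = emb (a * e + c * b) / emb (b * e)"
    using eb ee by (simp add: x y emb_mult emb_add field_simps)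
  have "ext_deriv d (x + y) = (d (a * e + c * b) - (x + y) * d (b * e)) / emb (b * e)"
    unfolding xy by (rule E[OF be])
  also have "\<dots> = ext_deriv d x + ext_deriv d y"
    unfolding dx dy d emb_mult xa yc by (rule quotient_rule_add[OF eb ee])
  finally show "ext_deriv d (x + y) = ext_deriv d x + ext_deriv d y" .
  have xy: "x * y = emb (a * c) / emb (b * e)" by (simp add: x y emb_mult)
  have "ext_deriv d (x * y) = (d (a * c) - (x * y) * d (b * e)) / emb (b * e)"
    unfolding xy by (rule E[OF be])
  also have "\<dots> = ext_deriv d x * y + x * ext_deriv d y"
    unfolding dx dy d emb_mult xa yc by (rule quotient_rule_mult[OF eb ee])
  finally show "ext_deriv d (x * y) = ext_deriv d x * y + x * ext_deriv d y" .
next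
  fix r :: int and x :: "'a genfield"
  assume v: "gf.vge r x"
  note E = ext_deriv[OF d(1)]
  have d0: "d 0 = 0" using d(2)[of 0 0] by (metis add.right_neutral add_left_cancel)
  have d1: "d 1 = 0" using d(1)[of 1 1] by (metis add.right_neutral add_left_cancel emb_1 mult.right_neutral mult_1)
  have dpow: "d (ps ^ n * f) = emb (ps ^ n) * d f" for n f
    by (induction n arbitrary: f) (simp_all add: d s emb_mult mult.assoc)
  have vd: "gf.vge (int (pord f)) (d f)" if f0: "f \<noteq> 0" for f
  proof -
    obtain g where g: "f = ps ^ pord f * g" using pord_factor[OF f0] .
    have "d f = emb (ps ^ pord f) * d g" by (subst g) (rule dpow)
    moreover have "ps ^ pord f \<noteq> (0 :: 'a polyfun)" using ps_nonzero by simp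
    moreover have "pord (ps ^ pord f * 1 :: 'a polyfun) = pord f" by (rule pord_unique) (simp add: ps_dvd_iff)
    ultimately have "gf.vge (int (pord f) + 0) (d f)"
      by (simp only:) (intro gf.vge_mult int; simp add: gf.vge_def gval_emb)
    then show ?thesis by simp
  qed
  show "gf.vge r (ext_deriv d x)"
  proof (cases "x = 0")
    case True
    have "x = emb 0 / emb 1" using True by simp
    then have "ext_deriv d x = 0" using E[of 1 0] by (simp add: d0)
    then show ?thesis by simp
  next
    case False
    obtain a b where x: "x = emb a / emb b" and b: "b \<noteq> 0" by (rule genfield_cases)
    have a: "a \<noteq> 0" using False x by auto
    have vx: "gval x = int (pord a) - int (pord b)" unfolding x by (rule gval[OF a b])
    have "gf.vge (gval x + int (pord b)) (x * d b)"
      by (intro gf.vge_mult vd b) (simp add: gf.vge_def)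
    then have "gf.vge (int (pord a)) (d a - x * d b)" using vd[OF a] vx by (intro gf.vge_diff) auto
    moreover have "gf.vge (- int (pord b)) (inverse (emb b))"
      using b by (simp add: gf.vge_def gf.v_inverse gval_emb)
    ultimately have "gf.vge (int (pord a) + - int (pord b)) ((d a - x * d b) * inverse (emb b))" by (rule gf.vge_mult)
    moreover have "r \<le> gval x" using v False by (simp add: gf.vge_def)
    moreover have "ext_deriv d x = (d a - x * d b) * inverse (emb b)"
      using E[OF b, of a] unfolding x[symmetric] by (simp add: divide_inverse)
    ultimately show ?thesis using vx gf.vge_mono by simp
  qed
qed

text \<open>The combination \<open>\<Sum> \<zeta> j \<partial> j\<close> of the partial derivatives, extended to the fraction field.\<close>

lemma prescribed_derivation:
  fixes \<zeta> :: "nat \<Rightarrow> 'k::field_char_0 genfield"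
  assumes "\<And>j. j < n \<Longrightarrow> gf.vge 0 (\<zeta> j)"
  obtains D where "gf.vderiv D" "\<And>j. j < n \<Longrightarrow> D (emb (pvar (Suc j))) = \<zeta> j" "D (emb ps) = 0" "\<And>c. D (cst c) = 0"
proof -
  define d where "d f = (\<Sum>j<n. \<zeta> j * emb (pd (Suc j) f))" for f
  have dm: "d (f * g) = d f * emb g + emb f * d g" for f g
    by (simp add: d_def pd_mult emb_add emb_mult sum.distrib sum_distrib_left sum_distrib_right algebra_simps)
  have da: "d (f + g) = d f + d g" for f g
    by (simp add: d_def pd_add emb_add sum.distrib algebra_simps)
  have ds: "d ps = 0" by (simp add: d_def pd_var)
  have dc: "d (pconst c) = 0" for c by (simp add: d_def pd_const)
  have d1: "d 1 = 0" using dc[of 1] by (simp add: d_def) (metis cst_1 cst_def emb_1 emb_eq_iff)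
  have dv: "d (pvar (Suc j)) = \<zeta> j" if "j < n" for j
    using that by (simp add: d_def pd_var if_distrib[of emb] if_distrib[of "\<lambda>x. _ * x"] sum.delta cong: if_cong)
  have int: "gf.vge 0 (d f)" for f
    unfolding d_def by (intro gf.vge_sum gf.vge_mult0 assms vge_emb) simp
  have E: "ext_deriv d (emb f) = d f" for f
    using ext_deriv[OF dm, of 1 f] by (simp add: d1)
  show thesis
    by (rule that[of "ext_deriv d"]) (auto simp: E dv ds dc cst_def intro: ext_deriv_vderiv dm da ds int)
qed

section \<open>Lie algebras given by structure constants\<close>

lemma sum_rotate: "(\<Sum>l\<in>A. \<Sum>i\<in>B. \<Sum>j\<in>C. F l i j) = (\<Sum>i\<in>B. \<Sum>j\<in>C. \<Sum>l\<in>A. F l i j)"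
proof -
  have "(\<Sum>l\<in>A. \<Sum>i\<in>B. \<Sum>j\<in>C. F l i j) = (\<Sum>i\<in>B. \<Sum>l\<in>A. \<Sum>j\<in>C. F l i j)" by (rule sum.swap)
  also have "\<dots> = (\<Sum>i\<in>B. \<Sum>j\<in>C. \<Sum>l\<in>A. F l i j)" by (intro sum.cong refl sum.swap)
  finally show ?thesis .
qed

text \<open>The vector \<open>c i j\<close> holds the coordinates of the bracket of the basis vectors \<open>i\<close> and \<open>j\<close>.\<close>

locale lie_mat = valued_field_mat v n for v :: "'a::field \<Rightarrow> int" and n +
  fixes c :: "nat \<Rightarrow> nat \<Rightarrow> nat \<Rightarrow> 'a"
  assumes c_skew: "i < n \<Longrightarrow> j < n \<Longrightarrow> l < n \<Longrightarrow> c i j l = - c j i l"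
    and c_jacobi: "i < n \<Longrightarrow> j < n \<Longrightarrow> k < n \<Longrightarrow> m < n \<Longrightarrow>
      (\<Sum>l<n. c i j l * c l k m) = (\<Sum>l<n. c i l m * c j k l) - (\<Sum>l<n. c j l m * c i k l)"
begin

definition adm :: "(nat \<Rightarrow> 'a) \<Rightarrow> 'a mtx" where
  "adm x = (\<lambda>l j. if l < n \<and> j < n then \<Sum>i<n. x i * c i j l else 0)"

definition br :: "(nat \<Rightarrow> 'a) \<Rightarrow> (nat \<Rightarrow> 'a) \<Rightarrow> nat \<Rightarrow> 'a" where
  "br x y = mv (adm x) y"

definition kap :: "(nat \<Rightarrow> 'a) \<Rightarrow> (nat \<Rightarrow> 'a) \<Rightarrow> 'a" where
  "kap x y = tr (adm x \<star> adm y)"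

lemma adm_in [simp]: "adm x \<in> mats" by (auto simp: adm_def mats_def)

lemma adm_add: "adm (x + y) = adm x + adm y"
  by (auto simp: adm_def fun_eq_iff sum.distrib algebra_simps)
lemma adm_scale: "adm (vscale t x) = (\<lambda>i j. t * adm x i j)"
  by (auto simp: adm_def fun_eq_iff vscale_def sum_distrib_left mult.assoc)

lemma br_eq: "l < n \<Longrightarrow> br x y l = (\<Sum>i<n. \<Sum>j<n. x i * y j * c i j l)"
  by (subst sum.swap) (simp add: br_def mv_def adm_def sum_distrib_right sum_distrib_left mult_ac)

lemma br_vecs [simp]: "br x y \<in> vecs" by (simp add: br_def)

lemma br_out: "\<not> l < n \<Longrightarrow> br x y l = 0" by (simp add: br_def mv_def)

lemma br_skew: "br x y = - br y x"
proof
  fix l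
  show "br x y l = (- br y x) l"
  proof (cases "l < n")
    case True
    have "br x y l = (\<Sum>j<n. \<Sum>i<n. x i * y j * c i j l)" unfolding br_eq[OF True] by (rule sum.swap)
    also have "\<dots> = (\<Sum>j<n. \<Sum>i<n. - (y j * x i * c j i l))"
    proof (intro sum.cong refl)
      fix j i assume "j \<in> {..<n}" "i \<in> {..<n}"
      then have "c i j l = - c j i l" using c_skew True by blast
      then show "x i * y j * c i j l = - (y j * x i * c j i l)" by (simp only: mult_minus_right mult.commute)
    qed
    finally show ?thesis by (simp add: br_eq[OF True] sum_negf)
  qed (simp add: br_out)
qed

lemma adm_br: "adm (br x y) = cm (adm x) (adm y)"
proof (intro ext)
  fix m k
  show "adm (br x y) m k = cm (adm x) (adm y) m k"
  proof (cases "m < n \<and> k < n")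
    case True
    have "adm (br x y) m k = (\<Sum>l<n. (\<Sum>i<n. \<Sum>j<n. x i * y j * c i j l) * c l k m)"
      using True by (simp add: adm_def br_eq)
    also have "\<dots> = (\<Sum>l<n. \<Sum>i<n. \<Sum>j<n. x i * y j * (c i j l * c l k m))"
      by (simp add: sum_distrib_right mult.assoc)
    also have "\<dots> = (\<Sum>i<n. \<Sum>j<n. \<Sum>l<n. x i * y j * (c i j l * c l k m))"
      by (rule sum_rotate)
    also have "\<dots> = (\<Sum>i<n. \<Sum>j<n. x i * y j * (\<Sum>l<n. c i j l * c l k m))"
      by (simp add: sum_distrib_left)
    also have "\<dots> = (\<Sum>i<n. \<Sum>j<n. x i * y j * ((\<Sum>l<n. c i l m * c j k l) - (\<Sum>l<n. c j l m * c i k l)))"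
      using True by (intro sum.cong) (auto simp: c_jacobi)
    also have "\<dots> = (\<Sum>i<n. \<Sum>j<n. \<Sum>l<n. (x i * c i l m) * (y j * c j k l))
       - (\<Sum>i<n. \<Sum>j<n. \<Sum>l<n. (y j * c j l m) * (x i * c i k l))"
      by (simp add: right_diff_distrib sum_subtractf sum_distrib_left mult_ac)
    also have "(\<Sum>i<n. \<Sum>j<n. \<Sum>l<n. (x i * c i l m) * (y j * c j k l)) = (adm x \<star> adm y) m k"
    proof -
      have "(adm x \<star> adm y) m k = (\<Sum>l<n. \<Sum>i<n. \<Sum>j<n. (x i * c i l m) * (y j * c j k l))"
        using True by (simp add: mm_def adm_def sum_product)
      also have "\<dots> = (\<Sum>i<n. \<Sum>j<n. \<Sum>l<n. (x i * c i l m) * (y j * c j k l))"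
        by (rule sum_rotate)
      finally show ?thesis by simp
    qed
    also have "(\<Sum>i<n. \<Sum>j<n. \<Sum>l<n. (y j * c j l m) * (x i * c i k l)) = (adm y \<star> adm x) m k"
    proof -
      have "(adm y \<star> adm x) m k = (\<Sum>l<n. \<Sum>j<n. \<Sum>i<n. (y j * c j l m) * (x i * c i k l))"
        using True by (simp add: mm_def adm_def sum_product)
      also have "\<dots> = (\<Sum>j<n. \<Sum>i<n. \<Sum>l<n. (y j * c j l m) * (x i * c i k l))"
        by (rule sum_rotate)
      also have "\<dots> = (\<Sum>i<n. \<Sum>j<n. \<Sum>l<n. (y j * c j l m) * (x i * c i k l))" by (rule sum.swap)
      finally show ?thesis by simp
    qed
    finally show ?thesis by (simp add: cm_def)
  qed (auto simp: adm_def cm_def mm_def)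
qed

lemma kap_comm: "kap x y = kap y x" by (simp add: kap_def tr_comm)
lemma kap_add_l: "kap (x + y) z = kap x z + kap y z" by (simp add: kap_def adm_add mm_ring tr_add)
lemma kap_add_r: "kap z (x + y) = kap z x + kap z y" by (simp add: kap_def adm_add mm_ring tr_add)
lemma kap_scale_l: "kap (vscale t x) y = t * kap x y"
  by (simp add: kap_def adm_scale tr_def mm_def sum_distrib_left mult_ac)
lemma kap_scale_r: "kap x (vscale t y) = t * kap x y"
  by (subst (1 2) kap_comm) (rule kap_scale_l)
lemma kap_0_r [simp]: "kap x 0 = 0" using kap_scale_r[of x 0 0] by (simp add: vscale_def zero_fun_def)
lemma kap_0_l [simp]: "kap 0 x = 0" by (subst kap_comm) simp
lemma kap_uminus_r: "kap x (- y) = - kap x y"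
  using kap_add_r[of x y "- y"] by (simp add: eq_neg_iff_add_eq_0 add.commute)
lemma kap_diff_r: "kap x (y - z) = kap x y - kap x z"
  using kap_add_r[of x y "- z"] by (simp add: kap_uminus_r)
lemma kap_uminus_l: "kap (- y) x = - kap y x" by (subst (1 2) kap_comm) (rule kap_uminus_r)
lemma kap_sum_l: "kap (\<Sum>i\<in>I. f i) y = (\<Sum>i\<in>I. kap (f i) y)"
proof (induction I rule: infinite_finite_induct)
  case (insert x F)
  have "kap (sum f (insert x F)) y = kap (f x + sum f F) y" using insert(1,2) by (subst sum.insert) simp_all
  also have "\<dots> = kap (f x) y + kap (sum f F) y" by (rule kap_add_l)
  also have "\<dots> = (\<Sum>i\<in>insert x F. kap (f i) y)" using insert by simp
  finally show ?case .
next
  case (infinite A)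
  show ?case unfolding sum.infinite[OF infinite] by (rule kap_0_l)
next
  case empty
  show ?case unfolding sum.empty by (rule kap_0_l)
qed
lemma kap_sum_r: "kap y (\<Sum>i\<in>I. f i) = (\<Sum>i\<in>I. kap y (f i))"
proof (induction I rule: infinite_finite_induct)
  case (insert x F)
  have "kap y (sum f (insert x F)) = kap y (f x + sum f F)" using insert(1,2) by (subst sum.insert) simp_all
  also have "\<dots> = kap y (f x) + kap y (sum f F)" by (rule kap_add_r)
  also have "\<dots> = (\<Sum>i\<in>insert x F. kap y (f i))" using insert by simp
  finally show ?case .
next
  case (infinite A)
  show ?case unfolding sum.infinite[OF infinite] by (rule kap_0_r)
next
  case empty
  show ?case unfolding sum.empty by (rule kap_0_r)
qed

lemma kap_inv: "kap (br x y) z = kap x (br y z)"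
proof -
  have "kap (br x y) z = tr (cm (adm x) (adm y) \<star> adm z)" by (simp add: kap_def adm_br)
  also have "\<dots> = tr (adm x \<star> cm (adm y) (adm z))" by (rule tr_cm[symmetric])
  finally show ?thesis by (simp add: kap_def adm_br)
qed

lemma kap_ad_skew: "kap (br x y) z = - kap y (br x z)"
  using kap_inv[of y x z] br_skew[of x y] by (simp add: kap_uminus_l)

lemma br_lin: "vs.lin (br x)" unfolding br_def by (rule mv_lin)

lemma br_add_l: "br (x + y) z = br x z + br y z"
  by (auto simp: br_def adm_add mv_def fun_eq_iff sum.distrib algebra_simps)
lemma br_scale_l: "br (vscale t x) z = vscale t (br x z)"
  unfolding br_def adm_scale by (auto simp: mv_def fun_eq_iff vscale_def sum_distrib_left mult.assoc)

lemma vecs_coord: "x \<in> vecs \<Longrightarrow> (\<Sum>j<n. vscale (x j) (unitv j)) = x"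
  by (intro ext) (auto simp: vs_sum unitv_def vecs_def if_distrib[of "\<lambda>x. _ * x"] cong: if_cong)

lemma mv_coord: "x \<in> vecs \<Longrightarrow> mv A x = (\<Sum>j<n. vscale (x j) (mv A (unitv j)))"
  by (subst vecs_coord[symmetric, of x]) (simp_all only: vs.lin_sum[OF mv_lin] vs.lin_scale[OF mv_lin])

definition integral_vec :: "(nat \<Rightarrow> 'a) \<Rightarrow> bool" where
  "integral_vec x \<longleftrightarrow> x \<in> vecs \<and> (\<forall>i. vge 0 (x i))"

lemma integral_vec_add: "integral_vec x \<Longrightarrow> integral_vec y \<Longrightarrow> integral_vec (x + y)"
  by (auto simp: integral_vec_def vecs_def intro: vge_add)
lemma integral_vec_diff: "integral_vec x \<Longrightarrow> integral_vec y \<Longrightarrow> integral_vec (x - y)"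
  by (auto simp: integral_vec_def vecs_def intro: vge_diff)
lemma integral_vec_uminus: "integral_vec x \<Longrightarrow> integral_vec (- x)"
  by (auto simp: integral_vec_def vecs_def)
lemma integral_vec_scale: "vge 0 t \<Longrightarrow> integral_vec x \<Longrightarrow> integral_vec (vscale t x)"
  by (auto simp: integral_vec_def vecs_def vscale_def intro: vge_mult0)
lemma integral_vec_sum: "(\<And>i. i \<in> I \<Longrightarrow> integral_vec (f i)) \<Longrightarrow> integral_vec (sum f I)"
  by (induction I rule: infinite_finite_induct) (auto intro: integral_vec_add simp: integral_vec_def[of 0] vecs_def)
lemma integral_vec_mv:
  assumes "\<And>i j. i < n \<Longrightarrow> j < n \<Longrightarrow> vge 0 (A i j)" "integral_vec x"
  shows "integral_vec (mv A x)"
  using assms mv_vecs unfolding integral_vec_def by (simp add: mv_def) (intro allI impI vge_sum vge_mult0, auto)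

end

text \<open>A pencil \<open>a + s z\<close> with \<open>s\<close> a uniformiser, \<open>a\<close> and the structure constants constant, \<open>ad a\<close>
  triangular, and \<open>z\<close> generic in the sense that derivations of the field move it arbitrarily.\<close>

locale generic_pencil = lie_mat v n c for v :: "'a::field \<Rightarrow> int" and n c +
  fixes s :: 'a and a z :: "nat \<Rightarrow> 'a" and gi :: "nat \<Rightarrow> nat \<Rightarrow> 'a"
  assumes s: "s \<noteq> 0" "v s = 1"
    and az: "a \<in> vecs" "z \<in> vecs" "\<And>i. vge 0 (a i)" "\<And>i. vge 0 (z i)"
    and c_int: "\<And>i j l. vge 0 (c i j l)"
    and tri: "\<And>i j. i < n \<Longrightarrow> j < i \<Longrightarrow> adm a i j = 0"
    and gi: "\<And>i j. vge 0 (gi i j)" "\<And>i j. i < n \<Longrightarrow> j < n \<Longrightarrow> (\<Sum>l<n. kap (unitv i) (unitv l) * gi l j) = (if i = j then 1 else 0)"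
    and gen: "\<And>x. integral_vec x \<Longrightarrow> \<exists>D. vderiv D \<and> D s = 0 \<and> (\<forall>i<n. D (z i) = x i) \<and> (\<forall>i<n. D (a i) = 0)
        \<and> (\<forall>i<n. \<forall>j<n. \<forall>l<n. D (c i j l) = 0)"
begin

definition gam :: "nat \<Rightarrow> 'a" where "gam = a + vscale s z"

lemma adm_int: "(\<And>i. vge 0 (x i)) \<Longrightarrow> vge 0 (adm x i j)"
  by (auto simp: adm_def intro!: vge_sum vge_mult0 c_int)

lemma vge_s: "vge 1 s" using s by (simp add: vge_def)

lemma adm_gam: "adm gam i j = adm a i j + s * adm z i j"
  by (simp add: gam_def adm_add adm_scale)

lemma gam_int: "vge 0 (gam i)"
  using az vge_mono[OF vge_s, of 0] by (auto simp: gam_def vscale_def intro!: vge_add vge_mult0)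

lemma iw_gam: "iw 0 (adm gam)"
proof (rule iw0I)
  show "vge 0 (adm gam i j)" for i j by (rule adm_int) (rule gam_int)
  show "vge 1 (adm gam i j)" if "i < n" "j < i" for i j
    using tri[OF that] adm_int[of z] az vge_s by (auto simp: adm_gam intro: vge_mult1l)
qed

text \<open>Directions \<open>\<zeta>\<close> in the image of \<open>ad \<gamma>\<close> integrate to isospectral derivations of \<open>\<gamma>\<close>, so
  that the smallness of the Kirillov form applies.\<close>

lemma image_pairing:
  assumes z1: "integral_vec z1" "z1 = br gam x1" and z2: "integral_vec z2" "z2 = br gam x2"
  shows "vge 0 (s * kap z1 x2)"
proof -
  obtain D1 where D1: "vderiv D1" "D1 s = 0" "\<forall>i<n. D1 (z i) = (- z1) i" "\<forall>i<n. D1 (a i) = 0"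
      "\<forall>i<n. \<forall>j<n. \<forall>l<n. D1 (c i j l) = 0"
    using gen[OF integral_vec_uminus[OF z1(1)]] by (elim exE conjE)
  obtain D2 where D2: "vderiv D2" "D2 s = 0" "\<forall>i<n. D2 (z i) = (- z2) i" "\<forall>i<n. D2 (a i) = 0"
      "\<forall>i<n. \<forall>j<n. \<forall>l<n. D2 (c i j l) = 0"
    using gen[OF integral_vec_uminus[OF z2(1)]] by (elim exE conjE)
  have iso: "Dm D (adm gam) = cm (adm (vscale s x)) (adm gam)" "\<forall>k<n. D (adm a k k) = 0"
    if D: "vderiv D" "D s = 0" "\<forall>i<n. D (z i) = (- br gam x) i" "\<forall>i<n. D (a i) = 0"
      "\<forall>i<n. \<forall>j<n. \<forall>l<n. D (c i j l) = 0" for D x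
  proof -
    note Dd = vderivD[OF D(1)]
    have D0: "D 0 = 0" by (rule D_0[OF D(1)])
    have Ds: "D (sum f {..<n}) = (\<Sum>k<n. D (f k))" for f
    proof -
      have "D (sum f {..<m}) = (\<Sum>k<m. D (f k))" for m by (induction m) (simp_all add: D0 Dd(1))
      then show ?thesis .
    qed
    have Dad: "D (adm y i j) = adm (\<lambda>k. D (y k)) i j" for y i j
      using D(5) by (auto simp: adm_def Ds Dd(2) D0 intro!: sum.cong)
    have e: "D (gam i) = vscale s (- br gam x) i" if "i < n" for i
      using D(2-4) that by (simp add: gam_def vscale_def Dd(1,2))
    have "Dm D (adm gam) = adm (vscale s (- br gam x))"
      by (intro ext) (simp add: Dm_def Dad, auto simp: adm_def e intro!: sum.cong)
    also have "vscale s (- br gam x) = br (vscale s x) gam"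
      by (subst br_skew[of gam x]) (simp add: br_scale_l)
    also have "adm (br (vscale s x) gam) = cm (adm (vscale s x)) (adm gam)" by (rule adm_br)
    finally show "Dm D (adm gam) = cm (adm (vscale s x)) (adm gam)" .
    show "\<forall>k<n. D (adm a k k) = 0" unfolding Dad using D(4) by (auto simp: adm_def)
  qed
  note i1 = iso[OF D1(1,2) D1(3)[unfolded z1(2)] D1(4,5)]
  note i2 = iso[OF D2(1,2) D2(3)[unfolded z2(2)] D2(4,5)]
  have "vge 1 (tr (adm gam \<star> cm (adm (vscale s x1)) (adm (vscale s x2))))"
  proof (rule isospectral_kirillov_small[OF D1(1) D2(1) adm_in iw_gam, where l = "\<lambda>k. adm a k k"])
    fix k assume k: "k < n"
    show "vge 1 (adm gam k k - adm a k k)"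
      using adm_int[of z] az vge_s by (auto simp: adm_gam intro: vge_mult1l)
    show "D1 (adm a k k) = 0" "D2 (adm a k k) = 0" using i1(2) i2(2) k by auto
  qed (auto simp: i1(1) i2(1))
  also have "tr (adm gam \<star> cm (adm (vscale s x1)) (adm (vscale s x2))) = kap gam (br (vscale s x1) (vscale s x2))"
    by (simp add: kap_def adm_br)
  also have "\<dots> = kap (br gam (vscale s x1)) (vscale s x2)" by (rule kap_inv[symmetric])
  also have "br gam (vscale s x1) = vscale s z1" by (simp add: z1(2) vs.lin_scale[OF br_lin])
  finally have "vge 1 (s * (s * kap z1 x2))" by (simp add: kap_scale_l kap_scale_r)
  moreover have "vge (- 1) (inverse s)" using s by (simp add: vge_def v_inverse)
  ultimately have "vge (- 1 + 1) (inverse s * (s * (s * kap z1 x2)))" by (intro vge_mult)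
  then show ?thesis using s by (simp add: mult.assoc[symmetric])
qed

lemma kap_coord: "x \<in> vecs \<Longrightarrow> kap y x = (\<Sum>j<n. x j * kap y (unitv j))"
  by (subst vecs_coord[symmetric, of x]) (simp_all only: kap_sum_r kap_scale_r)

text \<open>The Killing form is unimodular on the integral vectors, as the inverse Gram matrix is integral.\<close>

lemma dual_vec:
  assumes y: "\<And>i. vge 0 (y i)"
  shows "\<exists>w. integral_vec w \<and> (\<forall>x\<in>vecs. kap x w = (\<Sum>i<n. x i * y i))"
proof (intro exI conjI ballI)
  define w where "w = (\<lambda>l. if l < n then \<Sum>j<n. gi l j * y j else 0)"
  show "integral_vec w"
    using y gi(1) by (auto simp: integral_vec_def vecs_def w_def intro!: vge_sum vge_mult0)
  have wv: "w \<in> vecs" by (simp add: vecs_def w_def)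
  have u: "kap (unitv i) w = y i" if "i < n" for i
  proof -
    have "kap (unitv i) w = (\<Sum>l<n. (\<Sum>j<n. gi l j * y j) * kap (unitv i) (unitv l))"
      unfolding kap_coord[OF wv] by (simp add: w_def)
    also have "\<dots> = (\<Sum>l<n. \<Sum>j<n. kap (unitv i) (unitv l) * gi l j * y j)"
      by (simp add: sum_distrib_left sum_distrib_right mult_ac)
    also have "\<dots> = (\<Sum>j<n. (\<Sum>l<n. kap (unitv i) (unitv l) * gi l j) * y j)"
      by (subst sum.swap) (simp add: sum_distrib_right)
    also have "\<dots> = (\<Sum>j<n. if i = j then y j else 0)" using that by (intro sum.cong) (auto simp: gi)
    finally show ?thesis using that by simp
  qed
  fix x assume x: "x \<in> vecs"
  have "kap x w = (\<Sum>j<n. x j * kap w (unitv j))" by (subst kap_comm) (rule kap_coord[OF x])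
  then show "kap x w = (\<Sum>i<n. x i * y i)" using u by (simp add: kap_comm[of w])
qed

lemma kap_nondeg:
  assumes w: "w \<in> vecs" and 0: "\<And>x. x \<in> vecs \<Longrightarrow> kap x w = 0"
  shows "w = 0"
proof
  fix i
  show "w i = 0 i"
  proof (cases "i < n")
    case True
    have "vge 0 (unitv i j)" for j by (simp add: unitv_def)
    from dual_vec[of "unitv i", OF this] obtain x where x: "integral_vec x" "\<forall>y\<in>vecs. kap y x = (\<Sum>j<n. y j * unitv i j)"
      by (elim exE conjE)
    have "kap w x = w i" using x(2) w True by (simp add: unitv_def if_distrib[of "\<lambda>x. _ * x"] cong: if_cong)
    moreover have "kap w x = 0" using 0[of x] x(1) by (simp add: kap_comm[of w] integral_vec_def)
    ultimately show ?thesis by simp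
  next
    case False
    then show ?thesis using w by (simp add: vecs_def)
  qed
qed

text \<open>The torsion of the cokernel of \<open>ad \<gamma>\<close> on the lattice of integral vectors is killed by \<open>s\<close>.
  It carries a nondegenerate form, for which integrality of \<open>s \<kappa>(\<zeta>\<^sub>1, \<xi>\<^sub>2)\<close> makes \<open>s\<close> times the
  torsion orthogonal to everything.  In practice: \<open>s \<kappa>(-, \<xi>)\<close> is integral on the saturation of the
  image of \<open>ad \<gamma>\<close>, which a monomial form exhibits as a direct summand; so it extends to an integral
  functional, given by an integral vector \<open>w\<close>, and \<open>w - s \<xi>\<close> is orthogonal to the image.\<close>

lemma torsion_killed:
  assumes ze: "integral_vec ze" "ze = br gam xi"
  shows "\<exists>w. integral_vec w \<and> br gam w = vscale s ze"
proof -
  obtain g g' h h' where g: "iwgroup g g'" "iwgroup h h'" "monomial (g \<star> adm gam \<star> h)"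
    using iwahori_elimination[OF adm_in] by blast
  define S where "S = g \<star> adm gam \<star> h"
  have gm: "g \<in> mats" "g' \<in> mats" "iw 0 g" "iw 0 g'" "g \<star> g' = idm" "g' \<star> g = idm"
    and hm: "h \<in> mats" "h' \<in> mats" "h \<star> h' = idm" using g by (auto simp: iwgroup_def)
  have Ae: "adm gam = g' \<star> S \<star> h'"
  proof -
    have "g' \<star> S \<star> h' = (g' \<star> g) \<star> adm gam \<star> (h \<star> h')" by (simp add: S_def mm_assoc)
    then show ?thesis using gm hm by simp
  qed
  have Ah: "adm gam \<star> h = g' \<star> S"
  proof -
    have "g' \<star> S = (g' \<star> g) \<star> (adm gam \<star> h)" by (simp add: S_def mm_assoc)
    then show ?thesis using gm by simp
  qed
  define R where "R = {i. i < n \<and> (\<exists>j<n. S i j \<noteq> 0)}"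
  \<comment> \<open>The functional extended by zero on the summand spanned by the rows without pivot.\<close>
  define y where "y i = (if i \<in> R then s * kap (mv g' (unitv i)) xi else 0)" for i
  have yint: "vge 0 (y i)" for i
  proof (cases "i \<in> R")
    case True
    then obtain j where ij: "i < n" "j < n" "S i j \<noteq> 0" by (auto simp: R_def)
    then have cl: "clean S i j" using g(3) by (auto simp: monomial_def S_def)
    have Sj: "mv S (unitv j) = vscale (S i j) (unitv i)"
    proof
      fix k
      show "mv S (unitv j) k = vscale (S i j) (unitv i) k"
        using cl ij by (auto simp: mv_def unitv_def vscale_def clean_def if_distrib[of "\<lambda>x. _ * x"] cong: if_cong)
    qed
    have "br gam (vscale (inverse (S i j)) (mv h (unitv j))) = vscale (inverse (S i j)) (mv (adm gam \<star> h) (unitv j))"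
      by (simp add: vs.lin_scale[OF br_lin]) (simp add: br_def mv_mm)
    also have "\<dots> = vscale (inverse (S i j)) (mv g' (mv S (unitv j)))" by (simp add: Ah mv_mm)
    also have "\<dots> = mv g' (unitv i)"
      unfolding Sj vs.lin_scale[OF mv_lin] using ij by (simp add: vscale_def mult.assoc[symmetric])
    finally have e: "mv g' (unitv i) = br gam (vscale (inverse (S i j)) (mv h (unitv j)))" by (rule sym)
    have iu: "integral_vec (unitv i)" using ij by (auto simp: integral_vec_def vecs_def unitv_def)
    have "integral_vec (mv g' (unitv i))" by (rule integral_vec_mv[OF iw_integral[OF gm(4)] iu])
    from image_pairing[OF this e ze] show ?thesis using True by (simp add: y_def)
  qed (simp add: y_def)
  have "vge 0 (\<Sum>i<n. y i * g i p)" for p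
  proof (cases "p < n")
    case True
    then show ?thesis using yint iw_integral[OF gm(3)] by (intro vge_sum vge_mult0) auto
  next
    case False
    then show ?thesis using gm(1) by (simp add: mats_def)
  qed
  from dual_vec[of "\<lambda>p. \<Sum>i<n. y i * g i p", OF this] obtain w where w: "integral_vec w" "\<forall>x\<in>vecs. kap x w = (\<Sum>p<n. x p * (\<Sum>i<n. y i * g i p))"
    by (elim exE conjE)
  have kw: "kap (mv g' (unitv i)) w = y i" if "i < n" for i
  proof -
    have "kap (mv g' (unitv i)) w = (\<Sum>p<n. mv g' (unitv i) p * (\<Sum>k<n. y k * g k p))" using w(2) by simp
    also have "\<dots> = (\<Sum>p<n. g' p i * (\<Sum>k<n. y k * g k p))"
      using that by (intro sum.cong) (auto simp: mv_def unitv_def if_distrib[of "\<lambda>x. _ * x"] cong: if_cong)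
    also have "\<dots> = (\<Sum>p<n. \<Sum>k<n. y k * (g k p * g' p i))" by (simp add: sum_distrib_left mult_ac)
    also have "\<dots> = (\<Sum>k<n. y k * (g \<star> g') k i)"
      by (subst sum.swap) (simp add: mm_def that sum_distrib_left)
    also have "\<dots> = (\<Sum>k<n. if k = i then y k else 0)" unfolding gm(5) by (intro sum.cong) (auto simp: idm_def)
    finally show ?thesis using that by simp
  qed
  have "kap x (br gam (w - vscale s xi)) = 0" if x: "x \<in> vecs" for x
  proof -
    have "br gam x = mv g' (mv S (mv h' x))" unfolding br_def by (subst Ae) (simp add: mv_mm mm_assoc)
    moreover define t where "t = mv S (mv h' x)"
    have "mv g' t = (\<Sum>i<n. vscale (t i) (mv g' (unitv i)))" by (rule mv_coord) (simp add: t_def)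
    ultimately have gx: "br gam x = (\<Sum>i<n. vscale (t i) (mv g' (unitv i)))" by (simp only: t_def)
    have t0: "t i = 0" if i: "i < n" "i \<notin> R" for i
    proof -
      have "\<forall>k<n. S i k = 0" using i unfolding R_def by blast
      then have "(\<Sum>k<n. S i k * mv h' x k) = 0" by (intro sum.neutral ballI) simp
      then show ?thesis using i(1) unfolding t_def by (subst mv_def) simp
    qed
    have "kap (mv g' (unitv i)) (w - vscale s xi) * t i = 0" if i: "i < n" for i
    proof (cases "i \<in> R")
      case True
      have "kap (mv g' (unitv i)) (w - vscale s xi) = y i - s * kap (mv g' (unitv i)) xi"
        unfolding kap_diff_r kap_scale_r kw[OF i] by (rule refl)
      also have "\<dots> = 0" using True by (simp add: y_def)
      finally show ?thesis by (rule mult_eq_0_iff[THEN iffD2, OF disjI1])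
    next
      case False
      show ?thesis unfolding t0[OF i False] by (rule mult_zero_right)
    qed
    then have "(\<Sum>i<n. t i * kap (mv g' (unitv i)) (w - vscale s xi)) = 0"
      by (intro sum.neutral ballI) (simp only: lessThan_iff mult.commute)
    then have "kap (br gam x) (w - vscale s xi) = 0"
      unfolding gx by (simp only: kap_sum_l kap_scale_l)
    then show ?thesis using kap_ad_skew[of gam x "w - vscale s xi"] by simp
  qed
  then have "br gam (w - vscale s xi) = 0" by (intro kap_nondeg) auto
  then have "br gam w = vscale s ze" by (simp add: vs.lin_diff[OF br_lin] vs.lin_scale[OF br_lin] ze(2))
  then show ?thesis using w(1) by blast
qed

text \<open>The error \<open>[\<gamma>, u + s u']\<close> is \<open>s\<^sup>2 [z, u']\<close>.  Divided by \<open>s\<^sup>2\<close> it is an integral vector in the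
  image, and as \<open>s\<close> kills the torsion the error is \<open>s [\<gamma>, w]\<close> with \<open>w\<close> integral.\<close>

lemma lift_kernel:
  assumes u: "integral_vec u" "br a u = 0" and u': "integral_vec u'" "br a u' = - br z u"
  shows "\<exists>y. integral_vec y \<and> br gam (u + vscale s y) = 0"
proof -
  have ss: "vscale s (vscale (inverse s) x) = x" "vscale (inverse s) (vscale s x) = x" for x
    using s by (auto simp: vscale_def fun_eq_iff mult.assoc[symmetric])
  have g: "br gam x = br a x + vscale s (br z x)" for x by (simp add: gam_def br_add_l br_scale_l)
  have sa: "vscale s (p + q) = vscale s p + vscale s q" for p q by (auto simp: vscale_def algebra_simps)
  have "br gam (u + vscale s u') = vscale s (vscale s (br z u'))"
    unfolding g vs.lin_add[OF br_lin] vs.lin_scale[OF br_lin] u(2) u'(2)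
    by (simp add: sa) (simp add: vscale_def fun_eq_iff algebra_simps)
  then have e: "br gam (vscale (inverse s) (vscale (inverse s) (u + vscale s u'))) = br z u'"
    by (simp only: vs.lin_scale[OF br_lin] ss)
  have i: "integral_vec (br z u')"
    unfolding br_def by (intro integral_vec_mv u') (use adm_int[of z] az in auto)
  from torsion_killed[OF i e[symmetric]] obtain w where w: "integral_vec w" "br gam w = vscale s (br z u')" by (elim exE conjE)
  have "u + vscale s (u' - w) = (u + vscale s u') - vscale s w" by (auto simp: vscale_def algebra_simps)
  then have "br gam (u + vscale s (u' - w)) = br gam (u + vscale s u') - vscale s (br gam w)"
    by (simp only: vs.lin_diff[OF br_lin] vs.lin_scale[OF br_lin])
  also have "\<dots> = 0" by (simp only: \<open>br gam (u + vscale s u') = vscale s (vscale s (br z u'))\<close> w(2)) simp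
  finally show ?thesis using integral_vec_diff[OF u'(1) w(1)] by blast
qed

end

section \<open>Rank of the generic pencil\<close>

context valued_field_mat begin

lemma mats_bound: "A \<in> mats \<Longrightarrow> A i j \<noteq> 0 \<Longrightarrow> i < n \<and> j < n"
  by (auto simp: mats_def)

lemma kernel_dim:
  assumes Z: "finite Z" "\<And>l. l \<in> Z \<Longrightarrow> x l \<in> vecs \<and> mv A (x l) = 0"
    and ind: "\<And>q l. (\<Sum>l\<in>Z. vscale (q l) (x l)) = 0 \<Longrightarrow> l \<in> Z \<Longrightarrow> q l = 0"
    and N: "\<forall>t. (\<forall>i<m. (\<Sum>j<m. (\<Sum>p<n. \<Sum>q<n. P i p * A p q * Q q j) * t j) = 0) \<longrightarrow> (\<forall>j<m. t j = 0)"
  shows "card Z + m \<le> n"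
proof -
  obtain e where e: "bij_betw e {..<card Z} Z"
    using ex_bij_betw_nat_finite[OF Z(1)] by (auto simp: atLeast0LessThan)
  define col where "col j = (\<lambda>q. if q < n then Q q j else 0)" for j
  define h where "h l = (if l < card Z then x (e l) else col (l - card Z))" for l
  have ez: "e l \<in> Z" if "l < card Z" for l using e that by (auto simp: bij_betw_def)
  have hv: "h l \<in> vecs" if "l < card Z + m" for l
    using Z(2)[OF ez] by (auto simp: h_def col_def vecs_def)
  have hs: "(\<Sum>l<card Z + m. vscale (c l) (h l)) = (\<Sum>l<card Z. vscale (c l) (x (e l))) + (\<Sum>j<m. vscale (c (card Z + j)) (col j))" for c
    unfolding sum_add_index by (simp add: h_def)
  have "\<forall>l<card Z + m. c l = 0" if s: "(\<Sum>l<card Z + m. vscale (c l) (h l)) = 0" for c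
  proof -
    define X where "X = (\<Sum>l<card Z. vscale (c l) (x (e l)))"
    define Y where "Y = (\<Sum>j<m. vscale (c (card Z + j)) (col j))"
    have XY: "X + Y = 0" using s unfolding hs X_def Y_def .
    have "mv A X = (\<Sum>l<card Z. vscale (c l) (mv A (x (e l))))"
      unfolding X_def by (simp only: vs.lin_sum[OF mv_lin] vs.lin_scale[OF mv_lin])
    also have "\<dots> = 0" using Z(2)[OF ez] by (intro sum.neutral) auto
    finally have AX: "mv A X = 0" .
    have "mv A X + mv A Y = mv A 0" unfolding XY[symmetric] by (rule vs.lin_add[OF mv_lin, symmetric])
    then have AY: "mv A Y = 0" unfolding AX vs.lin_0[OF mv_lin] by (simp only: add_0_left)
    have t: "\<forall>j<m. c (card Z + j) = 0"
    proof (rule mp[OF spec[OF N]], intro allI impI)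
      fix i assume "i < m"
      have Yq: "Y q = (\<Sum>j<m. c (card Z + j) * Q q j)" if "q < n" for q
        using that by (simp add: Y_def vs_sum col_def)
      have "(\<Sum>j<m. (\<Sum>p<n. \<Sum>q<n. P i p * A p q * Q q j) * c (card Z + j))
          = (\<Sum>j<m. \<Sum>p<n. \<Sum>q<n. P i p * (A p q * (c (card Z + j) * Q q j)))"
        by (simp add: sum_distrib_left sum_distrib_right mult_ac)
      also have "\<dots> = (\<Sum>p<n. \<Sum>q<n. \<Sum>j<m. P i p * (A p q * (c (card Z + j) * Q q j)))" by (rule sum_rotate)
      also have "\<dots> = (\<Sum>p<n. P i p * (\<Sum>q<n. A p q * Y q))"
        by (simp add: Yq sum_distrib_left)
      also have "\<dots> = (\<Sum>p<n. P i p * mv A Y p)" by (simp add: mv_def)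
      finally show "(\<Sum>j<m. (\<Sum>p<n. \<Sum>q<n. P i p * A p q * Q q j) * c (card Z + j)) = 0" by (simp add: AY)
    qed
    then have "Y = 0" unfolding Y_def by (intro sum.neutral) (auto simp: vscale_def fun_eq_iff)
    then have X0: "X = 0" using XY by (simp only: add_0_right)
    define q where "q z = c (inv_into {..<card Z} e z)" for z
    have inj: "inj_on e {..<card Z}" and im: "e ` {..<card Z} = Z" using e by (auto simp: bij_betw_def)
    have "(\<Sum>z\<in>Z. vscale (q z) (x z)) = (\<Sum>l<card Z. vscale (q (e l)) (x (e l)))"
      using sum.reindex[OF inj, of "\<lambda>z. vscale (q z) (x z)"] im by simp
    also have "\<dots> = X" unfolding X_def by (intro sum.cong) (auto simp: q_def inj)
    finally have "(\<Sum>z\<in>Z. vscale (q z) (x z)) = 0" unfolding X0 .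
    then have "q (e l) = 0" if "l < card Z" for l using ind ez[OF that] by blast
    then have "c l = 0" if "l < card Z" for l using that by (simp add: q_def inj)
    then show ?thesis using t by (metis add_diff_inverse_nat nat_add_left_cancel_less)
  qed
  note fs = vs.indep_fam_set[where d = "card Z + m" and h = h, OF this]
  have "card (h ` {..<card Z + m}) \<le> vs.dim vecs"
    using vs.independent_card_fd[OF _ fs(2) fd_vecs] hv by blast
  then show ?thesis using card_image[OF fs(1)] vs.famb_dim[OF unitv_basis] by simp
qed

end

context generic_pencil begin

text \<open>A monomial form of the matrix of \<open>\<kappa>(z, [u, v])\<close> on the kernel of \<open>ad a\<close> has pivots in all but the
  columns \<open>Z\<close>.  The combinations of the \<open>u\<close> belonging to a column in \<open>Z\<close> lie in the radical; so \<open>[z, u]\<close>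
  is orthogonal to the kernel of \<open>ad a\<close>, hence in the image of \<open>ad a\<close>, and \<open>lift_kernel\<close> yields
  elements of the kernel of \<open>ad \<gamma>\<close>.  They remain independent, being so modulo the maximal ideal, and
  are therefore at most \<open>n - m\<close> in number.\<close>

theorem pencil_rank:
  fixes T :: "'a mtx"
  assumes u: "\<And>j. j < d \<Longrightarrow> integral_vec (u j)" "\<And>j. j < d \<Longrightarrow> br a (u j) = 0"
    and lam: "\<And>i p. vge 0 (lam i p)" "\<And>i j. i < d \<Longrightarrow> j < d \<Longrightarrow> (\<Sum>p<n. lam i p * u j p) = (if i = j then 1 else 0)"
    and T: "\<And>i j. vge 0 (T i j)" "\<And>x. x \<in> vecs \<Longrightarrow> (\<And>j. j < d \<Longrightarrow> kap x (u j) = 0) \<Longrightarrow> br a (mv T x) = x"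
    and N: "\<forall>t. (\<forall>i<m. (\<Sum>j<m. (\<Sum>p<n. \<Sum>q<n. P i p * adm gam p q * Q q j) * t j) = 0) \<longrightarrow> (\<forall>j<m. t j = 0)"
  shows "\<exists>P' Q'. \<forall>i<d - (n - m). \<forall>j<d - (n - m).
    (\<Sum>p<d. \<Sum>q<d. P' i p * kap z (br (u p) (u q)) * Q' q j) = (if i = j then 1 else 0)"
proof -
  interpret Md: valued_field_mat v d by unfold_locales
  define M where "M = (\<lambda>i j. if i < d \<and> j < d then kap z (br (u i) (u j)) else 0)"
  have "M \<in> Md.mats" by (auto simp: M_def Md.mats_def)
  from Md.iwahori_elimination[OF this] obtain g g' h h' where
    gh: "Md.iwgroup g g'" "Md.iwgroup h h'" "Md.monomial (Md.mm (Md.mm g M) h)" by (elim exE conjE)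
  define S where "S = Md.mm (Md.mm g M) h"
  define Z where "Z = {l. l < d \<and> (\<forall>i<d. S i l = 0)}"
  have gm: "g \<in> Md.mats" "g' \<in> Md.mats" "Md.mm g' g = Md.idm" "Md.iw 0 g"
    and hm: "h \<in> Md.mats" "h' \<in> Md.mats" "Md.mm h' h = Md.idm" "Md.iw 0 h" "Md.iw 0 h'"
    using gh by (auto simp: Md.iwgroup_def)
  have hint: "vge 0 (h i j)" "vge 0 (h' i j)" for i j
  proof -
    show "vge 0 (h i j)"
    proof (cases "h i j = 0")
      case False then show ?thesis using Md.iw_integral[OF hm(4)] Md.mats_bound[OF hm(1)] by blast
    qed simp
    show "vge 0 (h' i j)"
    proof (cases "h' i j = 0")
      case False then show ?thesis using Md.iw_integral[OF hm(5)] Md.mats_bound[OF hm(2)] by blast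
    qed simp
  qed
  have Mh: "Md.mm M h = Md.mm g' S"
  proof -
    have "Md.mm g' S = Md.mm (Md.mm g' g) (Md.mm M h)" by (simp only: S_def Md.mm_assoc)
    then show ?thesis unfolding gm(3) by simp
  qed
  define ul where "ul l = (\<Sum>j<d. vscale (h j l) (u j))" for l
  have ul: "integral_vec (ul l)" for l
    unfolding ul_def by (intro integral_vec_sum integral_vec_scale hint u) simp
  have ula: "br a (ul l) = 0" for l
    unfolding ul_def by (simp only: vs.lin_sum[OF br_lin] vs.lin_scale[OF br_lin])
      (intro sum.neutral ballI, simp add: u(2) vscale_def fun_eq_iff)
  have "\<exists>y. integral_vec y \<and> br gam (ul l + vscale s y) = 0" if l: "l \<in> Z" for l
  proof -
    have Ml: "(\<Sum>j<d. kap z (br (u i) (u j)) * h j l) = 0" if i: "i < d" for i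
    proof -
      have "(\<Sum>j<d. kap z (br (u i) (u j)) * h j l) = Md.mm M h i l"
        using i l by (simp add: Md.mm_def M_def Z_def)
      also have "\<dots> = 0" unfolding Mh using i l by (simp add: Md.mm_def Z_def)
      finally show ?thesis .
    qed
    have k0: "kap (br z (ul l)) (u i) = 0" if i: "i < d" for i
    proof -
      have "kap (br z (ul l)) (u i) = - kap z (br (u i) (ul l))"
        unfolding kap_inv br_skew[of "ul l"] by (rule kap_uminus_r)
      also have "br (u i) (ul l) = (\<Sum>j<d. vscale (h j l) (br (u i) (u j)))"
        unfolding ul_def by (simp only: vs.lin_sum[OF br_lin] vs.lin_scale[OF br_lin])
      also have "kap z \<dots> = (\<Sum>j<d. kap z (br (u i) (u j)) * h j l)"
        by (simp only: kap_sum_r kap_scale_r mult.commute)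
      finally show ?thesis using Ml[OF i] by simp
    qed
    have "br a (mv T (br z (ul l))) = br z (ul l)" by (rule T(2)) (auto intro: k0)
    then have e: "br a (- mv T (br z (ul l))) = - br z (ul l)"
      using vs.lin_diff[OF br_lin, of a 0 "mv T (br z (ul l))"] vs.lin_0[OF br_lin, of a] by (simp only: diff_0)
    have "integral_vec (br z (ul l))"
      unfolding br_def by (intro integral_vec_mv ul) (use adm_int[of z] az in auto)
    then have "integral_vec (- mv T (br z (ul l)))" by (intro integral_vec_uminus integral_vec_mv T(1))
    from lift_kernel[OF ul ula this e] show ?thesis .
  qed
  then have "\<forall>l. \<exists>y. l \<in> Z \<longrightarrow> integral_vec y \<and> br gam (ul l + vscale s y) = 0" by blast
  from choice[OF this] obtain y where y: "\<forall>l. l \<in> Z \<longrightarrow> integral_vec (y l) \<and> br gam (ul l + vscale s (y l)) = 0"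
    by (elim exE)
  define x where "x l = ul l + vscale s (y l)" for l
  have s0: "vge 0 s" using vge_mono[OF vge_s, of 0] by simp
  have finZ: "finite Z" by (rule finite_subset[of _ "{..<d}"]) (auto simp: Z_def)
  have ind: "q l = 0" if q0: "(\<Sum>l\<in>Z. vscale (q l) (x l)) = 0" and l: "l \<in> Z" for q l
  proof (rule ccontr)
    assume nz: "q l \<noteq> 0"
    \<comment> \<open>A relation is divided by a coefficient of least valuation and then reduced modulo the maximal ideal.\<close>
    define Z' where "Z' = {l \<in> Z. q l \<noteq> 0}"
    have "finite Z'" "Z' \<noteq> {}" using finZ nz l by (auto simp: Z'_def)
    then obtain l0 where l0: "l0 \<in> Z'" "\<And>l. l \<in> Z' \<Longrightarrow> v (q l0) \<le> v (q l)"
      using arg_min_if_finite[of Z' "\<lambda>l. v (q l)"] by (metis not_le)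
    define r where "r l = q l / q l0" for l
    have q0n: "q l0 \<noteq> 0" and l0Z: "l0 \<in> Z" using l0 by (auto simp: Z'_def)
    have r: "vge 0 (r l)" if "l \<in> Z" for l
    proof (cases "q l = 0")
      case False
      then have "v (q l0) \<le> v (q l)" using l0(2) that by (auto simp: Z'_def)
      then show ?thesis using False q0n by (simp add: r_def vge_def v_divide)
    qed (simp add: r_def)
    have rsum: "(\<Sum>l\<in>Z. r l * x l p) = 0" for p
    proof -
      have "(\<Sum>l\<in>Z. q l * x l p) = 0" using fun_cong[OF q0, of p] by (simp add: vs_sum)
      then have "(\<Sum>l\<in>Z. q l * x l p) / q l0 = 0" by simp
      then show ?thesis by (simp add: sum_divide_distrib r_def)
    qed
    have 1: "vge 1 (\<Sum>l\<in>Z. r l * ul l p)" for p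
    proof -
      have "(\<Sum>l\<in>Z. r l * ul l p) = - (\<Sum>l\<in>Z. s * (r l * y l p))"
      proof -
        have "(\<Sum>l\<in>Z. r l * ul l p) + (\<Sum>l\<in>Z. s * (r l * y l p)) = (\<Sum>l\<in>Z. r l * x l p)"
          unfolding sum.distrib[symmetric] by (intro sum.cong) (auto simp: x_def vscale_def algebra_simps)
        then show ?thesis using rsum by (simp add: eq_neg_iff_add_eq_0)
      qed
      moreover have "vge 1 (\<Sum>l\<in>Z. s * (r l * y l p))"
        using y r by (intro vge_sum vge_mult1l vge_s vge_mult0) (auto simp: integral_vec_def)
      ultimately show ?thesis by simp
    qed
    have 2: "vge 1 (\<Sum>l\<in>Z. r l * h j l)" if j: "j < d" for j
    proof -
      have "(\<Sum>p<n. lam j p * (\<Sum>l\<in>Z. r l * ul l p)) = (\<Sum>p<n. \<Sum>l\<in>Z. \<Sum>i<d. r l * h i l * (lam j p * u i p))"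
        by (simp add: ul_def vs_sum sum_distrib_left mult_ac)
      also have "\<dots> = (\<Sum>l\<in>Z. \<Sum>i<d. \<Sum>p<n. r l * h i l * (lam j p * u i p))" by (rule sum_rotate)
      also have "\<dots> = (\<Sum>l\<in>Z. \<Sum>i<d. r l * h i l * (if j = i then 1 else 0))"
        by (intro sum.cong refl) (simp add: sum_distrib_left[symmetric] lam(2)[OF j])
      also have "\<dots> = (\<Sum>l\<in>Z. r l * h j l)"
        using j by (simp add: if_distrib[of "\<lambda>x. _ * x"] cong: if_cong)
      finally have "(\<Sum>l\<in>Z. r l * h j l) = (\<Sum>p<n. lam j p * (\<Sum>l\<in>Z. r l * ul l p))" by simp
      then show ?thesis by (simp only:) (rule vge_sum, rule vge_mult1r[OF lam(1) 1])
    qed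
    have "(\<Sum>j<d. h' l0 j * (\<Sum>l\<in>Z. r l * h j l)) = (\<Sum>l\<in>Z. r l * (\<Sum>j<d. h' l0 j * h j l))"
      by (simp add: sum_distrib_left mult_ac) (rule sum.swap)
    also have "\<dots> = (\<Sum>l\<in>Z. r l * Md.mm h' h l0 l)"
      using l0Z by (intro sum.cong) (auto simp: Md.mm_def Z_def)
    also have "\<dots> = (\<Sum>l\<in>Z. if l = l0 then r l else 0)"
      unfolding hm(3) using l0Z by (intro sum.cong) (auto simp: Md.idm_def Z_def)
    also have "\<dots> = 1" using finZ l0Z q0n by (simp add: r_def)
    finally have "vge 1 (1 :: 'a)"
      using vge_sum[of "{..<d}" 1 "\<lambda>j. h' l0 j * (\<Sum>l\<in>Z. r l * h j l)"] 2 hint(2) by (simp add: vge_mult1r)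
    then show False by simp
  qed
  have xk: "x l \<in> vecs \<and> mv (adm gam) (x l) = 0" if l: "l \<in> Z" for l
  proof
    have "integral_vec (x l)" unfolding x_def
      by (intro integral_vec_add ul integral_vec_scale s0) (use y l in blast)
    then show "x l \<in> vecs" by (simp add: integral_vec_def)
    show "mv (adm gam) (x l) = 0" using y l by (simp add: x_def br_def)
  qed
  have card: "card Z + m \<le> n" 
    by (rule kernel_dim[where x = x and A = "adm gam" and P = P and Q = Q])
      (rule finZ, erule xk, erule (1) ind, rule N)
  define C where "C = {..<d} - Z"
  have "card C = d - card Z"
    unfolding C_def using finZ by (subst card_Diff_subset) (auto simp: Z_def)
  then have cC: "d - (n - m) \<le> card C" using card by simp
  have finC: "finite C" by (simp add: C_def)
  obtain e where e: "bij_betw e {..<card C} C"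
    using ex_bij_betw_nat_finite[OF finC] by (auto simp: atLeast0LessThan)
  have "\<forall>l. \<exists>i. l \<in> C \<longrightarrow> i < d \<and> S i l \<noteq> 0" by (auto simp: C_def Z_def)
  from choice[OF this] obtain pi where pi: "\<forall>l. l \<in> C \<longrightarrow> pi l < d \<and> S (pi l) l \<noteq> 0" by (elim exE)
  define P' where "P' i p = g (pi (e i)) p / S (pi (e i)) (e i)" for i p
  define Q' where "Q' q j = h q (e j)" for q j
  have "(\<Sum>p<d. \<Sum>q<d. P' i p * kap z (br (u p) (u q)) * Q' q j) = (if i = j then 1 else 0)"
    if ij: "i < d - (n - m)" "j < d - (n - m)" for i j
  proof -
    have ei: "e i \<in> C" "e j \<in> C" using e ij cC by (auto simp: bij_betw_def)
    have pd: "pi (e i) < d" "e j < d" "e i < d" "S (pi (e i)) (e i) \<noteq> 0" using pi ei by (auto simp: C_def)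
    have "S (pi (e i)) (e j) = (\<Sum>q<d. (\<Sum>p<d. g (pi (e i)) p * M p q) * h q (e j))"
      using pd by (simp add: S_def Md.mm_def)
    also have "\<dots> = (\<Sum>p<d. \<Sum>q<d. g (pi (e i)) p * kap z (br (u p) (u q)) * h q (e j))"
      by (simp add: sum_distrib_right M_def) (rule sum.swap)
    finally have "(\<Sum>p<d. \<Sum>q<d. P' i p * kap z (br (u p) (u q)) * Q' q j) = S (pi (e i)) (e j) / S (pi (e i)) (e i)"
      by (simp add: P'_def Q'_def sum_divide_distrib)
    moreover have "S (pi (e i)) (e j) = 0" if "i \<noteq> j"
    proof -
      have "e i \<noteq> e j" using e ij cC that by (auto simp: bij_betw_def inj_on_def)
      moreover have "Md.clean S (pi (e i)) (e i)" using gh(3) pd unfolding Md.monomial_def S_def by blast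
      ultimately show ?thesis using pd unfolding Md.clean_def by metis
    qed
    ultimately show ?thesis using pd by auto
  qed
  then show ?thesis by blast
qed

end

section \<open>Specialising the generic pencil\<close>

lemma det_injective:
  fixes N :: "nat \<Rightarrow> nat \<Rightarrow> 'f::field"
  assumes d: "det (mat m m (\<lambda>(i, j). N i j)) \<noteq> 0" and t: "\<And>i. i < m \<Longrightarrow> (\<Sum>j<m. N i j * t j) = 0" and l: "l < m"
  shows "t l = 0"
proof -
  let ?N = "mat m m (\<lambda>(i, j). N i j)"
  let ?J = "adj_mat ?N"
  have N: "?N \<in> carrier_mat m m" by simp
  have J: "?J \<in> carrier_mat m m" and JN: "?J * ?N = det ?N \<cdot>\<^sub>m 1\<^sub>m m" using adj_mat[OF N] by auto
  have e: "(\<Sum>i<m. ?J $$ (l, i) * N i j) = (if l = j then det ?N else 0)" if j: "j < m" for j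
  proof -
    have "(\<Sum>i<m. ?J $$ (l, i) * N i j) = (?J * ?N) $$ (l, j)"
      using l j carrier_matD[OF J] by (subst index_mult_mat(1)) (auto simp: scalar_prod_def atLeast0LessThan)
    then show ?thesis unfolding JN using l j by simp
  qed
  have "0 = (\<Sum>i<m. ?J $$ (l, i) * (\<Sum>j<m. N i j * t j))" using t by simp
  also have "\<dots> = (\<Sum>j<m. (\<Sum>i<m. ?J $$ (l, i) * N i j) * t j)"
    by (simp add: sum_distrib_left sum_distrib_right mult.assoc) (rule sum.swap)
  also have "\<dots> = (\<Sum>j<m. if j = l then det ?N * t j else 0)" by (intro sum.cong) (auto simp: e)
  also have "\<dots> = det ?N * t l" using l by simp
  finally show ?thesis using d by simp
qed

lemma det_delta: "det (mat m m (\<lambda>(i, j). if i = j then 1 else 0 :: 'f::comm_ring_1)) = 1"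
proof -
  have "mat m m (\<lambda>(i, j). if i = j then 1 else 0 :: 'f) = 1\<^sub>m m" by (rule eq_matI) auto
  then show ?thesis by simp
qed

lemma comm_ring_hom_ev: "comm_ring_hom (\<lambda>f :: 'k::comm_ring_1 polyfun. ev f x)"
  by unfold_locales auto
lemma comm_ring_hom_emb: "comm_ring_hom (emb :: 'k::field_char_0 polyfun \<Rightarrow> _)"
  by unfold_locales (auto simp: emb_add emb_mult)

lemma det_polyfun:
  fixes NR :: "nat \<Rightarrow> nat \<Rightarrow> 'k::field_char_0 polyfun" and m :: nat
  defines "D \<equiv> det (mat m m (\<lambda>(i, j). NR i j))"
  shows "ev D x = det (mat m m (\<lambda>(i, j). ev (NR i j) x))" "emb D = det (mat m m (\<lambda>(i, j). emb (NR i j)))"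
proof -
  interpret e: comm_ring_hom "\<lambda>f :: 'k polyfun. ev f x" by (rule comm_ring_hom_ev)
  interpret f: comm_ring_hom "emb :: 'k polyfun \<Rightarrow> _" by (rule comm_ring_hom_emb)
  have "map_mat (\<lambda>f. ev f x) (mat m m (\<lambda>(i, j). NR i j)) = mat m m (\<lambda>(i, j). ev (NR i j) x)"
    by (rule eq_matI) auto
  then show "ev D x = det (mat m m (\<lambda>(i, j). ev (NR i j) x))" unfolding D_def e.hom_det[symmetric] by simp
  have "map_mat emb (mat m m (\<lambda>(i, j). NR i j)) = mat m m (\<lambda>(i, j). emb (NR i j))"
    by (rule eq_matI) auto
  then show "emb D = det (mat m m (\<lambda>(i, j). emb (NR i j)))" unfolding D_def f.hom_det[symmetric] by simp
qed

lemma polyfun_nonzero_at: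
  assumes "f \<noteq> 0" obtains x where "ev f x \<noteq> 0"
  using assms by (auto simp: polyfun_eq_0_iff)

lemma common_denominator:
  fixes f :: "'i \<Rightarrow> 'k::field_char_0 genfield"
  assumes "finite I"
  shows "\<exists>D g. D \<noteq> 0 \<and> (\<forall>i\<in>I. emb D * f i = emb (g i))"
  using assms
proof (induction I rule: finite_induct)
  case empty
  show ?case by (intro exI[of _ 1]) simp
next
  case (insert j I)
  then obtain D g where D: "D \<noteq> 0" "\<forall>i\<in>I. emb D * f i = emb (g i)" by (elim exE conjE)
  obtain a b where ab: "f j = emb a / emb b" "b \<noteq> 0" by (rule genfield_cases)
  have "\<forall>i\<in>insert j I. emb (D * b) * f i = emb (if i = j then D * a else b * g i)"
  proof
    fix i assume i: "i \<in> insert j I"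
    show "emb (D * b) * f i = emb (if i = j then D * a else b * g i)"
    proof (cases "i = j")
      case True
      then show ?thesis using ab by (simp add: emb_mult)
    next
      case False
      then have "emb D * f i = emb (g i)" using i D by blast
      then show ?thesis using False by (simp add: emb_mult mult_ac)
    qed
  qed
  moreover have "D * b \<noteq> 0" using D ab by simp
  ultimately show ?case by (intro exI[of _ "D * b"] exI[of _ "\<lambda>i. if i = j then D * a else b * g i"] conjI)
qed

lemma trivial_valuation: "valued_field (\<lambda>_ :: 'k::field. 0 :: int)"
  by unfold_locales auto

text \<open>For \<open>z\<close> one takes a vector of independent variables, so that \<open>pencil_rank\<close> applies over the field of
  rational functions; the rank of \<open>ad (a + s z)\<close> there is at least the rank \<open>m\<close> of \<open>ad y\<close>, since
  \<open>s = 1\<close>, \<open>z = y - a\<close> is a specialisation.  Afterwards the matrices witnessing the rank of the form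
  are cleared of denominators and all variables specialised.\<close>

theorem index_coordinates:
  fixes c :: "nat \<Rightarrow> nat \<Rightarrow> nat \<Rightarrow> 'k::field_char_0"
    and kap br adm vecs unitv
  assumes L: "lie_mat (\<lambda>_. 0) n c"
  defines "kap \<equiv> lie_mat.kap n c" and "br \<equiv> lie_mat.br n c" and "adm \<equiv> lie_mat.adm n c"
    and "vecs \<equiv> valued_field_mat.vecs n" and "unitv \<equiv> valued_field_mat.unitv"
  assumes a: "a \<in> vecs" and tri: "\<And>i j. i < n \<Longrightarrow> j < i \<Longrightarrow> adm a i j = 0"
    and gi: "\<And>i j. i < n \<Longrightarrow> j < n \<Longrightarrow> (\<Sum>l<n. kap (unitv i) (unitv l) * gi l j) = (if i = j then 1 else 0)"
    and y: "\<And>i j. i < m \<Longrightarrow> j < m \<Longrightarrow> (\<Sum>p<n. \<Sum>q<n. P i p * adm y p q * Q q j) = (if i = j then 1 else 0)"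
    and u: "\<And>j. j < d \<Longrightarrow> u j \<in> vecs" "\<And>j. j < d \<Longrightarrow> br a (u j) = 0"
    and lam: "\<And>i j. i < d \<Longrightarrow> j < d \<Longrightarrow> (\<Sum>p<n. lam i p * u j p) = (if i = j then 1 else 0)"
    and T: "\<And>i p. i < n \<Longrightarrow> p < n \<Longrightarrow>
        (\<Sum>q<n. adm a i q * T q p) + (\<Sum>j<d. w j i * kap (unitv p) (u j)) = (if i = p then 1 else 0)"
  shows "\<exists>z\<in>vecs. \<exists>P' Q'. \<forall>i<d - (n - m). \<forall>j<d - (n - m).
    (\<Sum>p<d. \<Sum>q<d. P' i p * kap z (br (u p) (u q)) * Q' q j) = (if i = j then 1 else 0)"
proof -
  interpret k: lie_mat "\<lambda>_. 0" n c by (rule L)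
  define cK where "cK = (\<lambda>i j l. cst (c i j l))"
  interpret K: lie_mat gval n cK
  proof
    fix i j l m :: nat
    assume "i < n" "j < n" "l < n"
    then have "c i j l = - c j i l" by (rule k.c_skew)
    then show "cK i j l = - cK j i l" unfolding cK_def cst_uminus[symmetric] by (rule arg_cong)
    assume "m < n"
    have "(\<Sum>la<n. c i j la * c la l m) = (\<Sum>la<n. c i la m * c j l la) - (\<Sum>la<n. c j la m * c i l la)"
      by (rule k.c_jacobi) fact+
    then have "cst (\<Sum>la<n. c i j la * c la l m) = cst ((\<Sum>la<n. c i la m * c j l la) - (\<Sum>la<n. c j la m * c i l la))"
      by (rule arg_cong)
    then show "(\<Sum>la<n. cK i j la * cK la l m) = (\<Sum>la<n. cK i la m * cK j l la) - (\<Sum>la<n. cK j la m * cK i l la)"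
      by (simp only: cK_def cst_sum cst_mult diff_conv_add_uminus cst_add cst_uminus)
  qed
  note defs = kap_def br_def adm_def vecs_def unitv_def
  define C where "C x = (\<lambda>i :: nat. cst (x i :: 'k))" for x
  have adC: "K.adm (C x) i j = cst (adm x i j)" for x i j
    unfolding defs K.adm_def k.adm_def by (simp add: C_def cK_def cst_sum cst_mult)
  have brC: "K.br (C x) (C y) = C (br x y)" for x y
  proof
    fix i
    show "K.br (C x) (C y) i = C (br x y) i"
      using adC[unfolded defs] unfolding defs K.br_def k.br_def K.mv_def k.mv_def by (simp add: C_def cst_sum cst_mult)
  qed
  have kapC: "K.kap (C x) (C y) = cst (kap x y)" for x y
    using adC[unfolded defs] unfolding defs K.kap_def k.kap_def K.tr_def k.tr_def K.mm_def k.mm_def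
    by (simp add: cst_sum cst_mult)
  have vC: "x \<in> vecs \<Longrightarrow> C x \<in> K.vecs" for x unfolding defs k.vecs_def K.vecs_def by (simp add: C_def)
  have uC: "K.unitv i = C (unitv i)" for i unfolding defs K.unitv_def k.unitv_def C_def by (rule ext) simp
  have intC: "gf.vge 0 (C x i)" for x i unfolding C_def by (rule vge_cst)
  define zK where "zK i = (if i < n then emb (pvar (Suc i)) else 0 :: 'k genfield)" for i
  interpret G: generic_pencil gval n cK "emb ps" "C a" zK "\<lambda>i j. cst (gi i j)"
  proof
    show "emb ps \<noteq> 0" by simp
    show "gval (emb ps) = 1" by (rule gval_s)
    show "C a \<in> K.vecs" by (rule vC[OF a])
    show "zK \<in> K.vecs" by (simp add: zK_def K.vecs_def)
    show "gf.vge 0 (C a i)" for i by (rule intC)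
    show "gf.vge 0 (zK i)" for i unfolding zK_def by (cases "i < n") (simp_all only: if_True if_False vge_emb gf.vge_0)
    show "gf.vge 0 (cK i j l)" for i j l unfolding cK_def by (rule vge_cst)
    show "K.adm (C a) i j = 0" if "i < n" "j < i" for i j using tri[OF that] by (simp add: adC)
    show "gf.vge 0 (cst (gi i j))" for i j by (rule vge_cst)
    show "(\<Sum>l<n. K.kap (K.unitv i) (K.unitv l) * cst (gi l j)) = (if i = j then 1 else 0)" if "i < n" "j < n" for i j
      using arg_cong[OF gi[OF that], of cst] by (simp add: uC kapC cst_sum cst_mult if_distrib[of cst] cong: if_cong)
    fix x assume x: "K.integral_vec x"
    obtain D where D: "gf.vderiv D" "\<And>j. j < n \<Longrightarrow> D (emb (pvar (Suc j))) = x j" "D (emb ps) = 0" "\<And>c. D (cst c) = 0"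
      using prescribed_derivation[of n x] x unfolding K.integral_vec_def by blast
    show "\<exists>D. gf.vderiv D \<and> D (emb ps) = 0 \<and> (\<forall>i<n. D (zK i) = x i) \<and> (\<forall>i<n. D (C a i) = 0) \<and>
        (\<forall>i<n. \<forall>j<n. \<forall>l<n. D (cK i j l) = 0)"
      by (rule exI[of _ D]) (use D in \<open>simp add: zK_def C_def cK_def\<close>)
  qed
  define AR where "AR p q = pconst (adm a p q) + ps * (\<Sum>l<n. pvar (Suc l) * pconst (c l q p))" for p q
  have AR: "K.adm G.gam p q = emb (AR p q)" if "p < n" "q < n" for p q
  proof -
    have "K.adm zK p q = (\<Sum>l<n. zK l * cK l q p)" using that by (simp add: K.adm_def)
    also have "\<dots> = (\<Sum>l<n. emb (pvar (Suc l)) * cst (c l q p))"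
      by (intro sum.cong refl) (simp add: zK_def cK_def)
    finally show ?thesis unfolding G.adm_gam adC by (simp add: AR_def emb_add emb_mult emb_sum cst_def)
  qed
  define NR where "NR i j = (\<Sum>p<n. \<Sum>q<n. pconst (P i p) * AR p q * pconst (Q q j))" for i j
  \<comment> \<open>At this point the pencil specialises to the given element.\<close>
  define pt where "pt i = (case i of 0 \<Rightarrow> 1 | Suc l \<Rightarrow> y l - a l)" for i
  have ARpt: "ev (AR p q) pt = adm y p q" if "p < n" "q < n" for p q
    using that unfolding defs k.adm_def AR_def
    by (simp add: ev_sum pt_def left_diff_distrib sum_subtractf)
  have "ev (NR i j) pt = (if i = j then 1 else 0)" if "i < m" "j < m" for i j
    unfolding y[OF that, symmetric] NR_def by (simp add: ev_sum ARpt)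
  then have "mat m m (\<lambda>(i, j). ev (NR i j) pt) = mat m m (\<lambda>(i, j). if i = j then 1 else 0)"
    by (intro eq_matI) auto
  then have "ev (det (mat m m (\<lambda>(i, j). NR i j))) pt = 1" unfolding det_polyfun(1) by (simp add: det_delta)
  then have "det (mat m m (\<lambda>(i, j). NR i j)) \<noteq> 0" by auto
  then have dn: "det (mat m m (\<lambda>(i, j). emb (NR i j))) \<noteq> 0" unfolding det_polyfun(2)[symmetric] by simp
  have Ninj: "\<forall>t. (\<forall>i<m. (\<Sum>j<m. (\<Sum>p<n. \<Sum>q<n. cst (P i p) * K.adm G.gam p q * cst (Q q j)) * t j) = 0) \<longrightarrow> (\<forall>j<m. t j = 0)"
  proof (intro allI impI)
    fix t j assume t: "\<forall>i<m. (\<Sum>j<m. (\<Sum>p<n. \<Sum>q<n. cst (P i p) * K.adm G.gam p q * cst (Q q j)) * t j) = 0" and j: "j < m"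
    have "emb (NR i j) = (\<Sum>p<n. \<Sum>q<n. cst (P i p) * K.adm G.gam p q * cst (Q q j))" for i j
      by (simp add: NR_def emb_sum emb_mult AR cst_def)
    then show "t j = 0" using det_injective[OF dn _ j, of t] t by simp
  qed
  have Tk: "K.br (C a) (K.mv (\<lambda>i j. cst (T i j)) x) = x"
    if x: "x \<in> K.vecs" and x0: "\<And>j. j < d \<Longrightarrow> K.kap x (C (u j)) = 0" for x
  proof
    fix i
    show "K.br (C a) (K.mv (\<lambda>i j. cst (T i j)) x) i = x i"
    proof (cases "i < n")
      case i: True
      have kx: "(\<Sum>p<n. x p * cst (kap (unitv p) (u j))) = 0" if "j < d" for j
      proof -
        have "K.kap x (C (u j)) = (\<Sum>p<n. x p * K.kap (C (u j)) (K.unitv p))"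
          by (subst K.kap_comm) (rule G.kap_coord[OF x])
        moreover have "K.kap (C (u j)) (K.unitv p) = cst (kap (unitv p) (u j))" for p
          by (subst K.kap_comm) (simp only: uC kapC)
        ultimately show ?thesis using x0[OF that] by simp
      qed
      have "x i = (\<Sum>p<n. cst (if i = p then 1 else 0) * x p)"
        using i by (simp add: if_distrib[of cst] if_distrib[of "\<lambda>x. x * _"] cong: if_cong)
      also have "\<dots> = (\<Sum>p<n. cst ((\<Sum>q<n. adm a i q * T q p) + (\<Sum>j<d. w j i * kap (unitv p) (u j))) * x p)"
        by (intro sum.cong refl) (simp add: T[OF i])
      also have "\<dots> = (\<Sum>p<n. \<Sum>q<n. cst (adm a i q) * (cst (T q p) * x p))
          + (\<Sum>p<n. \<Sum>j<d. cst (w j i) * (x p * cst (kap (unitv p) (u j))))"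
        by (simp add: cst_add cst_sum cst_mult distrib_left sum.distrib sum_distrib_left mult_ac)
      also have "(\<Sum>p<n. \<Sum>j<d. cst (w j i) * (x p * cst (kap (unitv p) (u j)))) = 0"
        by (subst sum.swap) (simp add: sum_distrib_left[symmetric] kx)
      also have "(\<Sum>p<n. \<Sum>q<n. cst (adm a i q) * (cst (T q p) * x p)) = K.br (C a) (K.mv (\<lambda>i j. cst (T i j)) x) i"
        using i by (subst sum.swap) (simp add: K.br_def K.mv_def adC sum_distrib_left)
      finally show ?thesis by simp
    next
      case False
      then show ?thesis using x by (simp add: K.br_out K.vecs_def)
    qed
  qed
  have "\<exists>P' Q'. \<forall>i<d - (n - m). \<forall>j<d - (n - m).
      (\<Sum>p<d. \<Sum>q<d. P' i p * K.kap zK (K.br (C (u p)) (C (u q))) * Q' q j) = (if i = j then 1 else 0)"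
  proof (rule G.pencil_rank[where lam = "\<lambda>i p. cst (lam i p)" and T = "\<lambda>i j. cst (T i j)"])
    show "K.integral_vec (C (u j))" if "j < d" for j
      unfolding K.integral_vec_def by (intro conjI allI intC vC u(1) that)
    show "K.br (C a) (C (u j)) = 0" if "j < d" for j 
    proof -
      have "K.br (C a) (C (u j)) = C 0" unfolding brC u(2)[OF that] ..
      also have "C 0 = 0" unfolding C_def by (rule ext) simp
      finally show ?thesis .
    qed
    show "gf.vge 0 (cst (lam i p))" "gf.vge 0 (cst (T i p))" for i p by (rule vge_cst)+
    show "(\<Sum>p<n. cst (lam i p) * C (u j) p) = (if i = j then 1 else 0)" if "i < d" "j < d" for i j
      using arg_cong[OF lam[OF that], of cst] by (simp add: C_def cst_sum cst_mult if_distrib[of cst] cong: if_cong)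
  qed (fact Tk, fact Ninj)
  then obtain P' Q' where PQ: "\<forall>i<d - (n - m). \<forall>j<d - (n - m).
      (\<Sum>p<d. \<Sum>q<d. P' i p * K.kap zK (K.br (C (u p)) (C (u q))) * Q' q j) = (if i = j then 1 else 0)"
    by (elim exE)
  define e where "e = d - (n - m)"
  define MR where "MR p q = (\<Sum>l<n. pvar (Suc l) * pconst (kap (unitv l) (br (u p) (u q))))" for p q
  have MR: "K.kap zK (K.br (C (u p)) (C (u q))) = emb (MR p q)" for p q
  proof -
    have "K.kap zK (K.br (C (u p)) (C (u q))) = K.kap (C (br (u p) (u q))) zK" by (simp add: brC K.kap_comm)
    also have "\<dots> = (\<Sum>l<n. zK l * K.kap (C (br (u p) (u q))) (K.unitv l))"
      by (rule G.kap_coord) (simp add: zK_def K.vecs_def)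
    also have "\<dots> = (\<Sum>l<n. emb (pvar (Suc l)) * cst (kap (unitv l) (br (u p) (u q))))"
    proof (intro sum.cong refl)
      fix l assume l: "l \<in> {..<n}"
      have "K.kap (C (br (u p) (u q))) (K.unitv l) = cst (kap (unitv l) (br (u p) (u q)))"
        by (subst K.kap_comm) (simp only: uC kapC)
      then show "zK l * K.kap (C (br (u p) (u q))) (K.unitv l) = emb (pvar (Suc l)) * cst (kap (unitv l) (br (u p) (u q)))"
        using l by (simp add: zK_def)
    qed
    finally show ?thesis by (simp add: MR_def emb_sum emb_mult cst_def)
  qed
  obtain D1 g1 where D1: "D1 \<noteq> 0" "\<forall>x\<in>{..<e} \<times> {..<d}. emb D1 * (\<lambda>(i, p). P' i p) x = emb (g1 x)"
    using common_denominator[of "{..<e} \<times> {..<d}" "\<lambda>(i, p). P' i p", OF finite_cartesian_product[OF finite_lessThan finite_lessThan]]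
    by (elim exE conjE)
  obtain D2 g2 where D2: "D2 \<noteq> 0" "\<forall>x\<in>{..<d} \<times> {..<e}. emb D2 * (\<lambda>(i, p). Q' i p) x = emb (g2 x)"
    using common_denominator[of "{..<d} \<times> {..<e}" "\<lambda>(i, p). Q' i p", OF finite_cartesian_product[OF finite_lessThan finite_lessThan]]
    by (elim exE conjE)
  have g1: "emb D1 * P' i p = emb (g1 (i, p))" if "i < e" "p < d" for i p using D1(2) that by auto
  have g2: "emb D2 * Q' p j = emb (g2 (p, j))" if "j < e" "p < d" for j p using D2(2) that by auto
  have "D1 * D2 \<noteq> 0" using D1 D2 by simp
  then obtain x where x: "ev (D1 * D2) x \<noteq> 0" by (rule polyfun_nonzero_at)
  define z where "z i = (if i < n then x (Suc i) else 0)" for i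
  have zv: "z \<in> vecs" unfolding defs k.vecs_def by (simp add: z_def)
  have evM: "ev (MR p q) x = kap z (br (u p) (u q))" for p q
  proof -
    have "(\<Sum>l<n. k.vscale (z l) (k.unitv l)) = z" using zv unfolding defs by (rule k.vecs_coord)
    then have "kap z (br (u p) (u q)) = kap (\<Sum>l<n. k.vscale (z l) (k.unitv l)) (br (u p) (u q))" by simp
    also have "\<dots> = (\<Sum>l<n. z l * kap (unitv l) (br (u p) (u q)))"
      unfolding defs k.kap_sum_l k.kap_scale_l ..
    finally show ?thesis by (simp add: MR_def ev_sum z_def)
  qed
  have "(\<Sum>p<d. \<Sum>q<d. ev (g1 (i, p)) x / ev (D1 * D2) x * kap z (br (u p) (u q)) * ev (g2 (q, j)) x) = (if i = j then 1 else 0)"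
    if ij: "i < e" "j < e" for i j
  proof -
    have "emb (\<Sum>p<d. \<Sum>q<d. g1 (i, p) * MR p q * g2 (q, j)) = (\<Sum>p<d. \<Sum>q<d. (emb D1 * P' i p) * emb (MR p q) * (emb D2 * Q' q j))"
      using ij by (simp add: emb_sum emb_mult g1 g2)
    also have "\<dots> = emb D1 * emb D2 * (\<Sum>p<d. \<Sum>q<d. P' i p * emb (MR p q) * Q' q j)"
      by (simp add: sum_distrib_left mult_ac)
    also have "\<dots> = emb (D1 * D2 * (if i = j then 1 else 0))" using PQ ij by (simp add: MR e_def emb_mult)
    finally have "(\<Sum>p<d. \<Sum>q<d. g1 (i, p) * MR p q * g2 (q, j)) = D1 * D2 * (if i = j then 1 else 0)"
      by (simp only: emb_eq_iff)
    then have "ev (\<Sum>p<d. \<Sum>q<d. g1 (i, p) * MR p q * g2 (q, j)) x = ev (D1 * D2 * (if i = j then 1 else 0)) x"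
      by (rule arg_cong)
    then have "(\<Sum>p<d. \<Sum>q<d. ev (g1 (i, p)) x * kap z (br (u p) (u q)) * ev (g2 (q, j)) x) = ev (D1 * D2) x * (if i = j then 1 else 0)"
      by (simp add: ev_sum evM)
    then have "(\<Sum>p<d. \<Sum>q<d. ev (g1 (i, p)) x * kap z (br (u p) (u q)) * ev (g2 (q, j)) x) / ev (D1 * D2) x = (if i = j then 1 else 0)"
      using x by simp
    then show ?thesis by (simp add: sum_divide_distrib)
  qed
  then show ?thesis unfolding e_def[symmetric]
    by (intro bexI[OF _ zv] exI[of _ "\<lambda>i p. ev (g1 (i, p)) x / ev (D1 * D2) x"] exI[of _ "\<lambda>q j. ev (g2 (q, j)) x"] allI impI)
qed

section \<open>Complements, functionals, coordinates and traces\<close>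

context linear_space begin

lemma fam_in: "subspace W \<Longrightarrow> (\<And>l. l < d \<Longrightarrow> h l \<in> W) \<Longrightarrow> (\<Sum>l<d. c l *s h l) \<in> W"
  by (intro subspace_sum subspace_scale) auto

lemma fam_scale: "a *s (\<Sum>l<d. c l *s h l) = (\<Sum>l<d. (a * c l) *s h l)"
  by (simp add: scale_sum_right)

lemma fam_add: "(\<Sum>l<d. c l *s h l) + (\<Sum>l<d. c' l *s h l) = (\<Sum>l<d. (c l + c' l) *s h l)"
  by (simp add: scale_left_distrib sum.distrib)

lemma famb_extend:
  assumes "famb d u U" "U \<subseteq> W" "fd W"
  shows "\<exists>h. (\<forall>l<d. h l = u l) \<and> famb (dim W) h W"
proof -
  have u: "inj_on u {..<d}" "independent (u ` {..<d})"
    by (rule indep_fam_set; intro allI impI, erule (1) famb_indep[OF assms(1)])+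
  have uW: "u ` {..<d} \<subseteq> W" using famb_in[OF assms(1)] assms(2) by blast
  obtain B where B: "u ` {..<d} \<subseteq> B" "B \<subseteq> W" "independent B" "W \<subseteq> span B"
    by (rule maximal_independent_subset_extend[OF uW u(2)])
  have fin: "finite B" and card: "card B = dim W"
    using independent_card_fd[OF B(2,3) assms(3)] basis_card_eq_dim[OF B(2,4,3)] by auto
  define C where "C = B - u ` {..<d}"
  have cu: "card (u ` {..<d}) = d" using card_image[OF u(1)] by simp
  have "card C = card B - d" unfolding C_def using B(1) fin cu by (simp add: card_Diff_subset finite_subset)
  then have cC: "dim W = d + card C" using card card_mono[OF fin B(1)] cu by simp
  obtain e where "bij_betw e {0..<card C} C"
    using ex_bij_betw_nat_finite[of C] fin by (auto simp: C_def)
  then have e: "inj_on e {..<card C}" "e ` {..<card C} = C" by (auto simp: bij_betw_def atLeast0LessThan)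
  define h where "h l = (if l < d then u l else e (l - d))" for l
  have "h ` {..<dim W} = u ` {..<d} \<union> e ` {..<card C}"
  proof (intro equalityI subsetI)
    fix y assume "y \<in> u ` {..<d} \<union> e ` {..<card C}"
    then consider l where "l < d" "y = u l" | l where "l < card C" "y = e l" by blast
    then show "y \<in> h ` {..<dim W}"
    proof cases
      case 1 then show ?thesis by (intro image_eqI[of _ _ l]) (auto simp: h_def cC)
    next
      case 2 then show ?thesis by (intro image_eqI[of _ _ "d + l"]) (auto simp: h_def cC)
    qed
  qed (auto simp: h_def cC)
  then have im: "h ` {..<dim W} = B" using e(2) B(1) by (auto simp: C_def)
  then have "inj_on h {..<dim W}" by (intro eq_card_imp_inj_on) (auto simp: card)
  then have "famb (dim W) h W" using im by (intro famb_of_basis[OF _ B(3,2,4)]) (simp add: bij_betw_def)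
  then show ?thesis by (intro exI[of _ h]) (simp add: h_def)
qed

lemma complement_exists:
  assumes U: "subspace U" "U \<subseteq> W" and W: "fd W"
  shows "\<exists>p. (\<forall>j<dim W - dim U. p j \<in> W) \<and> (\<forall>t. (\<Sum>j<dim W - dim U. t j *s p j) \<in> U \<longrightarrow> (\<forall>j<dim W - dim U. t j = 0))"
proof -
  obtain u where u: "famb (dim U) u U" by (rule famb_exists[OF fd_subset[OF U(2) W]])
  from famb_extend[OF u U(2) W] obtain h where h: "\<forall>l<dim U. h l = u l" "famb (dim W) h W" by blast
  define e where "e = dim W - dim U"
  have dW: "dim W = dim U + e" using dim_mono_fd[OF U(2) W] by (simp add: e_def)
  have "\<forall>j<e. t j = 0" if t: "(\<Sum>j<e. t j *s h (dim U + j)) \<in> U" for t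
  proof -
    from famb_span[OF u t] obtain c where c: "(\<Sum>j<e. t j *s h (dim U + j)) = (\<Sum>l<dim U. c l *s u l)" by (elim exE)
    define q where "q l = (if l < dim U then - c l else t (l - dim U))" for l
    have "(\<Sum>l<dim W. q l *s h l) = 0"
      unfolding dW sum_add_index using h(1) c by (simp add: q_def sum_negf)
    then have "q (dim U + j) = 0" if "j < e" for j using that by (intro famb_indep[OF h(2)]) (auto simp: dW)
    then show ?thesis by (auto simp: q_def)
  qed
  moreover have "\<forall>j<e. h (dim U + j) \<in> W" using famb_in[OF h(2)] by (simp add: dW)
  ultimately show ?thesis unfolding e_def by (intro exI[of _ "\<lambda>j. h (dim U + j)"]) simp
qed

lemma dim_add_indep:
  assumes U: "subspace U" "U \<subseteq> W" and W: "subspace W" "fd W" and q: "\<And>j. j < e \<Longrightarrow> q j \<in> W"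
    and ind: "\<And>t. (\<Sum>j<e. t j *s q j) \<in> U \<Longrightarrow> \<forall>j<e. t j = 0"
  shows "dim U + e \<le> dim W"
proof -
  obtain u where u: "famb (dim U) u U" by (rule famb_exists[OF fd_subset[OF U(2) W(2)]])
  define h where "h l = (if l < dim U then u l else q (l - dim U))" for l
  have "\<forall>l<dim U + e. c l = 0" if c: "(\<Sum>l<dim U + e. c l *s h l) = 0" for c
  proof -
    have s: "(\<Sum>l<dim U. c l *s u l) + (\<Sum>j<e. c (dim U + j) *s q j) = 0"
      using c unfolding sum_add_index by (simp add: h_def)
    have "(\<Sum>l<dim U. c l *s u l) \<in> U" by (rule fam_in[OF U(1) famb_in[OF u]])
    then have "- (\<Sum>l<dim U. c l *s u l) \<in> U" by (rule subspace_neg[OF U(1)])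
    also have "- (\<Sum>l<dim U. c l *s u l) = (\<Sum>j<e. c (dim U + j) *s q j)" using s by (rule minus_unique)
    finally have t: "\<forall>j<e. c (dim U + j) = 0" by (rule ind)
    then have "(\<Sum>j<e. c (dim U + j) *s q j) = 0" by simp
    then have "(\<Sum>l<dim U. c l *s u l) = 0" using s by (simp only: add_0_right)
    then have u0: "c l = 0" if "l < dim U" for l using that by (rule famb_indep[OF u])
    show ?thesis
    proof (intro allI impI)
      fix l assume l: "l < dim U + e"
      show "c l = 0"
      proof (cases "l < dim U")
        case False
        then have "l - dim U < e" "dim U + (l - dim U) = l" using l by auto
        then show ?thesis using t by metis
      qed (rule u0)
    qed
  qed
  note fs = indep_fam_set[where d = "dim U + e" and h = h, OF this]
  have "h ` {..<dim U + e} \<subseteq> W" using famb_in[OF u] U(2) q by (auto simp: h_def)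
  then have "card (h ` {..<dim U + e}) \<le> dim W" using independent_card_fd fs(2) W(2) by blast
  then show ?thesis using card_image[OF fs(1)] by simp
qed

text \<open>Unlike independence of the set of its members, independence of a family excludes repetitions.\<close>

definition indf :: "nat \<Rightarrow> (nat \<Rightarrow> 'b) \<Rightarrow> bool" where
  "indf m a \<longleftrightarrow> (\<forall>c. (\<Sum>l<m. c l *s a l) = 0 \<longrightarrow> (\<forall>l<m. c l = 0))"

lemma indfD: "indf m a \<Longrightarrow> (\<Sum>l<m. c l *s a l) = 0 \<Longrightarrow> l < m \<Longrightarrow> c l = 0"
  unfolding indf_def by (drule spec[of _ c]) simp

lemma indf_set: 
  assumes "indf m a" shows "inj_on a {..<m}" "independent (a ` {..<m})"
  by (rule indep_fam_set; intro allI impI, erule (1) indfD[OF assms])+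

definition functional :: "('b \<Rightarrow> 'a) \<Rightarrow> bool" where
  "functional f \<longleftrightarrow> (\<forall>x y. f (x + y) = f x + f y) \<and> (\<forall>c x. f (c *s x) = c * f x)"

lemma functional_add: "functional f \<Longrightarrow> f (x + y) = f x + f y"
  and functional_scale: "functional f \<Longrightarrow> f (c *s x) = c * f x"
  by (auto simp: functional_def)
lemma functional_0: "functional f \<Longrightarrow> f 0 = 0" using functional_scale[of f 0 0] by simp
lemma functional_sum: "functional f \<Longrightarrow> f (sum g I) = (\<Sum>i\<in>I. f (g i))"
  by (induction I rule: infinite_finite_induct) (auto simp: functional_0 functional_add)
lemma functional_fam: "functional f \<Longrightarrow> f (\<Sum>i\<in>I. c i *s g i) = (\<Sum>i\<in>I. c i * f (g i))"
  by (simp add: functional_sum functional_scale)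

lemma functional_extend:
  assumes "independent B"
  shows "\<exists>f. functional f \<and> (\<forall>x\<in>B. f x = g x)"
proof -
  interpret p: vector_space_pair scale "(*) :: 'a \<Rightarrow> 'a \<Rightarrow> 'a" by unfold_locales (auto simp: algebra_simps)
  from p.linear_independent_extend[OF assms, of g] obtain f where f: "Vector_Spaces.linear scale (*) f" "\<forall>x\<in>B. f x = g x"
    by (elim exE conjE)
  interpret l: Vector_Spaces.linear scale "(*)" f by (rule f(1))
  show ?thesis using f(2) by (intro exI[of _ f]) (simp add: functional_def l.add l.scale)
qed

lemma functional_separates:
  assumes U: "subspace U" and y: "y \<notin> U"
  obtains f where "functional f" "\<And>x. x \<in> U \<Longrightarrow> f x = 0" "f y = 1"
proof -
  obtain B where B: "B \<subseteq> U" "independent B" "U \<subseteq> span B" "card B = dim U" by (rule basis_exists[of U])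
  have s: "span B = U" by (rule subset_antisym[OF span_minimal[OF B(1) U] B(3)])
  then have "y \<notin> span B" using y by (simp only:) simp
  then have ind: "independent (insert y B)" by (intro independent_insertI B(2))
  from functional_extend[OF ind, of "\<lambda>x. if x = y then 1 else 0"] obtain f
    where f: "functional f" "\<forall>x\<in>insert y B. f x = (if x = y then 1 else 0)" by (elim exE conjE)
  have "y \<notin> B" using B(1) y by blast
  have "f x = 0" if "x \<in> U" for x
  proof -
    have "x \<in> span B" using that s by simp
    then show ?thesis
    proof (induction rule: span_induct_alt)
      case base show ?case by (rule functional_0[OF f(1)])
    next
      case (step c x z)
      have "f x = 0" using f(2) step(1) \<open>y \<notin> B\<close> by auto
      then show ?case using step(2) by (simp add: functional_add[OF f(1)] functional_scale[OF f(1)])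
    qed
  qed
  moreover have "f y = 1" using f(2) by simp
  ultimately show thesis using f(1) by (intro that[of f]) simp_all
qed

lemma dual_family:
  assumes "indf m a"
  shows "\<exists>f. \<forall>i. functional (f i) \<and> (\<forall>j<m. f i (a j) = (if i = j then 1 else 0))"
proof -
  note fs = indf_set[OF assms]
  have "\<exists>f. functional f \<and> (\<forall>j<m. f (a j) = (if i = j then 1 else 0))" for i
  proof -
    from functional_extend[OF fs(2), of "\<lambda>x. if i = inv_into {..<m} a x then 1 else 0"] obtain f
      where f: "functional f" "\<forall>x\<in>a ` {..<m}. f x = (if i = inv_into {..<m} a x then 1 else 0)" by (elim exE conjE)
    then show ?thesis using fs(1) by (intro exI[of _ f]) simp
  qed
  then show ?thesis by (intro choice allI)
qed

text \<open>The determinant against a dual family of \<open>a\<close> is a polynomial in \<open>t\<close> with value 1 at 0.\<close>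

lemma independent_perturb:
  assumes "indf m a"
  shows "finite {t. \<not> indf m (\<lambda>l. a l + t *s b l)}"
proof -
  from dual_family[OF assms] obtain f where
    f0: "\<forall>i. functional (f i) \<and> (\<forall>j<m. f i (a j) = (if i = j then 1 else 0))" by (elim exE)
  then have f: "\<And>i. functional (f i)" "\<And>i j. j < m \<Longrightarrow> f i (a j) = (if i = j then 1 else 0)" by auto
  define D where "D = det (mat m m (\<lambda>(i, j). [:f i (a j), f i (b j):]))"
  have D: "poly D t = det (mat m m (\<lambda>(i, j). f i (a j + t *s b j)))" for t
  proof -
    have e: "comm_ring_hom (\<lambda>p :: 'a poly. poly p t)" by unfold_locales auto
    have "map_mat (\<lambda>p. poly p t) (mat m m (\<lambda>(i, j). [:f i (a j), f i (b j):])) = mat m m (\<lambda>(i, j). f i (a j + t *s b j))"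
      by (rule eq_matI) (auto simp: functional_add[OF f(1)] functional_scale[OF f(1)])
    then show ?thesis unfolding D_def comm_ring_hom.hom_det[OF e, symmetric] by simp
  qed
  have "mat m m (\<lambda>(i, j). f i (a j + 0 *s b j)) = mat m m (\<lambda>(i, j). if i = j then 1 else 0)"
    by (rule eq_matI) (auto simp: f(2))
  then have "poly D 0 = 1" unfolding D by (simp only: det_delta)
  then have "D \<noteq> 0" by auto
  then have "finite {t. poly D t = 0}" by (rule poly_roots_finite)
  moreover have "indf m (\<lambda>l. a l + t *s b l)" if "poly D t \<noteq> 0" for t
    unfolding indf_def
  proof (intro allI impI)
    fix c l assume c: "(\<Sum>l<m. c l *s (a l + t *s b l)) = 0" and l: "l < m"
    have d: "det (mat m m (\<lambda>(i, j). f i (a j + t *s b j))) \<noteq> 0" using that unfolding D .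
    show "c l = 0"
    proof (rule det_injective[OF d _ l])
      fix i
      have "f i (\<Sum>l<m. c l *s (a l + t *s b l)) = 0" unfolding c by (rule functional_0[OF f(1)])
      then show "(\<Sum>j<m. f i (a j + t *s b j) * c j) = 0"
        unfolding functional_fam[OF f(1)] by (simp only: mult.commute)
    qed
  qed
  ultimately show ?thesis by (elim finite_subset[rotated]) blast
qed

end

context linear_space begin

text \<open>The coordinates of a vector with respect to a basis \<open>h\<close> of the whole space.\<close>

definition cf :: "nat \<Rightarrow> (nat \<Rightarrow> 'b) \<Rightarrow> 'b \<Rightarrow> nat \<Rightarrow> 'a" where
  "cf m h w = (SOME c. w = (\<Sum>l<m. c l *s h l))"

lemma famb_indf: "famb m h W \<Longrightarrow> indf m h"
  unfolding famb_def indf_def by (elim conjE)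

lemma cf_sum:
  assumes "famb m h UNIV"
  shows "w = (\<Sum>l<m. cf m h w l *s h l)"
  unfolding cf_def by (rule someI_ex[OF famb_span[OF assms UNIV_I]])

lemma cf_fam:
  assumes h: "famb m h UNIV" and l: "l < m"
  shows "cf m h (\<Sum>l<m. c l *s h l) l = c l"
proof -
  let ?w = "\<Sum>l<m. c l *s h l"
  have "(\<Sum>l<m. (cf m h ?w l - c l) *s h l) = (\<Sum>l<m. cf m h ?w l *s h l) - ?w"
    by (simp add: scale_left_diff_distrib sum_subtractf)
  also have "\<dots> = 0" unfolding cf_sum[OF h, symmetric] by simp
  finally have "cf m h ?w l - c l = 0" using l by (rule famb_indep[OF h])
  then show ?thesis by simp
qed

lemma cf_functional:
  assumes h: "famb m h UNIV" and l: "l < m"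
  shows "functional (\<lambda>w. cf m h w l)"
  unfolding functional_def
proof (intro conjI allI)
  fix x y and c :: 'a
  have "x + y = (\<Sum>l<m. (cf m h x l + cf m h y l) *s h l)"
    unfolding fam_add[symmetric] cf_sum[OF h, symmetric] ..
  then have "cf m h (x + y) l = cf m h (\<Sum>l<m. (cf m h x l + cf m h y l) *s h l) l" by (rule arg_cong)
  then show "cf m h (x + y) l = cf m h x l + cf m h y l" unfolding cf_fam[OF h l] .
  have "c *s x = (\<Sum>l<m. (c * cf m h x l) *s h l)"
    unfolding fam_scale[symmetric] cf_sum[OF h, symmetric] ..
  then have "cf m h (c *s x) l = cf m h (\<Sum>l<m. (c * cf m h x l) *s h l) l" by (rule arg_cong)
  then show "cf m h (c *s x) l = c * cf m h x l" unfolding cf_fam[OF h l] .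
qed

lemma cf_basis:
  assumes h: "famb m h UNIV" and kl: "k < m" "l < m"
  shows "cf m h (h k) l = (if l = k then 1 else 0)"
proof -
  have "h k = (\<Sum>i<m. (if i = k then 1 else 0) *s h i)"
    using kl by (simp add: if_distrib[of "\<lambda>x. x *s _"] cong: if_cong)
  then have "cf m h (h k) l = cf m h (\<Sum>i<m. (if i = k then 1 else 0) *s h i) l" by (rule arg_cong)
  then show ?thesis unfolding cf_fam[OF h kl(2)] .
qed

lemma cf_lin:
  assumes h: "famb m h UNIV" and l: "l < m" and T: "lin T"
  shows "cf m h (T w) l = (\<Sum>k<m. cf m h w k * cf m h (T (h k)) l)"
proof -
  have "T w = (\<Sum>k<m. cf m h w k *s T (h k))"
    by (subst cf_sum[OF h, of w]) (simp only: lin_sum[OF T] lin_scale[OF T])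
  then have "cf m h (T w) l = cf m h (\<Sum>k<m. cf m h w k *s T (h k)) l" by (rule arg_cong)
  then show ?thesis unfolding functional_fam[OF cf_functional[OF h l]] .
qed

definition trace :: "nat \<Rightarrow> (nat \<Rightarrow> 'b) \<Rightarrow> ('b \<Rightarrow> 'b) \<Rightarrow> 'a" where
  "trace m h T = (\<Sum>l<m. cf m h (T (h l)) l)"

lemma trace_comm:
  assumes h: "famb m h UNIV" and S: "lin S" and T: "lin T"
  shows "trace m h (\<lambda>w. S (T w)) = trace m h (\<lambda>w. T (S w))"
proof -
  have e: "trace m h (\<lambda>w. S (T w)) = (\<Sum>l<m. \<Sum>k<m. cf m h (T (h l)) k * cf m h (S (h k)) l)" if S: "lin S" for S T
    unfolding trace_def by (intro sum.cong refl cf_lin[OF h _ S]) simp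
  show ?thesis unfolding e[OF S] e[OF T] by (subst sum.swap) (simp only: mult.commute)
qed

lemma trace_diff:
  assumes h: "famb m h UNIV"
  shows "trace m h (\<lambda>w. S w - T w) = trace m h S - trace m h T"
proof -
  have "cf m h (x - y) l = cf m h x l - cf m h y l" if "l < m" for x y l
  proof -
    have "cf m h (x - y + y) l = cf m h (x - y) l + cf m h y l" by (rule functional_add[OF cf_functional[OF h that]])
    then show ?thesis by (simp only: diff_add_cancel add_diff_cancel_right')
  qed
  then show ?thesis by (simp add: trace_def sum_subtractf)
qed

lemma trace_add:
  assumes h: "famb m h UNIV"
  shows "trace m h (\<lambda>w. S w + T w) = trace m h S + trace m h T"
  by (simp add: trace_def sum.distrib functional_add[OF cf_functional[OF h]])

lemma trace_scale:
  assumes h: "famb m h UNIV"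
  shows "trace m h (\<lambda>w. c *s T w) = c * trace m h T"
  by (simp add: trace_def sum_distrib_left functional_scale[OF cf_functional[OF h]])

text \<open>Both sides are the trace of the composite of the two base changes with \<open>T\<close>.\<close>

lemma trace_basis:
  assumes h: "famb m h UNIV" and h': "famb m' h' UNIV" and T: "lin T"
  shows "trace m h T = trace m' h' T"
proof -
  have 1: "cf m' h' w j = (\<Sum>i<m. cf m h w i * cf m' h' (h i) j)" if "j < m'" for w j
  proof -
    have "cf m' h' w j = cf m' h' (\<Sum>i<m. cf m h w i *s h i) j" using cf_sum[OF h, of w] by (rule arg_cong)
    then show ?thesis unfolding functional_fam[OF cf_functional[OF h' that]] .
  qed
  have "trace m h T = (\<Sum>i<m. \<Sum>j<m'. cf m' h' (h i) j * cf m h (T (h' j)) i)"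
    unfolding trace_def
  proof (intro sum.cong refl)
    fix i assume "i \<in> {..<m}"
    then have i: "i < m" by simp
    have "T (h i) = (\<Sum>j<m'. cf m' h' (h i) j *s T (h' j))"
      by (subst cf_sum[OF h', of "h i"]) (simp only: lin_sum[OF T] lin_scale[OF T])
    then have "cf m h (T (h i)) i = cf m h (\<Sum>j<m'. cf m' h' (h i) j *s T (h' j)) i" by (rule arg_cong)
    then show "cf m h (T (h i)) i = (\<Sum>j<m'. cf m' h' (h i) j * cf m h (T (h' j)) i)"
      unfolding functional_fam[OF cf_functional[OF h i]] .
  qed
  also have "\<dots> = (\<Sum>j<m'. \<Sum>i<m. cf m h (T (h' j)) i * cf m' h' (h i) j)"
    by (subst sum.swap) (simp only: mult.commute)
  also have "\<dots> = trace m' h' T" unfolding trace_def by (intro sum.cong refl) (simp add: 1)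
  finally show ?thesis .
qed

section \<open>Generalised eigenspaces and spectral operators\<close>

lemma lin_shift: "lin T \<Longrightarrow> lin (\<lambda>w. T w - \<mu> *s w)"
  by (simp add: lin_def scale_right_distrib scale_right_diff_distrib scale_left_commute)

text \<open>The generalised eigenspace of \<open>\<mu>\<close>.\<close>

definition gen :: "('b \<Rightarrow> 'b) \<Rightarrow> 'a \<Rightarrow> 'b set" where
  "gen T \<mu> = {w. \<exists>N. ((\<lambda>w. T w - \<mu> *s w) ^^ N) w = 0}"

lemma genI: "((\<lambda>w. T w - \<mu> *s w) ^^ N) w = 0 \<Longrightarrow> w \<in> gen T \<mu>" by (auto simp: gen_def)

lemma funpow_kill:
  assumes "lin A" "(A ^^ N) w = 0" "N \<le> M" shows "(A ^^ M) w = 0"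
proof -
  have "(A ^^ M) w = (A ^^ (M - N)) ((A ^^ N) w)"
    using assms(3) by (metis comp_apply funpow_add le_add_diff_inverse2)
  then show ?thesis by (simp add: assms(2) lin_0[OF lin_pow[OF assms(1)]])
qed

lemma subspace_gen:
  assumes T: "lin T"
  shows "subspace (gen T \<mu>)"
proof (rule subspaceI)
  let ?A = "\<lambda>w. T w - \<mu> *s w"
  have A: "lin ?A" by (rule lin_shift[OF T])
  show "0 \<in> gen T \<mu>" by (rule genI[where N = 0]) simp
  fix x y c assume x: "x \<in> gen T \<mu>"
  then obtain N where N: "(?A ^^ N) x = 0" by (auto simp: gen_def)
  show "c *s x \<in> gen T \<mu>" by (rule genI[where N = N]) (simp add: lin_scale[OF lin_pow[OF A]] N)
  assume "y \<in> gen T \<mu>"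
  then obtain M where M: "(?A ^^ M) y = 0" by (auto simp: gen_def)
  show "x + y \<in> gen T \<mu>"
    by (rule genI[where N = "N + M"])
      (simp add: lin_add[OF lin_pow[OF A]] funpow_kill[OF A N] funpow_kill[OF A M])
qed

lemma gen_step:
  assumes "T w - \<mu> *s w \<in> gen T \<mu>"
  shows "w \<in> gen T \<mu>"
proof -
  obtain N where "((\<lambda>w. T w - \<mu> *s w) ^^ N) (T w - \<mu> *s w) = 0" using assms by (auto simp: gen_def)
  then have "((\<lambda>w. T w - \<mu> *s w) ^^ Suc N) w = 0" unfolding funpow_Suc_right comp_def .
  then show ?thesis by (rule genI)
qed

lemma gen_image: 
  assumes T: "lin T" and w: "w \<in> gen T \<mu>"
  shows "T w - \<mu> *s w \<in> gen T \<mu>"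
proof -
  let ?A = "\<lambda>w. T w - \<mu> *s w"
  obtain N where N: "(?A ^^ N) w = 0" using w by (auto simp: gen_def)
  have "(?A ^^ N) (?A w) = ?A ((?A ^^ N) w)" by (rule funpow_swap1[symmetric])
  also have "\<dots> = 0" unfolding N by (rule lin_0[OF lin_shift[OF T]])
  finally show ?thesis by (rule genI)
qed

end

locale closed_space = linear_space scale
  for scale :: "'a::{alg_closed_field, field_char_0} \<Rightarrow> 'b::ab_group_add \<Rightarrow> 'b" (infixr \<open>*s\<close> 75) +
  assumes fd_UNIV: "fd (UNIV :: 'b set)"
begin

text \<open>A Jordan basis up to the normalisation of the off-diagonal coefficients: triangular, with blocks
  separated by eigenvalue.\<close>

definition block :: "('b \<Rightarrow> 'b) \<Rightarrow> nat \<Rightarrow> (nat \<Rightarrow> 'b) \<Rightarrow> (nat \<Rightarrow> 'a) \<Rightarrow> (nat \<Rightarrow> nat \<Rightarrow> 'a) \<Rightarrow> bool" where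
  "block T m v lam N \<longleftrightarrow> (\<forall>j<m. T (v j) = lam j *s v j + (\<Sum>i<j. N i j *s v i) \<and> (\<forall>i<j. N i j \<noteq> 0 \<longrightarrow> lam i = lam j))"

lemma blockD:
  assumes "block T m v lam N" "j < m"
  shows "T (v j) = lam j *s v j + (\<Sum>i<j. N i j *s v i)" "i < j \<Longrightarrow> N i j \<noteq> 0 \<Longrightarrow> lam i = lam j"
  using assms unfolding block_def by blast+

lemma indf_bound: "indf m h \<Longrightarrow> m \<le> dim (UNIV :: 'b set)"
  using indf_set[of m h] independent_card_fd[OF subset_UNIV _ fd_UNIV, of "h ` {..<m}"] card_image[of h "{..<m}"]
  by simp

text \<open>A polynomial in \<open>T\<close> of least degree that moves some vector outside \<open>S\<close> into \<open>S\<close> has a root, and what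
  remains of it after splitting off the linear factor does not move that vector into \<open>S\<close>.\<close>

lemma eigenvector_mod:
  assumes T: "lin T" and S: "subspace S" and w0: "w0 \<notin> S"
  obtains w \<mu> where "w \<notin> S" "T w - \<mu> *s w \<in> S"
proof -
  define Q where "Q p \<longleftrightarrow> p \<noteq> 0 \<and> (\<exists>w. w \<notin> S \<and> pa T p w \<in> S)" for p
  define n where "n = dim (UNIV :: 'b set)"
  have "\<not> indf (Suc n) (\<lambda>k. (T ^^ k) w0)" using indf_bound[of "Suc n" "\<lambda>k. (T ^^ k) w0"] by (auto simp: n_def)
  then obtain c l where c: "(\<Sum>k<Suc n. c k *s (T ^^ k) w0) = 0" "l < Suc n" "c l \<noteq> 0"
    unfolding indf_def by blast
  define p where "p = (\<Sum>k<Suc n. Polynomial.monom (c k) k)"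
  have "coeff p l = c l" using c(2) unfolding p_def by (simp only: coeff_sum coeff_monom) (simp add: sum.delta)
  then have "p \<noteq> 0" using c(3) by auto
  moreover have "pa T p w0 = 0" unfolding p_def pa_sum[OF T] using c(1) by (simp only: pa_monom[OF T])
  ultimately have "Q p" unfolding Q_def using w0 subspace_0[OF S] by (intro conjI exI[of _ w0]) simp_all
  then obtain p where p: "Q p" "\<And>q. Q q \<Longrightarrow> degree p \<le> degree q" using ex_has_least_nat[of Q p degree] by blast
  then obtain w where w: "p \<noteq> 0" "w \<notin> S" "pa T p w \<in> S" unfolding Q_def by blast
  have "degree p \<noteq> 0"
  proof
    assume "degree p = 0"
    then obtain a where a: "p = [:a:]" by (rule degree_eq_zeroE)
    then have "a *s w \<in> S" and a0: "a \<noteq> 0" using w T by auto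
    then have "inverse a *s (a *s w) \<in> S" by (intro subspace_scale[OF S, of "a *s w"])
    then show False using w a0 by simp
  qed
  then obtain z where "poly p z = 0" using alg_closed_imp_poly_has_root[of p] by auto
  then obtain q where q: "p = [:- z, 1:] * q" unfolding poly_eq_0_iff_dvd by (rule dvdE)
  have "q \<noteq> 0" using w(1) unfolding q by auto
  then have "degree p = Suc (degree q)" unfolding q by (subst degree_mult_eq) auto
  then have "\<not> Q q" using p(2)[of q] by auto
  then have "pa T q w \<notin> S" using \<open>q \<noteq> 0\<close> w(2) unfolding Q_def by blast
  moreover have "pa T p w = T (pa T q w) - z *s pa T q w"
    unfolding q pa_mult[OF T] by (simp add: pa_pCons[OF T] lin_0[OF T])
  then have "T (pa T q w) - z *s pa T q w \<in> S" using w(3) by simp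
  ultimately show thesis by (rule that)
qed

definition fs :: "nat \<Rightarrow> (nat \<Rightarrow> 'b) \<Rightarrow> 'b set" where
  "fs m v = {w. \<exists>c. w = (\<Sum>l<m. c l *s v l)}"

lemma fsI: "w = (\<Sum>l<m. c l *s v l) \<Longrightarrow> w \<in> fs m v" by (auto simp: fs_def)

lemma subspace_fs: "subspace (fs m v)"
proof (rule subspaceI)
  show "0 \<in> fs m v" by (rule fsI[where c = "\<lambda>_. 0"]) simp
  fix x y a assume "x \<in> fs m v"
  then obtain c where c: "x = (\<Sum>l<m. c l *s v l)" unfolding fs_def by (elim CollectE exE)
  show "a *s x \<in> fs m v" unfolding c fam_scale by (rule fsI[OF refl])
  assume "y \<in> fs m v"
  then obtain c' where c': "y = (\<Sum>l<m. c' l *s v l)" unfolding fs_def by (elim CollectE exE)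
  show "x + y \<in> fs m v" unfolding c c' fam_add by (rule fsI[OF refl])
qed

lemma fs_in: "j < m \<Longrightarrow> v j \<in> fs m v"
  by (rule fsI[where c = "\<lambda>i. if i = j then 1 else 0"]) (simp add: if_distrib[of "\<lambda>x. x *s _"] cong: if_cong)

text \<open>Away from its eigenvalue \<open>T - \<mu>\<close> is invertible on a block, being triangular.\<close>

lemma block_shift_surj:
  assumes T: "lin T" and b: "block T m v lam N" and j: "j < m" "lam j \<noteq> \<mu>"
  shows "v j \<in> (\<lambda>w. T w - \<mu> *s w) ` fs m v"
  using j
proof (induction j rule: less_induct)
  case (less j)
  let ?I = "(\<lambda>w. T w - \<mu> *s w) ` fs m v"
  have I: "subspace ?I" by (rule subspace_im[OF lin_shift[OF T] subspace_fs])
  have "T (v j) - \<mu> *s v j \<in> ?I" by (rule imageI[OF fs_in[OF less(2)]])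
  moreover have "(\<Sum>i<j. N i j *s v i) \<in> ?I"
  proof (rule subspace_sum[OF I])
    fix i assume i: "i \<in> {..<j}"
    show "N i j *s v i \<in> ?I"
    proof (cases "N i j = 0")
      case True then show ?thesis using subspace_0[OF I] by simp
    next
      case False
      then have "lam i = lam j" using blockD(2)[OF b less(2)] i by simp
      then show ?thesis using less i by (intro subspace_scale[OF I]) simp
    qed
  qed
  ultimately have "T (v j) - \<mu> *s v j - (\<Sum>i<j. N i j *s v i) \<in> ?I" by (rule subspace_diff[OF I])
  also have "T (v j) - \<mu> *s v j - (\<Sum>i<j. N i j *s v i) = (lam j - \<mu>) *s v j"
    unfolding blockD(1)[OF b less(2)] by (simp add: scale_left_diff_distrib)
  finally have "inverse (lam j - \<mu>) *s (lam j - \<mu>) *s v j \<in> ?I" by (rule subspace_scale[OF I])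
  then show ?case using less(3) by simp
qed

text \<open>A longest independent family of this kind is a basis.  Otherwise an eigenvector modulo its span is
  corrected by an element of the span, so that its deviation from an eigenvector lies in the
  block of its own eigenvalue, and it prolongs the family.\<close>

theorem jordan_basis:
  assumes T: "lin T"
  obtains m v lam N where "famb m v UNIV" "block T m v lam N"
proof -
  define Q where "Q m \<longleftrightarrow> (\<exists>v lam N. indf m v \<and> block T m v lam N)" for m
  have "Q 0" by (simp add: Q_def indf_def block_def)
  moreover have "\<forall>m. Q m \<longrightarrow> m \<le> dim (UNIV :: 'b set)" using indf_bound by (auto simp: Q_def)
  ultimately have "\<exists>m. Q m \<and> (\<forall>m'. Q m' \<longrightarrow> m' \<le> m)"
    using Nat.ex_has_greatest_nat[of Q 0 "dim (UNIV :: 'b set)"] by simp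
  then obtain m where m: "Q m" "\<forall>m'. Q m' \<longrightarrow> m' \<le> m" by (elim exE conjE)
  from m(1) obtain v lam N where v: "indf m v" and b: "block T m v lam N" unfolding Q_def by (elim exE conjE)
  have "fs m v = UNIV"
  proof (rule ccontr)
    assume "fs m v \<noteq> UNIV"
    then obtain w0 where w0: "w0 \<notin> fs m v" by blast
    obtain w \<mu> where w: "w \<notin> fs m v" "T w - \<mu> *s w \<in> fs m v" by (rule eigenvector_mod[OF T subspace_fs w0])
    let ?A = "\<lambda>w. T w - \<mu> *s w"
    obtain c where c: "?A w = (\<Sum>l<m. c l *s v l)" using w(2) unfolding fs_def by (elim CollectE exE)
    have I: "subspace (?A ` fs m v)" by (rule subspace_im[OF lin_shift[OF T] subspace_fs])
    have "(\<Sum>l<m. (if lam l = \<mu> then 0 else c l) *s v l) \<in> ?A ` fs m v"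
      using block_shift_surj[OF T b] by (intro subspace_sum[OF I]) (auto intro: subspace_scale[OF I] simp: subspace_0[OF I])
    then obtain s where s: "s \<in> fs m v" "(\<Sum>l<m. (if lam l = \<mu> then 0 else c l) *s v l) = ?A s" by blast
    define w' where "w' = w - s"
    have w': "w' \<notin> fs m v" using w(1) s(1) subspace_add[OF subspace_fs, of w' m v s] by (auto simp: w'_def)
    have "?A w' = (\<Sum>l<m. c l *s v l) - (\<Sum>l<m. (if lam l = \<mu> then 0 else c l) *s v l)"
      unfolding w'_def s(2) c[symmetric] by (rule lin_diff[OF lin_shift[OF T]])
    also have "\<dots> = (\<Sum>l<m. (if lam l = \<mu> then c l else 0) *s v l)"
      unfolding sum_subtractf[symmetric] by (intro sum.cong) auto
    finally have e: "T w' = \<mu> *s w' + (\<Sum>l<m. (if lam l = \<mu> then c l else 0) *s v l)" by (simp only: diff_eq_eq add.commute)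
    define v' where "v' = v(m := w')"
    have v': "i < m \<Longrightarrow> v' i = v i" "v' m = w'" for i by (auto simp: v'_def)
    have "indf (Suc m) v'" unfolding indf_def
    proof (intro allI impI)
      fix d l assume d: "(\<Sum>l<Suc m. d l *s v' l) = 0" and l: "l < Suc m"
      have s0: "(\<Sum>l<m. d l *s v l) + d m *s w' = 0" using d by (simp add: v')
      have dm: "d m = 0"
      proof (rule ccontr)
        assume "d m \<noteq> 0"
        have "- (\<Sum>l<m. d l *s v l) \<in> fs m v" by (rule subspace_neg[OF subspace_fs fsI[OF refl]])
        also have "- (\<Sum>l<m. d l *s v l) = d m *s w'" using s0 by (rule minus_unique)
        finally have "inverse (d m) *s d m *s w' \<in> fs m v" by (rule subspace_scale[OF subspace_fs])
        then show False using w' \<open>d m \<noteq> 0\<close> by simp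
      qed
      then have "(\<Sum>l<m. d l *s v l) = 0" using s0 by simp
      then have "l < m \<Longrightarrow> d l = 0" by (rule indfD[OF v])
      then show "d l = 0" using l dm by (cases "l = m") auto
    qed
    moreover have "block T (Suc m) v' (lam(m := \<mu>)) (\<lambda>i j. if j = m then if lam i = \<mu> then c i else 0 else N i j)"
      unfolding block_def
    proof (intro allI impI conjI)
      fix j assume j: "j < Suc m"
      show "T (v' j) = (lam(m := \<mu>)) j *s v' j + (\<Sum>i<j. (if j = m then if lam i = \<mu> then c i else 0 else N i j) *s v' i)"
      proof (cases "j = m")
        case True
        then show ?thesis using e by (simp add: v')
      next
        case False
        then have "j < m" using j by simp
        then show ?thesis using blockD(1)[OF b] by (simp add: v')
      qed
      fix i assume "i < j" "(if j = m then if lam i = \<mu> then c i else 0 else N i j) \<noteq> 0"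
      then show "(lam(m := \<mu>)) i = (lam(m := \<mu>)) j"
        using j blockD(2)[OF b, of j i] by (cases "j = m") (auto split: if_splits)
    qed
    ultimately have "Q (Suc m)" unfolding Q_def by (intro exI conjI)
    then show False using m(2) by fastforce
  qed
  then have "w \<in> fs m v" for w by simp
  then have sp: "\<exists>c. w = (\<Sum>l<m. c l *s v l)" for w unfolding fs_def by (rule CollectD)
  have "famb m v UNIV" by (rule fambI, rule UNIV_I, rule sp, erule (1) indfD[OF v])
  then show thesis using b by (rule that)
qed

text \<open>The operator acting as the scalar \<open>\<phi> \<mu>\<close> on the generalised eigenspace of \<open>\<mu>\<close>.\<close>

definition spectral :: "nat \<Rightarrow> (nat \<Rightarrow> 'b) \<Rightarrow> (nat \<Rightarrow> 'a) \<Rightarrow> ('a \<Rightarrow> 'a) \<Rightarrow> 'b \<Rightarrow> 'b" where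
  "spectral m v lam \<phi> w = (\<Sum>j<m. (\<phi> (lam j) * cf m v w j) *s v j)"

context
  fixes T m v lam N
  assumes T: "lin T" and v: "famb m v UNIV" and b: "block T m v lam N"
begin

lemma block_cf:
  assumes "k < m" "l < m"
  shows "cf m v (T (v k)) l = (if l = k then lam k else if l < k then N l k else 0)"
proof -
  have "(\<Sum>i<m. (if i = k then lam k else if i < k then N i k else 0) *s v i)
      = (\<Sum>i<m. (if i = k then lam k *s v k else 0) + (if i < k then N i k *s v i else 0))"
    by (intro sum.cong) auto
  also have "\<dots> = (\<Sum>i<m. if i = k then lam k *s v k else 0) + (\<Sum>i<m. if i < k then N i k *s v i else 0)"
    by (rule sum.distrib)
  also have "(\<Sum>i<m. if i = k then lam k *s v k else 0) = lam k *s v k" using assms by simp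
  also have "(\<Sum>i<m. if i < k then N i k *s v i else 0) = (\<Sum>i<k. N i k *s v i)"
    using assms by (intro sum.mono_neutral_cong_right) auto
  finally have "T (v k) = (\<Sum>i<m. (if i = k then lam k else if i < k then N i k else 0) *s v i)"
    unfolding blockD(1)[OF b assms(1)] by (rule sym)
  then have "cf m v (T (v k)) l = cf m v (\<Sum>i<m. (if i = k then lam k else if i < k then N i k else 0) *s v i) l"
    by (rule arg_cong)
  then show ?thesis unfolding cf_fam[OF v assms(2)] .
qed

lemma block_gen:
  assumes "j < m" shows "v j \<in> gen T (lam j)"
  using assms
proof (induction j rule: less_induct)
  case (less j)
  have "T (v j) - lam j *s v j = (\<Sum>i<j. N i j *s v i)" unfolding blockD(1)[OF b less(2)] by simp
  also have "\<dots> \<in> gen T (lam j)"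
  proof (rule subspace_sum[OF subspace_gen[OF T]])
    fix i assume i: "i \<in> {..<j}"
    show "N i j *s v i \<in> gen T (lam j)"
    proof (cases "N i j = 0")
      case True then show ?thesis using subspace_0[OF subspace_gen[OF T]] by simp
    next
      case False
      then have "lam i = lam j" using blockD(2)[OF b less(2)] i by simp
      moreover have "v i \<in> gen T (lam i)" using less i by simp
      ultimately show ?thesis by (intro subspace_scale[OF subspace_gen[OF T]]) simp
    qed
  qed
  finally show ?case by (rule gen_step)
qed

text \<open>By descending induction on the index, the coefficient at \<open>j\<close> is multiplied by \<open>lam j - \<mu>\<close> whenever
  \<open>T - \<mu>\<close> is applied, so it vanishes if a power of \<open>T - \<mu>\<close> kills the vector.\<close>

lemma gen_cf:
  assumes w: "w \<in> gen T \<mu>" and j: "j < m" "lam j \<noteq> \<mu>"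
  shows "cf m v w j = 0"
proof -
  let ?A = "\<lambda>w. T w - \<mu> *s w"
  have "\<forall>w\<in>gen T \<mu>. j < m \<longrightarrow> lam j \<noteq> \<mu> \<longrightarrow> cf m v w j = 0" for j
  proof (induction "m - j" arbitrary: j rule: less_induct)
    case less
    show ?case
    proof (intro ballI impI)
      fix w assume w: "w \<in> gen T \<mu>" and j: "j < m" "lam j \<noteq> \<mu>"
      have F: "functional (\<lambda>w. cf m v w j)" by (rule cf_functional[OF v j(1)])
      have step: "cf m v (?A x) j = (lam j - \<mu>) * cf m v x j" if x: "x \<in> gen T \<mu>" for x
      proof -
        have "cf m v (T x) j = (\<Sum>k<m. cf m v x k * cf m v (T (v k)) j)" by (rule cf_lin[OF v j(1) T])
        also have "\<dots> = (\<Sum>k<m. if k = j then cf m v x j * lam j else 0)"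
        proof (intro sum.cong refl)
          fix k assume k: "k \<in> {..<m}"
          consider "k = j" | "k < j" | "j < k" "N j k = 0" | "j < k" "N j k \<noteq> 0" by linarith
          then show "cf m v x k * cf m v (T (v k)) j = (if k = j then cf m v x j * lam j else 0)"
          proof cases
            case 4
            then have "lam j = lam k" using blockD(2)[OF b] k by simp
            then have "cf m v x k = 0" using less[of k] x k 4 j by auto
            then show ?thesis using 4 by simp
          qed (use k j block_cf in auto)
        qed
        also have "\<dots> = cf m v x j * lam j" using j by simp
        finally have "cf m v (T x) j = cf m v x j * lam j" .
        moreover have "cf m v (?A x + \<mu> *s x) j = cf m v (?A x) j + \<mu> * cf m v x j"
          by (simp only: functional_add[OF F] functional_scale[OF F])
        ultimately show ?thesis by (simp add: algebra_simps)
      qed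
      have pw: "(?A ^^ M) w \<in> gen T \<mu> \<and> cf m v ((?A ^^ M) w) j = (lam j - \<mu>) ^ M * cf m v w j" for M
      proof (induction M)
        case (Suc M)
        then have g: "(?A ^^ M) w \<in> gen T \<mu>" by simp
        have e: "(?A ^^ Suc M) w = ?A ((?A ^^ M) w)" by simp
        show ?case unfolding e step[OF g] using gen_image[OF T g] Suc by simp
      qed (use w in simp)
      obtain M where "(?A ^^ M) w = 0" using w by (auto simp: gen_def)
      then have "(lam j - \<mu>) ^ M * cf m v w j = 0" using pw[of M] functional_0[OF F] by simp
      then show "cf m v w j = 0" using j by simp
    qed
  qed
  then show ?thesis using w j by blast
qed

lemma spectral_lin: "lin (spectral m v lam \<phi>)"
proof -
  have F: "functional (\<lambda>w. cf m v w j)" if "j < m" for j by (rule cf_functional[OF v that])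
  show ?thesis unfolding lin_def
  proof (intro conjI allI)
    fix x y c
    show "spectral m v lam \<phi> (x + y) = spectral m v lam \<phi> x + spectral m v lam \<phi> y"
      unfolding spectral_def fam_add by (intro sum.cong refl) (simp add: functional_add[OF F] distrib_left)
    show "spectral m v lam \<phi> (c *s x) = c *s spectral m v lam \<phi> x"
      unfolding spectral_def fam_scale by (intro sum.cong refl) (simp add: functional_scale[OF F] mult_ac)
  qed
qed

lemma spectral_gen:
  assumes w: "w \<in> gen T \<mu>"
  shows "spectral m v lam \<phi> w = \<phi> \<mu> *s w"
proof -
  have "spectral m v lam \<phi> w = (\<Sum>j<m. (\<phi> \<mu> * cf m v w j) *s v j)"
    unfolding spectral_def
  proof (intro sum.cong refl)
    fix j assume "j \<in> {..<m}"
    then show "(\<phi> (lam j) * cf m v w j) *s v j = (\<phi> \<mu> * cf m v w j) *s v j"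
      using gen_cf[OF w, of j] by (cases "lam j = \<mu>") auto
  qed
  also have "\<dots> = \<phi> \<mu> *s w" unfolding fam_scale[symmetric] cf_sum[OF v, symmetric] ..
  finally show ?thesis .
qed

lemma trace_spectral: "trace m v (\<lambda>w. T (spectral m v lam \<phi> w)) = (\<Sum>j<m. lam j * \<phi> (lam j))"
  unfolding trace_def
proof (intro sum.cong refl)
  fix j assume "j \<in> {..<m}"
  then have j: "j < m" by simp
  have "T (spectral m v lam \<phi> (v j)) = \<phi> (lam j) *s T (v j)"
    unfolding spectral_gen[OF block_gen[OF j]] by (rule lin_scale[OF T])
  then have "cf m v (T (spectral m v lam \<phi> (v j))) j = cf m v (\<phi> (lam j) *s T (v j)) j" by (rule arg_cong)
  also have "\<dots> = \<phi> (lam j) * lam j" unfolding functional_scale[OF cf_functional[OF v j]] block_cf[OF j j] by simp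
  finally show "cf m v (T (spectral m v lam \<phi> (v j))) j = lam j * \<phi> (lam j)" by (simp add: mult.commute)
qed

lemma spectrum_zero_nil: "(\<And>j. j < m \<Longrightarrow> lam j = 0) \<Longrightarrow> w \<in> gen T 0"
  by (subst cf_sum[OF v, of w]) (intro subspace_sum subspace_gen T subspace_scale, use block_gen in force)

lemma nil_spectrum_zero:
  assumes "\<And>w. w \<in> gen T 0" "j < m" shows "lam j = 0"
  using gen_cf[OF assms(1,2), of "v j"] cf_basis[OF v assms(2,2)] by (auto intro: ccontr)

lemma commutes_spectral:
  assumes S: "lin S" and st: "\<And>\<mu> w. w \<in> gen T \<mu> \<Longrightarrow> S w \<in> gen T \<mu>"
  shows "S (spectral m v lam \<phi> w) = spectral m v lam \<phi> (S w)"
proof -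
  have e: "S (spectral m v lam \<phi> (v j)) = spectral m v lam \<phi> (S (v j))" if "j < m" for j
    unfolding spectral_gen[OF block_gen[OF that]] spectral_gen[OF st[OF block_gen[OF that]]] by (rule lin_scale[OF S])
  show ?thesis
    by (subst (1 2) cf_sum[OF v, of w])
      (simp add: lin_sum[OF S] lin_scale[OF S] lin_sum[OF spectral_lin] lin_scale[OF spectral_lin] e)
qed

end

lemma trace_nil:
  assumes T: "lin T" and nil: "\<And>w. w \<in> gen T 0" and h: "famb k h UNIV"
  shows "trace k h T = 0"
proof -
  obtain m v lam N where v: "famb m v UNIV" "block T m v lam N" by (rule jordan_basis[OF T])
  have "trace k h T = trace m v T" by (rule trace_basis[OF h v(1) T])
  also have "\<dots> = 0" unfolding trace_def
  proof (rule sum.neutral, rule ballI)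
    fix j assume "j \<in> {..<m}"
    then have j: "j < m" by simp
    have "lam j = 0" by (rule nil_spectrum_zero[OF T v nil j])
    then show "cf m v (T (v j)) j = 0" unfolding block_cf[OF T v j j] by simp
  qed
  finally show ?thesis .
qed

end

section \<open>Cartan subalgebras are centralizers\<close>

context closed_space begin

lemma gen0_iff: "w \<in> gen T 0 \<longleftrightarrow> (\<exists>N. (T ^^ N) w = 0)"
  by (simp add: gen_def)

text \<open>The nonzero ones among \<open>w\<close>, \<open>T w\<close>, \<open>T (T w)\<close>, ... are independent.\<close>

lemma nil_bound:
  assumes T: "lin T" and w: "(T ^^ N) w = 0"
  shows "(T ^^ dim (UNIV :: 'b set)) w = 0"
proof -
  define k where "k = (LEAST k. (T ^^ k) w = 0)"
  have k: "(T ^^ k) w = 0" unfolding k_def by (rule LeastI[of _ N]) (rule w)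
  have less: "(T ^^ j) w \<noteq> 0" if "j < k" for j using not_less_Least that unfolding k_def by blast
  have "indf k (\<lambda>i. (T ^^ i) w)" unfolding indf_def
  proof (rule allI, rule impI)
    fix c assume c: "(\<Sum>i<k. c i *s (T ^^ i) w) = 0"
    have "i < k \<longrightarrow> c i = 0" for i
    proof (induction i rule: less_induct)
      case (less i)
      show ?case
      proof
        assume i: "i < k"
        have "(T ^^ (k - 1 - i)) (\<Sum>j<k. c j *s (T ^^ j) w) = (\<Sum>j<k. c j *s (T ^^ (k - 1 - i + j)) w)"
          by (simp add: lin_sum[OF lin_pow[OF T]] lin_scale[OF lin_pow[OF T]] funpow_add)
        also have "\<dots> = (\<Sum>j<k. if j = i then c i *s (T ^^ (k - 1)) w else 0)"
        proof (intro sum.cong refl)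
          fix j assume j: "j \<in> {..<k}"
          consider "j < i" | "j = i" | "i < j" by linarith
          then show "c j *s (T ^^ (k - 1 - i + j)) w = (if j = i then c i *s (T ^^ (k - 1)) w else 0)"
          proof cases
            case 3
            have "(T ^^ (k - 1 - i + j)) w = 0" by (rule funpow_kill[OF T k]) (use 3 i in simp)
            then show ?thesis using 3 by simp
          qed (use less j i in auto)
        qed
        also have "\<dots> = c i *s (T ^^ (k - 1)) w" using i by simp
        finally have "c i *s (T ^^ (k - 1)) w = 0" unfolding c lin_0[OF lin_pow[OF T]] by (rule sym)
        moreover have "(T ^^ (k - 1)) w \<noteq> 0" using i by (intro \<open>\<And>j. j < k \<Longrightarrow> (T ^^ j) w \<noteq> 0\<close>) simp
        ultimately show "c i = 0" by simp
      qed
    qed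
    then show "\<forall>i<k. c i = 0" by blast
  qed
  then have "k \<le> dim (UNIV :: 'b set)" by (rule indf_bound)
  then show ?thesis by (rule funpow_kill[OF T k])
qed

lemma pencil_power:
  assumes A: "lin A" and B: "lin B"
  shows "\<exists>u. u N = (B ^^ N) w \<and> (\<forall>t. ((\<lambda>w. A w + t *s B w) ^^ N) w = (\<Sum>i<Suc N. t ^ i *s u i))"
proof (induction N)
  case 0
  show ?case by (rule exI[of _ "\<lambda>_. w"]) simp
next
  case (Suc N)
  then obtain u where u: "u N = (B ^^ N) w" "\<forall>t. ((\<lambda>w. A w + t *s B w) ^^ N) w = (\<Sum>i<Suc N. t ^ i *s u i)"
    by (elim exE conjE)
  define u' where "u' i = (if i < Suc N then A (u i) else 0) + (if i = 0 then 0 else B (u (i - 1)))" for i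
  have "((\<lambda>w. A w + t *s B w) ^^ Suc N) w = (\<Sum>i<Suc (Suc N). t ^ i *s u' i)" for t
  proof -
    have "(\<Sum>i<Suc (Suc N). t ^ i *s u' i) = (\<Sum>i<Suc (Suc N). t ^ i *s (if i < Suc N then A (u i) else 0))
        + (\<Sum>i<Suc (Suc N). t ^ i *s (if i = 0 then 0 else B (u (i - 1))))"
      by (simp only: u'_def scale_right_distrib sum.distrib)
    also have "(\<Sum>i<Suc (Suc N). t ^ i *s (if i < Suc N then A (u i) else 0)) = (\<Sum>i<Suc N. t ^ i *s A (u i))"
      by (subst sum.lessThan_Suc) simp
    also have "(\<Sum>i<Suc (Suc N). t ^ i *s (if i = 0 then 0 else B (u (i - 1)))) = (\<Sum>i<Suc N. t ^ Suc i *s B (u i))"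
      by (subst sum.lessThan_Suc_shift) simp
    also have "(\<Sum>i<Suc N. t ^ i *s A (u i)) = A (\<Sum>i<Suc N. t ^ i *s u i)"
      by (simp only: lin_sum[OF A] lin_scale[OF A])
    also have "(\<Sum>i<Suc N. t ^ Suc i *s B (u i)) = t *s B (\<Sum>i<Suc N. t ^ i *s u i)"
      by (simp only: lin_sum[OF B] lin_scale[OF B] scale_sum_right scale_scale power_Suc)
    finally show ?thesis using u(2) by simp
  qed
  moreover have "u' (Suc N) = (B ^^ Suc N) w" by (simp add: u'_def u(1))
  ultimately show ?case by (intro exI[of _ u'] conjI allI)
qed

lemma poly_vec_zero:
  assumes inf: "infinite {t. (\<Sum>i<n. t ^ i *s u i) = 0}" and i: "i < n"
  shows "u i = 0"
proof -
  obtain h where h: "famb (dim (UNIV :: 'b set)) h UNIV" by (rule famb_exists[OF fd_UNIV])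
  have "cf (dim (UNIV :: 'b set)) h (u i) l = 0" if l: "l < dim (UNIV :: 'b set)" for l
  proof -
    let ?f = "\<lambda>w. cf (dim (UNIV :: 'b set)) h w l"
    have F: "functional ?f" by (rule cf_functional[OF h l])
    define p where "p = (\<Sum>i<n. Polynomial.monom (?f (u i)) i)"
    have "poly p t = ?f (\<Sum>i<n. t ^ i *s u i)" for t
      unfolding functional_fam[OF F] p_def by (simp add: poly_sum poly_monom mult.commute)
    then have "{t. (\<Sum>i<n. t ^ i *s u i) = 0} \<subseteq> {t. poly p t = 0}" using functional_0[OF F] by auto
    then have "infinite {t. poly p t = 0}" using inf by (meson finite_subset)
    then have "p = 0" using poly_roots_finite by blast
    then have "coeff p i = 0" by simp
    moreover have "coeff p i = ?f (u i)" unfolding p_def using i by (simp only: coeff_sum coeff_monom) (simp add: sum.delta)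
    ultimately show ?thesis by simp
  qed
  then show ?thesis by (subst cf_sum[OF h, of "u i"]) simp
qed

end

locale fd_lie = lie_algebra scale bracket
  for scale :: "'k::{alg_closed_field, field_char_0} \<Rightarrow> 'v::ab_group_add \<Rightarrow> 'v" (infixr \<open>*s\<close> 75)
    and bracket +
  assumes fin: finite_dimensional
begin

sublocale closed_space scale
proof
  show "linear_space.fd scale UNIV"
    using fin unfolding finite_dimensional_def linear_space.fd_def[OF linear_space.intro[OF vector_space_axioms]] by auto
qed

lemma lin_bracket: "lin (bracket x)"
  by (simp add: lin_def bracket_add_right bracket_scale_right)

lemma bracket_zero_left: "bracket 0 x = 0"
  using bracket_scale_left[of 0 0 x] by simp

lemma bracket_minus_right: "bracket x (- y) = - bracket x y"
  using bracket_scale_right[of x "- 1" y] by simp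

lemma derivation: "bracket x (bracket y z) = bracket (bracket x y) z + bracket y (bracket x z)"
proof -
  have "bracket x (bracket y z) + bracket y (bracket z x) = - bracket z (bracket x y)"
    using jacobi[of x y z] by (simp only: eq_neg_iff_add_eq_0)
  also have "\<dots> = bracket (bracket x y) z" using bracket_commute[of "bracket x y" z] by simp
  finally have "bracket x (bracket y z) = bracket (bracket x y) z - bracket y (bracket z x)" by (simp only: eq_diff_eq)
  also have "bracket y (bracket z x) = - bracket y (bracket x z)"
    unfolding bracket_commute[of z x] by (rule bracket_minus_right)
  finally show ?thesis by simp
qed

text \<open>The Leibniz rule for \<open>ad h - (\<alpha> + \<beta>)\<close>.\<close>

lemma gen_bracket:
  assumes a: "a \<in> gen (bracket h) \<alpha>" and b: "b \<in> gen (bracket h) \<beta>"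
  shows "bracket a b \<in> gen (bracket h) (\<alpha> + \<beta>)"
proof -
  let ?A = "\<lambda>\<mu> w. bracket h w - \<mu> *s w"
  have G: "subspace (gen (bracket h) \<mu>)" for \<mu> by (rule subspace_gen[OF lin_bracket])
  have main: "(?A \<alpha> ^^ N) a = 0 \<longrightarrow> (?A \<beta> ^^ M) b = 0 \<longrightarrow> bracket a b \<in> gen (bracket h) (\<alpha> + \<beta>)" for N M a b
  proof (induction "N + M" arbitrary: N M a b rule: less_induct)
    case less
    show ?case
    proof (intro impI)
      assume ab: "(?A \<alpha> ^^ N) a = 0" "(?A \<beta> ^^ M) b = 0"
      consider "N = 0" | "M = 0" | N' M' where "N = Suc N'" "M = Suc M'" by (cases N; cases M) auto
      then show "bracket a b \<in> gen (bracket h) (\<alpha> + \<beta>)"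
      proof cases
        case 1
        then show ?thesis using ab subspace_0[OF G] by (simp add: bracket_zero_left)
      next
        case 2
        then show ?thesis using ab subspace_0[OF G] by (simp add: bracket_zero_right)
      next
        case 3
        have a': "(?A \<alpha> ^^ N') (?A \<alpha> a) = 0" using ab(1) unfolding 3 funpow_Suc_right comp_def .
        have b': "(?A \<beta> ^^ M') (?A \<beta> b) = 0" using ab(2) unfolding 3 funpow_Suc_right comp_def .
        have 1: "bracket (?A \<alpha> a) b \<in> gen (bracket h) (\<alpha> + \<beta>)"
          by (rule mp[OF mp[OF less(1)[of N' M] a'] ab(2)]) (simp add: 3)
        have 2: "bracket a (?A \<beta> b) \<in> gen (bracket h) (\<alpha> + \<beta>)"
          by (rule mp[OF mp[OF less(1)[of N M'] ab(1)] b']) (simp add: 3)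
        have d1: "bracket (?A \<alpha> a) b = bracket (bracket h a) b - \<alpha> *s bracket a b"
        proof -
          have "bracket (?A \<alpha> a + \<alpha> *s a) b = bracket (?A \<alpha> a) b + \<alpha> *s bracket a b"
            by (simp only: bracket_add_left bracket_scale_left)
          then show ?thesis by (simp only: diff_add_cancel eq_diff_eq)
        qed
        have d2: "bracket a (?A \<beta> b) = bracket a (bracket h b) - \<beta> *s bracket a b"
          unfolding lin_diff[OF lin_bracket] bracket_scale_right ..
        have "bracket h (bracket a b) - (\<alpha> + \<beta>) *s bracket a b = bracket (?A \<alpha> a) b + bracket a (?A \<beta> b)"
          unfolding d1 d2 derivation[of h a b] by (simp add: scale_left_distrib)
        also have "\<dots> \<in> gen (bracket h) (\<alpha> + \<beta>)" by (rule subspace_add[OF G 1 2])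
        finally show ?thesis by (rule gen_step)
      qed
    qed
  qed
  then show ?thesis using a b unfolding gen_def[of _ \<alpha>] gen_def[of _ \<beta>] by blast
qed

lemma lower_central_subspace: "subspace H \<Longrightarrow> subspace (lower_central H k)"
  by (cases k) (auto simp: bracket_space_def)

lemma lower_central_bracket: "x \<in> H \<Longrightarrow> y \<in> lower_central H k \<Longrightarrow> bracket x y \<in> lower_central H (Suc k)"
  by (auto simp: bracket_space_def intro!: span_base)

lemma lower_central_subset:
  assumes "lie_subalgebra H"
  shows "lower_central H k \<subseteq> H"
proof (induction k)
  case (Suc k)
  show ?case unfolding lower_central.simps bracket_space_def
    by (rule span_minimal) (use Suc assms in \<open>auto simp: lie_subalgebra_def\<close>)
qed simp

text \<open>Engel's theorem for the action of \<open>H\<close> on \<open>L / H\<close>.  On a minimal nonzero invariant subspace, the terms of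
  the lower central series act by zero one after the other, from the last one up: if \<open>[H, x]\<close> acts by
  zero, then the kernel of \<open>x\<close> is invariant, and it is not zero because \<open>x\<close> is nilpotent.\<close>

lemma engel_quotient:
  assumes H: "lie_subalgebra H" "nilpotent H"
    and L: "subspace L" "H \<subset> L" "\<And>x y. x \<in> H \<Longrightarrow> y \<in> L \<Longrightarrow> bracket x y \<in> L"
    and nil: "\<And>x y. x \<in> H \<Longrightarrow> y \<in> L \<Longrightarrow> \<exists>N. (bracket x ^^ N) y \<in> H"
  shows "\<exists>y\<in>L - H. \<forall>x\<in>H. bracket x y \<in> H"
proof -
  have sH: "subspace H" and bH: "\<And>x y. x \<in> H \<Longrightarrow> y \<in> H \<Longrightarrow> bracket x y \<in> H"
    using H(1) by (auto simp: lie_subalgebra_def)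
  define Q where "Q W \<longleftrightarrow> subspace W \<and> H \<subset> W \<and> W \<subseteq> L \<and> (\<forall>x\<in>H. \<forall>y\<in>W. bracket x y \<in> W)" for W
  have "Q L" using L by (simp add: Q_def)
  then obtain W where W: "Q W" "\<And>W'. Q W' \<Longrightarrow> dim W \<le> dim W'" using ex_has_least_nat[of Q L dim] by blast
  then have sW: "subspace W" "H \<subset> W" "W \<subseteq> L" "\<And>x y. x \<in> H \<Longrightarrow> y \<in> W \<Longrightarrow> bracket x y \<in> W"
    by (auto simp: Q_def)
  obtain K where K: "lower_central H K = {0}" using H(2) by (auto simp: nilpotent_def)
  have main: "k \<le> K \<Longrightarrow> \<forall>x\<in>lower_central H k. \<forall>y\<in>W. bracket x y \<in> H" for k
  proof (induction rule: inc_induct)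
    case base
    show ?case using subspace_0[OF sH] by (simp add: K bracket_zero_left)
  next
    case (step k)
    show ?case
    proof
      fix x assume x: "x \<in> lower_central H k"
      have xH: "x \<in> H" using x lower_central_subset[OF H(1)] by blast
      define W' where "W' = {y \<in> W. bracket x y \<in> H}"
      have "Q W'" unfolding Q_def
      proof (intro conjI ballI)
        show "subspace W'"
          unfolding W'_def using sW(1) sH
          by (intro subspaceI) (auto simp: bracket_zero_right bracket_add_right bracket_scale_right intro: subspace_0 subspace_add subspace_scale)
        obtain y where y: "y \<in> W" "y \<notin> H" using sW(2) by blast
        obtain N where N: "(bracket x ^^ N) y \<in> H" using nil[OF xH] y sW(3) by blast
        define i where "i = (LEAST i. (bracket x ^^ i) y \<in> H)"
        have i: "(bracket x ^^ i) y \<in> H" unfolding i_def by (rule LeastI[of _ N]) (rule N)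
        have "i \<noteq> 0" using i y by (intro notI) simp
        then obtain j where j: "i = Suc j" by (cases i) auto
        have nj: "(bracket x ^^ j) y \<notin> H" using not_less_Least[of j "\<lambda>i. (bracket x ^^ i) y \<in> H"] j unfolding i_def by simp
        have "(bracket x ^^ j) y \<in> W" using y(1) sW(4)[OF xH] by (intro pow_in) auto
        then have "(bracket x ^^ j) y \<in> W'" using i j by (simp add: W'_def)
        moreover have "H \<subseteq> W'" using sW(2) bH[OF xH] by (auto simp: W'_def)
        ultimately show "H \<subset> W'" using nj by blast
        show "W' \<subseteq> L" using sW(3) by (auto simp: W'_def)
        fix z y' assume z: "z \<in> H" and y': "y' \<in> W'"
        have "bracket z x \<in> lower_central H (Suc k)" by (rule lower_central_bracket[OF z x])
        then have "bracket (bracket z x) y' \<in> H" using step(3) y' by (auto simp: W'_def)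
        then have 1: "- bracket (bracket z x) y' \<in> H" by (rule subspace_neg[OF sH])
        have "bracket x (bracket z y') = bracket (bracket x z) y' + bracket z (bracket x y')" by (rule derivation)
        also have "bracket (bracket x z) y' = - bracket (bracket z x) y'"
          unfolding bracket_commute[of x z] using bracket_scale_left[of "- 1" "bracket z x" y'] by simp
        finally have e: "bracket x (bracket z y') = - bracket (bracket z x) y' + bracket z (bracket x y')" .
        have "bracket z (bracket x y') \<in> H" using bH[OF z] y' by (simp add: W'_def)
        then have "bracket x (bracket z y') \<in> H" unfolding e by (rule subspace_add[OF sH 1])
        then show "bracket z y' \<in> W'" using sW(4)[OF z] y' by (simp add: W'_def)
      qed
      then have "W' = W" using W(2) by (intro dim_eq_fd[OF _ _ fd_subset[OF subset_UNIV fd_UNIV]]) (auto simp: Q_def W'_def)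
      then show "\<forall>y\<in>W. bracket x y \<in> H" by (auto simp: W'_def)
    qed
  qed
  obtain y where "y \<in> W" "y \<notin> H" using sW(2) by blast
  then show ?thesis using main[of 0] sW(3) by auto
qed

text \<open>Let \<open>h\<close> minimise the dimension of the null space \<open>L = g\<^sup>0(ad h)\<close>.  For \<open>x\<close> in \<open>H\<close>, almost all \<open>h + t x\<close>
  act injectively on the complement \<open>M\<close> of \<open>L\<close>, so their null spaces are contained in \<open>L\<close>, and equal to it
  by minimality.  Nilpotency of \<open>ad h + t ad x\<close> on \<open>L\<close> for infinitely many \<open>t\<close> implies that of \<open>ad x\<close>.  So if
  \<open>L\<close> were larger than \<open>H\<close>, then by Engel's theorem the normaliser of \<open>H\<close> would be, too.\<close>

theorem cartan_regular:
  assumes "cartan_subalgebra H"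
  shows "\<exists>h\<in>H. gen (bracket h) 0 = H"
proof -
  have H: "lie_subalgebra H" "nilpotent H" "normalizer H = H" using assms by (auto simp: cartan_subalgebra_def)
  have sH: "subspace H" using H(1) by (simp add: lie_subalgebra_def)
  obtain K where K: "lower_central H K = {0}" using H(2) by (auto simp: nilpotent_def)
  have HG: "H \<subseteq> gen (bracket x) 0" if x: "x \<in> H" for x
  proof
    fix y assume y: "y \<in> H"
    have "(bracket x ^^ k) y \<in> lower_central H k" for k
    proof (induction k)
      case (Suc k)
      then show ?case using lower_central_bracket[OF x] by simp
    qed (simp add: y)
    from this[of K] show "y \<in> gen (bracket x) 0" unfolding gen0_iff K by blast
  qed
  define n where "n = dim (UNIV :: 'v set)"
  define g where "g h = dim (gen (bracket h) 0)" for h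
  have fdg: "fd S" for S by (rule fd_subset[OF subset_UNIV fd_UNIV])
  have "0 \<in> H" by (rule subspace_0[OF sH])
  then obtain h where h: "h \<in> H" "\<And>h'. h' \<in> H \<Longrightarrow> g h \<le> g h'" using ex_has_least_nat[of "\<lambda>h. h \<in> H" 0 g] by blast
  define L where "L = gen (bracket h) 0"
  have sL: "subspace L" unfolding L_def by (rule subspace_gen[OF lin_bracket])
  obtain m v lam N where v: "famb m v UNIV" "block (bracket h) m v lam N" by (rule jordan_basis[OF lin_bracket])
  note jb = lin_bracket v
  \<comment> \<open>The projection to \<open>L\<close> along the sum \<open>M\<close> of the other generalised eigenspaces.\<close>
  define S where "S = spectral m v lam (\<lambda>\<mu>. if \<mu> = 0 then 1 else 0)"
  have S: "lin S" unfolding S_def by (rule spectral_lin[OF jb])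
  have SL: "S w = w" if "w \<in> L" for w using spectral_gen[OF jb] that by (simp add: S_def L_def)
  have SinL: "S w \<in> L" for w unfolding S_def spectral_def
  proof (rule subspace_sum[OF sL])
    fix j assume "j \<in> {..<m}"
    then show "((if lam j = 0 then 1 else 0) * cf m v w j) *s v j \<in> L"
      using block_gen[OF jb, of j] subspace_0[OF sL] by (auto simp: L_def intro: subspace_scale[OF sL[unfolded L_def]])
  qed
  have comm: "bracket x (S w) = S (bracket x w)" if x: "x \<in> H" for x w
    unfolding S_def
  proof (rule commutes_spectral[OF jb lin_bracket])
    fix \<mu> w assume "w \<in> gen (bracket h) \<mu>"
    then have "bracket x w \<in> gen (bracket h) (0 + \<mu>)" using HG[OF h(1)] x by (intro gen_bracket) auto
    then show "bracket x w \<in> gen (bracket h) \<mu>" by simp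
  qed
  define M where "M = {w. S w = 0}"
  have sM: "subspace M" using subspace_ker[OF S subspace_UNIV] by (simp add: M_def)
  obtain p where p: "famb (dim M) p M" by (rule famb_exists[OF fdg])
  have ind: "indf (dim M) (\<lambda>l. bracket h (p l))" unfolding indf_def
  proof (intro allI impI)
    fix c l assume c: "(\<Sum>l<dim M. c l *s bracket h (p l)) = 0" and l: "l < dim M"
    let ?w = "\<Sum>l<dim M. c l *s p l"
    have "bracket h ?w = 0" using c by (simp add: lin_sum[OF lin_bracket] lin_scale[OF lin_bracket])
    then have "(bracket h ^^ 1) ?w = 0" by simp
    then have "?w \<in> L" unfolding L_def gen0_iff by blast
    moreover have "?w \<in> M" by (rule fam_in[OF sM famb_in[OF p]])
    ultimately have "?w = 0" using SL by (simp add: M_def)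
    then show "c l = 0" using l by (rule famb_indep[OF p])
  qed
  have nilL: "(bracket x ^^ n) w = 0" if x: "x \<in> H" and w: "w \<in> L" for x w
  proof -
    have good: "((\<lambda>w. bracket h w + t *s bracket x w) ^^ n) w = 0"
      if t: "indf (dim M) (\<lambda>l. bracket h (p l) + t *s bracket x (p l))" for t
    proof -
      define y where "y = h + t *s x"
      have y: "y \<in> H" unfolding y_def by (intro subspace_add[OF sH] subspace_scale[OF sH] h x)
      have yb: "bracket y w = bracket h w + t *s bracket x w" for w
        by (simp add: y_def bracket_add_left bracket_scale_left)
      have inj: "w = 0" if w: "w \<in> M" "bracket y w = 0" for w
      proof -
        from famb_span[OF p w(1)] obtain c where c: "w = (\<Sum>l<dim M. c l *s p l)" by (elim exE)
        have "(\<Sum>l<dim M. c l *s bracket y (p l)) = bracket y w"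
          unfolding c by (simp only: lin_sum[OF lin_bracket] lin_scale[OF lin_bracket])
        also have "\<dots> = 0" by (rule w(2))
        finally have "(\<Sum>l<dim M. c l *s (bracket h (p l) + t *s bracket x (p l))) = 0" unfolding yb .
        then have "l < dim M \<Longrightarrow> c l = 0" for l by (rule indfD[OF t])
        then show ?thesis unfolding c by (intro sum.neutral) simp
      qed
      have "gen (bracket y) 0 \<subseteq> L"
      proof
        fix w assume "w \<in> gen (bracket y) 0"
        then obtain k where k: "(bracket y ^^ k) w = 0" by (auto simp: gen0_iff)
        have Sk: "(bracket y ^^ k) (S w) = S ((bracket y ^^ k) w)" for k w
          by (induction k) (simp_all add: comm[OF y])
        define u where "u = w - S w"
        have "S u = 0" unfolding u_def lin_diff[OF S] SL[OF SinL] by simp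
        then have uM: "(bracket y ^^ i) u \<in> M" for i by (simp add: M_def Sk[symmetric] lin_0[OF lin_pow[OF lin_bracket]])
        have uk: "(bracket y ^^ k) u = 0"
          unfolding u_def lin_diff[OF lin_pow[OF lin_bracket]] Sk k lin_0[OF S] by simp
        have "(bracket y ^^ i) u = 0 \<Longrightarrow> u = 0" for i
          by (induction i) (use inj[OF uM] in auto)
        then have "u = 0" using uk .
        then show "w \<in> L" using SinL[of w] by (simp add: u_def)
      qed
      then have "gen (bracket y) 0 = L"
        using h(2)[OF y] by (intro dim_eq_fd fdg subspace_gen[OF lin_bracket]) (simp_all add: g_def L_def)
      then obtain k where "(bracket y ^^ k) w = 0" using w gen0_iff by blast
      then have "(bracket y ^^ n) w = 0" unfolding n_def by (rule nil_bound[OF lin_bracket])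
      moreover have "bracket y = (\<lambda>w. bracket h w + t *s bracket x w)" using yb by (rule ext)
      ultimately show ?thesis by (simp only:)
    qed
    define P where "P t \<longleftrightarrow> indf (dim M) (\<lambda>l. bracket h (p l) + t *s bracket x (p l))" for t
    have fin: "finite {t. \<not> P t}" unfolding P_def by (rule independent_perturb[OF ind])
    have "infinite {t. P t}"
    proof
      assume "finite {t. P t}"
      from finite_Collect_not[OF this] fin have "finite (UNIV :: 'k set)" by simp
      then show False using infinite_UNIV_char_0 by blast
    qed
    moreover from pencil_power[OF lin_bracket lin_bracket, of n x w h] obtain u where u: "u n = (bracket x ^^ n) w"
        "\<forall>t. ((\<lambda>w. bracket h w + t *s bracket x w) ^^ n) w = (\<Sum>i<Suc n. t ^ i *s u i)" by (elim exE conjE)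
    have "{t. P t} \<subseteq> {t. (\<Sum>i<Suc n. t ^ i *s u i) = 0}"
    proof
      fix t assume "t \<in> {t. P t}"
      then have "((\<lambda>w. bracket h w + t *s bracket x w) ^^ n) w = 0" unfolding P_def by (intro good) simp
      then show "t \<in> {t. (\<Sum>i<Suc n. t ^ i *s u i) = 0}" unfolding u(2)[rule_format] by (rule CollectI)
    qed
    ultimately have "infinite {t. (\<Sum>i<Suc n. t ^ i *s u i) = 0}" using infinite_super by blast
    then have "u n = 0" by (rule poly_vec_zero[where i = n]) simp
    then show ?thesis unfolding u(1) .
  qed
  have "L = H"
  proof (rule ccontr)
    assume "L \<noteq> H"
    then have "H \<subset> L" using HG[OF h(1)] by (auto simp: L_def)
    moreover have "bracket x y \<in> L" if "x \<in> H" "y \<in> L" for x y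
      using gen_bracket[of x h 0 y 0] that HG[OF h(1)] by (auto simp: L_def)
    moreover have "\<exists>N. (bracket x ^^ N) y \<in> H" if "x \<in> H" "y \<in> L" for x y
      using nilL[OF that] subspace_0[OF sH] by (intro exI[of _ n]) simp
    ultimately obtain y where y: "y \<in> L - H" "\<forall>x\<in>H. bracket x y \<in> H" using engel_quotient[OF H(1,2) sL] by blast
    then have "bracket y x \<in> H" if "x \<in> H" for x
      using that subspace_neg[OF sH] unfolding bracket_commute[of y x] by blast
    then have "y \<in> normalizer H" by (auto simp: normalizer_def)
    then show False using H(3) y(1) by blast
  qed
  then show ?thesis using h(1) by (auto simp: L_def)
qed

end

section \<open>The Killing form\<close>

lemma rational_functional:
  fixes x :: "'k::field_char_0"
  assumes "x \<noteq> 0"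
  shows "\<exists>f :: 'k \<Rightarrow> rat. (\<forall>a b. f (a + b) = f a + f b) \<and> (\<forall>q a. f (of_rat q * a) = q * f a) \<and> f x = 1"
proof -
  interpret p: vector_space_pair "\<lambda>q (a :: 'k). of_rat q * a" "(*) :: rat \<Rightarrow> rat \<Rightarrow> rat"
    by unfold_locales (auto simp: algebra_simps of_rat_add of_rat_mult)
  have "p.vs1.independent {x}" using assms by simp
  from p.linear_independent_extend[OF this, of "\<lambda>_. 1"] obtain f
    where f: "Vector_Spaces.linear (\<lambda>q (a :: 'k). of_rat q * a) (*) f" "\<forall>y\<in>{x}. f y = 1" by (elim exE conjE)
  interpret l: Vector_Spaces.linear "\<lambda>q (a :: 'k). of_rat q * a" "(*)" f by (rule f(1))
  show ?thesis using f(2) by (intro exI[of _ f]) (simp add: l.add l.scale)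
qed

context fd_lie begin

text \<open>A basis fixed for the definition of traces, which do not depend on it.\<close>

definition hb :: "nat \<Rightarrow> 'v" where "hb = (SOME h. famb (dim (UNIV :: 'v set)) h UNIV)"

lemma hb: "famb (dim (UNIV :: 'v set)) hb UNIV"
proof -
  have "\<exists>h. famb (dim (UNIV :: 'v set)) h UNIV" by (rule famb_exists[OF fd_UNIV]) (rule exI)
  then show ?thesis unfolding hb_def by (rule someI_ex)
qed

definition tra :: "('v \<Rightarrow> 'v) \<Rightarrow> 'k" where "tra = trace (dim (UNIV :: 'v set)) hb"

definition kil :: "'v \<Rightarrow> 'v \<Rightarrow> 'k" where "kil x y = tra (\<lambda>w. bracket x (bracket y w))"

lemma tra_eq: "famb m h UNIV \<Longrightarrow> lin T \<Longrightarrow> tra T = trace m h T"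
  unfolding tra_def by (rule trace_basis[OF hb])

lemmas tra_comm = trace_comm[OF hb, folded tra_def]
lemmas tra_diff = trace_diff[OF hb, folded tra_def]
lemmas tra_add = trace_add[OF hb, folded tra_def]
lemmas tra_scale = trace_scale[OF hb, folded tra_def]

lemma lin_ad_comp: "lin T \<Longrightarrow> lin (\<lambda>w. bracket x (T w))"
  by (rule lin_comp[OF lin_bracket])

lemma kil_comm: "kil x y = kil y x"
  unfolding kil_def by (rule tra_comm[OF lin_bracket lin_bracket])

lemma bracket_bracket: "bracket (bracket x y) z = bracket x (bracket y z) - bracket y (bracket x z)"
  unfolding derivation[of x y z] by simp

lemma kil_inv: "kil (bracket x y) z = kil x (bracket y z)"
proof -
  have "kil (bracket x y) z = tra (\<lambda>w. bracket x (bracket y (bracket z w))) - tra (\<lambda>w. bracket y (bracket x (bracket z w)))"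
    unfolding kil_def bracket_bracket tra_diff ..
  also have "tra (\<lambda>w. bracket y (bracket x (bracket z w))) = tra (\<lambda>w. bracket x (bracket z (bracket y w)))"
    by (rule tra_comm[OF lin_bracket lin_ad_comp[OF lin_bracket]])
  also have "tra (\<lambda>w. bracket x (bracket y (bracket z w))) - \<dots> = kil x (bracket y z)"
    unfolding kil_def bracket_bracket lin_diff[OF lin_bracket] tra_diff ..
  finally show ?thesis .
qed

lemma functional_kil: "functional (kil x)"
  unfolding functional_def kil_def
  by (simp only: bracket_add_left bracket_scale_left lin_add[OF lin_bracket] lin_scale[OF lin_bracket] tra_add tra_scale simp_thms)

lemma functional_kil_left: "functional (\<lambda>x. kil x y)"
  by (subst kil_comm) (rule functional_kil)

lemma functional_span_zero:
  assumes f: "functional f" and S: "\<And>x. x \<in> S \<Longrightarrow> f x = 0" and x: "x \<in> span S"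
  shows "f x = 0"
  using x
proof (induction rule: span_induct_alt)
  case base show ?case by (rule functional_0[OF f])
next
  case (step c x y)
  then show ?case by (simp add: functional_add[OF f] functional_scale[OF f] S)
qed

lemma functional_tra: "functional (\<lambda>y. tra (\<lambda>w. bracket y (T w)))"
  unfolding functional_def by (simp only: bracket_add_left bracket_scale_left tra_add tra_scale simp_thms)

lemma lin_eq_on_basis:
  assumes v: "famb m v UNIV" and F: "lin F" and G: "lin G" and e: "\<And>i. i < m \<Longrightarrow> F (v i) = G (v i)"
  shows "F w = G w"
  by (subst (1 2) cf_sum[OF v, of w]) (simp add: lin_sum[OF F] lin_sum[OF G] lin_scale[OF F] lin_scale[OF G] e)

lemma lin_bracket_left: "lin T \<Longrightarrow> lin (\<lambda>a. bracket (T a) b)"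
  by (simp add: lin_def bracket_add_left bracket_scale_left)

lemma lin_plus: "lin F \<Longrightarrow> lin G \<Longrightarrow> lin (\<lambda>a. F a + G a)"
  by (simp add: lin_def scale_right_distrib algebra_simps)

lemma lin_id: "lin (\<lambda>a. a)" by (simp add: lin_def)

lemma tra_nil:
  assumes "lin T" "\<And>w. (T ^^ N) w = 0"
  shows "tra T = 0"
  unfolding tra_def by (rule trace_nil[OF assms(1) _ hb]) (use assms(2) gen0_iff in blast)

text \<open>The bracket takes the generalised eigenspaces of \<open>\<alpha>\<close> and \<open>\<beta>\<close> to that of \<open>\<alpha> + \<beta>\<close>.\<close>

lemma spectral_derivation:
  assumes v: "famb m v UNIV" and b: "block (bracket x) m v lam N"
    and phi: "\<And>\<alpha> \<beta>. \<phi> (\<alpha> + \<beta>) = \<phi> \<alpha> + \<phi> \<beta>"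
  shows "spectral m v lam \<phi> (bracket a b) = bracket (spectral m v lam \<phi> a) b + bracket a (spectral m v lam \<phi> b)"
proof -
  note jb = lin_bracket v b
  let ?D = "spectral m v lam \<phi>"
  have D: "lin ?D" by (rule spectral_lin[OF jb])
  have 1: "?D (bracket (v i) (v j)) = bracket (?D (v i)) (v j) + bracket (v i) (?D (v j))" if "i < m" "j < m" for i j
  proof -
    note gi = block_gen[OF jb that(1)] and gj = block_gen[OF jb that(2)]
    show ?thesis
      unfolding spectral_gen[OF jb gi] spectral_gen[OF jb gj] spectral_gen[OF jb gen_bracket[OF gi gj]]
        phi scale_left_distrib bracket_scale_left bracket_scale_right ..
  qed
  have 2: "?D (bracket a (v j)) = bracket (?D a) (v j) + bracket a (?D (v j))" if "j < m" for j
    by (rule lin_eq_on_basis[OF v, where F = "\<lambda>a. ?D (bracket a (v j))" and G = "\<lambda>a. bracket (?D a) (v j) + bracket a (?D (v j))"])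
      (intro lin_comp[OF D] lin_plus lin_bracket_left lin_id D 1[OF _ that] | assumption)+
  show ?thesis
    by (rule lin_eq_on_basis[OF v, where F = "\<lambda>b. ?D (bracket a b)" and G = "\<lambda>b. bracket (?D a) b + bracket a (?D b)"])
      (intro lin_comp[OF D] lin_plus lin_bracket lin_ad_comp D 2 | assumption)+
qed

end

locale simple_lie = fd_lie +
  assumes simp: simple
begin

lemma perfect: "span {bracket x y | x y. True} = UNIV"
proof -
  let ?I = "span {bracket x y | x y. True}"
  have "lie_ideal ?I" unfolding lie_ideal_def by (auto intro: span_base)
  then have "?I = {0} \<or> ?I = UNIV" using simp by (simp add: simple_def)
  moreover obtain x y where "bracket x y \<noteq> 0" using simp by (auto simp: simple_def)
  then have "?I \<noteq> {0}" using span_base[of "bracket x y" "{bracket x y | x y. True}"] by auto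
  ultimately show ?thesis by simp
qed

text \<open>If the form vanishes, then \<open>ad x\<close> is trace-orthogonal to every derivation, as \<open>x\<close> is a sum of
  brackets.  The derivations obtained from rational linear functionals \<open>f\<close> give \<open>\<Sum> \<lambda> f(\<lambda>) = 0\<close>, and
  applying \<open>f\<close> once more makes this a sum of squares of rational numbers.\<close>

lemma kil_zero_spectrum:
  assumes kil: "\<And>x y. kil x y = 0" and v: "famb m v UNIV" and b: "block (bracket x) m v lam N" and j: "j < m"
  shows "lam j = 0"
proof (rule ccontr)
  assume "lam j \<noteq> 0"
  from rational_functional[OF this] obtain f :: "'a \<Rightarrow> rat"
    where f: "\<forall>a b. f (a + b) = f a + f b" "\<forall>q a. f (of_rat q * a) = q * f a" "f (lam j) = 1" by (elim exE conjE)
  note jb = lin_bracket v b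
  define D where "D = spectral m v lam (\<lambda>\<mu>. of_rat (f \<mu>))"
  have D: "lin D" unfolding D_def by (rule spectral_lin[OF jb])
  have der: "D (bracket a b) = bracket (D a) b + bracket a (D b)" for a b
    unfolding D_def by (rule spectral_derivation[OF v b]) (simp add: f of_rat_add)
  have t: "tra (\<lambda>w. bracket (bracket a b) (D w)) = 0" for a b
  proof -
    have "tra (\<lambda>w. bracket (bracket a b) (D w)) = tra (\<lambda>w. bracket a (bracket b (D w))) - tra (\<lambda>w. bracket b (bracket a (D w)))"
      unfolding bracket_bracket tra_diff ..
    also have "tra (\<lambda>w. bracket b (bracket a (D w))) = tra (\<lambda>w. bracket a (D (bracket b w)))"
      by (rule tra_comm[OF lin_bracket lin_ad_comp[OF D]])
    also have "\<dots> = kil a (D b) + tra (\<lambda>w. bracket a (bracket b (D w)))"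
      unfolding der lin_add[OF lin_bracket] tra_add kil_def ..
    finally show ?thesis by (simp add: kil)
  qed
  have "x \<in> span {bracket x y | x y. True}" unfolding perfect by (rule UNIV_I)
  then have "tra (\<lambda>w. bracket x (D w)) = 0"
    by (rule functional_span_zero[OF functional_tra, rotated]) (auto simp: t)
  also have "tra (\<lambda>w. bracket x (D w)) = trace m v (\<lambda>w. bracket x (D w))" by (rule tra_eq[OF v lin_ad_comp[OF D]])
  also have "\<dots> = (\<Sum>j<m. lam j * of_rat (f (lam j)))" unfolding D_def by (rule trace_spectral[OF jb])
  finally have "(\<Sum>j<m. lam j * of_rat (f (lam j))) = 0" .
  then have "f (\<Sum>j<m. lam j * of_rat (f (lam j))) = f 0" by (rule arg_cong)
  moreover have f0: "f 0 = 0" using f(2)[rule_format, of 0 0] by simp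
  moreover have "f (\<Sum>j<k. lam j * of_rat (f (lam j))) = (\<Sum>j<k. f (lam j) * f (lam j))" for k
    by (induction k) (simp_all add: f0 f(1) f(2)[rule_format] mult.commute[of _ "of_rat _"])
  ultimately have "(\<Sum>j<m. f (lam j) * f (lam j)) = 0" by simp
  then have "f (lam j) * f (lam j) = 0" using j by (subst (asm) sum_nonneg_eq_0_iff) auto
  then show False using f(3) by simp
qed

text \<open>The radical is an ideal.  If it is everything, then \<open>ad h\<close> has no eigenvalue but 0, so a Cartan
  subalgebra is the whole algebra, which would be nilpotent although it equals its derived algebra.\<close>

theorem kil_nondegenerate:
  assumes H: "cartan_subalgebra H" and x: "\<And>y. kil x y = 0"
  shows "x = 0"
proof -
  define R where "R = {x. \<forall>y. kil x y = 0}"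
  have "subspace R" unfolding R_def
    by (rule subspaceI) (simp_all add: functional_0[OF functional_kil_left] functional_add[OF functional_kil_left] functional_scale[OF functional_kil_left])
  moreover have "bracket a b \<in> R" if "b \<in> R" for a b
  proof -
    have "kil (bracket a b) y = 0" for y
    proof -
      have "kil (bracket a b) y = kil y (bracket a b)" by (rule kil_comm)
      also have "\<dots> = kil (bracket y a) b" by (rule kil_inv[symmetric])
      also have "\<dots> = kil b (bracket y a)" by (rule kil_comm)
      finally show ?thesis using that by (simp add: R_def)
    qed
    then show ?thesis by (simp add: R_def)
  qed
  ultimately have "lie_ideal R" by (simp add: lie_ideal_def)
  then consider "R = {0}" | "R = UNIV" using simp by (auto simp: simple_def)
  then show ?thesis
  proof cases
    case 1
    then show ?thesis using x by (auto simp: R_def)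
  next
    case 2
    then have kil: "kil x y = 0" for x y by (auto simp: R_def)
    obtain h where h: "h \<in> H" "gen (bracket h) 0 = H" using cartan_regular[OF H] by blast
    obtain m v lam N where v: "famb m v UNIV" "block (bracket h) m v lam N" by (rule jordan_basis[OF lin_bracket])
    have "w \<in> gen (bracket h) 0" for w
      by (rule spectrum_zero_nil[OF lin_bracket v]) (rule kil_zero_spectrum[OF kil v])
    then have "H = UNIV" using h(2) by blast
    then obtain K where K: "lower_central UNIV K = {0}" using H by (auto simp: cartan_subalgebra_def nilpotent_def)
    have "lower_central UNIV k = UNIV" for k
      by (induction k) (use perfect in \<open>simp_all add: bracket_space_def\<close>)
    then have "x \<in> {0}" using K by simp
    then show ?thesis by simp
  qed
qed

text \<open>The last nonzero term of the lower central series is central, and it is contained in the derived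
  algebra unless \<open>H\<close> is abelian.\<close>

lemma nilpotent_center:
  assumes H: "lie_subalgebra H" "nilpotent H" and ab: "x \<in> H" "y \<in> H" "bracket x y \<noteq> 0"
  obtains c where "c \<in> H" "c \<noteq> 0" "c \<in> span {bracket a b | a b. a \<in> H \<and> b \<in> H}" "\<forall>z\<in>H. bracket z c = 0"
proof -
  have sH: "subspace H" using H(1) by (simp add: lie_subalgebra_def)
  obtain K0 where K0: "lower_central H K0 = {0}" using H(2) by (auto simp: nilpotent_def)
  define K where "K = (LEAST K. lower_central H K = {0})"
  have K: "lower_central H K = {0}" unfolding K_def by (rule LeastI[of _ K0]) (rule K0)
  have K1: "bracket x y \<in> lower_central H 1" using lower_central_bracket[of x H y 0] ab by simp
  have "K \<noteq> 0"
  proof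
    assume "K = 0"
    then have "x = 0" using K ab(1) by simp
    then show False using ab(3) by (simp add: bracket_zero_left)
  qed
  moreover have "K \<noteq> 1"
  proof
    assume K': "K = 1"
    have "bracket x y \<in> {0}" using K1 unfolding K[unfolded K'] .
    then show False using ab(3) by simp
  qed
  ultimately obtain k where k: "K = Suc (Suc k)" by (metis One_nat_def not0_implies_Suc)
  have "lower_central H (Suc k) \<noteq> {0}"
    using not_less_Least[of "Suc k" "\<lambda>K. lower_central H K = {0}"] k unfolding K_def by simp
  then obtain c where c: "c \<in> lower_central H (Suc k)" "c \<noteq> 0"
    using subspace_0[OF lower_central_subspace[OF sH]] by blast
  show thesis
  proof
    show "c \<in> H" using c(1) lower_central_subset[OF H(1)] by blast
    show "c \<noteq> 0" by (rule c(2))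
    have "bracket_space H (lower_central H k) \<subseteq> span {bracket a b | a b. a \<in> H \<and> b \<in> H}"
      unfolding bracket_space_def by (rule span_mono) (use lower_central_subset[OF H(1)] in auto)
    then show "c \<in> span {bracket a b | a b. a \<in> H \<and> b \<in> H}" using c(1) by auto
    show "\<forall>z\<in>H. bracket z c = 0"
    proof
      fix z assume "z \<in> H"
      then have "bracket z c \<in> lower_central H K" unfolding k using c(1) by (rule lower_central_bracket)
      then show "bracket z c = 0" using K by simp
    qed
  qed
qed

text \<open>\<open>ad c\<close> is trace-orthogonal to every operator commuting with the action of \<open>H\<close>, among them the
  projections to the generalised eigenspaces of \<open>ad c\<close>.  So no eigenvalue other than 0 can occur.\<close>

lemma central_commutator_nil:
  assumes c: "c \<in> span {bracket a b | a b. a \<in> H \<and> b \<in> H}" "\<And>z. z \<in> H \<Longrightarrow> bracket z c = 0"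
  shows "w \<in> gen (bracket c) 0"
proof -
  obtain m v lam N where v: "famb m v UNIV" "block (bracket c) m v lam N" by (rule jordan_basis[OF lin_bracket])
  note jb = lin_bracket v
  have "lam j = 0" if j: "j < m" for j
  proof (rule ccontr)
    assume nz: "lam j \<noteq> 0"
    define D where "D = spectral m v lam (\<lambda>\<mu>. if \<mu> = lam j then 1 else 0)"
    have D: "lin D" unfolding D_def by (rule spectral_lin[OF jb])
    have comm: "bracket z (D w) = D (bracket z w)" if z: "z \<in> H" for z w
      unfolding D_def
    proof (rule commutes_spectral[OF jb lin_bracket])
      fix \<mu> w assume w: "w \<in> gen (bracket c) \<mu>"
      have "bracket c z = 0" using c(2)[OF z] bracket_commute[of c z] by simp
      then have "(bracket c ^^ 1) z = 0" by simp
      then have "z \<in> gen (bracket c) 0" unfolding gen0_iff by blast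
      from gen_bracket[OF this w] show "bracket z w \<in> gen (bracket c) \<mu>" by simp
    qed
    have t: "tra (\<lambda>w. bracket (bracket a b) (D w)) = 0" if ab: "a \<in> H" "b \<in> H" for a b
    proof -
      have "tra (\<lambda>w. bracket (bracket a b) (D w)) = tra (\<lambda>w. bracket a (bracket b (D w))) - tra (\<lambda>w. bracket b (bracket a (D w)))"
        unfolding bracket_bracket tra_diff ..
      also have "tra (\<lambda>w. bracket b (bracket a (D w))) = tra (\<lambda>w. bracket a (D (bracket b w)))"
        by (rule tra_comm[OF lin_bracket lin_ad_comp[OF D]])
      finally show ?thesis unfolding comm[OF ab(2)] by simp
    qed
    have "tra (\<lambda>w. bracket c (D w)) = 0"
      by (rule functional_span_zero[OF functional_tra _ c(1)]) (auto simp: t)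
    also have "tra (\<lambda>w. bracket c (D w)) = trace m v (\<lambda>w. bracket c (D w))" by (rule tra_eq[OF v(1) lin_ad_comp[OF D]])
    also have "\<dots> = (\<Sum>i<m. lam i * (if lam i = lam j then 1 else 0))" unfolding D_def by (rule trace_spectral[OF jb])
    also have "\<dots> = (\<Sum>i\<in>{i\<in>{..<m}. lam i = lam j}. lam j)"
      unfolding sum.inter_filter[OF finite_lessThan] by (intro sum.cong) auto
    also have "\<dots> = of_nat (card {i\<in>{..<m}. lam i = lam j}) * lam j" by simp
    finally have "card {i\<in>{..<m}. lam i = lam j} = 0" using nz by simp
    then show False using j by auto
  qed
  then show ?thesis by (rule spectrum_zero_nil[OF jb])
qed

text \<open>If \<open>H\<close> were not abelian, a central commutator \<open>c\<close> would exist.  As \<open>ad c\<close> is nilpotent and commutes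
  with \<open>ad H\<close>, \<open>c\<close> is orthogonal to \<open>H\<close>; it is also orthogonal to the image of a power of \<open>ad h\<close>, which
  complements \<open>H\<close>.  This contradicts nondegeneracy.\<close>

theorem cartan_centralizer:
  assumes H: "cartan_subalgebra H"
  obtains h where "H = centralizer h" "\<forall>x\<in>H. \<forall>y\<in>H. bracket x y = 0"
proof -
  have sH: "lie_subalgebra H" "nilpotent H" using H by (auto simp: cartan_subalgebra_def)
  obtain h where h: "h \<in> H" "gen (bracket h) 0 = H" using cartan_regular[OF H] by blast
  have ab: "bracket x y = 0" if xy: "x \<in> H" "y \<in> H" for x y
  proof (rule ccontr)
    assume nz: "bracket x y \<noteq> 0"
    obtain c where
      c: "c \<in> H" "c \<noteq> 0" "c \<in> span {bracket a b | a b. a \<in> H \<and> b \<in> H}" and cz: "\<forall>z\<in>H. bracket z c = 0"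
      by (rule nilpotent_center[OF sH xy nz])
    note c = c bspec[OF cz]
    have nil: "(bracket c ^^ dim (UNIV :: 'b set)) w = 0" for w
    proof -
      have "w \<in> gen (bracket c) 0" by (rule central_commutator_nil[OF c(3,4)])
      then obtain N where "(bracket c ^^ N) w = 0" unfolding gen0_iff by (elim exE)
      then show ?thesis by (rule nil_bound[OF lin_bracket])
    qed
    have kH: "kil c y = 0" if y: "y \<in> H" for y
    proof -
      have e: "bracket y (bracket c w) = bracket c (bracket y w)" for w
        using derivation[of y c w] c(4)[OF y] by (simp add: bracket_zero_left)
      have e2: "bracket y ((bracket c ^^ k) w) = (bracket c ^^ k) (bracket y w)" for k w
        by (induction k) (simp_all add: e)
      have p: "((\<lambda>w. bracket c (bracket y w)) ^^ k) w = (bracket c ^^ k) ((bracket y ^^ k) w)" for k w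
        by (induction k) (simp_all add: e2)
      show ?thesis unfolding kil_def
        by (rule tra_nil[where N = "dim (UNIV :: 'b set)", OF lin_ad_comp[OF lin_bracket]]) (simp only: p nil)
    qed
    have "kil c y = 0" for y
    proof -
      obtain N where N: "N \<ge> 1" "\<And>w. w \<in> UNIV \<Longrightarrow> \<exists>u\<in>UNIV. (bracket h ^^ N) w = (bracket h ^^ N) ((bracket h ^^ N) u)"
        by (rule fitting[OF lin_bracket subspace_UNIV fd_UNIV]) auto
      obtain u where u: "(bracket h ^^ N) y = (bracket h ^^ N) ((bracket h ^^ N) u)" using N(2)[of y] by blast
      have "(bracket h ^^ N) (y - (bracket h ^^ N) u) = 0"
        unfolding lin_diff[OF lin_pow[OF lin_bracket]] u by simp
      then have "y - (bracket h ^^ N) u \<in> H" using h(2) gen0_iff by blast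
      then have "kil c (y - (bracket h ^^ N) u) = 0" by (rule kH)
      moreover obtain M where M: "N = Suc M" using N(1) by (cases N) auto
      have "bracket c h = 0" using c(4)[OF h(1)] bracket_commute[of c h] by simp
      then have "kil (bracket c h) z = 0" for z using functional_0[OF functional_kil_left] by simp
      then have "kil c ((bracket h ^^ N) u) = 0" unfolding M by (simp add: kil_inv)
      moreover have "kil c (y - (bracket h ^^ N) u + (bracket h ^^ N) u) = kil c (y - (bracket h ^^ N) u) + kil c ((bracket h ^^ N) u)"
        by (rule functional_add[OF functional_kil])
      ultimately show ?thesis by (simp only: diff_add_cancel add_0_left)
    qed
    then have "c = 0" by (rule kil_nondegenerate[OF H])
    then show False using c(2) by simp
  qed
  have "H = centralizer h"
  proof (intro equalityI subsetI)
    fix y assume "y \<in> centralizer h"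
    then have "(bracket h ^^ 1) y = 0" by (simp add: centralizer_def)
    then show "y \<in> H" using h(2) gen0_iff by blast
  qed (simp add: centralizer_def ab[OF h(1)])
  then show thesis by (rule that) (use ab in blast)
qed

end

section \<open>The index of a centralizer is at least the minimal dimension of centralizers\<close>

locale killing_lie = fd_lie +
  assumes nondeg: "(\<forall>y. kil x y = 0) \<Longrightarrow> x = 0"
begin

lemma subspace_centralizer: "subspace (centralizer x)"
  using lie_subalgebra_centralizer[of x] by (simp add: lie_subalgebra_def)

lemma fd_any: "fd S" by (rule fd_subset[OF subset_UNIV fd_UNIV])

lemma functional_eq_on_basis:
  assumes v: "famb m v UNIV" and F: "functional F" and G: "functional G" and e: "\<And>i. i < m \<Longrightarrow> F (v i) = G (v i)"
  shows "F w = G w"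
  by (subst (1 2) cf_sum[OF v, of w]) (simp add: functional_fam[OF F] functional_fam[OF G] e)

text \<open>A vector in the kernel of the Gram matrix would be orthogonal to everything.\<close>

lemma gram_inverse:
  assumes h: "famb m h UNIV"
  shows "\<exists>gi. \<forall>i<m. \<forall>j<m. (\<Sum>l<m. kil (h i) (h l) * gi l j) = (if i = j then 1 else 0)"
proof -
  let ?G = "mat m m (\<lambda>(i, l). kil (h i) (h l))"
  have G: "?G \<in> carrier_mat m m" by simp
  have "det ?G \<noteq> 0"
  proof
    assume "det ?G = 0"
    then obtain v where v: "v \<in> carrier_vec m" "v \<noteq> 0\<^sub>v m" "?G *\<^sub>v v = 0\<^sub>v m"
      using det_0_iff_vec_prod_zero[OF G] by blast
    define w where "w = (\<Sum>l<m. (v $ l) *s h l)"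
    have kh: "kil (h i) w = 0" if i: "i < m" for i
    proof -
      have "kil (h i) w = (\<Sum>l<m. v $ l * kil (h i) (h l))" unfolding w_def by (rule functional_fam[OF functional_kil])
      also have "\<dots> = (?G *\<^sub>v v) $ i"
        using i v(1) by (simp add: scalar_prod_def atLeast0LessThan mult.commute)
      finally show ?thesis using i by (simp add: v(3))
    qed
    have "functional (\<lambda>_. 0)" by (simp add: functional_def)
    then have "kil y w = 0" for y
      by (rule functional_eq_on_basis[OF h functional_kil_left _ kh])
    then have "w = 0" by (intro nondeg) (simp add: kil_comm[of w])
    then have "v $ l = 0" if "l < m" for l using that unfolding w_def by (rule famb_indep[OF h])
    then have "v = 0\<^sub>v m" using v(1) by (intro eq_vecI) auto
    then show False using v(2) by simp
  qed
  define gi where "gi l j = adj_mat ?G $$ (l, j) / det ?G" for l j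
  have "(\<Sum>l<m. kil (h i) (h l) * gi l j) = (if i = j then 1 else 0)" if ij: "i < m" "j < m" for i j
  proof -
    have J: "adj_mat ?G \<in> carrier_mat m m" "?G * adj_mat ?G = det ?G \<cdot>\<^sub>m 1\<^sub>m m" using adj_mat[OF G] by auto
    have "(\<Sum>l<m. kil (h i) (h l) * adj_mat ?G $$ (l, j)) = (?G * adj_mat ?G) $$ (i, j)"
      using ij carrier_matD[OF J(1)] by (subst index_mult_mat(1)) (auto simp: scalar_prod_def atLeast0LessThan)
    also have "\<dots> = (if i = j then det ?G else 0)" unfolding J(2) using ij by simp
    finally have "(\<Sum>l<m. kil (h i) (h l) * adj_mat ?G $$ (l, j)) / det ?G = (if i = j then 1 else 0)"
      using \<open>det ?G \<noteq> 0\<close> by simp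
    then show ?thesis by (simp add: gi_def sum_divide_distrib)
  qed
  then show ?thesis by (intro exI[of _ gi] allI impI)
qed

lemma riesz:
  assumes f: "functional f"
  shows "\<exists>z. \<forall>y. f y = kil z y"
proof -
  define m where "m = dim (UNIV :: 'b set)"
  have h: "famb m hb UNIV" unfolding m_def by (rule hb)
  from gram_inverse[OF h] obtain gi
    where gi: "\<forall>i<m. \<forall>j<m. (\<Sum>l<m. kil (hb i) (hb l) * gi l j) = (if i = j then 1 else 0)" by (elim exE)
  define z where "z = (\<Sum>l<m. (\<Sum>j<m. gi l j * f (hb j)) *s hb l)"
  have hz: "kil (hb i) z = f (hb i)" if i: "i < m" for i
  proof -
    have "kil (hb i) z = (\<Sum>l<m. (\<Sum>j<m. gi l j * f (hb j)) * kil (hb i) (hb l))"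
      unfolding z_def by (rule functional_fam[OF functional_kil])
    also have "\<dots> = (\<Sum>l<m. \<Sum>j<m. kil (hb i) (hb l) * gi l j * f (hb j))"
      by (simp add: sum_distrib_right sum_distrib_left mult_ac)
    also have "\<dots> = (\<Sum>j<m. \<Sum>l<m. kil (hb i) (hb l) * gi l j * f (hb j))" by (rule sum.swap)
    also have "\<dots> = (\<Sum>j<m. (\<Sum>l<m. kil (hb i) (hb l) * gi l j) * f (hb j))" by (simp only: sum_distrib_right)
    also have "\<dots> = (\<Sum>j<m. if i = j then f (hb j) else 0)" using gi i by (intro sum.cong) auto
    also have "\<dots> = f (hb i)" using i by simp
    finally show ?thesis .
  qed
  have "f (hb i) = kil z (hb i)" if "i < m" for i using hz[OF that] kil_comm[of z "hb i"] by (simp only:)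
  then have "f y = kil z y" for y by (rule functional_eq_on_basis[OF h f functional_kil])
  then show ?thesis by (intro exI allI)
qed

lemma kil_ad_skew: "kil (bracket x y) z = - kil y (bracket x z)"
proof -
  have "kil (bracket x y) z = kil (- bracket y x) z" using bracket_commute[of x y] by (rule arg_cong)
  also have "\<dots> = - kil (bracket y x) z" using functional_scale[OF functional_kil_left, of "- 1"] by simp
  finally show ?thesis by (simp only: kil_inv)
qed

text \<open>A functional that vanishes on the image of \<open>ad x\<close> is given by an element \<open>v\<close> of the centralizer of \<open>x\<close>.\<close>

lemma image_orthogonal:
  assumes y: "\<And>u. u \<in> centralizer x \<Longrightarrow> kil y u = 0"
  shows "\<exists>t. y = bracket x t"
proof (rule ccontr)
  assume "\<nexists>t. y = bracket x t"
  then have "y \<notin> range (bracket x)" by auto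
  then obtain f where f: "functional f" "\<And>w. w \<in> range (bracket x) \<Longrightarrow> f w = 0" "f y = 1"
    by (rule functional_separates[OF subspace_im[OF lin_bracket subspace_UNIV]]) blast
  from riesz[OF f(1)] obtain v where v: "\<forall>y. f y = kil v y" by (elim exE)
  have "kil (bracket v x) t = 0" for t using f(2)[of "bracket x t"] v by (simp add: kil_inv)
  then have "bracket v x = 0" by (intro nondeg allI)
  then have "v \<in> centralizer x" using bracket_commute[of x v] by (simp add: centralizer_def)
  then have "kil v y = 0" using y kil_comm[of v y] by simp
  then show False using f(3) v by simp
qed

definition radical :: "'b \<Rightarrow> 'b \<Rightarrow> 'b set" where
  "radical x z = {u \<in> centralizer x. \<forall>v\<in>centralizer x. kil z (bracket u v) = 0}"

lemma subspace_radical: "subspace (radical x z)"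
proof (rule subspaceI)
  show "0 \<in> radical x z" using subspace_0[OF subspace_centralizer]
    by (simp add: radical_def bracket_zero_left functional_0[OF functional_kil])
  fix u w and c assume u: "u \<in> radical x z"
  show "c *s u \<in> radical x z" using u
    by (simp add: radical_def bracket_scale_left functional_scale[OF functional_kil] subspace_scale[OF subspace_centralizer])
  assume w: "w \<in> radical x z"
  show "u + w \<in> radical x z" using u w
    by (simp add: radical_def bracket_add_left functional_add[OF functional_kil] subspace_add[OF subspace_centralizer])
qed

lemma radical_subset: "radical x z \<subseteq> centralizer x" by (auto simp: radical_def)

text \<open>The dimension of the centralizer of a regular element.\<close>

definition reg :: nat where "reg = (LEAST r. \<exists>y. dim (centralizer y) = r)"

lemma reg_le: "reg \<le> dim (centralizer y)"
  unfolding reg_def by (rule Least_le) blast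

lemma reg_attained: "\<exists>y. dim (centralizer y) = reg"
  unfolding reg_def by (rule LeastI_ex) blast

text \<open>Vinberg's inequality: the rank of \<open>ad (x + t z)\<close> for small \<open>t\<close> is at least that of \<open>ad x\<close> plus
  that of the form \<open>\<kappa>(z, [u, v])\<close> on the centralizer of \<open>x\<close>.\<close>

theorem radical_ge: "reg \<le> dim (radical x z)"
proof -
  define n where "n = dim (UNIV :: 'b set)"
  define d where "d = dim (centralizer x)"
  define \<rho> where "\<rho> = dim (radical x z)"
  have le: "\<rho> \<le> d" "d \<le> n"
    unfolding \<rho>_def d_def n_def by (rule dim_mono_fd[OF radical_subset fd_any], rule dim_mono_fd[OF subset_UNIV fd_UNIV])
  from complement_exists[OF subspace_centralizer subset_UNIV fd_UNIV, of x] obtain p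
    where p: "\<forall>t. (\<Sum>j<n - d. t j *s p j) \<in> centralizer x \<longrightarrow> (\<forall>j<n - d. t j = 0)"
    unfolding n_def[symmetric] d_def[symmetric] by (elim exE conjE)
  from complement_exists[OF subspace_radical radical_subset fd_any, of x z] obtain u
    where u: "\<forall>j<d - \<rho>. u j \<in> centralizer x"
      "\<forall>t. (\<Sum>j<d - \<rho>. t j *s u j) \<in> radical x z \<longrightarrow> (\<forall>j<d - \<rho>. t j = 0)"
    unfolding d_def[symmetric] \<rho>_def[symmetric] by (elim exE conjE)
  define m where "m = (n - d) + (d - \<rho>)"
  define a where "a l = (if l < n - d then bracket x (p l) else bracket z (u (l - (n - d))))" for l
  define b where "b l = (if l < n - d then bracket z (p l) else 0)" for l
  have "indf m a" unfolding indf_def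
  proof (rule allI, rule impI)
    fix c assume c: "(\<Sum>l<m. c l *s a l) = 0"
    define X where "X = (\<Sum>l<n - d. c l *s p l)"
    define U where "U = (\<Sum>j<d - \<rho>. c (n - d + j) *s u j)"
    have "bracket x X + bracket z U = (\<Sum>l<m. c l *s a l)"
      unfolding m_def sum_add_index X_def U_def by (simp add: lin_sum[OF lin_bracket] lin_scale[OF lin_bracket] a_def)
    then have s: "bracket x X + bracket z U = 0" unfolding c .
    have UC: "U \<in> centralizer x" unfolding U_def by (rule fam_in[OF subspace_centralizer]) (use u(1) in blast)
    have "kil z (bracket U v) = 0" if v: "v \<in> centralizer x" for v
    proof -
      have "bracket x v = 0" using v by (simp add: centralizer_def)
      then have "kil (bracket x X) v = 0" unfolding kil_ad_skew by (simp add: functional_0[OF functional_kil])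
      moreover have "kil (bracket x X + bracket z U) v = kil (bracket x X) v + kil (bracket z U) v"
        by (rule functional_add[OF functional_kil_left])
      moreover have "kil (bracket x X + bracket z U) v = 0" unfolding s by (rule functional_0[OF functional_kil_left])
      ultimately show ?thesis by (simp add: kil_inv)
    qed
    then have "U \<in> radical x z" using UC by (simp add: radical_def)
    then have cu: "\<forall>j<d - \<rho>. c (n - d + j) = 0" unfolding U_def by (rule mp[OF spec[OF u(2)]])
    then have "U = 0" unfolding U_def by (intro sum.neutral) simp
    then have "bracket x X = 0" using s by (simp add: bracket_zero_right)
    then have "X \<in> centralizer x" by (simp add: centralizer_def)
    then have cp: "\<forall>l<n - d. c l = 0" unfolding X_def by (rule mp[OF spec[OF p]])
    show "\<forall>l<m. c l = 0"
    proof (intro allI impI)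
      fix l assume l: "l < m"
      show "c l = 0"
      proof (cases "l < n - d")
        case False
        then have "l - (n - d) < d - \<rho>" "n - d + (l - (n - d)) = l" using l by (auto simp: m_def)
        then show ?thesis using cu by metis
      qed (use cp in blast)
    qed
  qed
  then have "finite {t. \<not> indf m (\<lambda>l. a l + t *s b l)}" by (rule independent_perturb)
  then have "finite (insert 0 {t. \<not> indf m (\<lambda>l. a l + t *s b l)})" by simp
  then obtain t :: 'a where t: "t \<notin> insert 0 {t. \<not> indf m (\<lambda>l. a l + t *s b l)}"
    using infinite_UNIV_char_0[where 'a = 'a] by (meson ex_new_if_finite)
  then have t0: "t \<noteq> 0" and ti: "indf m (\<lambda>l. a l + t *s b l)" by auto
  define y where "y = x + t *s z"
  \<comment> \<open>The vectors \<open>u\<close> commute with \<open>x\<close>, so dividing by \<open>t\<close> makes \<open>ad y\<close> take them to \<open>[z, u]\<close>.\<close>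
  define q where "q l = (if l < n - d then p l else inverse t *s u (l - (n - d)))" for l
  have yq: "bracket y (q l) = a l + t *s b l" if l: "l < m" for l
  proof (cases "l < n - d")
    case True
    then show ?thesis by (simp add: y_def q_def a_def b_def bracket_add_left bracket_scale_left)
  next
    case False
    then have "u (l - (n - d)) \<in> centralizer x" using u(1) l by (auto simp: m_def)
    then have "bracket x (u (l - (n - d))) = 0" by (simp add: centralizer_def)
    then show ?thesis using False t0
      by (simp add: y_def q_def a_def b_def bracket_add_left bracket_scale_left bracket_scale_right)
  qed
  have "dim (centralizer y) + m \<le> n" unfolding n_def
  proof (rule dim_add_indep[OF subspace_centralizer subset_UNIV subspace_UNIV fd_UNIV])
    fix c assume c: "(\<Sum>j<m. c j *s q j) \<in> centralizer y"
    have "(\<Sum>j<m. c j *s (a j + t *s b j)) = bracket y (\<Sum>j<m. c j *s q j)"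
      unfolding lin_sum[OF lin_bracket] lin_scale[OF lin_bracket] by (intro sum.cong refl) (simp add: yq)
    also have "\<dots> = 0" using c by (simp add: centralizer_def)
    finally have "(\<Sum>j<m. c j *s (a j + t *s b j)) = 0" .
    then show "\<forall>j<m. c j = 0" using indfD[OF ti] by blast
  qed simp
  then have "reg + m \<le> n" using reg_le[of y] by linarith
  then show ?thesis using le unfolding m_def \<rho>_def[symmetric] by linarith
qed

end

section \<open>The index of a centralizer is the rank\<close>

context killing_lie begin

text \<open>In coordinates with respect to a triangularising basis of \<open>ad x\<close>, the generic pencil
  supplies a form on the centralizer of \<open>x\<close> whose radical is no larger than a minimal centralizer.\<close>

theorem radical_le: "\<exists>z. dim (radical x z) \<le> reg"
proof -
  obtain n h ev N where h: "famb n h UNIV" and blk: "block (bracket x) n h ev N" by (rule jordan_basis[OF lin_bracket])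
  have dn: "dim (UNIV :: 'b set) = n" by (rule famb_dim[OF h])
  note cfF = cf_functional[OF h]
  define c where "c i j l = cf n h (bracket (h i) (h j)) l" for i j l
  have cfl: "cf n h (bracket w b) l = (\<Sum>k<n. cf n h w k * cf n h (bracket (h k) b) l)" if "l < n" for w b l
    by (rule cf_lin[OF h that lin_bracket_left[OF lin_id]])
  have cfr: "cf n h (bracket a w) l = (\<Sum>k<n. cf n h w k * cf n h (bracket a (h k)) l)" if "l < n" for w a l
    by (rule cf_lin[OF h that lin_bracket])
  have lm: "lie_mat (\<lambda>_. 0) n c"
  proof (rule lie_mat.intro)
    show "valued_field_mat (\<lambda>_ :: 'a. 0)" unfolding valued_field_mat_def by (rule trivial_valuation)
    show "lie_mat_axioms n c"
    proof
      fix i j k l :: nat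
      assume ij: "i < n" "j < n" and l: "l < n"
      have "c i j l = cf n h (- bracket (h j) (h i)) l" unfolding c_def by (subst bracket_commute) (rule refl)
      also have "\<dots> = - c j i l" unfolding c_def using functional_scale[OF cfF[OF l], of "- 1"] by simp
      finally show "c i j l = - c j i l" .
      assume k: "k < n"
      show "(\<Sum>la<n. c i j la * c la l k) = (\<Sum>la<n. c i la k * c j l la) - (\<Sum>la<n. c j la k * c i l la)"
      proof -
        have "(\<Sum>la<n. c i j la * c la l k) = cf n h (bracket (bracket (h i) (h j)) (h l)) k"
          unfolding c_def by (rule cfl[OF k, symmetric])
        also have "\<dots> = cf n h (bracket (h i) (bracket (h j) (h l)) - bracket (h j) (bracket (h i) (h l))) k"
          unfolding bracket_bracket ..
        also have "\<dots> = cf n h (bracket (h i) (bracket (h j) (h l))) k - cf n h (bracket (h j) (bracket (h i) (h l))) k"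
          using functional_add[OF cfF[OF k], of "bracket (h i) (bracket (h j) (h l)) - bracket (h j) (bracket (h i) (h l))" "bracket (h j) (bracket (h i) (h l))"]
          by (simp only: diff_add_cancel eq_diff_eq)
        also have "cf n h (bracket (h i) (bracket (h j) (h l))) k = (\<Sum>la<n. c i la k * c j l la)"
          unfolding c_def by (subst cfr[OF k]) (simp only: mult.commute)
        also have "cf n h (bracket (h j) (bracket (h i) (h l))) k = (\<Sum>la<n. c j la k * c i l la)"
          unfolding c_def by (subst cfr[OF k]) (simp only: mult.commute)
        finally show ?thesis .
      qed
    qed
  qed
  interpret k: lie_mat "\<lambda>_ :: 'a. 0" n c by (rule lm)
  define co where "co w i = (if i < n then cf n h w i else 0)" for w i
  have cov: "co w \<in> k.vecs" for w by (simp add: co_def k.vecs_def)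
  have adm: "k.adm (co a) i j = cf n h (bracket a (h j)) i" if "i < n" "j < n" for a i j
    using that by (simp add: k.adm_def co_def c_def cfl[of i a])
  have br: "k.br (co a) (co b) = co (bracket a b)" for a b
  proof (rule ext)
    fix l
    show "k.br (co a) (co b) l = co (bracket a b) l"
    proof (cases "l < n")
      case True
      have "k.br (co a) (co b) l = (\<Sum>j<n. cf n h (bracket a (h j)) l * cf n h b j)"
        using True by (simp add: k.br_def k.mv_def adm) (simp add: co_def)
      also have "\<dots> = cf n h (bracket a b) l" by (subst cfr[OF True, of a b]) (simp only: mult.commute)
      finally show ?thesis using True by (simp add: co_def)
    qed (simp add: k.br_out co_def)
  qed
  have kap: "k.kap (co a) (co b) = kil a b" for a b
  proof -
    have "k.kap (co a) (co b) = (\<Sum>i<n. \<Sum>j<n. cf n h (bracket a (h j)) i * cf n h (bracket b (h i)) j)"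
      by (simp add: k.kap_def k.tr_def k.mm_def adm)
    also have "\<dots> = (\<Sum>i<n. cf n h (bracket a (bracket b (h i))) i)"
      by (intro sum.cong refl) (simp add: cfr[of _ a "bracket b _"] mult.commute)
    also have "\<dots> = kil a b" unfolding kil_def tra_eq[OF h lin_ad_comp[OF lin_bracket]] trace_def ..
    finally show ?thesis .
  qed
  have un: "k.unitv i = co (h i)" if "i < n" for i
    unfolding k.unitv_def co_def by (rule ext) (use that in \<open>auto simp: cf_basis[OF h]\<close>)
  define d where "d = dim (centralizer x)"
  obtain u where u: "famb d u (centralizer x)" unfolding d_def by (rule famb_exists[OF fd_any])
  from reg_attained obtain y where y: "dim (centralizer y) = reg" by (elim exE)
  define m where "m = n - reg"
  have regn: "reg \<le> n" "reg \<le> d" "d \<le> n"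
    using reg_le[of x] reg_le[of y] dim_mono_fd[OF subset_UNIV fd_UNIV, of "centralizer x"] by (auto simp: dn d_def)
  from complement_exists[OF subspace_centralizer subset_UNIV fd_UNIV, of y] obtain p
    where p: "\<forall>t. (\<Sum>j<m. t j *s p j) \<in> centralizer y \<longrightarrow> (\<forall>j<m. t j = 0)"
    unfolding dn y m_def[symmetric] by (elim exE conjE)
  have "indf m (\<lambda>j. bracket y (p j))" unfolding indf_def
  proof (rule allI, rule impI)
    fix t assume "(\<Sum>j<m. t j *s bracket y (p j)) = 0"
    then have "bracket y (\<Sum>j<m. t j *s p j) = 0" by (simp only: lin_sum[OF lin_bracket] lin_scale[OF lin_bracket])
    then show "\<forall>j<m. t j = 0" by (intro mp[OF spec[OF p]]) (simp add: centralizer_def)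
  qed
  from dual_family[OF this] obtain f
    where f: "\<forall>i. functional (f i) \<and> (\<forall>j<m. f i (bracket y (p j)) = (if i = j then 1 else 0))" by (elim exE)
  from dual_family[OF famb_indf[OF u]] obtain g
    where g: "\<forall>i. functional (g i) \<and> (\<forall>j<d. g i (u j) = (if i = j then 1 else 0))" by (elim exE)
  have "\<forall>i. \<exists>w. \<forall>v. g i v = kil w v" using riesz g by blast
  from choice[OF this] obtain w where w: "\<forall>i v. g i v = kil (w i) v" by (elim exE)
  \<comment> \<open>The \<open>w\<close> are dual to the basis \<open>u\<close> of the centralizer; what remains after subtracting them is in
    the image of \<open>ad x\<close>, and \<open>\<tau>\<close> inverts \<open>ad x\<close> there.\<close>
  have "\<exists>t. h q - (\<Sum>j<d. kil (h q) (u j) *s w j) = bracket x t" for q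
  proof (rule image_orthogonal)
    let ?r = "h q - (\<Sum>j<d. kil (h q) (u j) *s w j)"
    have ru: "kil ?r (u i) = 0" if i: "i < d" for i
    proof -
      have "kil (\<Sum>j<d. kil (h q) (u j) *s w j) (u i) = (\<Sum>j<d. kil (h q) (u j) * kil (w j) (u i))"
        by (rule functional_fam[OF functional_kil_left])
      also have "\<dots> = (\<Sum>j<d. if j = i then kil (h q) (u i) else 0)"
        using g w i by (intro sum.cong) auto
      also have "\<dots> = kil (h q) (u i)" using i by simp
      finally have e: "kil (\<Sum>j<d. kil (h q) (u j) *s w j) (u i) = kil (h q) (u i)" .
      have "kil (?r + (\<Sum>j<d. kil (h q) (u j) *s w j)) (u i) = kil ?r (u i) + kil (\<Sum>j<d. kil (h q) (u j) *s w j) (u i)"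
        by (rule functional_add[OF functional_kil_left])
      then show ?thesis unfolding e by (simp only: diff_add_cancel add_cancel_right_left)
    qed
    fix v assume "v \<in> centralizer x"
    from famb_span[OF u this] obtain b where b: "v = (\<Sum>i<d. b i *s u i)" by (elim exE)
    show "kil ?r v = 0" unfolding b functional_fam[OF functional_kil] by (intro sum.neutral) (simp add: ru)
  qed
  then have "\<forall>q. \<exists>t. h q - (\<Sum>j<d. kil (h q) (u j) *s w j) = bracket x t" by (rule allI)
  from choice[OF this] obtain \<tau> where \<tau>: "\<forall>q. h q - (\<Sum>j<d. kil (h q) (u j) *s w j) = bracket x (\<tau> q)" by (elim exE)
  from gram_inverse[OF h] obtain gi
    where gi: "\<forall>i<n. \<forall>j<n. (\<Sum>l<n. kil (h i) (h l) * gi l j) = (if i = j then 1 else 0)" by (elim exE)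
  have "\<exists>z\<in>k.vecs. \<exists>P' Q'. \<forall>i<d - (n - m). \<forall>j<d - (n - m).
    (\<Sum>p<d. \<Sum>q<d. P' i p * k.kap z (k.br (co (u p)) (co (u q))) * Q' q j) = (if i = j then 1 else 0)"
  proof (rule index_coordinates[OF lm, where a = "co x" and gi = gi and y = "co y" and P = "\<lambda>i p. f i (h p)"
        and Q = "\<lambda>q j. cf n h (p j) q" and lam = "\<lambda>i p. g i (h p)" and T = "\<lambda>i q. cf n h (\<tau> q) i"
        and w = "\<lambda>j i. cf n h (w j) i"])
    show "co x \<in> k.vecs" by (rule cov)
    show "k.adm (co x) i j = 0" if "i < n" "j < i" for i j
    proof -
      have "j < n" using that by simp
      show ?thesis unfolding adm[OF that(1) \<open>j < n\<close>] block_cf[OF lin_bracket h blk \<open>j < n\<close> that(1)] using that by simp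
    qed
    show "(\<Sum>l<n. k.kap (k.unitv i) (k.unitv l) * gi l j) = (if i = j then 1 else 0)" if "i < n" "j < n" for i j
      using gi that by (simp add: un kap)
    show "(\<Sum>pa<n. \<Sum>q<n. f i (h pa) * k.adm (co y) pa q * cf n h (p j) q) = (if i = j then 1 else 0)"
      if ij: "i < m" "j < m" for i j
    proof -
      have "(\<Sum>pa<n. \<Sum>q<n. f i (h pa) * k.adm (co y) pa q * cf n h (p j) q)
          = (\<Sum>pa<n. cf n h (bracket y (p j)) pa * f i (h pa))"
      proof (intro sum.cong refl)
        fix r assume "r \<in> {..<n}"
        then have r: "r < n" by simp
        have "(\<Sum>q<n. f i (h r) * k.adm (co y) r q * cf n h (p j) q) = (\<Sum>q<n. cf n h (p j) q * cf n h (bracket y (h q)) r) * f i (h r)"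
          using r by (simp add: adm sum_distrib_left mult_ac)
        then show "(\<Sum>q<n. f i (h r) * k.adm (co y) r q * cf n h (p j) q) = cf n h (bracket y (p j)) r * f i (h r)"
          unfolding cfr[OF r, of y "p j"] .
      qed
      also have "\<dots> = f i (\<Sum>r<n. cf n h (bracket y (p j)) r *s h r)"
        using f by (intro functional_fam[symmetric]) blast
      also have "\<dots> = f i (bracket y (p j))" unfolding cf_sum[OF h, symmetric] ..
      also have "\<dots> = (if i = j then 1 else 0)" using f ij by simp
      finally show ?thesis .
    qed
    show "co (u j) \<in> k.vecs" for j by (rule cov)
    show "k.br (co x) (co (u j)) = 0" if "j < d" for j
    proof -
      have "bracket x (u j) = 0" using famb_in[OF u that] by (simp add: centralizer_def)
      then have "k.br (co x) (co (u j)) = co 0" unfolding br by (simp only:)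
      also have "co 0 = 0" unfolding co_def by (rule ext) (simp add: functional_0[OF cfF])
      finally show ?thesis .
    qed
    show "(\<Sum>p<n. g i (h p) * co (u j) p) = (if i = j then 1 else 0)" if "i < d" "j < d" for i j
    proof -
      have "(\<Sum>p<n. g i (h p) * co (u j) p) = (\<Sum>p<n. cf n h (u j) p * g i (h p))"
        by (intro sum.cong) (auto simp: co_def)
      also have "\<dots> = g i (\<Sum>p<n. cf n h (u j) p *s h p)"
        using g by (intro functional_fam[symmetric]) blast
      also have "\<dots> = g i (u j)" unfolding cf_sum[OF h, symmetric] ..
      finally show ?thesis using g that by simp
    qed
    show "(\<Sum>q<n. k.adm (co x) i q * cf n h (\<tau> p) q) + (\<Sum>j<d. cf n h (w j) i * k.kap (k.unitv p) (co (u j))) = (if i = p then 1 else 0)"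
      if ip: "i < n" "p < n" for i p
    proof -
      have "(\<Sum>q<n. k.adm (co x) i q * cf n h (\<tau> p) q) = cf n h (bracket x (\<tau> p)) i"
        using ip by (simp add: adm cfr[of i x "\<tau> p"] mult.commute)
      moreover have "(\<Sum>j<d. cf n h (w j) i * k.kap (k.unitv p) (co (u j))) = cf n h (\<Sum>j<d. kil (h p) (u j) *s w j) i"
        unfolding functional_fam[OF cfF[OF ip(1)]] un[OF ip(2)] kap by (simp only: mult.commute)
      moreover have "cf n h (bracket x (\<tau> p)) i + cf n h (\<Sum>j<d. kil (h p) (u j) *s w j) i = cf n h (h p) i"
        unfolding functional_add[OF cfF[OF ip(1)], symmetric] \<tau>[rule_format, symmetric] by (simp only: diff_add_cancel)
      ultimately show ?thesis using cf_basis[OF h ip(2,1)] by simp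
    qed
  qed
  then obtain z P' Q' where z: "z \<in> k.vecs" and PQ: "\<forall>i<d - (n - m). \<forall>j<d - (n - m).
    (\<Sum>p<d. \<Sum>q<d. P' i p * k.kap z (k.br (co (u p)) (co (u q))) * Q' q j) = (if i = j then 1 else 0)"
    by (elim bexE exE)
  define z' where "z' = (\<Sum>l<n. z l *s h l)"
  have "co z' = z" unfolding co_def z'_def by (rule ext) (use z in \<open>auto simp: cf_fam[OF h] k.vecs_def\<close>)
  define e where "e = d - reg"
  have nm: "d - (n - m) = e" using regn by (simp add: m_def e_def)
  have PQ': "(\<Sum>p<d. \<Sum>q<d. P' i p * kil z' (bracket (u p) (u q)) * Q' q j) = (if i = j then 1 else 0)" if "i < e" "j < e" for i j
    using PQ that unfolding nm br \<open>co z' = z\<close>[symmetric] kap by blast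
  have "dim (radical x z') + e \<le> d" unfolding d_def
  proof (rule dim_add_indep[OF subspace_radical radical_subset subspace_centralizer fd_any])
    show "(\<Sum>q<d. Q' q j *s u q) \<in> centralizer x" for j by (rule fam_in[OF subspace_centralizer famb_in[OF u]])
    fix t assume t: "(\<Sum>j<e. t j *s (\<Sum>q<d. Q' q j *s u q)) \<in> radical x z'"
    let ?s = "\<Sum>j<e. t j *s (\<Sum>q<d. Q' q j *s u q)"
    show "\<forall>i<e. t i = 0"
    proof (intro allI impI)
      fix i assume i: "i < e"
      have zs: "kil z' (bracket (u r) ?s) = 0" if "r < d" for r
      proof -
        have "kil z' (bracket ?s (u r)) = 0" using t famb_in[OF u that] by (simp add: radical_def)
        then show ?thesis unfolding bracket_commute[of "u r" ?s] using functional_scale[OF functional_kil, of z' "- 1"] by simp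
      qed
      have ex: "kil z' (bracket (u r) ?s) = (\<Sum>j<e. t j * (\<Sum>q<d. Q' q j * kil z' (bracket (u r) (u q))))" for r
        by (simp only: lin_sum[OF lin_bracket] lin_scale[OF lin_bracket] functional_sum[OF functional_kil] functional_scale[OF functional_kil])
      have "0 = (\<Sum>r<d. P' i r * (\<Sum>j<e. t j * (\<Sum>q<d. Q' q j * kil z' (bracket (u r) (u q)))))"
        using zs unfolding ex by simp
      also have "\<dots> = (\<Sum>r<d. \<Sum>j<e. \<Sum>q<d. t j * (P' i r * kil z' (bracket (u r) (u q)) * Q' q j))"
        by (simp add: sum_distrib_left mult_ac)
      also have "\<dots> = (\<Sum>j<e. \<Sum>r<d. \<Sum>q<d. t j * (P' i r * kil z' (bracket (u r) (u q)) * Q' q j))"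
        by (rule sum.swap)
      also have "\<dots> = (\<Sum>j<e. t j * (\<Sum>r<d. \<Sum>q<d. P' i r * kil z' (bracket (u r) (u q)) * Q' q j))"
        by (simp only: sum_distrib_left)
      also have "\<dots> = (\<Sum>j<e. if i = j then t j else 0)" by (intro sum.cong refl) (simp add: PQ'[OF i])
      also have "\<dots> = t i" using i by simp
      finally show "t i = 0" by (rule sym)
    qed
  qed
  then have "dim (radical x z') \<le> reg" using regn(2) unfolding e_def by linarith
  then show ?thesis by (rule exI)
qed

lemma dual_sum:
  fixes d :: nat
  assumes K: "subspace K" and f: "f \<in> dual K" and u: "\<And>j. j < d \<Longrightarrow> u j \<in> K"
  shows "f (\<Sum>j<d. c j *s u j) = (\<Sum>j<d. c j * f (u j))"
  using u
proof (induction d)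
  case 0
  have "f (0 *s 0) = 0 * f 0" using f subspace_0[OF K] unfolding dual_def by blast
  then show ?case by simp
next
  case (Suc d)
  have "(\<Sum>j<d. c j *s u j) \<in> K" "c d *s u d \<in> K" using Suc(2) by (auto intro!: subspace_sum[OF K] subspace_scale[OF K])
  then have "f ((\<Sum>j<d. c j *s u j) + c d *s u d) = f (\<Sum>j<d. c j *s u j) + f (c d *s u d)"
    using f unfolding dual_def by blast
  moreover have "f (c d *s u d) = c d * f (u d)" using f Suc(2)[of d] unfolding dual_def by blast
  ultimately show ?case using Suc by simp
qed

lemma dual_riesz:
  assumes K: "subspace K" and f: "f \<in> dual K"
  shows "\<exists>z. \<forall>v\<in>K. f v = kil z v"
proof -
  obtain u where u: "famb (dim K) u K" by (rule famb_exists[OF fd_any])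
  from dual_family[OF famb_indf[OF u]] obtain g
    where g: "\<forall>i. functional (g i) \<and> (\<forall>j<dim K. g i (u j) = (if i = j then 1 else 0))" by (elim exE)
  define F where "F v = (\<Sum>i<dim K. f (u i) * g i v)" for v
  have F: "functional F" unfolding functional_def F_def
    using g by (simp add: functional_add functional_scale distrib_left sum.distrib sum_distrib_left mult_ac)
  from riesz[OF F] obtain z where z: "\<forall>y. F y = kil z y" by (elim exE)
  have Fu: "F (u j) = f (u j)" if j: "j < dim K" for j
  proof -
    have "F (u j) = (\<Sum>i<dim K. if i = j then f (u j) else 0)"
      unfolding F_def using g j by (intro sum.cong) auto
    then show ?thesis using j by simp
  qed
  have "f v = kil z v" if v: "v \<in> K" for v
  proof -
    from famb_span[OF u v] obtain c where c: "v = (\<Sum>j<dim K. c j *s u j)" by (elim exE)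
    have "f v = (\<Sum>j<dim K. c j * f (u j))" unfolding c by (rule dual_sum[OF K f famb_in[OF u]])
    also have "\<dots> = (\<Sum>j<dim K. c j * F (u j))" by (intro sum.cong) (auto simp: Fu)
    also have "\<dots> = F v" unfolding c by (rule functional_fam[OF F, symmetric])
    finally show ?thesis using z by simp
  qed
  then show ?thesis by blast
qed

theorem index_centralizer: "index (centralizer x) = reg"
  unfolding index_def
proof (rule cInf_eq_minimum)
  have ge: "reg \<le> dim (form_radical (centralizer x) f)" if f: "f \<in> dual (centralizer x)" for f
  proof -
    from dual_riesz[OF subspace_centralizer f] obtain z where z: "\<forall>v\<in>centralizer x. f v = kil z v" by (elim exE)
    have "bracket u v \<in> centralizer x" if "u \<in> centralizer x" "v \<in> centralizer x" for u v
      using lie_subalgebra_centralizer[of x] that by (simp add: lie_subalgebra_def)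
    then have "form_radical (centralizer x) f = radical x z" using z by (auto simp: form_radical_def radical_def)
    then show ?thesis using radical_ge by simp
  qed
  then show "\<And>r. r \<in> (\<lambda>f. dim (form_radical (centralizer x) f)) ` dual (centralizer x) \<Longrightarrow> reg \<le> r" by auto
  from radical_le[of x] obtain z where z: "dim (radical x z) \<le> reg" by (elim exE)
  define f where "f v = (if v \<in> centralizer x then kil z v else 0)" for v
  have f: "f \<in> dual (centralizer x)"
    by (auto simp: dual_def f_def functional_add[OF functional_kil] functional_scale[OF functional_kil]
        subspace_add[OF subspace_centralizer] subspace_scale[OF subspace_centralizer])
  have "bracket u v \<in> centralizer x" if "u \<in> centralizer x" "v \<in> centralizer x" for u v
    using lie_subalgebra_centralizer[of x] that by (simp add: lie_subalgebra_def)
  then have "form_radical (centralizer x) f = radical x z" by (auto simp: form_radical_def radical_def f_def)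
  then have "dim (form_radical (centralizer x) f) = reg" using ge[OF f] z by simp
  then show "reg \<in> (\<lambda>f. dim (form_radical (centralizer x) f)) ` dual (centralizer x)" using f by (intro image_eqI[OF sym])
qed

end

context simple_lie begin

lemma killing_lie: "cartan_subalgebra H \<Longrightarrow> killing_lie scale bracket"
  by unfold_locales (rule kil_nondegenerate, auto)

text \<open>On an abelian algebra every form \<open>f [u, v]\<close> is zero, so its index is its dimension.\<close>

lemma dim_cartan:
  assumes H: "cartan_subalgebra H"
  shows "dim H = index (centralizer x)"
proof -
  interpret killing_lie scale bracket by (rule killing_lie[OF H])
  obtain h where h: "H = centralizer h" and ab: "\<forall>x\<in>H. \<forall>y\<in>H. bracket x y = 0" by (rule cartan_centralizer[OF H])
  have "0 \<in> H" unfolding h by (rule subspace_0[OF subspace_centralizer])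
  have "form_radical H f = H" if f: "f \<in> dual H" for f
  proof -
    have "f (0 *s 0) = 0 * f 0" using f \<open>0 \<in> H\<close> unfolding dual_def by blast
    then show ?thesis using ab by (auto simp: form_radical_def)
  qed
  moreover have "(\<lambda>_. 0) \<in> dual H" by (simp add: dual_def)
  ultimately have "(\<lambda>f. dim (form_radical H f)) ` dual H = {dim H}" by auto
  then have "index H = dim H" unfolding index_def by simp
  then show ?thesis using index_centralizer[of h] index_centralizer[of x] unfolding h by simp
qed

theorem index_eq_rank:
  assumes H: "cartan_subalgebra H"
  shows "index (centralizer x) = rank"
  unfolding rank_def
proof (rule the_equality[symmetric])
  show "\<exists>H. cartan_subalgebra H \<and> dim H = index (centralizer x)" using H dim_cartan by blast
  show "r = index (centralizer x)" if "\<exists>H. cartan_subalgebra H \<and> dim H = r" for r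
    using that dim_cartan by blast
qed

end

theorem mainTheorem1:
  fixes scale :: "'k::{alg_closed_field, field_char_0} \<Rightarrow> 'v::ab_group_add \<Rightarrow> 'v"
    and bracket :: "'v \<Rightarrow> 'v \<Rightarrow> 'v"
    and x :: 'v
  assumes "lie_algebra scale bracket"
    and "lie_algebra.finite_dimensional scale"
    and "lie_algebra.simple scale bracket"
    and "lie_algebra.of_exceptional_type scale bracket"
  shows "lie_algebra.index scale bracket (lie_algebra.centralizer bracket x)
       = lie_algebra.rank scale bracket"
proof -
  interpret lie_algebra scale bracket by (rule assms(1))
  interpret simple_lie scale bracket by unfold_locales (rule assms(2), rule assms(3))
  obtain H where "cartan_subalgebra H"
    using assms(4) unfolding of_exceptional_type_def has_cartan_matrix_def by blast
  then show ?thesis by (rule index_eq_rank)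
qed

end
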